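(* Let $n\ge 1$, $0<\lambda<n$, $s\ge\frac{\lambda}{2}$, $t_0\in\mathbb{R}$, $T>0$, $\theta\in\mathbb{R}\setminus\{0\}$, and let $\alpha,\beta\in C([-T+t_0,T+t_0])$ be real-valued with $\beta(t)\neq 0$ for all $t\in[-T+t_0,T+t_0]$. Let $u_0\in H^s(\mathbb{R}^n)$. Then there exist $T_0=T_0(\|u_0\|_{H^s})$ with $0<T_0\le T$ and a unique solution $u$ of the integral equation $$u(t)=U(t,t_0)u_0+i\theta\int_{t_0}^tU(t,\tau)\{(|x|^{-\lambda}*|u(\tau)|^{2})u(\tau)\}\,d\tau$$ in the class $C([-T_0+t_0,T_0+t_0];H^s(\mathbb{R}^n))$ verifying $$\|u\|_{L^{\infty}([-T_0+t_0,T_0+t_0];H^s(\mathbb{R}^n))}\le C\|u_0\|_{H^s(\mathbb{R}^n)},$$ where $C>0$ is a constant not depending on $u_0$.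
   Context: $U(t,r)$ denotes the linear propagator of $i\partial_tu+\alpha(t)\Delta u+\beta(t)\Delta^2u=0$, i.e. the Fourier multiplier operator $$U(t,r)f=\left[e^{-i|\xi|^2A(t,r)+i|\xi|^4B(t,r)}\widehat f(\xi)\right]^{\vee},\qquad A(t,r)=\int_r^t\alpha(\tau)\,d\tau,\quad B(t,r)=\int_r^t\beta(\tau)\,d\tau .$$ The integral equation is the Duhamel (mild) formulation of the Cauchy problem $i\partial_tu+\alpha(t)\Delta u+\beta(t)\Delta^2u+\theta(|x|^{-\lambda}*|u|^2)u=0$, $u(\cdot,t_0)=u_0$, for complex-valued $u$ on $\mathbb{R}^n\times\mathbb{R}$; here $*$ is convolution in $x$. $H^s(\mathbb{R}^n)$ is the $L^2$-based inhomogeneous Sobolev space with norm $\|\langle\xi\rangle^s\widehat f\|_{L^2}$. The notation $T_0=T_0(\|u_0\|_{H^s})$ means that $T_0$ depends on $u_0$ only through $\|u_0\|_{H^s}$. *)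

theory Defs
  imports "HOL-Analysis.Analysis" "HOL-Probability.Essential_Supremum"
begin

section \<open>The Hilbert space \<open>L\<^sup>2\<close> of complex-valued functions modulo null sets\<close>

definition square_integrable :: "('a::euclidean_space \<Rightarrow> complex) \<Rightarrow> bool" where
  "square_integrable f \<longleftrightarrow>
     f \<in> borel_measurable lborel \<and> integrable lborel (\<lambda>x. (cmod (f x))\<^sup>2)"

definition L2_eq :: "('a::euclidean_space \<Rightarrow> complex) \<Rightarrow> ('a \<Rightarrow> complex) \<Rightarrow> bool" where
  "L2_eq f g \<longleftrightarrow> square_integrable f \<and> square_integrable g \<and> (AE x in lborel. f x = g x)"

lemma square_integrable_zero: "square_integrable (\<lambda>x. 0)"
  by (simp add: square_integrable_def)

lemma square_integrable_cmult:
  assumes "square_integrable f"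
  shows "square_integrable (\<lambda>x. c * f x)"
  using assms by (auto simp: square_integrable_def norm_mult power_mult_distrib)

lemma square_integrable_add:
  assumes "square_integrable f" "square_integrable g"
  shows "square_integrable (\<lambda>x. f x + g x)"
proof -
  have [measurable]: "f \<in> borel_measurable lborel" "g \<in> borel_measurable lborel"
    using assms by (auto simp: square_integrable_def)
  have "integrable lborel (\<lambda>x. (cmod (f x + g x))\<^sup>2)"
  proof (rule Bochner_Integration.integrable_bound)
    show "integrable lborel (\<lambda>x. 2 * (cmod (f x))\<^sup>2 + 2 * (cmod (g x))\<^sup>2)"
      using assms by (auto simp: square_integrable_def)
    have "(cmod (f x + g x))\<^sup>2 \<le> 2 * (cmod (f x))\<^sup>2 + 2 * (cmod (g x))\<^sup>2" for x
    proof -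
      have "(cmod (f x + g x))\<^sup>2 \<le> (cmod (f x) + cmod (g x))\<^sup>2"
        by (intro power_mono norm_triangle_ineq) auto
      also have "\<dots> \<le> 2 * (cmod (f x))\<^sup>2 + 2 * (cmod (g x))\<^sup>2"
        using sum_squares_bound[of "cmod (f x)" "cmod (g x)"] by (simp add: power2_sum)
      finally show ?thesis .
    qed
    then show "AE x in lborel. norm ((cmod (f x + g x))\<^sup>2)
        \<le> norm (2 * (cmod (f x))\<^sup>2 + 2 * (cmod (g x))\<^sup>2)"
      by simp
  qed measurable
  then show ?thesis by (auto simp: square_integrable_def)
qed

lemma square_integrable_inner:
  assumes "square_integrable f" "square_integrable g"
  shows "integrable lborel (\<lambda>x. f x \<bullet> g x)"
proof -
  have [measurable]: "f \<in> borel_measurable lborel" "g \<in> borel_measurable lborel"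
    using assms by (auto simp: square_integrable_def)
  show ?thesis
  proof (rule Bochner_Integration.integrable_bound)
    show "integrable lborel (\<lambda>x. (cmod (f x))\<^sup>2 + (cmod (g x))\<^sup>2)"
      using assms by (auto simp: square_integrable_def)
    have "\<bar>f x \<bullet> g x\<bar> \<le> (cmod (f x))\<^sup>2 + (cmod (g x))\<^sup>2" for x
    proof -
      have "\<bar>f x \<bullet> g x\<bar> \<le> cmod (f x) * cmod (g x)"
        by (rule Cauchy_Schwarz_ineq2)
      moreover have "0 \<le> cmod (f x) * cmod (g x)" by simp
      ultimately show ?thesis
        using sum_squares_bound[of "cmod (f x)" "cmod (g x)"] by linarith
    qed
    then show "AE x in lborel. norm (f x \<bullet> g x) \<le> norm ((cmod (f x))\<^sup>2 + (cmod (g x))\<^sup>2)"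
      by simp
  qed measurable
qed

quotient_type (overloaded) 'a L2 = "'a::euclidean_space \<Rightarrow> complex" / partial: L2_eq
  morphisms L2_fun abs_L2
proof (rule part_equivpI)
  show "\<exists>f::'a \<Rightarrow> complex. L2_eq f f"
    using square_integrable_zero by (auto simp: L2_eq_def)
  show "symp (L2_eq :: ('a \<Rightarrow> complex) \<Rightarrow> _)"
    by (auto simp: symp_def L2_eq_def)
  show "transp (L2_eq :: ('a \<Rightarrow> complex) \<Rightarrow> _)"
    by (auto simp: transp_def L2_eq_def)
qed

text \<open>\<open>L2_fun f\<close> is an arbitrary representative of the class \<open>f\<close>; every construction below
  depends on it only up to null sets.\<close>

lift_definition L2_cmult :: "complex \<Rightarrow> 'a::euclidean_space L2 \<Rightarrow> 'a L2"
  is "\<lambda>c f x. c * f x"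
  unfolding L2_eq_def by (auto simp: square_integrable_cmult)

instantiation L2 :: (euclidean_space) real_inner
begin

lift_definition zero_L2 :: "'a L2" is "\<lambda>x. 0"
  by (simp add: L2_eq_def square_integrable_zero)

lift_definition plus_L2 :: "'a L2 \<Rightarrow> 'a L2 \<Rightarrow> 'a L2" is "\<lambda>f g x. f x + g x"
  unfolding L2_eq_def by (auto simp: square_integrable_add)

lift_definition uminus_L2 :: "'a L2 \<Rightarrow> 'a L2" is "\<lambda>f x. - f x"
  unfolding L2_eq_def using square_integrable_cmult[where c = "-1"] by auto

definition minus_L2 :: "'a L2 \<Rightarrow> 'a L2 \<Rightarrow> 'a L2" where
  "minus_L2 f g = f + (- g)"

lift_definition scaleR_L2 :: "real \<Rightarrow> 'a L2 \<Rightarrow> 'a L2" is "\<lambda>r f x. r *\<^sub>R f x"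
  unfolding L2_eq_def by (auto simp: scaleR_conv_of_real square_integrable_cmult)

text \<open>As \<open>z \<bullet> w = Re (z * cnj w)\<close> on \<^typ>\<open>complex\<close>, this is the real part of the usual Hermitian
  inner product; it induces the usual norm.\<close>

lift_definition inner_L2 :: "'a L2 \<Rightarrow> 'a L2 \<Rightarrow> real" is "\<lambda>f g. LINT x|lborel. f x \<bullet> g x"
  unfolding L2_eq_def
  by (intro integral_cong_AE) (auto simp: square_integrable_def)

definition norm_L2 :: "'a L2 \<Rightarrow> real" where
  "norm_L2 f = sqrt (f \<bullet> f)"

definition dist_L2 :: "'a L2 \<Rightarrow> 'a L2 \<Rightarrow> real" where
  "dist_L2 f g = norm (f - g)"

definition sgn_L2 :: "'a L2 \<Rightarrow> 'a L2" where
  "sgn_L2 f = inverse (norm f) *\<^sub>R f"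

definition uniformity_L2 :: "('a L2 \<times> 'a L2) filter" where
  "uniformity_L2 = (INF e\<in>{0 <..}. principal {(f, g). dist f g < e})"

definition open_L2 :: "'a L2 set \<Rightarrow> bool" where
  "open_L2 U \<longleftrightarrow> (\<forall>f\<in>U. eventually (\<lambda>(f', g). f' = f \<longrightarrow> g \<in> U) uniformity)"

instance
proof
  fix f g h :: "'a L2" and r q :: real
  show "f + g + h = f + (g + h)"
    by transfer (auto simp: L2_eq_def square_integrable_add add.assoc)
  show "f + g = g + f"
    by transfer (auto simp: L2_eq_def square_integrable_add add.commute)
  show "0 + f = f"
    by transfer (auto simp: L2_eq_def)
  show "- f + f = 0"
    by transfer (auto simp: L2_eq_def square_integrable_zero)
  show "f - g = f + - g"
    by (rule minus_L2_def)
  show "r *\<^sub>R (f + g) = r *\<^sub>R f + r *\<^sub>R g"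
    by transfer
      (auto simp: L2_eq_def scaleR_conv_of_real square_integrable_cmult square_integrable_add
        distrib_left)
  show "(r + q) *\<^sub>R f = r *\<^sub>R f + q *\<^sub>R f"
    by transfer
      (auto simp: L2_eq_def scaleR_conv_of_real square_integrable_cmult square_integrable_add
        distrib_right)
  show "r *\<^sub>R q *\<^sub>R f = (r * q) *\<^sub>R f"
    by transfer
      (auto simp: L2_eq_def scaleR_conv_of_real square_integrable_cmult mult.assoc)
  show "1 *\<^sub>R f = f"
    by transfer (auto simp: L2_eq_def)
  show "dist f g = norm (f - g)"
    by (rule dist_L2_def)
  show "sgn f = inverse (norm f) *\<^sub>R f"
    by (rule sgn_L2_def)
  show "(uniformity :: ('a L2 \<times> 'a L2) filter) =
      (INF e\<in>{0 <..}. principal {(f, g). dist f g < e})"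
    by (rule uniformity_L2_def)
  show "open U \<longleftrightarrow> (\<forall>f\<in>U. \<forall>\<^sub>F (f', g) in uniformity. f' = f \<longrightarrow> g \<in> U)" for U :: "'a L2 set"
    by (rule open_L2_def)
  show "f \<bullet> g = g \<bullet> f"
    by transfer (simp add: inner_commute)
  show "(f + g) \<bullet> h = f \<bullet> h + g \<bullet> h"
    by transfer (simp add: inner_add_left L2_eq_def square_integrable_inner)
  show "(r *\<^sub>R f) \<bullet> g = r * (f \<bullet> g)"
    by transfer simp
  show "0 \<le> f \<bullet> f"
    by transfer (simp add: integral_nonneg_AE)
  show "f \<bullet> f = 0 \<longleftrightarrow> f = 0"
  proof (transfer, goal_cases)
    case (1 f)
    then have f: "square_integrable f" by (simp add: L2_eq_def)
    have "(LINT x|lborel. f x \<bullet> f x) = 0 \<longleftrightarrow> (AE x in lborel. f x \<bullet> f x = 0)"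
      using square_integrable_inner[OF f f] by (intro integral_nonneg_eq_0_iff_AE) auto
    then show ?case using f by (simp add: L2_eq_def square_integrable_zero)
  qed
  show "norm f = sqrt (f \<bullet> f)"
    by (rule norm_L2_def)
qed

end

text \<open>The class of a function that is not square integrable is set to the dummy value \<open>0\<close>.\<close>

definition to_L2 :: "('a::euclidean_space \<Rightarrow> complex) \<Rightarrow> 'a L2" where
  "to_L2 f = (if square_integrable f then abs_L2 f else 0)"


section \<open>Fourier transform, Sobolev spaces, propagator\<close>

text \<open>The unitary normalisation with phase \<open>exp (- i x \<cdot> \<xi>)\<close>, so that the Laplacian has the symbol
  \<open>- |\<xi>|\<^sup>2\<close>.\<close>

definition fourier_integral :: "('a::euclidean_space \<Rightarrow> complex) \<Rightarrow> 'a \<Rightarrow> complex" where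
  "fourier_integral f \<xi> =
     of_real ((2 * pi) powr (- real DIM('a) / 2)) *
     (LINT x|lborel. exp (- \<i> * of_real (x \<bullet> \<xi>)) * f x)"

definition inv_fourier_integral :: "('a::euclidean_space \<Rightarrow> complex) \<Rightarrow> 'a \<Rightarrow> complex" where
  "inv_fourier_integral g x =
     of_real ((2 * pi) powr (- real DIM('a) / 2)) *
     (LINT \<xi>|lborel. exp (\<i> * of_real (x \<bullet> \<xi>)) * g \<xi>)"

definition truncate_ball :: "real \<Rightarrow> ('a::euclidean_space \<Rightarrow> complex) \<Rightarrow> 'a \<Rightarrow> complex" where
  "truncate_ball R f x = (if norm x \<le> R then f x else 0)"

text \<open>The Plancherel transform on \<open>L\<^sup>2\<close>, as the limit in mean of the transforms of the truncations,
  which lie in \<open>L\<^sup>1 \<inter> L\<^sup>2\<close>.\<close>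

definition fourier :: "'a::euclidean_space L2 \<Rightarrow> 'a L2" where
  "fourier f = Lim at_top (\<lambda>R. to_L2 (fourier_integral (truncate_ball R (L2_fun f))))"

definition inv_fourier :: "'a::euclidean_space L2 \<Rightarrow> 'a L2" where
  "inv_fourier g = Lim at_top (\<lambda>R. to_L2 (inv_fourier_integral (truncate_ball R (L2_fun g))))"

definition fourier_multiplier ::
    "('a::euclidean_space \<Rightarrow> complex) \<Rightarrow> 'a L2 \<Rightarrow> 'a L2" where
  "fourier_multiplier m f = inv_fourier (to_L2 (\<lambda>\<xi>. m \<xi> * L2_fun (fourier f) \<xi>))"

definition japanese_bracket :: "'a::euclidean_space \<Rightarrow> real" where
  "japanese_bracket \<xi> = sqrt (1 + (norm \<xi>)\<^sup>2)"

definition sobolev_weighted :: "real \<Rightarrow> 'a::euclidean_space L2 \<Rightarrow> 'a \<Rightarrow> complex" where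
  "sobolev_weighted s f \<xi> = of_real (japanese_bracket \<xi> powr s) * L2_fun (fourier f) \<xi>"

text \<open>\<open>H\<^sup>s\<close> as a subset of \<open>L\<^sup>2\<close>; this is the whole Sobolev space only for \<open>s \<ge> 0\<close>.\<close>

definition sobolev_space :: "real \<Rightarrow> 'a::euclidean_space L2 set" where
  "sobolev_space s = {f. square_integrable (sobolev_weighted s f)}"

definition sobolev_norm :: "real \<Rightarrow> 'a::euclidean_space L2 \<Rightarrow> real" where
  "sobolev_norm s f = norm (to_L2 (sobolev_weighted s f))"

definition continuous_sobolev :: "real \<Rightarrow> real set \<Rightarrow> (real \<Rightarrow> 'a::euclidean_space L2) \<Rightarrow> bool" where
  "continuous_sobolev s I u \<longleftrightarrow>
     (\<forall>t\<in>I. u t \<in> sobolev_space s) \<and>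
     (\<forall>t\<in>I. ((\<lambda>\<tau>. sobolev_norm s (u \<tau> - u t)) \<longlongrightarrow> 0) (at t within I))"

definition Linf_sobolev_norm :: "real \<Rightarrow> real set \<Rightarrow> (real \<Rightarrow> 'a::euclidean_space L2) \<Rightarrow> ereal" where
  "Linf_sobolev_norm s I u = esssup (lebesgue_on I) (\<lambda>t. ereal (sobolev_norm s (u t)))"

definition oriented_integral :: "real \<Rightarrow> real \<Rightarrow> (real \<Rightarrow> 'b::real_normed_vector) \<Rightarrow> 'b" where
  "oriented_integral a b f = (if a \<le> b then integral {a..b} f else - integral {b..a} f)"

definition propagator ::
    "(real \<Rightarrow> real) \<Rightarrow> (real \<Rightarrow> real) \<Rightarrow> real \<Rightarrow> real \<Rightarrow> 'a::euclidean_space L2 \<Rightarrow> 'a L2" where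
  "propagator \<alpha> \<beta> t r =
     fourier_multiplier (\<lambda>\<xi>.
       exp (- \<i> * of_real ((norm \<xi>)^2 * oriented_integral r t \<alpha>)
            + \<i> * of_real ((norm \<xi>)^4 * oriented_integral r t \<beta>)))"


section \<open>The Hartree nonlinearity and the integral equation\<close>

definition convolution :: "('a::euclidean_space \<Rightarrow> real) \<Rightarrow> ('a \<Rightarrow> real) \<Rightarrow> 'a \<Rightarrow> real" where
  "convolution g h x = (LINT y|lborel. g (x - y) * h y)"

definition hartree :: "real \<Rightarrow> 'a::euclidean_space L2 \<Rightarrow> 'a L2" where
  "hartree lam f = to_L2 (\<lambda>x.
     of_real (convolution (\<lambda>z. norm z powr (- lam)) (\<lambda>y. (cmod (L2_fun f y))\<^sup>2) x) * L2_fun f x)"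

text \<open>The time integral is taken in \<open>L\<^sup>2\<close>.  For \<open>u\<close> continuous into \<open>H\<^sup>s\<close> with \<open>s \<ge> lam/2\<close> the
  integrand is continuous into \<open>H\<^sup>s\<close>, which embeds continuously into \<open>L\<^sup>2\<close>, so this is the same
  element as the integral in \<open>H\<^sup>s\<close>.\<close>

definition mild_solution ::
    "real \<Rightarrow> real \<Rightarrow> (real \<Rightarrow> real) \<Rightarrow> (real \<Rightarrow> real) \<Rightarrow> real \<Rightarrow> 'a::euclidean_space L2 \<Rightarrow> real set \<Rightarrow>
     (real \<Rightarrow> 'a L2) \<Rightarrow> bool" where
  "mild_solution lam \<theta> \<alpha> \<beta> t\<^sub>0 u\<^sub>0 I u \<longleftrightarrow>
     (\<forall>t\<in>I.
        (\<lambda>\<tau>. propagator \<alpha> \<beta> t \<tau> (hartree lam (u \<tau>))) integrable_on closed_segment t\<^sub>0 t \<and>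
        u t = propagator \<alpha> \<beta> t t\<^sub>0 u\<^sub>0 +
          L2_cmult (\<i> * of_real \<theta>)
            (oriented_integral t\<^sub>0 t (\<lambda>\<tau>. propagator \<alpha> \<beta> t \<tau> (hartree lam (u \<tau>)))))"

end

theory Submission
  imports Defs "HOL-Probability.Characteristic_Functions"
begin

text \<open>
  Writing \<open>|x|\<^sup>-\<^sup>\<lambda>\<close> as a superposition of Gaussians, Plancherel's theorem and Schur's test for the
  Riesz kernel give the Hardy inequality \<open>(|x|\<^sup>-\<^sup>\<lambda> * |u|\<^sup>2)(y) \<le> H \<integral> |\<xi>|\<^sup>\<lambda> |v(\<xi>)|\<^sup>2 d\<xi>\<close>, uniformly
  in \<open>y\<close>, where \<open>v\<close> is the Fourier transform of \<open>u\<close>.  So for \<open>s \<ge> \<lambda> / 2\<close> the Hartree term is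
  Lipschitz in \<open>L\<^sup>2\<close> on balls of \<open>H\<^sup>s\<close>.  Its cubic bound in \<open>H\<^sup>s\<close> follows by duality: since the
  Riesz kernel has a positive Fourier transform, the pairing is controlled by an integral over
  four frequencies, and the weight of the output frequency is distributed over the three inputs.
  After conjugation with the unitary propagator (the interaction picture) the Picard iterates stay
  in a ball of \<open>H\<^sup>s\<close> and converge in \<open>L\<^sup>2\<close>; the limit stays in the ball, and the equation itself
  then gives continuity in \<open>H\<^sup>s\<close>.  Uniqueness is a Gronwall argument in \<open>L\<^sup>2\<close>.
\<close>

section \<open>Calculus and completeness of \<open>L\<^sup>2\<close>\<close>

text \<open>Since \<open>lam / 2 < d / 2\<close>, at the endpoint \<open>s = lam / 2\<close> the
  space H^s contains unbounded functions and is no algebra; what stays bounded is the potential, and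
  Hardy's inequality is exactly that bound. The obstacle is the H^s norm of the product. The weight
  sits on the output frequency, and once it has been moved to an input only moduli of transforms
  remain, which no longer belong to the given functions. So the moduli are turned into functions of
  their own by \<open>of_spec\<close>: Sobolev norms do not change, and because these transforms are
  nonnegative the frequency integral is, up to a constant, the exact value of an integral in space,
  where Hardy and Cauchy-Schwarz are available again. Every passage between
  \<open>|x| powr (- lam)\<close> and \<open>|\<xi>| powr (lam - d)\<close> is made for one Gaussian
  at a time and integrated over the widths afterwards, so that no transform of a distribution is
  taken. The Lipschitz bound is one in L2, hence a contraction in L2; membership in H^s is carried
  by balls, closed in L2 because the H^s norm is a supremum of norms of bounded operators. The ball
  has twice the radius of the data, hence C = 2.\<close>

lemma square_integrable_iff_nn_integral:
  fixes f :: "'a::euclidean_space \<Rightarrow> complex"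
  assumes [measurable]: "f \<in> borel_measurable borel"
  shows "square_integrable f \<longleftrightarrow> (\<integral>\<^sup>+x. ennreal ((cmod (f x))\<^sup>2) \<partial>lborel) < \<infinity>"
  unfolding square_integrable_def by (auto simp: integrable_iff_bounded)

lemma square_integrable_measurable: "square_integrable f \<Longrightarrow> f \<in> borel_measurable borel"
  by (simp add: square_integrable_def)

lemma square_integrable_L2_fun [simp]: "square_integrable (L2_fun f)"
  using Quotient3_rep_reflp[OF Quotient3_L2, of f] by (simp add: L2_eq_def)

lemma measurable_L2_fun [measurable]: "L2_fun f \<in> borel_measurable borel"
  by (rule square_integrable_measurable) simp

lemma square_integrable_mono:
  assumes "square_integrable g" and [measurable]: "f \<in> borel_measurable borel"
    and "\<And>x. cmod (f x) \<le> cmod (g x)"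
  shows "square_integrable f"
proof -
  have "integrable lborel (\<lambda>x. (cmod (f x))\<^sup>2)"
  proof (rule Bochner_Integration.integrable_bound)
    show "integrable lborel (\<lambda>x. (cmod (g x))\<^sup>2)"
      using assms(1) by (simp add: square_integrable_def)
    show "AE x in lborel. norm ((cmod (f x))\<^sup>2) \<le> norm ((cmod (g x))\<^sup>2)"
      using power_mono[OF assms(3) norm_ge_zero, where n = 2] by simp
  qed measurable
  then show ?thesis by (simp add: square_integrable_def)
qed

lemma square_integrable_diff:
  assumes "square_integrable f" "square_integrable g"
  shows "square_integrable (\<lambda>x. f x - g x)"
  using square_integrable_add[OF assms(1) square_integrable_cmult[OF assms(2), of "-1"]] by simp

lemma to_L2_L2_fun [simp]: "to_L2 (L2_fun f) = f"
  using Quotient3_abs_rep[OF Quotient3_L2] by (simp add: to_L2_def)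

lemma L2_fun_to_L2:
  assumes "square_integrable f"
  shows "AE x in lborel. L2_fun (to_L2 f) x = f x"
  using Quotient3_rep_abs[OF Quotient3_L2, of f] assms by (simp add: to_L2_def L2_eq_def)

lemma square_integrable_cong_AE:
  assumes "square_integrable f" and [measurable]: "g \<in> borel_measurable borel"
    and "AE x in lborel. f x = g x"
  shows "square_integrable g"
proof -
  have [measurable]: "f \<in> borel_measurable borel" by (rule square_integrable_measurable) fact
  have "integrable lborel (\<lambda>x. (cmod (g x))\<^sup>2) = integrable lborel (\<lambda>x. (cmod (f x))\<^sup>2)"
    using assms(3) by (intro integrable_cong_AE) auto
  then show ?thesis using assms(1) by (simp add: square_integrable_def)
qed

lemma to_L2_cong_AE:
  assumes [measurable]: "f \<in> borel_measurable borel" "g \<in> borel_measurable borel"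
    and eq: "AE x in lborel. f x = g x"
  shows "to_L2 f = to_L2 g"
proof (cases "square_integrable f")
  case True
  then have "square_integrable g" using square_integrable_cong_AE[of f g] eq by simp
  with True show ?thesis
    using Quotient3_rel[OF Quotient3_L2, of f g] eq by (simp add: to_L2_def L2_eq_def)
next
  case False
  have "AE x in lborel. g x = f x" using eq by eventually_elim simp
  with False have "\<not> square_integrable g" using square_integrable_cong_AE[of g f] by auto
  with False show ?thesis by (simp add: to_L2_def)
qed

lemma to_L2_add:
  assumes "square_integrable f" "square_integrable g"
  shows "to_L2 f + to_L2 g = to_L2 (\<lambda>x. f x + g x)"
  using assms plus_L2.abs_eq[of f g] by (simp add: to_L2_def L2_eq_def square_integrable_add)

lemma to_L2_uminus:
  assumes "square_integrable f"
  shows "- to_L2 f = to_L2 (\<lambda>x. - f x)"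
  using assms uminus_L2.abs_eq[of f] square_integrable_cmult[OF assms, of "-1"]
  by (simp add: to_L2_def L2_eq_def)

lemma to_L2_diff:
  assumes "square_integrable f" "square_integrable g"
  shows "to_L2 f - to_L2 g = to_L2 (\<lambda>x. f x - g x)"
  unfolding diff_conv_add_uminus to_L2_uminus[OF assms(2)]
  using assms square_integrable_cmult[OF assms(2), of "-1"] by (simp add: to_L2_add)

lemma to_L2_scaleR:
  assumes "square_integrable f"
  shows "r *\<^sub>R to_L2 f = to_L2 (\<lambda>x. of_real r * f x)"
  using assms scaleR_L2.abs_eq[of f r]
  by (simp add: to_L2_def L2_eq_def square_integrable_cmult scaleR_conv_of_real)

lemma L2_cmult_to_L2:
  assumes "square_integrable f"
  shows "L2_cmult c (to_L2 f) = to_L2 (\<lambda>x. c * f x)"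
  using assms L2_cmult.abs_eq[of f c] by (simp add: to_L2_def L2_eq_def square_integrable_cmult)

lemma to_L2_inner:
  assumes "square_integrable f" "square_integrable g"
  shows "to_L2 f \<bullet> to_L2 g = (LINT x|lborel. f x \<bullet> g x)"
  using assms inner_L2.abs_eq[of f g] by (simp add: to_L2_def L2_eq_def)

lemma L2_inner: "f \<bullet> g = (LINT x|lborel. L2_fun f x \<bullet> L2_fun g x)"
  using to_L2_inner[of "L2_fun f" "L2_fun g"] by simp

lemma L2_fun_add: "AE x in lborel. L2_fun (f + g) x = L2_fun f x + L2_fun g x"
  using L2_fun_to_L2[of "\<lambda>x. L2_fun f x + L2_fun g x"] to_L2_add[of "L2_fun f" "L2_fun g"]
  by (simp add: square_integrable_add)

lemma L2_fun_diff: "AE x in lborel. L2_fun (f - g) x = L2_fun f x - L2_fun g x"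
  using L2_fun_to_L2[of "\<lambda>x. L2_fun f x - L2_fun g x"] to_L2_diff[of "L2_fun f" "L2_fun g"]
  by (simp add: square_integrable_diff)

lemma L2_fun_scaleR: "AE x in lborel. L2_fun (r *\<^sub>R f) x = of_real r * L2_fun f x"
  using L2_fun_to_L2[of "\<lambda>x. of_real r * L2_fun f x"] to_L2_scaleR[of "L2_fun f" r]
  by (simp add: square_integrable_cmult)

lemma norm_to_L2_square:
  assumes "square_integrable f"
  shows "(norm (to_L2 f))\<^sup>2 = (LINT x|lborel. (cmod (f x))\<^sup>2)"
  using to_L2_inner[OF assms assms] by (simp add: power2_norm_eq_inner)

lemma nn_norm_to_L2_square:
  assumes "square_integrable f"
  shows "ennreal ((norm (to_L2 f))\<^sup>2) = (\<integral>\<^sup>+x. ennreal ((cmod (f x))\<^sup>2) \<partial>lborel)"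
  using assms by (simp add: norm_to_L2_square nn_integral_eq_integral square_integrable_def)

lemma nn_norm_L2_square:
  "ennreal ((norm f)\<^sup>2) = (\<integral>\<^sup>+x. ennreal ((cmod (L2_fun f x))\<^sup>2) \<partial>lborel)"
  using nn_norm_to_L2_square[of "L2_fun f"] by simp

lemma norm_to_L2_le:
  assumes "0 \<le> B" "(\<integral>\<^sup>+x. ennreal ((cmod (f x))\<^sup>2) \<partial>lborel) \<le> ennreal (B\<^sup>2)"
  shows "norm (to_L2 f) \<le> B"
proof (cases "square_integrable f")
  case True
  then have "ennreal ((norm (to_L2 f))\<^sup>2) \<le> ennreal (B\<^sup>2)"
    using assms(2) by (simp add: nn_norm_to_L2_square)
  then have "(norm (to_L2 f))\<^sup>2 \<le> B\<^sup>2" by (simp add: ennreal_le_iff)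
  then show ?thesis using assms(1) by (rule power2_le_imp_le)
qed (use assms in \<open>simp add: to_L2_def\<close>)

lemma nn_integral_le_square_imp_square_integrable:
  fixes f :: "'a::euclidean_space \<Rightarrow> complex"
  assumes "f \<in> borel_measurable borel"
    and "(\<integral>\<^sup>+x. ennreal ((cmod (f x))\<^sup>2) \<partial>lborel) \<le> ennreal B"
  shows "square_integrable f"
  unfolding square_integrable_iff_nn_integral[OF assms(1)]
  by (rule order_le_less_trans[OF assms(2)]) simp

text \<open>Riesz--Fischer.  Along a subsequence with increments \<open>d\<^sub>n\<close> of norm at most \<open>2\<^sup>-\<^sup>n\<close> the
  series of the \<open>2\<^sup>n d\<^sub>n\<^sup>2\<close> has a finite integral, and \<open>2 d\<^sub>n \<le> 2\<^sup>n d\<^sub>n\<^sup>2 + 2\<^sup>-\<^sup>n\<close> gives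
  pointwise convergence almost everywhere.\<close>

lemma L2_Cauchy_converges_AE_subseq:
  fixes X :: "nat \<Rightarrow> 'a::euclidean_space L2"
  assumes "Cauchy X"
  shows "\<exists>r. strict_mono r \<and> (AE x in lborel. convergent (\<lambda>n. L2_fun (X (r n)) x))"
proof -
  have "\<exists>N. \<forall>m\<ge>N. \<forall>n\<ge>N. norm (X m - X n) < (1/2)^k" for k
    using assms by (intro CauchyD) auto
  then obtain N where N: "\<And>k m n. N k \<le> m \<Longrightarrow> N k \<le> n \<Longrightarrow> norm (X m - X n) < (1/2)^k"
    by metis
  \<comment> \<open>\<open>Suc p\<close> makes \<open>r\<close> strictly increasing, hence a
    subsequence; the maximum keeps it above the threshold \<open>N\<close>, hence increments below
    \<open>(1/2)^n\<close>.\<close>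
  define r where "r = rec_nat (N 0) (\<lambda>k p. max (Suc p) (N (Suc k)))"
  have r: "strict_mono r" unfolding strict_mono_Suc_iff r_def by (auto simp: less_max_iff_disj)
  have rN: "N k \<le> r k" for k by (cases k) (auto simp: r_def)
  define d where "d n x = cmod (L2_fun (X (r (Suc n))) x - L2_fun (X (r n)) x)" for n x
  have dm[measurable]: "d n \<in> borel_measurable borel" for n unfolding d_def by measurable
  have dn: "(\<integral>\<^sup>+x. ennreal ((d n x)\<^sup>2) \<partial>lborel) \<le> ennreal ((1/4)^n)" for n
  proof -
    have "(\<integral>\<^sup>+x. ennreal ((d n x)\<^sup>2) \<partial>lborel) = ennreal ((norm (X (r (Suc n)) - X (r n)))\<^sup>2)"
      using nn_norm_to_L2_square[of "\<lambda>x. L2_fun (X (r (Suc n))) x - L2_fun (X (r n)) x"]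
        to_L2_diff[of "L2_fun (X (r (Suc n)))" "L2_fun (X (r n))"]
      by (simp add: square_integrable_diff d_def)
    also have "\<dots> \<le> ennreal (((1/2)^n)\<^sup>2)"
      using N[of n "r (Suc n)" "r n"] rN[of n] r[THEN strict_monoD, of n "Suc n"]
      by (intro ennreal_leI power_mono) auto
    also have "((1/2)^n)\<^sup>2 = ((1/4)^n :: real)"
      by (simp add: power_divide power2_eq_square flip: power_mult_distrib)
    finally show ?thesis .
  qed
  have "(\<integral>\<^sup>+x. (\<Sum>n. ennreal (2^n * (d n x)\<^sup>2)) \<partial>lborel)
      = (\<Sum>n. \<integral>\<^sup>+x. ennreal (2^n * (d n x)\<^sup>2) \<partial>lborel)"
    by (rule nn_integral_suminf) measurable
  also have "\<dots> \<le> (\<Sum>n. ennreal ((1/2)^n))"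
  proof (rule suminf_le)
    fix n
    have "(\<integral>\<^sup>+x. ennreal (2^n * (d n x)\<^sup>2) \<partial>lborel)
        = ennreal (2^n) * (\<integral>\<^sup>+x. ennreal ((d n x)\<^sup>2) \<partial>lborel)"
      by (subst nn_integral_cmult[symmetric]) (auto simp: ennreal_mult)
    also have "\<dots> \<le> ennreal (2^n) * ennreal ((1/4)^n)" by (intro mult_left_mono dn) auto
    also have "\<dots> = ennreal (2^n * (1/4)^n)" by (rule ennreal_mult[symmetric]) auto
    also have "2^n * (1/4)^n = (1/2 :: real)^n" by (subst power_mult_distrib[symmetric]) simp
    finally show "(\<integral>\<^sup>+x. ennreal (2^n * (d n x)\<^sup>2) \<partial>lborel) \<le> ennreal ((1/2)^n)" .
  qed auto
  also have "\<dots> = ennreal 2"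
    by (subst suminf_ennreal2) (auto simp: suminf_geometric)
  finally have "AE x in lborel. (\<Sum>n. ennreal (2^n * (d n x)\<^sup>2)) \<noteq> \<infinity>"
    by (intro nn_integral_PInf_AE) (auto simp: top_unique)
  then have "AE x in lborel. convergent (\<lambda>n. L2_fun (X (r n)) x)"
  proof eventually_elim
    case (elim x)
    then have "summable (\<lambda>n. 2^n * (d n x)\<^sup>2)"
      by (intro summable_suminf_not_top) auto
    then have "summable (\<lambda>n. (2^n * (d n x)\<^sup>2 + (1/2)^n) / 2)"
      by (intro summable_divide summable_add summable_geometric) auto
    moreover have "d n x \<le> (2^n * (d n x)\<^sup>2 + (1/2)^n) / 2" for n
    proof -
      have "0 \<le> (2^n * d n x - 1)\<^sup>2 / 2^n" by simp
      also have "\<dots> = 2^n * (d n x)\<^sup>2 + (1/2)^n - 2 * d n x"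
        by (simp add: power2_eq_square field_simps)
      finally show ?thesis by simp
    qed
    moreover have "0 \<le> d n x" for n by (simp add: d_def)
    ultimately have "summable (\<lambda>n. d n x)"
      by (intro summable_comparison_test'[of "\<lambda>n. (2^n * (d n x)\<^sup>2 + (1/2)^n) / 2" 0 "\<lambda>n. d n x"]) auto
    then have "summable (\<lambda>n. L2_fun (X (r (Suc n))) x - L2_fun (X (r n)) x)"
      unfolding d_def by (rule summable_norm_cancel)
    then have "convergent (\<lambda>n. L2_fun (X (r n)) x - L2_fun (X (r 0)) x)"
      by (simp add: summable_iff_convergent sum_lessThan_telescope[where f = "\<lambda>n. L2_fun (X (r n)) x"])
    then have "convergent (\<lambda>n. L2_fun (X (r n)) x - L2_fun (X (r 0)) x + L2_fun (X (r 0)) x)"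
      by (intro convergent_add convergent_const)
    then show ?case by simp
  qed
  with r show ?thesis by blast
qed

text \<open>The pointwise limit of the subsequence is the candidate. Fatou's lemma, applied to
  differences with one index fixed, turns the Cauchy bound into a bound on the distance to it, and a
  Cauchy sequence with a convergent subsequence converges.\<close>

instance L2 :: (euclidean_space) banach
proof
  fix X :: "nat \<Rightarrow> 'a L2" assume X: "Cauchy X"
  obtain r where r: "strict_mono r" and cv: "AE x in lborel. convergent (\<lambda>n. L2_fun (X (r n)) x)"
    using L2_Cauchy_converges_AE_subseq[OF X] by blast
  \<comment> \<open>\<open>lim\<close> is a total function, so \<open>F\<close> is measurable on the
    whole space; its values on the null set of divergence are arbitrary.\<close>
  define F where "F x = lim (\<lambda>n. L2_fun (X (r n)) x)" for x
  have Fm[measurable]: "F \<in> borel_measurable borel" unfolding F_def by measurable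
  have est: "\<exists>N. \<forall>n\<ge>N. (\<integral>\<^sup>+x. ennreal ((cmod (L2_fun (X (r n)) x - F x))\<^sup>2) \<partial>lborel) \<le> ennreal (e\<^sup>2)"
    if "e > 0" for e
  proof -
    obtain N where N: "\<And>m n. m \<ge> N \<Longrightarrow> n \<ge> N \<Longrightarrow> norm (X m - X n) < e"
      using CauchyD[OF X \<open>e > 0\<close>] by blast
    have "(\<integral>\<^sup>+x. ennreal ((cmod (L2_fun (X (r n)) x - F x))\<^sup>2) \<partial>lborel) \<le> ennreal (e\<^sup>2)"
      if n: "n \<ge> N" for n
    proof -
      let ?g = "\<lambda>m x. L2_fun (X (r n)) x - L2_fun (X (r m)) x"
      have "(\<integral>\<^sup>+x. ennreal ((cmod (L2_fun (X (r n)) x - F x))\<^sup>2) \<partial>lborel)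
          = (\<integral>\<^sup>+x. liminf (\<lambda>m. ennreal ((cmod (?g m x))\<^sup>2)) \<partial>lborel)"
      proof (rule nn_integral_cong_AE, use cv in eventually_elim)
        case (elim x)
        then have "(\<lambda>m. L2_fun (X (r m)) x) \<longlonglongrightarrow> F x"
          by (simp add: F_def convergent_LIMSEQ_iff)
        then have "(\<lambda>m. ennreal ((cmod (?g m x))\<^sup>2)) \<longlonglongrightarrow> ennreal ((cmod (L2_fun (X (r n)) x - F x))\<^sup>2)"
          by (intro tendsto_ennrealI tendsto_intros)
        then show ?case by (intro lim_imp_Liminf[symmetric]) auto
      qed
      also have "\<dots> \<le> liminf (\<lambda>m. \<integral>\<^sup>+x. ennreal ((cmod (?g m x))\<^sup>2) \<partial>lborel)"
        by (rule nn_integral_liminf) measurable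
      also have "\<dots> \<le> ennreal (e\<^sup>2)"
      proof (rule order_trans[OF Liminf_le_Limsup Limsup_bounded])
        show "\<forall>\<^sub>F m in sequentially. (\<integral>\<^sup>+x. ennreal ((cmod (?g m x))\<^sup>2) \<partial>lborel) \<le> ennreal (e\<^sup>2)"
          using eventually_ge_at_top[of N]
        proof eventually_elim
          case (elim m)
          have "(\<integral>\<^sup>+x. ennreal ((cmod (?g m x))\<^sup>2) \<partial>lborel) = ennreal ((norm (X (r n) - X (r m)))\<^sup>2)"
            using nn_norm_to_L2_square[of "?g m"] to_L2_diff[of "L2_fun (X (r n))" "L2_fun (X (r m))"]
            by (simp add: square_integrable_diff)
          also have "\<dots> \<le> ennreal (e\<^sup>2)"
            using N[of "r n" "r m"] n elim seq_suble[OF r, of n] seq_suble[OF r, of m]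
            by (intro ennreal_leI power_mono) auto
          finally show ?case .
        qed
      qed simp
      finally show ?thesis .
    qed
    then show ?thesis by blast
  qed
  \<comment> \<open>The limit is a representative minus an error of finite norm; this is how
    \<open>F\<close> is found to lie in L2 at all.\<close>
  have "square_integrable (\<lambda>x. L2_fun (X (r n)) x - (L2_fun (X (r n)) x - F x))"
    if "(\<integral>\<^sup>+x. ennreal ((cmod (L2_fun (X (r n)) x - F x))\<^sup>2) \<partial>lborel) \<le> ennreal (1\<^sup>2)" for n
    using that
    by (intro square_integrable_diff[OF square_integrable_L2_fun] nn_integral_le_square_imp_square_integrable[of _ "1\<^sup>2"]) auto
  then have F: "square_integrable F" using est[of 1] by auto
  have "(X \<circ> r) \<longlonglongrightarrow> to_L2 F"
  proof (rule LIMSEQ_I)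
    fix e :: real assume "e > 0"
    then obtain N where N: "\<And>n. n \<ge> N \<Longrightarrow>
        (\<integral>\<^sup>+x. ennreal ((cmod (L2_fun (X (r n)) x - F x))\<^sup>2) \<partial>lborel) \<le> ennreal ((e/2)\<^sup>2)"
      using est[of "e/2"] by auto
    have "norm ((X \<circ> r) n - to_L2 F) < e" if "n \<ge> N" for n
    proof -
      have "norm (to_L2 (\<lambda>x. L2_fun (X (r n)) x - F x)) \<le> e/2"
        using N[OF that] \<open>e > 0\<close> by (intro norm_to_L2_le) auto
      then show ?thesis using to_L2_diff[of "L2_fun (X (r n))" F] F \<open>e > 0\<close> by simp
    qed
    then show "\<exists>no. \<forall>n\<ge>no. norm ((X \<circ> r) n - to_L2 F) < e" by blast
  qed
  then show "convergent X"
    using Cauchy_converges_subseq[OF X r] unfolding convergent_def by (auto simp: o_def)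
qed

subsection \<open>Dominated convergence and multiplication operators\<close>

text \<open>Dominated convergence for |f_n - F|^2 with the majorant 4 h^2. Square integrability is
  part of the conclusion because \<open>to_L2\<close> sends everything else to 0, and a limit of
  such dummy values would say nothing.\<close>

lemma tendsto_to_L2_dominated:
  fixes f :: "nat \<Rightarrow> 'a::euclidean_space \<Rightarrow> complex" and h :: "'a \<Rightarrow> real"
  assumes [measurable]: "\<And>n. f n \<in> borel_measurable borel" "F \<in> borel_measurable borel"
    and h: "integrable lborel (\<lambda>x. (h x)\<^sup>2)"
    and lim: "AE x in lborel. (\<lambda>n. f n x) \<longlonglongrightarrow> F x"
    and bd: "\<And>n. AE x in lborel. cmod (f n x) \<le> h x"
  shows "square_integrable F" "\<And>n. square_integrable (f n)" "(\<lambda>n. to_L2 (f n)) \<longlonglongrightarrow> to_L2 F"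
proof -
  have bd': "AE x in lborel. \<forall>n. cmod (f n x) \<le> h x" using bd by (simp add: AE_all_countable)
  have bdF: "AE x in lborel. cmod (F x) \<le> h x"
    using lim bd'
  proof eventually_elim
    case (elim x)
    then show ?case by (intro tendsto_upperbound[OF tendsto_norm]) auto
  qed
  have sq: "square_integrable k" if "AE x in lborel. cmod (k x) \<le> h x" and [measurable]: "k \<in> borel_measurable borel"
    for k :: "'a \<Rightarrow> complex"
  proof -
    have "integrable lborel (\<lambda>x. (cmod (k x))\<^sup>2)"
    proof (rule Bochner_Integration.integrable_bound[OF h])
      show "AE x in lborel. norm ((cmod (k x))\<^sup>2) \<le> norm ((h x)\<^sup>2)"
        using that(1) by eventually_elim (simp add: power_mono)
    qed measurable
    then show ?thesis by (simp add: square_integrable_def)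
  qed
  show F: "square_integrable F" and f: "square_integrable (f n)" for n
    using sq bd bdF by auto
  have "(\<lambda>n. LINT x|lborel. (cmod (f n x - F x))\<^sup>2) \<longlonglongrightarrow> (LINT x|(lborel :: 'a measure). 0)"
  proof (rule integral_dominated_convergence[where w = "\<lambda>x. 4 * (h x)\<^sup>2"])
    show "AE x in lborel. (\<lambda>n. (cmod (f n x - F x))\<^sup>2) \<longlonglongrightarrow> 0"
      using lim
    proof eventually_elim
      case (elim x)
      then have "(\<lambda>n. (cmod (f n x - F x))\<^sup>2) \<longlonglongrightarrow> (cmod (F x - F x))\<^sup>2" by (intro tendsto_intros)
      then show ?case by simp
    qed
    show "AE x in lborel. norm ((cmod (f n x - F x))\<^sup>2) \<le> 4 * (h x)\<^sup>2" for n
      using bd[of n] bdF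
    proof eventually_elim
      case (elim x)
      have "cmod (f n x - F x) \<le> 2 * h x" using norm_triangle_ineq4[of "f n x" "F x"] elim by linarith
      then have "(cmod (f n x - F x))\<^sup>2 \<le> (2 * h x)\<^sup>2" by (intro power_mono) auto
      then show ?case by (simp add: power2_eq_square)
    qed
  qed (use h in auto)
  then have "(\<lambda>n. (norm (to_L2 (f n) - to_L2 F))\<^sup>2) \<longlonglongrightarrow> 0"
    using f F by (simp add: to_L2_diff norm_to_L2_square square_integrable_diff)
  then have "(\<lambda>n. sqrt ((norm (to_L2 (f n) - to_L2 F))\<^sup>2)) \<longlonglongrightarrow> sqrt 0" by (rule tendsto_real_sqrt)
  then show "(\<lambda>n. to_L2 (f n)) \<longlonglongrightarrow> to_L2 F"
    by (simp add: tendsto_norm_zero_iff LIM_zero_iff)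
qed

definition L2_mult :: "('a::euclidean_space \<Rightarrow> complex) \<Rightarrow> 'a L2 \<Rightarrow> 'a L2" where
  "L2_mult m f = to_L2 (\<lambda>x. m x * L2_fun f x)"

text \<open>The bound is asked at every point, as it is available for the symbols that occur:
  unimodular phases, truncated weights, constants and Hartree potentials. Outside this class
  \<open>L2_mult\<close> may hit the dummy value 0 and can fail to be linear.\<close>

locale bounded_multiplier =
  fixes m :: "'a::euclidean_space \<Rightarrow> complex" and B :: real
  assumes measurable_m [measurable]: "m \<in> borel_measurable borel"
    and bound: "\<And>x. cmod (m x) \<le> B"
begin

lemma bound_nonneg: "0 \<le> B"
  using bound[of 0] norm_ge_zero order_trans by blast

lemma square_integrable_mult:
  assumes "square_integrable f"
  shows "square_integrable (\<lambda>x. m x * f x)"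
proof (rule square_integrable_mono)
  show "square_integrable (\<lambda>x. of_real B * f x)" using assms by (rule square_integrable_cmult)
  show "cmod (m x * f x) \<le> cmod (of_real B * f x)" for x
    using bound[of x] bound_nonneg by (simp add: norm_mult mult_right_mono)
  show "(\<lambda>x. m x * f x) \<in> borel_measurable borel"
    using square_integrable_measurable[OF assms] by measurable
qed

lemma L2_fun_mult: "AE x in lborel. L2_fun (L2_mult m f) x = m x * L2_fun f x"
  unfolding L2_mult_def by (intro L2_fun_to_L2 square_integrable_mult) simp

lemma mult_to_L2:
  assumes f: "square_integrable f"
  shows "L2_mult m (to_L2 f) = to_L2 (\<lambda>x. m x * f x)"
  unfolding L2_mult_def
proof (rule to_L2_cong_AE)
  have [measurable]: "f \<in> borel_measurable borel" using f by (rule square_integrable_measurable)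
  show "(\<lambda>x. m x * f x) \<in> borel_measurable borel" by measurable
  show "AE x in lborel. m x * L2_fun (to_L2 f) x = m x * f x"
    using L2_fun_to_L2[OF f] by eventually_elim simp
qed measurable

lemma norm_mult_le: "norm (L2_mult m f) \<le> B * norm f"
proof -
  have "(norm (L2_mult m f))\<^sup>2 = (LINT x|lborel. (cmod (m x * L2_fun f x))\<^sup>2)"
    unfolding L2_mult_def by (intro norm_to_L2_square square_integrable_mult) simp
  also have "\<dots> \<le> (LINT x|lborel. B\<^sup>2 * (cmod (L2_fun f x))\<^sup>2)"
  proof (rule integral_mono)
    show "integrable lborel (\<lambda>x. (cmod (m x * L2_fun f x))\<^sup>2)"
      using square_integrable_mult[of "L2_fun f", OF square_integrable_L2_fun] by (simp add: square_integrable_def)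
    show "integrable lborel (\<lambda>x. B\<^sup>2 * (cmod (L2_fun f x))\<^sup>2)"
      using square_integrable_L2_fun[of f] by (simp add: square_integrable_def)
    show "(cmod (m x * L2_fun f x))\<^sup>2 \<le> B\<^sup>2 * (cmod (L2_fun f x))\<^sup>2" for x
      unfolding norm_mult power_mult_distrib using bound[of x] by (intro mult_right_mono power_mono) auto
  qed
  also have "\<dots> = (B * norm f)\<^sup>2"
    using norm_to_L2_square[of "L2_fun f"] by (simp add: power_mult_distrib)
  finally show ?thesis by (rule power2_le_imp_le) (simp add: bound_nonneg)
qed

lemma bounded_linear_mult: "bounded_linear (L2_mult m)"
proof (rule bounded_linear_intro)
  have sq: "square_integrable (\<lambda>x. m x * L2_fun f x)" for f by (rule square_integrable_mult) simp
  show "L2_mult m (f + g) = L2_mult m f + L2_mult m g" for f g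
  proof -
    have "L2_mult m (f + g) = to_L2 (\<lambda>x. m x * L2_fun f x + m x * L2_fun g x)"
      unfolding L2_mult_def
      using L2_fun_add[of f g] by (intro to_L2_cong_AE) (auto simp: distrib_left elim: eventually_mono)
    then show ?thesis by (simp add: L2_mult_def to_L2_add sq)
  qed
  show "L2_mult m (r *\<^sub>R f) = r *\<^sub>R L2_mult m f" for r f
  proof -
    have "L2_mult m (r *\<^sub>R f) = to_L2 (\<lambda>x. of_real r * (m x * L2_fun f x))"
      unfolding L2_mult_def
      using L2_fun_scaleR[of r f] by (intro to_L2_cong_AE) (auto elim: eventually_mono)
    then show ?thesis by (simp add: L2_mult_def to_L2_scaleR sq)
  qed
  show "norm (L2_mult m f) \<le> norm f * B" for f
    using norm_mult_le[of f] by (simp add: mult.commute)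
qed

text \<open>On both sides \<open>to_L2\<close> receives functions that agree almost everywhere, so
  for an unbounded \<open>k\<close> even the dummy value is the same on both sides.\<close>

lemma mult_mult:
  assumes [measurable]: "k \<in> borel_measurable borel"
  shows "L2_mult k (L2_mult m f) = L2_mult (\<lambda>x. k x * m x) f"
  unfolding L2_mult_def[of k] L2_mult_def[of "\<lambda>x. k x * m x"]
  using L2_fun_mult[of f] by (intro to_L2_cong_AE) (auto elim: eventually_mono)

end

lemma L2_mult_one [simp]: "L2_mult (\<lambda>x. 1) f = f"
  by (simp add: L2_mult_def)

lemma L2_cmult_eq_mult: "L2_cmult c f = L2_mult (\<lambda>x. c) f"
  using L2_cmult_to_L2[of "L2_fun f" c] by (simp add: L2_mult_def)

lemma bounded_multiplier_const: "bounded_multiplier (\<lambda>x. c) (cmod c)"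
  by standard auto

lemma norm_L2_mult_unimodular:
  assumes [measurable]: "m \<in> borel_measurable borel" and "\<And>x. cmod (m x) = 1"
  shows "norm (L2_mult m f) = norm f"
proof -
  interpret bounded_multiplier m 1 by standard (use assms in auto)
  have "(norm (L2_mult m f))\<^sup>2 = (LINT x|lborel. (cmod (m x * L2_fun f x))\<^sup>2)"
    unfolding L2_mult_def by (intro norm_to_L2_square square_integrable_mult) simp
  also have "\<dots> = (norm f)\<^sup>2"
    using norm_to_L2_square[of "L2_fun f"] by (simp add: norm_mult assms(2))
  finally show ?thesis by simp
qed

text \<open>The symbols converge only pointwise, so the operators converge strongly and in general
  not in norm; the uniform bound provides the majorant \<open>B * |f|\<close>. This is the source of
  the continuity in time of the evolution.\<close>

lemma tendsto_L2_mult: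
  assumes "\<And>n. bounded_multiplier (m n) B" and "bounded_multiplier k C"
    and lim: "\<And>x. (\<lambda>n. m n x) \<longlonglongrightarrow> k x"
  shows "(\<lambda>n. L2_mult (m n) f) \<longlonglongrightarrow> L2_mult k f"
  unfolding L2_mult_def
proof (rule tendsto_to_L2_dominated(3)[where h = "\<lambda>x. B * cmod (L2_fun f x)"])
  interpret k: bounded_multiplier k C by fact
  show "(\<lambda>x. m n x * L2_fun f x) \<in> borel_measurable borel" for n
  proof -
    interpret bounded_multiplier "m n" B by fact
    show ?thesis by measurable
  qed
  show "AE x in lborel. cmod (m n x * L2_fun f x) \<le> B * cmod (L2_fun f x)" for n
    using bounded_multiplier.bound[OF assms(1), of n] by (simp add: norm_mult mult_right_mono)
  show "integrable lborel (\<lambda>x. (B * cmod (L2_fun f x))\<^sup>2)"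
    using square_integrable_L2_fun[of f] by (simp add: square_integrable_def power_mult_distrib)
  show "(\<lambda>x. k x * L2_fun f x) \<in> borel_measurable borel" by measurable
  show "AE x in lborel. (\<lambda>n. m n x * L2_fun f x) \<longlonglongrightarrow> k x * L2_fun f x"
    using lim by (intro AE_I2 tendsto_intros) auto
qed

section \<open>Gaussian integrals\<close>

lemma integral_lborel_prod:
  fixes f :: "'a::euclidean_space \<Rightarrow> real \<Rightarrow> complex"
  assumes "\<And>b. b \<in> Basis \<Longrightarrow> integrable lborel (f b)"
  shows "(LINT x|lborel. (\<Prod>b\<in>Basis. f b (x \<bullet> b))) = (\<Prod>b\<in>Basis. LINT x|lborel. f b x)"
proof -
  interpret product_sigma_finite "\<lambda>b::'a. lborel :: real measure" ..
  have [measurable]: "b \<in> Basis \<Longrightarrow> f b \<in> borel_measurable borel" for b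
    using borel_measurable_integrable[OF assms] by simp
  have "(LINT x|lborel. (\<Prod>b\<in>Basis. f b (x \<bullet> b)))
      = (LINT g|(\<Pi>\<^sub>M b\<in>Basis. lborel). (\<Prod>b\<in>Basis. f b ((\<Sum>b'\<in>Basis. g b' *\<^sub>R b') \<bullet> b)))"
    by (subst lborel_eq) (rule integral_distr; measurable)
  also have "\<dots> = (LINT g|(\<Pi>\<^sub>M b\<in>Basis. lborel). (\<Prod>b\<in>Basis. f b (g b)))"
    by (intro Bochner_Integration.integral_cong prod.cong refl) (simp add: inner_sum_left_Basis)
  also have "\<dots> = (\<Prod>b\<in>Basis. LINT x|lborel. f b x)"
    by (rule product_integral_prod) (use assms in auto)
  finally show ?thesis .
qed

definition gauss :: "real \<Rightarrow> 'a::euclidean_space \<Rightarrow> real" where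
  "gauss t x = exp (- (t * (norm x)\<^sup>2))"

lemma gauss_pos [simp]: "0 < gauss t x" and gauss_nonneg [simp]: "0 \<le> gauss t x"
  by (auto simp: gauss_def)

lemma gauss_le_one: "0 \<le> t \<Longrightarrow> gauss t x \<le> 1"
  by (simp add: gauss_def)

lemma measurable_gauss [measurable]: "gauss t \<in> borel_measurable borel"
  unfolding gauss_def by measurable

lemma gauss_conv_prod: "gauss t x = (\<Prod>b\<in>Basis. exp (- (t * (x \<bullet> b)\<^sup>2)))"
proof -
  have "(norm x)\<^sup>2 = (\<Sum>b\<in>Basis. (x \<bullet> b)\<^sup>2)"
    by (subst power2_norm_eq_inner, subst euclidean_inner) (simp add: power2_eq_square)
  then show ?thesis by (simp add: gauss_def exp_sum sum_distrib_left flip: sum_negf)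
qed

text \<open>After rescaling this is the characteristic function of the standard normal law, which
  replaces a shift of contour.\<close>

lemma has_bochner_integral_gauss_real:
  assumes t: "t > 0"
  shows "has_bochner_integral lborel (\<lambda>x. iexp (x * y) * of_real (exp (- (t * x\<^sup>2))))
    (of_real (sqrt (pi / t) * exp (- (y\<^sup>2 / (4 * t)))))"
proof -
  \<comment> \<open>With \<open>x = c * z\<close> the exponent \<open>t * x^2\<close> becomes
    \<open>z^2 / 2\<close>, that of the standard normal density.\<close>
  define c where "c = 1 / sqrt (2 * t)"
  have c: "c > 0" "c\<^sup>2 = 1 / (2 * t)" using t by (auto simp: c_def power_divide)
  have std: "integrable lborel (\<lambda>z. std_normal_density z *\<^sub>R iexp (c * y * z))"
  proof (rule Bochner_Integration.integrable_bound)
    show "integrable lborel std_normal_density" by (simp add: integrable_normal_density)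
    show "AE z in lborel. norm (std_normal_density z *\<^sub>R iexp (c * y * z)) \<le> norm (std_normal_density z)"
      by simp
  qed measurable
  have "(LINT z|lborel. std_normal_density z *\<^sub>R iexp (c * y * z)) = char std_normal_distribution (c * y)"
    unfolding char_def by (subst integral_density) auto
  also have "\<dots> = of_real (exp (- (y\<^sup>2 / (4 * t))))"
    by (simp add: char_std_normal_distribution power_mult_distrib c(2))
  finally have "has_bochner_integral lborel (\<lambda>z. std_normal_density z *\<^sub>R iexp (c * y * z))
      (of_real (exp (- (y\<^sup>2 / (4 * t)))))"
    using std by (simp add: has_bochner_integral_iff)
  then have "has_bochner_integral lborel (\<lambda>z. of_real (sqrt (2 * pi)) * (std_normal_density z *\<^sub>R iexp (c * y * z)))
      (of_real (sqrt (2 * pi)) * of_real (exp (- (y\<^sup>2 / (4 * t)))))"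
    by (rule has_bochner_integral_mult_right)
  also have "(\<lambda>z. of_real (sqrt (2 * pi)) * (std_normal_density z *\<^sub>R iexp (c * y * z)))
      = (\<lambda>z. iexp ((0 + c * z) * y) * of_real (exp (- (t * (0 + c * z)\<^sup>2))))"
    using t by (auto simp: fun_eq_iff normal_density_def power_mult_distrib c(2) scaleR_conv_of_real field_simps)
  also have "of_real (sqrt (2 * pi)) * of_real (exp (- (y\<^sup>2 / (4 * t))))
      = of_real (sqrt (pi / t) * exp (- (y\<^sup>2 / (4 * t)))) /\<^sub>R \<bar>c\<bar>"
  proof -
    have *: "sqrt (2 * pi) = sqrt (pi / t) / c" using t by (simp add: c_def real_sqrt_mult[symmetric])
    have "sqrt (2 * pi) * r = inverse \<bar>c\<bar> * (sqrt (pi / t) * r)" for r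
      unfolding * abs_of_pos[OF c(1)] divide_inverse by (simp only: mult_ac)
    then show ?thesis unfolding scaleR_conv_of_real by (simp only: of_real_mult[symmetric])
  qed
  finally show ?thesis
    using c lborel_has_bochner_integral_real_affine_iff[of c _ _ 0] by blast
qed

text \<open>The phase and the Gaussian both factor over the coordinates, so the integral is a
  product of one-dimensional ones.\<close>

lemma integral_iexp_gauss:
  fixes y :: "'a::euclidean_space"
  assumes t: "t > 0"
  shows "(LINT x|lborel. iexp (x \<bullet> y) * of_real (gauss t x))
    = of_real ((pi / t) powr (DIM('a) / 2) * gauss (1 / (4 * t)) y)"
proof -
  have "iexp (x \<bullet> y) * of_real (gauss t x)
      = (\<Prod>b\<in>Basis. iexp ((x \<bullet> b) * (y \<bullet> b)) * of_real (exp (- (t * (x \<bullet> b)\<^sup>2))))" for x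
    unfolding gauss_conv_prod prod.distrib by (subst euclidean_inner) (simp add: exp_sum sum_distrib_left)
  then have "(LINT x|lborel. iexp (x \<bullet> y) * of_real (gauss t x))
      = (\<Prod>b\<in>Basis. LINT x|lborel. iexp (x * (y \<bullet> b)) * of_real (exp (- (t * x\<^sup>2))))"
    by (simp only:) (rule integral_lborel_prod, use has_bochner_integral_gauss_real[OF t] in \<open>auto simp: has_bochner_integral_iff\<close>)
  also have "\<dots> = (\<Prod>b\<in>Basis. of_real (sqrt (pi / t) * exp (- ((y \<bullet> b)\<^sup>2 / (4 * t)))))"
    using has_bochner_integral_gauss_real[OF t] by (simp add: has_bochner_integral_iff)
  also have "\<dots> = of_real (sqrt (pi / t) ^ DIM('a) * gauss (1 / (4 * t)) y)"
    by (simp add: gauss_conv_prod prod.distrib)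
  also have "sqrt (pi / t) ^ DIM('a) = (pi / t) powr (DIM('a) / 2)"
    using t by (simp add: powr_half_sqrt[symmetric] powr_powr flip: powr_realpow)
  finally show ?thesis .
qed

lemma nn_integral_gauss:
  assumes t: "t > 0"
  shows "(\<integral>\<^sup>+x. ennreal (gauss t (x::'a::euclidean_space)) \<partial>lborel) = ennreal ((pi / t) powr (DIM('a) / 2))"
proof -
  have *: "(\<integral>\<^sup>+x. ennreal (exp (- (t * x\<^sup>2))) \<partial>(lborel :: real measure)) = ennreal (sqrt (pi / t))"
  proof (subst nn_integral_eq_integral)
    have "has_bochner_integral lborel (\<lambda>x. Re (of_real (exp (- (t * x\<^sup>2))))) (Re (of_real (sqrt (pi / t))))"
      using has_bochner_integral_Re[OF has_bochner_integral_gauss_real[OF t, of 0]] by simp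
    then show "integrable lborel (\<lambda>x. exp (- (t * x\<^sup>2)))"
      "ennreal (LINT x|lborel. exp (- (t * x\<^sup>2))) = ennreal (sqrt (pi / t))"
      by (auto simp: has_bochner_integral_iff)
  qed auto
  have "(\<integral>\<^sup>+x. ennreal (gauss t (x::'a)) \<partial>lborel)
      = (\<integral>\<^sup>+x. (\<Prod>b\<in>Basis. ennreal (exp (- (t * (x \<bullet> b)\<^sup>2)))) \<partial>(lborel :: 'a measure))"
    by (simp add: gauss_conv_prod prod_ennreal)
  also have "\<dots> = (\<Prod>b\<in>(Basis::'a set). ennreal (sqrt (pi / t)))"
    by (subst nn_integral_lborel_prod) (auto simp: *)
  also have "\<dots> = ennreal (sqrt (pi / t) ^ DIM('a))" using t by (simp add: ennreal_power)
  also have "sqrt (pi / t) ^ DIM('a) = (pi / t) powr (DIM('a) / 2)"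
    using t by (simp add: powr_half_sqrt[symmetric] powr_powr flip: powr_realpow)
  finally show ?thesis .
qed

lemma integrable_gauss: "t > 0 \<Longrightarrow> integrable lborel (gauss t)"
  by (auto simp: integrable_iff_bounded nn_integral_gauss)

lemma integral_gauss:
  "t > 0 \<Longrightarrow> (LINT x|lborel. gauss t (x::'a::euclidean_space)) = (pi / t) powr (DIM('a) / 2)"
proof -
  assume t: "t > 0"
  have "ennreal (LINT x|lborel. gauss t (x::'a)) = ennreal ((pi / t) powr (DIM('a) / 2))"
    using nn_integral_eq_integral[OF integrable_gauss[OF t, where 'a='a]] nn_integral_gauss[OF t, where 'a='a]
    by simp
  moreover have "0 \<le> (LINT x|lborel. gauss t (x::'a))"
    by (rule Bochner_Integration.integral_nonneg) simp
  ultimately show ?thesis by (simp add: ennreal_inj)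
qed

section \<open>Plancherel's theorem\<close>

definition phase :: "real \<Rightarrow> 'a::euclidean_space \<Rightarrow> 'a \<Rightarrow> complex" where
  "phase \<sigma> x \<xi> = exp (- \<i> * of_real (\<sigma> * (x \<bullet> \<xi>)))"

lemma cmod_phase [simp]: "cmod (phase \<sigma> x \<xi>) = 1"
  by (simp add: phase_def norm_exp_eq_Re)

lemma cnj_phase: "cnj (phase \<sigma> x \<xi>) = phase (- \<sigma>) x \<xi>"
  by (simp add: phase_def exp_cnj)

lemma measurable_cnj [measurable]:
  assumes [measurable]: "f \<in> borel_measurable M"
  shows "(\<lambda>x. cnj (f x)) \<in> borel_measurable M"
  by (rule borel_measurable_continuous_on[OF _ assms]) (intro continuous_intros)

lemma measurable_phase [measurable]:
  assumes [measurable]: "f \<in> borel_measurable M" "g \<in> borel_measurable M"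
  shows "(\<lambda>x. phase \<sigma> (f x) (g x)) \<in> borel_measurable M"
  unfolding phase_def by measurable

lemma integrable_prod_mult:
  fixes f k :: "'a::euclidean_space \<Rightarrow> complex"
  assumes f: "integrable lborel f" and k: "integrable lborel k"
    and [measurable]: "p \<in> borel_measurable (borel \<Otimes>\<^sub>M borel)"
    and p: "\<And>z. cmod (p z) \<le> B"
  shows "integrable (lborel \<Otimes>\<^sub>M lborel) (\<lambda>(x, y). p (x, y) * (f x * k y))"
proof -
  have [measurable]: "f \<in> borel_measurable borel" "k \<in> borel_measurable borel"
    using f k by (auto dest: borel_measurable_integrable)
  have "integrable (lborel \<Otimes>\<^sub>M lborel) (\<lambda>z. case z of (x, y) \<Rightarrow> f x * k y)"
  proof (rule lborel_pair.Fubini_integrable)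
    show "(\<lambda>(x, y). f x * k y) \<in> borel_measurable (lborel \<Otimes>\<^sub>M lborel)" by measurable
    show "integrable lborel (\<lambda>x. LINT y|lborel. norm (case (x, y) of (x, y) \<Rightarrow> f x * k y))"
      using f k by (simp add: norm_mult)
    show "AE x in lborel. integrable lborel (\<lambda>y. case (x, y) of (x, y) \<Rightarrow> f x * k y)"
      using k by simp
  qed
  then have "integrable (lborel \<Otimes>\<^sub>M lborel) (\<lambda>z. of_real B * (case z of (x, y) \<Rightarrow> f x * k y))"
    by (rule integrable_mult_right)
  then show ?thesis
  proof (rule Bochner_Integration.integrable_bound)
    show "(\<lambda>(x, y). p (x, y) * (f x * k y)) \<in> borel_measurable (lborel \<Otimes>\<^sub>M lborel)" by measurable
    have "norm (p (x, y) * (f x * k y)) \<le> norm (of_real B * (f x * k y))" for x y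
    proof -
      have "cmod (p (x, y)) \<le> \<bar>B\<bar>" using p[of "(x, y)"] by linarith
      then show ?thesis unfolding norm_mult norm_of_real by (intro mult_right_mono) auto
    qed
    then show "AE z in lborel \<Otimes>\<^sub>M lborel. norm (case z of (x, y) \<Rightarrow> p (x, y) * (f x * k y))
        \<le> norm (of_real B * (case z of (x, y) \<Rightarrow> f x * k y))" by auto
  qed
qed

text \<open>A unimodular kernel leaves \<open>f x * k \<xi>\<close> absolutely integrable on the
  product, so Fubini applies as soon as both functions are in L1. Later exchanges of integrals with
  a phase all go through this formula.\<close>

lemma integral_phase_swap:
  fixes f k :: "'a::euclidean_space \<Rightarrow> complex"
  assumes f: "integrable lborel f" and k: "integrable lborel k"
  shows "(LINT \<xi>|lborel. k \<xi> * (LINT x|lborel. phase \<sigma> x \<xi> * f x))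
    = (LINT x|lborel. f x * (LINT \<xi>|lborel. phase \<sigma> x \<xi> * k \<xi>))"
proof -
  have "integrable (lborel \<Otimes>\<^sub>M lborel) (\<lambda>(x, \<xi>). (\<lambda>z. phase \<sigma> (fst z) (snd z)) (x, \<xi>) * (f x * k \<xi>))"
    by (rule integrable_prod_mult[OF f k, where B = 1]) auto
  then have int: "integrable (lborel \<Otimes>\<^sub>M lborel) (\<lambda>(x, \<xi>). phase \<sigma> x \<xi> * (f x * k \<xi>))"
    by simp
  have "(LINT \<xi>|lborel. k \<xi> * (LINT x|lborel. phase \<sigma> x \<xi> * f x))
      = (LINT \<xi>|lborel. LINT x|lborel. phase \<sigma> x \<xi> * (f x * k \<xi>))"
    by (subst integral_mult_right_zero[symmetric]) (simp add: mult_ac)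
  also have "\<dots> = (LINT x|lborel. LINT \<xi>|lborel. phase \<sigma> x \<xi> * (f x * k \<xi>))"
    using lborel_pair.Fubini_integral[OF int] by simp
  also have "\<dots> = (LINT x|lborel. f x * (LINT \<xi>|lborel. phase \<sigma> x \<xi> * k \<xi>))"
    by (subst integral_mult_right_zero[symmetric]) (simp add: mult_ac)
  finally show ?thesis .
qed

lemma integrable_phase_mult:
  assumes f: "integrable lborel f"
  shows "integrable lborel (\<lambda>x. phase \<sigma> x \<xi> * f x)"
proof (rule Bochner_Integration.integrable_bound[OF f])
  have [measurable]: "f \<in> borel_measurable borel" using f by (auto dest: borel_measurable_integrable)
  show "(\<lambda>x. phase \<sigma> x \<xi> * f x) \<in> borel_measurable lborel" by measurable
qed (simp add: norm_mult)

lemma integrable_bounded_mult: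
  fixes f g :: "'a::euclidean_space \<Rightarrow> complex"
  assumes f: "integrable lborel f" and [measurable]: "g \<in> borel_measurable borel"
    and g: "\<And>x. cmod (g x) \<le> B"
  shows "integrable lborel (\<lambda>x. g x * f x)"
proof (rule Bochner_Integration.integrable_bound)
  show "integrable lborel (\<lambda>x. of_real B * f x)" using f by simp
  have [measurable]: "f \<in> borel_measurable borel" using f by (auto dest: borel_measurable_integrable)
  show "(\<lambda>x. g x * f x) \<in> borel_measurable lborel" by measurable
  have "cmod (g x) \<le> \<bar>B\<bar>" for x using g[of x] by linarith
  then show "AE x in lborel. norm (g x * f x) \<le> norm (of_real B * f x)"
    unfolding norm_mult norm_of_real by (intro AE_I2 mult_right_mono) auto
qed

text \<open>The parameter \<open>\<sigma> = 1\<close> gives the Fourier integral and \<open>\<sigma> = - 1\<close> the inverse one.\<close>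

definition FI :: "real \<Rightarrow> ('a::euclidean_space \<Rightarrow> complex) \<Rightarrow> 'a \<Rightarrow> complex" where
  "FI \<sigma> f \<xi> = of_real ((2 * pi) powr (- real DIM('a) / 2)) * (LINT x|lborel. phase \<sigma> x \<xi> * f x)"

lemma fourier_integral_eq_FI: "fourier_integral f = FI 1 f"
  by (simp add: fourier_integral_def FI_def phase_def fun_eq_iff)

lemma inv_fourier_integral_eq_FI: "inv_fourier_integral f = FI (- 1) f"
  by (simp add: inv_fourier_integral_def FI_def phase_def fun_eq_iff inner_commute)

lemma measurable_FI [measurable]:
  assumes [measurable]: "f \<in> borel_measurable borel"
  shows "FI \<sigma> f \<in> borel_measurable borel"
  unfolding FI_def by measurable

lemma cmod_integral_phase_le:
  assumes "integrable lborel f"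
  shows "cmod (LINT x|lborel. phase \<sigma> x \<xi> * f x) \<le> (LINT x|lborel. cmod (f x))"
  using integral_norm_bound[of lborel "\<lambda>x. phase \<sigma> x \<xi> * f x"] by (simp add: norm_mult)

lemma integral_lborel_affine:
  fixes G :: "'a::euclidean_space \<Rightarrow> complex"
  assumes [measurable]: "G \<in> borel_measurable borel" and c: "c > 0"
  shows "(LINT y|lborel. G y) = of_real (c ^ DIM('a)) * (LINT z|lborel. G (t + c *\<^sub>R z))"
proof -
  have "(LINT y|lborel. G y) = (LINT y|density (distr lborel borel (\<lambda>x. t + c *\<^sub>R x)) (\<lambda>_. ennreal (\<bar>c\<bar> ^ DIM('a))). G y)"
    using c by (subst lborel_affine[of c t]) simp_all
  also have "\<dots> = (LINT y|distr lborel borel (\<lambda>x. t + c *\<^sub>R x). (c ^ DIM('a)) *\<^sub>R G y)"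
    using c by (subst integral_density) simp_all
  also have "\<dots> = (LINT z|lborel. (c ^ DIM('a)) *\<^sub>R G (t + c *\<^sub>R z))"
    by (subst integral_distr) simp_all
  also have "\<dots> = of_real (c ^ DIM('a)) * (LINT z|lborel. G (t + c *\<^sub>R z))"
    by (simp add: scaleR_conv_of_real)
  finally show ?thesis .
qed

lemma gauss_scale: "gauss t (c *\<^sub>R x) = gauss (t * c\<^sup>2) x"
  by (simp add: gauss_def power_mult_distrib mult.assoc)

text \<open>For \<open>f\<close> in L1 the transform \<open>A\<close> is bounded, but |A|^2 may fail
  to be integrable; the Gaussian repairs this. The exchange formula is used twice, once to move
  \<open>A\<close> onto \<open>f\<close> and once to unfold the conjugate factor, and what is left
  is the transform of a Gaussian.\<close>

lemma integral_gauss_square_transform: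
  fixes f :: "'a::euclidean_space \<Rightarrow> complex"
  assumes f: "integrable lborel f" and \<sigma>: "\<bar>\<sigma>\<bar> = 1" and e: "e > 0"
  defines "A \<equiv> \<lambda>\<xi>. LINT x|lborel. phase \<sigma> x \<xi> * f x"
  shows "(LINT \<xi>|lborel. of_real (gauss e \<xi>) * (cnj (A \<xi>) * A \<xi>))
    = of_real ((pi / e) powr (DIM('a) / 2)) *
      (LINT x|lborel. f x * (LINT y|lborel. of_real (gauss (1 / (4 * e)) (y - x)) * cnj (f y)))"
proof -
  have [measurable]: "f \<in> borel_measurable borel" using f by (auto dest: borel_measurable_integrable)
  have [measurable]: "A \<in> borel_measurable borel" unfolding A_def by measurable
  have g: "integrable lborel (\<lambda>\<xi>::'a. of_real (gauss e \<xi>) :: complex)"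
    using integrable_gauss[OF e] by (rule integrable_of_real)
  have A: "cmod (cnj (A \<xi>)) \<le> (LINT x|lborel. cmod (f x))" for \<xi>
    using cmod_integral_phase_le[OF f] by (simp add: A_def)
  have k: "integrable lborel (\<lambda>\<xi>. cnj (A \<xi>) * of_real (gauss e \<xi>))"
    by (rule integrable_bounded_mult[OF g _ A]) measurable
  have inner: "(LINT \<xi>|lborel. phase \<sigma> x \<xi> * (cnj (A \<xi>) * of_real (gauss e \<xi>)))
      = of_real ((pi / e) powr (DIM('a) / 2)) * (LINT y|lborel. of_real (gauss (1 / (4 * e)) (y - x)) * cnj (f y))" for x
  proof -
    have "cnj (A \<xi>) = (LINT y|lborel. phase (- \<sigma>) y \<xi> * cnj (f y))" for \<xi>
      unfolding A_def by (subst Bochner_Integration.integral_cnj[symmetric]) (simp add: cnj_phase)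
    then have "(LINT \<xi>|lborel. phase \<sigma> x \<xi> * (cnj (A \<xi>) * of_real (gauss e \<xi>)))
       = (LINT \<xi>|lborel. (phase \<sigma> \<xi> x * of_real (gauss e \<xi>)) * (LINT y|lborel. phase (- \<sigma>) y \<xi> * cnj (f y)))"
      by (simp add: mult_ac phase_def inner_commute)
    also have "\<dots> = (LINT y|lborel. cnj (f y) * (LINT \<xi>|lborel. phase (- \<sigma>) y \<xi> * (phase \<sigma> \<xi> x * of_real (gauss e \<xi>))))"
      using f by (intro integral_phase_swap integrable_phase_mult g) simp
    also have "\<dots> = (LINT y|lborel. cnj (f y) * of_real ((pi / e) powr (DIM('a) / 2) * gauss (1 / (4 * e)) (\<sigma> *\<^sub>R (y - x))))"
    proof (rule Bochner_Integration.integral_cong[OF refl])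
      fix y
      have "phase (- \<sigma>) y \<xi> * (phase \<sigma> \<xi> x * of_real (gauss e \<xi>))
          = iexp (\<xi> \<bullet> (\<sigma> *\<^sub>R (y - x))) * of_real (gauss e \<xi>)" for \<xi>
        unfolding phase_def mult.assoc[symmetric] exp_add[symmetric]
        by (simp add: inner_diff_right algebra_simps inner_commute[of \<xi> y])
      then show "cnj (f y) * (LINT \<xi>|lborel. phase (- \<sigma>) y \<xi> * (phase \<sigma> \<xi> x * of_real (gauss e \<xi>)))
          = cnj (f y) * of_real ((pi / e) powr (DIM('a) / 2) * gauss (1 / (4 * e)) (\<sigma> *\<^sub>R (y - x)))"
        by (simp only: integral_iexp_gauss[OF e])
    qed
    also have "\<dots> = (LINT y|lborel. of_real ((pi / e) powr (DIM('a) / 2)) * (of_real (gauss (1 / (4 * e)) (y - x)) * cnj (f y)))"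
    proof -
      \<comment> \<open>The sign only reflects the argument of an even function; this is where
        \<open>|\<sigma>| = 1\<close> enters.\<close>
      have "\<sigma>\<^sup>2 = 1" using \<sigma> by (metis power2_abs one_power2)
      then show ?thesis by (simp add: gauss_scale mult_ac)
    qed
    finally show ?thesis by simp
  qed
  have "(LINT \<xi>|lborel. of_real (gauss e \<xi>) * (cnj (A \<xi>) * A \<xi>))
      = (LINT \<xi>|lborel. (cnj (A \<xi>) * of_real (gauss e \<xi>)) * A \<xi>)" by (simp add: mult_ac)
  also have "\<dots> = (LINT x|lborel. f x * (LINT \<xi>|lborel. phase \<sigma> x \<xi> * (cnj (A \<xi>) * of_real (gauss e \<xi>))))"
    unfolding A_def by (rule integral_phase_swap[OF f k[unfolded A_def]])
  also have "\<dots> = (LINT x|lborel. of_real ((pi / e) powr (DIM('a) / 2)) *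
      (f x * (LINT y|lborel. of_real (gauss (1 / (4 * e)) (y - x)) * cnj (f y))))"
    unfolding inner by (simp only: mult_ac)
  finally show ?thesis by simp
qed

definition integrable_L1_L2 :: "('a::euclidean_space \<Rightarrow> complex) \<Rightarrow> bool" where
  "integrable_L1_L2 f \<longleftrightarrow> integrable lborel f \<and> square_integrable f"

lemma integrable_L1_L2_bounded_support:
  fixes f :: "'a::euclidean_space \<Rightarrow> complex"
  assumes [measurable]: "f \<in> borel_measurable borel"
    and bd: "\<And>x. cmod (f x) \<le> M" and supp: "\<And>x. norm x > R \<Longrightarrow> f x = 0"
  shows "integrable_L1_L2 f"
proof -
  have fin: "integrable lborel (\<lambda>x. c * indicator (cball 0 R) (x::'a))" for c :: real
    using emeasure_lborel_cball_finite[of "0::'a" R]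
    by (intro integrable_mult_right) (simp add: integrable_indicator_iff)
  have le: "cmod (f x) ^ k \<le> M ^ k * indicator (cball 0 R) x" if "k > 0" for x k
    using bd[of x] supp[of x] that by (auto simp: indicator_def power_mono not_le zero_power)
  have "integrable lborel f"
  proof (rule Bochner_Integration.integrable_bound[OF fin[of M]])
    show "AE x in lborel. norm (f x) \<le> norm (M * indicator (cball 0 R) x)"
      using order_trans[OF le[of 1] abs_ge_self] by (intro AE_I2) simp
  qed measurable
  moreover have "integrable lborel (\<lambda>x. (cmod (f x))\<^sup>2)"
  proof (rule Bochner_Integration.integrable_bound[OF fin[of "M\<^sup>2"]])
    show "AE x in lborel. norm ((cmod (f x))\<^sup>2) \<le> norm (M\<^sup>2 * indicator (cball 0 R) x)"
      using order_trans[OF le[of 2] abs_ge_self] by (intro AE_I2) simp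
  qed measurable
  ultimately show ?thesis by (simp add: integrable_L1_L2_def square_integrable_def)
qed

lemma continuous_compact_support_bounded:
  fixes f :: "'a::euclidean_space \<Rightarrow> complex"
  assumes "continuous_on UNIV f" and supp: "\<And>x. norm x > R \<Longrightarrow> f x = 0"
  shows "\<exists>M\<ge>0. \<forall>x. cmod (f x) \<le> M"
proof -
  have "compact (f ` cball 0 R)"
    using assms(1) by (intro compact_continuous_image) (auto intro: continuous_on_subset)
  then obtain M where M: "\<forall>z\<in>f ` cball 0 R. norm z \<le> M"
    using compact_imp_bounded bounded_iff by blast
  have "cmod (f x) \<le> max M 0" for x
    using M supp[of x] by (cases "norm x \<le> R") (auto simp: le_max_iff_disj)
  then show ?thesis by (intro exI[of _ "max M 0"]) auto
qed

text \<open>Gaussian regularisation: as \<open>e\<close> tends to \<open>0\<close>, the right-hand side of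
  \<open>integral_gauss_square_transform\<close>, after the substitution \<open>y = x + 2 \<surd>e z\<close>, tends to
  \<open>\<integral> |f|\<^sup>2\<close>.\<close>

lemma plancherel_continuous:
  fixes f :: "'a::euclidean_space \<Rightarrow> complex"
  assumes cont: "continuous_on UNIV f" and supp: "\<And>x. norm x > R \<Longrightarrow> f x = 0" and \<sigma>: "\<bar>\<sigma>\<bar> = 1"
  shows "(\<integral>\<^sup>+\<xi>. ennreal ((cmod (FI \<sigma> f \<xi>))\<^sup>2) \<partial>lborel) = (\<integral>\<^sup>+x. ennreal ((cmod (f x))\<^sup>2) \<partial>lborel)"
proof -
  let ?d = "real DIM('a) / 2"
  have [measurable]: "f \<in> borel_measurable borel" using cont by (rule borel_measurable_continuous_onI)
  obtain M where M: "M \<ge> 0" "\<And>x. cmod (f x) \<le> M"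
    using continuous_compact_support_bounded[OF cont supp] by blast
  have nice: "integrable_L1_L2 f" by (rule integrable_L1_L2_bounded_support[OF _ M(2) supp]) measurable
  then have f: "integrable lborel f" and f2: "integrable lborel (\<lambda>x. (cmod (f x))\<^sup>2)"
    by (auto simp: integrable_L1_L2_def square_integrable_def)
  define h where "h n = 1 / real (Suc n)" for n
  \<comment> \<open>The factor 1/4 makes \<open>1 / (4 * e n) * (h n)^2 = 1\<close>, so that the
    substitution \<open>y = x + h n * z\<close> turns the kernel into \<open>gauss 1\<close>, free
    of \<open>n\<close>.\<close>
  define e where "e n = (h n)\<^sup>2 / 4" for n
  have h: "h n > 0" for n by (simp add: h_def)
  have e: "e n > 0" for n using h[of n] by (simp add: e_def)
  have h0: "h \<longlonglongrightarrow> 0" unfolding h_def using LIMSEQ_Suc[OF lim_1_over_n] by simp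
  have e0: "e \<longlonglongrightarrow> 0"
  proof -
    have "e \<longlonglongrightarrow> 0\<^sup>2 / 4" unfolding e_def by (intro tendsto_intros h0) simp
    then show ?thesis by simp
  qed
  define J where "J n x = (LINT z|lborel. of_real (gauss 1 z) * cnj (f (x + h n *\<^sub>R z)))" for n x
  have Jm[measurable]: "J n \<in> borel_measurable borel" for n unfolding J_def by measurable
  have gint: "integrable lborel (gauss 1 :: 'a \<Rightarrow> real)" by (rule integrable_gauss) simp
  have J: "J n x \<in> {z. cmod z \<le> M * pi powr ?d}" for n x
  proof -
    have "cmod (J n x) \<le> (LINT z|lborel. M * gauss 1 (z::'a))"
      unfolding J_def
    proof (rule order_trans[OF integral_norm_bound integral_mono])
      show "integrable lborel (\<lambda>z. norm (of_real (gauss 1 z) * cnj (f (x + h n *\<^sub>R z))))"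
        using integrable_bounded_mult[of "\<lambda>z. of_real (gauss 1 z)" "\<lambda>z. cnj (f (x + h n *\<^sub>R z))" M] gint M(2)
        by (intro integrable_norm) (simp add: mult.commute)
      show "integrable lborel (\<lambda>z::'a. M * gauss 1 z)" using gint by simp
      show "norm (of_real (gauss 1 z) * cnj (f (x + h n *\<^sub>R z))) \<le> M * gauss 1 z" for z
        using M(2)[of "x + h n *\<^sub>R z"] by (simp add: norm_mult mult.commute mult_right_mono)
    qed
    then show ?thesis by (simp add: integral_gauss)
  qed
  have Jlim: "(\<lambda>n. J n x) \<longlonglongrightarrow> of_real (pi powr ?d) * cnj (f x)" for x
  proof -
    have "(\<lambda>n. J n x) \<longlonglongrightarrow> (LINT z|lborel. of_real (gauss 1 (z::'a)) * cnj (f x))"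
      unfolding J_def
    proof (rule integral_dominated_convergence[where w = "\<lambda>z. M * gauss 1 z"])
      show "integrable lborel (\<lambda>z::'a. M * gauss 1 z)" using gint by simp
      show "AE z in lborel. norm (of_real (gauss 1 z) * cnj (f (x + h n *\<^sub>R z))) \<le> M * gauss 1 z" for n
        using M(2) by (intro AE_I2) (simp add: norm_mult mult.commute mult_right_mono)
      have "(\<lambda>n. x + h n *\<^sub>R z) \<longlonglongrightarrow> x + 0 *\<^sub>R z" for z by (intro tendsto_intros h0)
      then have "(\<lambda>n. f (x + h n *\<^sub>R z)) \<longlonglongrightarrow> f (x + 0 *\<^sub>R z)" for z
        by (rule continuous_on_tendsto_compose[OF cont]) auto
      then show "AE z in lborel. (\<lambda>n. of_real (gauss 1 z) * cnj (f (x + h n *\<^sub>R z))) \<longlonglongrightarrow> of_real (gauss 1 z) * cnj (f x)"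
        by (intro AE_I2 tendsto_mult tendsto_const tendsto_cnj) simp
    qed measurable
    also have "(LINT z|lborel. of_real (gauss 1 (z::'a)) * cnj (f x)) = of_real (LINT z|lborel. gauss 1 (z::'a)) * cnj (f x)"
      by (simp add: integral_complex_of_real)
    also have "(LINT z|lborel. gauss 1 (z::'a)) = pi powr ?d" by (simp add: integral_gauss)
    finally show ?thesis .
  qed
  let ?c = "(2 * pi) powr (- real DIM('a) / 2)"
  define L where "L n = (LINT \<xi>|lborel. gauss (e n) \<xi> * (cmod (FI \<sigma> f \<xi>))\<^sup>2)" for n
  have FIbd: "(cmod (FI \<sigma> f \<xi>))\<^sup>2 \<le> (?c * (LINT x|lborel. cmod (f x)))\<^sup>2" for \<xi>
    unfolding FI_def norm_mult using cmod_integral_phase_le[OF f, of \<sigma> \<xi>]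
    by (intro power_mono mult_mono) auto
  have Lint: "integrable lborel (\<lambda>\<xi>. gauss (e n) \<xi> * (cmod (FI \<sigma> f \<xi>))\<^sup>2)" for n
  proof (rule Bochner_Integration.integrable_bound)
    show "integrable lborel (\<lambda>\<xi>::'a. gauss (e n) \<xi> * (?c * (LINT x|lborel. cmod (f x)))\<^sup>2)"
      by (intro integrable_mult_left integrable_gauss e)
    show "AE \<xi> in lborel. norm (gauss (e n) \<xi> * (cmod (FI \<sigma> f \<xi>))\<^sup>2)
        \<le> norm (gauss (e n) \<xi> * (?c * (LINT x|lborel. cmod (f x)))\<^sup>2)"
      using FIbd by (intro AE_I2) (simp add: abs_mult mult_left_mono)
  qed measurable
  have L: "of_real (L n) = of_real (pi powr (- ?d)) * (LINT x|lborel. f x * J n x)" for n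
  proof -
    let ?A = "\<lambda>\<xi>. LINT x|lborel. phase \<sigma> x \<xi> * f x"
    have scl: "(LINT y|lborel. of_real (gauss (1 / (4 * e n)) (y - x)) * cnj (f y)) = of_real (h n ^ DIM('a)) * J n x" for x
    proof -
      have "1 / (4 * e n) * (h n)\<^sup>2 = 1" using h[of n] by (simp add: e_def)
      then show ?thesis
        unfolding J_def by (subst integral_lborel_affine[OF _ h[of n], where t = x]) (simp_all add: gauss_scale)
    qed
    have "(of_real (gauss (e n) \<xi> * (cmod (FI \<sigma> f \<xi>))\<^sup>2) :: complex)
        = of_real (?c\<^sup>2) * (of_real (gauss (e n) \<xi>) * (cnj (?A \<xi>) * ?A \<xi>))" for \<xi>
    proof -
      have "(cmod (FI \<sigma> f \<xi>))\<^sup>2 = ?c\<^sup>2 * (cmod (?A \<xi>))\<^sup>2"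
        by (simp add: FI_def norm_mult power_mult_distrib)
      then show ?thesis by (simp only: of_real_mult complex_norm_square mult_ac)
    qed
    then have "of_real (L n) = of_real (?c\<^sup>2) * (LINT \<xi>|lborel. of_real (gauss (e n) \<xi>) * (cnj (?A \<xi>) * ?A \<xi>))"
      unfolding L_def integral_complex_of_real[symmetric] by (simp only: integral_mult_right_zero)
    also have "\<dots> = of_real (?c\<^sup>2) * (of_real ((pi / e n) powr ?d) *
        (LINT x|lborel. f x * (LINT y|lborel. of_real (gauss (1 / (4 * e n)) (y - x)) * cnj (f y))))"
      by (simp only: integral_gauss_square_transform[OF f \<sigma> e])
    also have "\<dots> = of_real (?c\<^sup>2) * (of_real ((pi / e n) powr ?d) * (LINT x|lborel. f x * (of_real (h n ^ DIM('a)) * J n x)))"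
      by (simp only: scl)
    also have "of_real (?c\<^sup>2) * (of_real ((pi / e n) powr ?d) * (LINT x|lborel. f x * (of_real (h n ^ DIM('a)) * J n x)))
        = of_real (?c\<^sup>2 * (pi / e n) powr ?d * h n ^ DIM('a)) * (LINT x|lborel. f x * J n x)"
    proof -
      have "(LINT x|lborel. f x * (of_real (h n ^ DIM('a)) * J n x))
          = of_real (h n ^ DIM('a)) * (LINT x|lborel. f x * J n x)"
        by (subst integral_mult_right_zero[symmetric]) (simp only: mult_ac)
      then show ?thesis by (simp only: of_real_mult mult.assoc)
    qed
    \<comment> \<open>The normalisation of the transform, the Gaussian integral and the Jacobian
      cancel up to this power, the inverse of the mass of \<open>gauss 1\<close> that appears in the
      limit of \<open>J\<close>.\<close>
    also have "?c\<^sup>2 * (pi / e n) powr ?d * h n ^ DIM('a) = pi powr (- ?d)"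
    proof -
      have sq: "x\<^sup>2 powr ?d = x ^ DIM('a)" if "x > 0" for x :: real
      proof -
        have "x\<^sup>2 = x powr 2" using that by simp
        then have "x\<^sup>2 powr ?d = x powr real DIM('a)" by (simp only: powr_powr) simp
        then show ?thesis by (simp only: powr_realpow[OF that])
      qed
      have hp: "h n ^ DIM('a) = (h n)\<^sup>2 powr ?d" using sq[OF h[of n]] by simp
      have cp: "?c\<^sup>2 = (1 / (4 * pi\<^sup>2)) powr ?d"
      proof -
        have "?c\<^sup>2 = ((2 * pi) powr (- ?d)) * ((2 * pi) powr (- ?d))" by (simp only: power2_eq_square minus_divide_left)
        also have "\<dots> = (2 * pi) powr (- ?d + - ?d)" by (rule powr_add[symmetric])
        also have "- ?d + - ?d = - 2 * ?d" by simp
        also have "(2 * pi) powr (- 2 * ?d) = ((2 * pi) powr (- 2)) powr ?d" by (rule powr_powr[symmetric])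
        also have "(2 * pi) powr (- 2) = 1 / (4 * pi\<^sup>2)"
          by (simp add: powr_minus_divide power_mult_distrib)
        finally show ?thesis .
      qed
      have "?c\<^sup>2 * (pi / e n) powr ?d * h n ^ DIM('a) = (1 / (4 * pi\<^sup>2) * (pi / e n) * (h n)\<^sup>2) powr ?d"
        unfolding hp cp using h[of n] e[of n] by (simp only: powr_mult)
      also have "1 / (4 * pi\<^sup>2) * (pi / e n) * (h n)\<^sup>2 = 1 / pi"
        using h[of n] by (simp add: e_def power2_eq_square)
      also have "(1 / pi) powr ?d = pi powr (- ?d)" by (simp add: powr_minus_divide powr_divide)
      finally show ?thesis .
    qed
    finally show ?thesis .
  qed
  have Llim: "L \<longlonglongrightarrow> (LINT x|lborel. (cmod (f x))\<^sup>2)"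
  proof -
    have "(\<lambda>n. LINT x|lborel. f x * J n x) \<longlonglongrightarrow> (LINT x|lborel. f x * (of_real (pi powr ?d) * cnj (f x)))"
    proof (rule integral_dominated_convergence[where w = "\<lambda>x. cmod (f x) * (M * pi powr ?d)"])
      show "integrable lborel (\<lambda>x. cmod (f x) * (M * pi powr ?d))" using f by simp
      show "AE x in lborel. norm (f x * J n x) \<le> cmod (f x) * (M * pi powr ?d)" for n
        using J unfolding norm_mult by (intro AE_I2 mult_left_mono) auto
      show "AE x in lborel. (\<lambda>n. f x * J n x) \<longlonglongrightarrow> f x * (of_real (pi powr ?d) * cnj (f x))"
        by (intro AE_I2 tendsto_mult Jlim tendsto_const)
    qed measurable
    also have "(LINT x|lborel. f x * (of_real (pi powr ?d) * cnj (f x)))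
        = (LINT x|lborel. of_real (pi powr ?d) * of_real ((cmod (f x))\<^sup>2))"
      by (simp only: complex_norm_square mult_ac)
    finally have "(\<lambda>n. of_real (pi powr (- ?d)) * (LINT x|lborel. f x * J n x))
        \<longlonglongrightarrow> of_real (pi powr (- ?d)) * (LINT x|lborel. of_real (pi powr ?d) * of_real ((cmod (f x))\<^sup>2))"
      by (intro tendsto_mult tendsto_const)
    also have "of_real (pi powr (- ?d)) * (LINT x|lborel. of_real (pi powr ?d) * of_real ((cmod (f x))\<^sup>2))
        = (of_real (pi powr (- ?d) * (pi powr ?d)) * of_real (LINT x|lborel. (cmod (f x))\<^sup>2) :: complex)"
      by (simp only: integral_mult_right_zero integral_complex_of_real of_real_mult mult.assoc)
    also have "pi powr (- ?d) * (pi powr ?d) = 1" by (simp add: powr_add[symmetric])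
    finally have "(\<lambda>n. complex_of_real (L n)) \<longlonglongrightarrow> of_real (LINT x|lborel. (cmod (f x))\<^sup>2)"
      unfolding L by simp
    then show ?thesis by (simp only: tendsto_of_real_iff)
  qed
  have nnL: "(\<integral>\<^sup>+\<xi>. ennreal (gauss (e n) \<xi> * (cmod (FI \<sigma> f \<xi>))\<^sup>2) \<partial>lborel) = ennreal (L n)" for n
    unfolding L_def by (rule nn_integral_eq_integral[OF Lint]) simp
  have nnLlim: "(\<lambda>n. ennreal (L n)) \<longlonglongrightarrow> (\<integral>\<^sup>+x. ennreal ((cmod (f x))\<^sup>2) \<partial>lborel)"
    using tendsto_ennrealI[OF Llim] f2 by (simp add: nn_integral_eq_integral)
  \<comment> \<open>Fatou's lemma gives one inequality and \<open>gauss \<le> 1\<close> the other.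
    Integrability of the squared transform is not known beforehand, so both sides are compared as
    nonnegative integrals.\<close>
  show ?thesis
  proof (rule antisym)
    have "(\<integral>\<^sup>+\<xi>. ennreal ((cmod (FI \<sigma> f \<xi>))\<^sup>2) \<partial>lborel)
        = (\<integral>\<^sup>+\<xi>. liminf (\<lambda>n. ennreal (gauss (e n) \<xi> * (cmod (FI \<sigma> f \<xi>))\<^sup>2)) \<partial>lborel)"
    proof (rule nn_integral_cong)
      fix \<xi> :: 'a
      have "(\<lambda>n. gauss (e n) \<xi> * (cmod (FI \<sigma> f \<xi>))\<^sup>2) \<longlonglongrightarrow> exp (- (0 * (norm \<xi>)\<^sup>2)) * (cmod (FI \<sigma> f \<xi>))\<^sup>2"
        unfolding gauss_def by (intro tendsto_intros e0)
      then have "(\<lambda>n. ennreal (gauss (e n) \<xi> * (cmod (FI \<sigma> f \<xi>))\<^sup>2)) \<longlonglongrightarrow> ennreal ((cmod (FI \<sigma> f \<xi>))\<^sup>2)"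
        by (intro tendsto_ennrealI) simp
      then show "ennreal ((cmod (FI \<sigma> f \<xi>))\<^sup>2) = liminf (\<lambda>n. ennreal (gauss (e n) \<xi> * (cmod (FI \<sigma> f \<xi>))\<^sup>2))"
        by (intro lim_imp_Liminf[symmetric]) auto
    qed
    also have "\<dots> \<le> liminf (\<lambda>n. \<integral>\<^sup>+\<xi>. ennreal (gauss (e n) \<xi> * (cmod (FI \<sigma> f \<xi>))\<^sup>2) \<partial>lborel)"
      by (rule nn_integral_liminf) measurable
    also have "\<dots> = (\<integral>\<^sup>+x. ennreal ((cmod (f x))\<^sup>2) \<partial>lborel)"
      unfolding nnL by (rule lim_imp_Liminf[OF _ nnLlim]) simp
    finally show "(\<integral>\<^sup>+\<xi>. ennreal ((cmod (FI \<sigma> f \<xi>))\<^sup>2) \<partial>lborel) \<le> (\<integral>\<^sup>+x. ennreal ((cmod (f x))\<^sup>2) \<partial>lborel)" .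
    have "ennreal (L n) \<le> (\<integral>\<^sup>+\<xi>. ennreal ((cmod (FI \<sigma> f \<xi>))\<^sup>2) \<partial>lborel)" for n
      unfolding nnL[symmetric] using gauss_le_one[of "e n"] e[of n]
      by (intro nn_integral_mono ennreal_leI mult_left_le_one_le) auto
    then show "(\<integral>\<^sup>+x. ennreal ((cmod (f x))\<^sup>2) \<partial>lborel) \<le> (\<integral>\<^sup>+\<xi>. ennreal ((cmod (FI \<sigma> f \<xi>))\<^sup>2) \<partial>lborel)"
      by (intro LIMSEQ_le_const2[OF nnLlim]) auto
  qed
qed

lemma integrable_L1_L2D:
  assumes "integrable_L1_L2 f"
  shows "integrable lborel f" "square_integrable f" "f \<in> borel_measurable borel"
  using assms by (auto simp: integrable_L1_L2_def square_integrable_def)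

lemma integrable_L1_L2_diff:
  "integrable_L1_L2 f \<Longrightarrow> integrable_L1_L2 g \<Longrightarrow> integrable_L1_L2 (\<lambda>x. f x - g x)"
  by (simp add: integrable_L1_L2_def square_integrable_diff)

section \<open>Approximation by continuous functions of bounded support\<close>

text \<open>A measurable function is almost everywhere a limit of continuous ones, but without
  control of size or support. Composing with the radial projection onto a disc and multiplying by a
  cutoff supplies both and leaves the limit unchanged, since \<open>f\<close> has its values in the
  disc and vanishes outside the ball.\<close>

lemma continuous_approximants:
  fixes f :: "'a::euclidean_space \<Rightarrow> complex"
  assumes [measurable]: "f \<in> borel_measurable borel"
    and bd: "\<And>x. cmod (f x) \<le> M" and supp: "\<And>x. norm x > R \<Longrightarrow> f x = 0"
  shows "\<exists>g. (\<forall>n. continuous_on UNIV (g n)) \<and> (\<forall>n x. norm x > R + 1 \<longrightarrow> g n x = 0) \<and>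
    (\<forall>n x. cmod (g n x) \<le> \<bar>M\<bar> + 1) \<and> (AE x in lborel. (\<lambda>n. g n x) \<longlonglongrightarrow> f x)"
proof -
  have "f measurable_on UNIV"
    by (rule lebesgue_measurable_imp_measurable_on) (auto intro!: measurable_completion)
  then obtain N g where N: "negligible N" and g: "\<And>n. continuous_on UNIV (g n)"
    and lim: "\<And>x. x \<notin> N \<Longrightarrow> (\<lambda>n. g n x) \<longlonglongrightarrow> f x"
    unfolding measurable_on_def by auto
  \<comment> \<open>The added 1 keeps the radius positive even if \<open>f\<close> vanishes, as the
    division in \<open>clamp\<close> requires.\<close>
  define K where "K = \<bar>M\<bar> + 1"
  have K: "K > 0" "\<And>x. cmod (f x) < K"
    using le_less_trans[OF order_trans[OF bd abs_ge_self]] by (auto simp: K_def)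
  define clamp where "clamp z = of_real (K / max K (cmod z)) * z" for z :: complex
  have clamp_le: "cmod (clamp z) \<le> K" for z
  proof -
    have "cmod (clamp z) = K / max K (cmod z) * cmod z"
      using K by (simp add: clamp_def norm_mult norm_divide abs_of_pos less_max_iff_disj)
    also have "\<dots> \<le> K"
      using K by (simp add: divide_le_eq less_max_iff_disj mult_left_mono)
    finally show ?thesis .
  qed
  have clamp_cont: "continuous_on UNIV clamp"
    unfolding clamp_def using K by (intro continuous_intros) (auto simp: max_def)
  have clamp_id: "clamp z = z" if "cmod z < K" for z
    using that K by (simp add: clamp_def max_def)
  \<comment> \<open>Equal to 1 on the ball of radius \<open>R\<close> and to 0 outside radius
    \<open>R + 1\<close>, which is why the supports grow by 1.\<close>
  define cut where "cut x = max 0 (min 1 (R + 1 - norm x))" for x :: 'a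
  have cut_cont: "continuous_on UNIV cut" unfolding cut_def by (intro continuous_intros)
  have cut_bd: "0 \<le> cut x" "cut x \<le> 1" for x by (auto simp: cut_def)
  have "AE x in lborel. (\<lambda>n. of_real (cut x) * clamp (g n x)) \<longlonglongrightarrow> f x"
  proof -
    have "AE x in lebesgue. x \<notin> N"
      using N by (simp add: negligible_iff_null_sets AE_not_in)
    then have "AE x in lborel. x \<notin> N" by (simp add: AE_completion_iff)
    then show ?thesis
    proof eventually_elim
      case (elim x)
      have "(\<lambda>n. clamp (g n x)) \<longlonglongrightarrow> clamp (f x)"
        by (rule continuous_on_tendsto_compose[OF clamp_cont lim[OF elim]]) auto
      then have "(\<lambda>n. of_real (cut x) * clamp (g n x)) \<longlonglongrightarrow> of_real (cut x) * clamp (f x)"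
        by (intro tendsto_intros)
      moreover have "of_real (cut x) * clamp (f x) = f x"
        using K(2)[of x] supp[of x] by (cases "norm x \<le> R") (auto simp: clamp_id cut_def)
      ultimately show ?case by simp
    qed
  qed
  moreover have "continuous_on UNIV (\<lambda>x. of_real (cut x) * clamp (g n x))" for n
    using continuous_on_compose2[OF clamp_cont g[of n]] cut_cont by (intro continuous_intros) auto
  moreover have "of_real (cut x) * clamp (g n x) = 0" if "norm x > R + 1" for n x
    using that by (simp add: cut_def)
  moreover have "cmod (of_real (cut x) * clamp (g n x)) \<le> \<bar>M\<bar> + 1" for n x
  proof -
    have "cmod (of_real (cut x) * clamp (g n x)) \<le> 1 * K"
      unfolding norm_mult using cut_bd clamp_le by (intro mult_mono) auto
    then show ?thesis by (simp add: K_def)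
  qed
  ultimately show ?thesis by (intro exI[of _ "\<lambda>n x. of_real (cut x) * clamp (g n x)"]) auto
qed

text \<open>Two passages to the limit: from continuous functions to bounded ones of bounded support,
  then to the whole class by truncating both the argument and the value. The majorant
  \<open>h\<close> lies in L1 and in L2 because the case \<open>lim\<close> serves pointwise
  convergence of transforms as well as convergence of norms.\<close>

lemma integrable_L1_L2_induct [consumes 1, case_names cont lim]:
  fixes f :: "'a::euclidean_space \<Rightarrow> complex"
  assumes f: "integrable_L1_L2 f"
    and cont: "\<And>f R. continuous_on UNIV f \<Longrightarrow> (\<And>x. norm x > R \<Longrightarrow> f x = 0) \<Longrightarrow> integrable_L1_L2 f \<Longrightarrow> P f"
    and lim: "\<And>f g h. integrable_L1_L2 f \<Longrightarrow> (\<And>n. integrable_L1_L2 (g n)) \<Longrightarrow> (\<And>n. P (g n)) \<Longrightarrow>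
      integrable lborel h \<Longrightarrow> integrable lborel (\<lambda>x. (h x)\<^sup>2) \<Longrightarrow>
      (\<And>n x. cmod (g n x) \<le> h x) \<Longrightarrow> (AE x in lborel. (\<lambda>n. g n x) \<longlonglongrightarrow> f x) \<Longrightarrow> P f"
  shows "P f"
proof -
  have bdd: "P k" if km [measurable]: "k \<in> borel_measurable borel" and bd: "\<And>x. cmod (k x) \<le> M"
    and supp: "\<And>x. norm x > R \<Longrightarrow> k x = 0" for k :: "'a \<Rightarrow> complex" and M R
  proof -
    obtain g where g: "\<And>n. continuous_on UNIV (g n)" "\<And>n x. norm x > R + 1 \<Longrightarrow> g n x = 0"
      "\<And>n x. cmod (g n x) \<le> \<bar>M\<bar> + 1" "AE x in lborel. (\<lambda>n. g n x) \<longlonglongrightarrow> k x"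
      using continuous_approximants[OF km bd supp] by blast
    have gn: "integrable_L1_L2 (g n)" for n
      using g by (intro integrable_L1_L2_bounded_support[where R = "R + 1"] borel_measurable_continuous_onI) auto
    let ?h = "\<lambda>x::'a. (\<bar>M\<bar> + 1) * indicator (cball 0 (R + 1)) x"
    have h: "integrable lborel (\<lambda>x::'a. c * indicator (cball 0 (R + 1)) x)" for c :: real
      using emeasure_lborel_cball_finite[of "0::'a" "R + 1"]
      by (intro integrable_mult_right) (simp add: integrable_indicator_iff)
    show ?thesis
    proof (rule lim[of k g ?h])
      show "integrable_L1_L2 k" by (rule integrable_L1_L2_bounded_support[OF _ bd supp]) measurable
      show "P (g n)" for n using g gn by (intro cont[where R = "R + 1"]) auto
      show "integrable lborel ?h" by (rule h)
      have "(\<lambda>x. (?h x)\<^sup>2) = (\<lambda>x. (\<bar>M\<bar> + 1)\<^sup>2 * indicator (cball 0 (R + 1)) x)"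
        by (auto simp: indicator_def fun_eq_iff)
      then show "integrable lborel (\<lambda>x. (?h x)\<^sup>2)" using h by simp
      show "cmod (g n x) \<le> ?h x" for n x
        using g(2)[of x n] g(3)[of n x] by (cases "norm x \<le> R + 1") auto
    qed (use gn g in auto)
  qed
  note f' = integrable_L1_L2D[OF f]
  note [measurable] = f'(3)
  define g where "g n x = (if norm x \<le> real n \<and> cmod (f x) \<le> real n then f x else 0)" for n x
  have [measurable]: "g n \<in> borel_measurable borel" for n unfolding g_def by measurable
  have bd: "cmod (g n x) \<le> real n" and supp: "norm x > real n \<Longrightarrow> g n x = 0" for n x
    by (auto simp: g_def)
  show "P f"
  proof (rule lim[of f g "\<lambda>x. cmod (f x)"])
    show "integrable_L1_L2 (g n)" for n by (rule integrable_L1_L2_bounded_support[OF _ bd supp]) measurable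
    show "P (g n)" for n by (rule bdd[OF _ bd supp]) measurable
    show "integrable lborel (\<lambda>x. cmod (f x))" "integrable lborel (\<lambda>x. (cmod (f x))\<^sup>2)"
      using f' by (auto simp: square_integrable_def)
    show "cmod (g n x) \<le> cmod (f x)" for n x by (simp add: g_def)
    show "AE x in lborel. (\<lambda>n. g n x) \<longlonglongrightarrow> f x"
    proof (rule AE_I2)
      fix x
      obtain n0 :: nat where n0: "max (norm x) (cmod (f x)) \<le> real n0" using real_arch_simple by blast
      have "\<forall>\<^sub>F n in sequentially. g n x = f x"
        using eventually_ge_at_top[of n0]
      proof eventually_elim
        case (elim n)
        then have "real n0 \<le> real n" by simp
        with n0 show ?case by (simp add: g_def)
      qed
      then show "(\<lambda>n. g n x) \<longlonglongrightarrow> f x" by (rule tendsto_eventually)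
    qed
  qed (rule f)
qed

section \<open>The Fourier integral as an isometry in the L2 norm\<close>

lemma FI_diff:
  assumes "integrable lborel f" "integrable lborel g"
  shows "FI \<sigma> (\<lambda>x. f x - g x) \<xi> = FI \<sigma> f \<xi> - FI \<sigma> g \<xi>"
proof -
  have "(LINT x|lborel. phase \<sigma> x \<xi> * (f x - g x))
      = (LINT x|lborel. phase \<sigma> x \<xi> * f x) - (LINT x|lborel. phase \<sigma> x \<xi> * g x)"
    unfolding right_diff_distrib by (intro Bochner_Integration.integral_diff integrable_phase_mult assms)
  then show ?thesis by (simp add: FI_def right_diff_distrib)
qed

lemma FI_add:
  assumes "integrable lborel f" "integrable lborel g"
  shows "FI \<sigma> (\<lambda>x. f x + g x) \<xi> = FI \<sigma> f \<xi> + FI \<sigma> g \<xi>"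
proof -
  have "(LINT x|lborel. phase \<sigma> x \<xi> * (f x + g x))
      = (LINT x|lborel. phase \<sigma> x \<xi> * f x) + (LINT x|lborel. phase \<sigma> x \<xi> * g x)"
    unfolding distrib_left by (intro Bochner_Integration.integral_add integrable_phase_mult assms)
  then show ?thesis by (simp add: FI_def distrib_left)
qed

lemma FI_cmult: "FI \<sigma> (\<lambda>x. c * f x) \<xi> = c * FI \<sigma> f \<xi>"
proof -
  have "(LINT x|lborel. phase \<sigma> x \<xi> * (c * f x)) = c * (LINT x|lborel. phase \<sigma> x \<xi> * f x)"
    by (subst integral_mult_right_zero[symmetric]) (simp only: mult_ac)
  then show ?thesis by (simp add: FI_def)
qed

lemma FI_cong_AE:
  assumes [measurable]: "f \<in> borel_measurable borel" "g \<in> borel_measurable borel"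
    and "AE x in lborel. f x = g x"
  shows "FI \<sigma> f = FI \<sigma> g"
proof -
  have "(LINT x|lborel. phase \<sigma> x \<xi> * f x) = (LINT x|lborel. phase \<sigma> x \<xi> * g x)" for \<xi>
    using assms(3) by (intro integral_cong_AE) auto
  then show ?thesis by (simp add: FI_def fun_eq_iff)
qed

text \<open>Transforms converge pointwise along the approximation, and Fatou's lemma preserves only
  an inequality. It is the decisive step all the same: applied to differences it makes the transform
  a contraction, and then the equality passes to limits as well.\<close>

lemma FI_square_integral_le:
  assumes f: "integrable_L1_L2 f" and \<sigma>: "\<bar>\<sigma>\<bar> = 1"
  shows "(\<integral>\<^sup>+\<xi>. ennreal ((cmod (FI \<sigma> f \<xi>))\<^sup>2) \<partial>lborel) \<le> (\<integral>\<^sup>+x. ennreal ((cmod (f x))\<^sup>2) \<partial>lborel)"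
  using f
proof (induct rule: integrable_L1_L2_induct)
  case (cont f R)
  show ?case using plancherel_continuous[OF cont(1,2) \<sigma>] by simp
next
  case (lim f g h)
  note [measurable] = integrable_L1_L2D(3)[OF lim(1)] integrable_L1_L2D(3)[OF lim(2)]
    borel_measurable_integrable[OF lim(4)]
  have FIlim: "(\<lambda>n. FI \<sigma> (g n) \<xi>) \<longlonglongrightarrow> FI \<sigma> f \<xi>" for \<xi>
    unfolding FI_def
  proof (intro tendsto_mult tendsto_const integral_dominated_convergence[where w = h])
    show "AE x in lborel. (\<lambda>n. phase \<sigma> x \<xi> * g n x) \<longlonglongrightarrow> phase \<sigma> x \<xi> * f x"
      using lim(7) by eventually_elim (intro tendsto_intros)
  qed (use lim in \<open>auto simp: norm_mult\<close>)
  have sqlim: "(\<lambda>n. \<integral>\<^sup>+x. ennreal ((cmod (g n x))\<^sup>2) \<partial>lborel) \<longlonglongrightarrow> (\<integral>\<^sup>+x. ennreal ((cmod (f x))\<^sup>2) \<partial>lborel)"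
  proof (rule nn_integral_dominated_convergence[where w = "\<lambda>x. ennreal ((h x)\<^sup>2)"])
    show "AE x in lborel. ennreal ((cmod (g n x))\<^sup>2) \<le> ennreal ((h x)\<^sup>2)" for n
      using lim(6) by (intro AE_I2 ennreal_leI power_mono) auto
    show "(\<integral>\<^sup>+x. ennreal ((h x)\<^sup>2) \<partial>lborel) < \<infinity>"
      using lim(5) by (simp add: nn_integral_eq_integral)
    show "AE x in lborel. (\<lambda>n. ennreal ((cmod (g n x))\<^sup>2)) \<longlonglongrightarrow> ennreal ((cmod (f x))\<^sup>2)"
      using lim(7) by eventually_elim (intro tendsto_ennrealI tendsto_intros)
  qed measurable
  have "(\<integral>\<^sup>+\<xi>. ennreal ((cmod (FI \<sigma> f \<xi>))\<^sup>2) \<partial>lborel)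
      = (\<integral>\<^sup>+\<xi>. liminf (\<lambda>n. ennreal ((cmod (FI \<sigma> (g n) \<xi>))\<^sup>2)) \<partial>lborel)"
    by (intro nn_integral_cong lim_imp_Liminf[symmetric] tendsto_ennrealI tendsto_intros FIlim) simp
  also have "\<dots> \<le> liminf (\<lambda>n. \<integral>\<^sup>+\<xi>. ennreal ((cmod (FI \<sigma> (g n) \<xi>))\<^sup>2) \<partial>lborel)"
    by (rule nn_integral_liminf) measurable
  also have "\<dots> \<le> liminf (\<lambda>n. \<integral>\<^sup>+x. ennreal ((cmod (g n x))\<^sup>2) \<partial>lborel)"
    using lim(3) by (intro Liminf_mono always_eventually) auto
  also have "\<dots> = (\<integral>\<^sup>+x. ennreal ((cmod (f x))\<^sup>2) \<partial>lborel)"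
    by (rule lim_imp_Liminf[OF _ sqlim]) simp
  finally show ?case .
qed

lemma square_integrable_FI:
  assumes f: "integrable_L1_L2 f" and \<sigma>: "\<bar>\<sigma>\<bar> = 1"
  shows "square_integrable (FI \<sigma> f)"
proof -
  note f' = integrable_L1_L2D[OF f]
  have m: "FI \<sigma> f \<in> borel_measurable borel" using f'(3) by measurable
  show ?thesis
    unfolding square_integrable_iff_nn_integral[OF m]
    using f'(2) unfolding square_integrable_iff_nn_integral[OF f'(3)]
    by (rule order_le_less_trans[OF FI_square_integral_le[OF f \<sigma>]])
qed

text \<open>Linearity reduces this to the inequality for \<open>f - g\<close>. The bound controls
  the limits that define and identify the transform on L2.\<close>

lemma norm_to_L2_FI_diff_le:
  assumes f: "integrable_L1_L2 f" and g: "integrable_L1_L2 g" and \<sigma>: "\<bar>\<sigma>\<bar> = 1"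
  shows "norm (to_L2 (FI \<sigma> f) - to_L2 (FI \<sigma> g)) \<le> norm (to_L2 f - to_L2 g)"
proof -
  have "to_L2 (FI \<sigma> f) - to_L2 (FI \<sigma> g) = to_L2 (FI \<sigma> (\<lambda>x. f x - g x))"
    using square_integrable_FI[OF f \<sigma>] square_integrable_FI[OF g \<sigma>] f g
    by (simp add: to_L2_diff fun_eq_iff[symmetric] integrable_L1_L2_def flip: FI_diff)
  moreover have "to_L2 f - to_L2 g = to_L2 (\<lambda>x. f x - g x)"
    using f g by (simp add: to_L2_diff integrable_L1_L2_def)
  moreover have "norm (to_L2 (FI \<sigma> (\<lambda>x. f x - g x))) \<le> norm (to_L2 (\<lambda>x. f x - g x))"
  proof (rule norm_to_L2_le)
    have "square_integrable (\<lambda>x. f x - g x)" using integrable_L1_L2_diff[OF f g] by (simp add: integrable_L1_L2_def)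
    then show "(\<integral>\<^sup>+\<xi>. ennreal ((cmod (FI \<sigma> (\<lambda>x. f x - g x) \<xi>))\<^sup>2) \<partial>lborel) \<le> ennreal ((norm (to_L2 (\<lambda>x. f x - g x)))\<^sup>2)"
      using FI_square_integral_le[OF integrable_L1_L2_diff[OF f g] \<sigma>] by (simp add: nn_norm_to_L2_square)
  qed simp
  ultimately show ?thesis by simp
qed

text \<open>Both sides are continuous along the approximating sequences: the functions converge in
  L2 by domination, their transforms by contraction.\<close>

lemma plancherel_L1_L2:
  assumes f: "integrable_L1_L2 f" and \<sigma>: "\<bar>\<sigma>\<bar> = 1"
  shows "norm (to_L2 (FI \<sigma> f)) = norm (to_L2 f)"
  using f
proof (induct rule: integrable_L1_L2_induct)
  case (cont f R)
  have "ennreal ((norm (to_L2 (FI \<sigma> f)))\<^sup>2) = ennreal ((norm (to_L2 f))\<^sup>2)"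
    using plancherel_continuous[OF cont(1,2) \<sigma>] square_integrable_FI[OF cont(3) \<sigma>] integrable_L1_L2D(2)[OF cont(3)]
    by (simp add: nn_norm_to_L2_square)
  then show ?case by (simp add: ennreal_inj)
next
  case (lim f g h)
  have 1: "(\<lambda>n. to_L2 (g n)) \<longlonglongrightarrow> to_L2 f"
    using lim integrable_L1_L2D(3)[OF lim(1)] integrable_L1_L2D(3)[OF lim(2)]
    by (intro tendsto_to_L2_dominated[where h = h]) auto
  have 2: "(\<lambda>n. to_L2 (FI \<sigma> (g n))) \<longlonglongrightarrow> to_L2 (FI \<sigma> f)"
  proof (rule Lim_transform_bound[THEN LIM_zero_cancel])
    show "\<forall>\<^sub>F n in sequentially. norm (to_L2 (FI \<sigma> (g n)) - to_L2 (FI \<sigma> f)) \<le> norm (to_L2 (g n) - to_L2 f)"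
      using lim by (intro always_eventually allI norm_to_L2_FI_diff_le \<sigma>) auto
    show "(\<lambda>n. to_L2 (g n) - to_L2 f) \<longlonglongrightarrow> 0" using 1 by (rule LIM_zero)
  qed
  show ?case
    using LIMSEQ_unique[OF tendsto_norm[OF 2]] tendsto_norm[OF 1] by (simp add: lim(3))
qed

section \<open>The Plancherel transform as a unitary operator on L2\<close>

definition FT :: "real \<Rightarrow> 'a::euclidean_space L2 \<Rightarrow> 'a L2" where
  "FT \<sigma> f = Lim at_top (\<lambda>R. to_L2 (FI \<sigma> (truncate_ball R (L2_fun f))))"

lemma fourier_eq_FT: "fourier = FT 1"
  by (simp add: fun_eq_iff fourier_def FT_def fourier_integral_eq_FI)

lemma inv_fourier_eq_FT: "inv_fourier = FT (- 1)"
  by (simp add: fun_eq_iff inv_fourier_def FT_def inv_fourier_integral_eq_FI)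

text \<open>On a ball |f| is at most 1 + |f|^2, so square integrability yields integrability
  there.\<close>

lemma integrable_L1_L2_truncate:
  assumes f: "square_integrable f"
  shows "integrable_L1_L2 (truncate_ball R f)"
proof -
  have [measurable]: "f \<in> borel_measurable borel" using f by (rule square_integrable_measurable)
  have m[measurable]: "truncate_ball R f \<in> borel_measurable borel" unfolding truncate_ball_def by measurable
  have sq: "square_integrable (truncate_ball R f)"
    by (rule square_integrable_mono[OF f m]) (simp add: truncate_ball_def)
  have "integrable lborel (truncate_ball R f)"
  proof (rule Bochner_Integration.integrable_bound)
    show "integrable lborel (\<lambda>x. indicator (cball 0 R) x + (cmod (f x))\<^sup>2 :: real)"
      using f emeasure_lborel_cball_finite[of "0::'a" R]
      by (intro Bochner_Integration.integrable_add) (auto simp: square_integrable_def integrable_indicator_iff)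
    have "t \<le> 1 + t\<^sup>2" for t :: real
    proof -
      have "0 \<le> (t - 1/2)\<^sup>2" by simp
      then show ?thesis by (simp add: power2_eq_square algebra_simps)
    qed
    then show "AE x in lborel. norm (truncate_ball R f x) \<le> norm (indicator (cball 0 R) x + (cmod (f x))\<^sup>2 :: real)"
      by (intro AE_I2) (simp add: truncate_ball_def indicator_def)
  qed measurable
  with sq show ?thesis by (simp add: integrable_L1_L2_def)
qed

lemma tendsto_truncate:
  assumes f: "square_integrable f"
  shows "((\<lambda>R. to_L2 (truncate_ball R f)) \<longlongrightarrow> to_L2 f) at_top"
proof (rule tendsto_at_topI_sequentially)
  fix X :: "nat \<Rightarrow> real" assume X: "filterlim X at_top sequentially"
  show "(\<lambda>n. to_L2 (truncate_ball (X n) f)) \<longlonglongrightarrow> to_L2 f"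
  proof (rule tendsto_to_L2_dominated(3)[where h = "\<lambda>x. cmod (f x)"])
    show "AE x in lborel. (\<lambda>n. truncate_ball (X n) f x) \<longlonglongrightarrow> f x"
    proof (rule AE_I2)
      fix x :: 'a
      have "\<forall>\<^sub>F n in sequentially. norm x \<le> X n" using X by (simp add: filterlim_at_top)
      then have "\<forall>\<^sub>F n in sequentially. truncate_ball (X n) f x = f x"
        by eventually_elim (simp add: truncate_ball_def)
      then show "(\<lambda>n. truncate_ball (X n) f x) \<longlonglongrightarrow> f x" by (rule tendsto_eventually)
    qed
    show "truncate_ball (X n) f \<in> borel_measurable borel" for n
      by (rule integrable_L1_L2D(3)[OF integrable_L1_L2_truncate[OF f]])
  qed (use f in \<open>auto simp: square_integrable_def truncate_ball_def\<close>)
qed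

text \<open>\<open>Lim\<close> denotes a limit only once convergence is established. Contraction
  makes the transforms of the truncations Cauchy along the integers, completeness gives a limit, and
  comparison with the integer radii extends it to every sequence of radii tending to
  infinity.\<close>

lemma FT_tendsto:
  assumes \<sigma>: "\<bar>\<sigma>\<bar> = 1"
  shows "((\<lambda>R. to_L2 (FI \<sigma> (truncate_ball R (L2_fun f)))) \<longlongrightarrow> FT \<sigma> f) at_top"
proof -
  let ?T = "\<lambda>R. truncate_ball R (L2_fun f)"
  let ?Z = "\<lambda>R. to_L2 (FI \<sigma> (?T R))"
  have nice: "integrable_L1_L2 (?T R)" for R by (rule integrable_L1_L2_truncate) simp
  have T: "((\<lambda>R. to_L2 (?T R)) \<longlongrightarrow> f) at_top" using tendsto_truncate[of "L2_fun f"] by simp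
  have le: "dist (?Z R) (?Z S) \<le> dist (to_L2 (?T R)) (to_L2 (?T S))" for R S
    unfolding dist_norm by (rule norm_to_L2_FI_diff_le[OF nice nice \<sigma>])
  have TN: "(\<lambda>n. to_L2 (?T (real n))) \<longlonglongrightarrow> f"
    using filterlim_compose[OF T filterlim_real_sequentially] .
  have "Cauchy (\<lambda>n. ?Z (real n))"
  proof (rule metric_CauchyI)
    fix e :: real assume "e > 0"
    then obtain M where "\<forall>m\<ge>M. \<forall>n\<ge>M. dist (to_L2 (?T (real m))) (to_L2 (?T (real n))) < e"
      using LIMSEQ_imp_Cauchy[OF TN] metric_CauchyD by blast
    then show "\<exists>M. \<forall>m\<ge>M. \<forall>n\<ge>M. dist (?Z (real m)) (?Z (real n)) < e"
      using le by (meson le_less_trans)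
  qed
  then obtain l where l: "(\<lambda>n. ?Z (real n)) \<longlonglongrightarrow> l" using Cauchy_convergent convergent_def by blast
  have "(?Z \<longlongrightarrow> l) at_top"
  proof (rule tendsto_at_topI_sequentially)
    fix X :: "nat \<Rightarrow> real" assume "filterlim X at_top sequentially"
    then have "(\<lambda>n. to_L2 (?T (X n))) \<longlonglongrightarrow> f" using filterlim_compose[OF T] by blast
    then have "(\<lambda>n. dist (to_L2 (?T (X n))) (to_L2 (?T (real n)))) \<longlonglongrightarrow> dist f f"
      by (intro tendsto_dist TN)
    then have d0: "(\<lambda>n. dist (to_L2 (?T (X n))) (to_L2 (?T (real n)))) \<longlonglongrightarrow> 0" by simp
    have "(\<lambda>n. dist (?Z (X n)) (?Z (real n))) \<longlonglongrightarrow> 0"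
      by (rule tendsto_sandwich[OF _ _ tendsto_const d0]) (intro always_eventually allI zero_le_dist le)+
    then have "(\<lambda>n. ?Z (X n) - ?Z (real n)) \<longlonglongrightarrow> 0" by (simp add: dist_norm tendsto_norm_zero_iff)
    from tendsto_add[OF this l] show "(\<lambda>n. ?Z (X n)) \<longlonglongrightarrow> l" by simp
  qed
  moreover from this have "FT \<sigma> f = l" unfolding FT_def by (intro tendsto_Lim) auto
  ultimately show ?thesis by simp
qed

text \<open>The definition acts on an arbitrary representative. Changing it on a null set does not
  alter the integrals, and the transforms of the truncations of \<open>f\<close> itself converge by
  contraction.\<close>

lemma FT_to_L2:
  assumes f: "integrable_L1_L2 f" and \<sigma>: "\<bar>\<sigma>\<bar> = 1"
  shows "FT \<sigma> (to_L2 f) = to_L2 (FI \<sigma> f)"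
proof -
  note f' = integrable_L1_L2D[OF f]
  have eq: "FI \<sigma> (truncate_ball R (L2_fun (to_L2 f))) = FI \<sigma> (truncate_ball R f)" for R
  proof (rule FI_cong_AE)
    show "AE x in lborel. truncate_ball R (L2_fun (to_L2 f)) x = truncate_ball R f x"
      using L2_fun_to_L2[OF f'(2)] by eventually_elim (simp add: truncate_ball_def)
  qed (rule integrable_L1_L2D(3)[OF integrable_L1_L2_truncate], use f' in simp)+
  have "((\<lambda>R. to_L2 (FI \<sigma> (truncate_ball R f))) \<longlongrightarrow> to_L2 (FI \<sigma> f)) at_top"
  proof (rule Lim_transform_bound[THEN LIM_zero_cancel])
    show "\<forall>\<^sub>F R in at_top. norm (to_L2 (FI \<sigma> (truncate_ball R f)) - to_L2 (FI \<sigma> f)) \<le> norm (to_L2 (truncate_ball R f) - to_L2 f)"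
      using f' by (intro always_eventually allI norm_to_L2_FI_diff_le integrable_L1_L2_truncate f \<sigma>)
    show "((\<lambda>R. to_L2 (truncate_ball R f) - to_L2 f) \<longlongrightarrow> 0) at_top"
      using tendsto_truncate[OF f'(2)] by (rule LIM_zero)
  qed
  then show ?thesis
    using FT_tendsto[OF \<sigma>, of "to_L2 f"] tendsto_unique[OF trivial_limit_at_top_linorder] unfolding eq by blast
qed

text \<open>The truncations of an element to balls are in L1 and L2 and converge to it, so an
  identity between continuous maps has to be checked on such functions only.\<close>

lemma L2_dense_induct:
  fixes f :: "'a::euclidean_space L2"
  assumes "closed {f. P f}" and nice: "\<And>f. integrable_L1_L2 f \<Longrightarrow> P (to_L2 f)"
  shows "P f"
proof -
  have T: "((\<lambda>R. to_L2 (truncate_ball R (L2_fun f))) \<longlongrightarrow> f) at_top"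
    using tendsto_truncate[of "L2_fun f"] by simp
  have "f \<in> {f. P f}"
    by (rule Lim_in_closed_set[OF assms(1) _ _ T]) (auto intro!: nice integrable_L1_L2_truncate always_eventually)
  then show ?thesis by simp
qed

lemma FT_linear:
  assumes \<sigma>: "\<bar>\<sigma>\<bar> = 1"
  shows "FT \<sigma> (f + g) = FT \<sigma> f + FT \<sigma> g" "FT \<sigma> (r *\<^sub>R f) = r *\<^sub>R FT \<sigma> f"
proof -
  let ?T = "\<lambda>f R. truncate_ball R (L2_fun f)"
  let ?Z = "\<lambda>f R. to_L2 (FI \<sigma> (?T f R))"
  have nice: "integrable_L1_L2 (?T f R)" for f R by (rule integrable_L1_L2_truncate) simp
  note nice' = integrable_L1_L2D[OF nice]
  have "?Z (f + g) R = ?Z f R + ?Z g R" for R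
  proof -
    have "FI \<sigma> (?T (f + g) R) = FI \<sigma> (\<lambda>x. ?T f R x + ?T g R x)"
    proof (rule FI_cong_AE)
      show "AE x in lborel. ?T (f + g) R x = ?T f R x + ?T g R x"
        using L2_fun_add[of f g] by eventually_elim (simp add: truncate_ball_def)
    qed (use nice'(3) in measurable)
    also have "\<dots> = (\<lambda>\<xi>. FI \<sigma> (?T f R) \<xi> + FI \<sigma> (?T g R) \<xi>)"
      by (intro ext FI_add nice'(1))
    finally show ?thesis by (simp add: to_L2_add square_integrable_FI[OF nice \<sigma>])
  qed
  then have "((\<lambda>R. ?Z (f + g) R) \<longlongrightarrow> FT \<sigma> f + FT \<sigma> g) at_top"
    using tendsto_add[OF FT_tendsto[OF \<sigma>, of f] FT_tendsto[OF \<sigma>, of g]] by simp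
  then show "FT \<sigma> (f + g) = FT \<sigma> f + FT \<sigma> g"
    using FT_tendsto[OF \<sigma>, of "f + g"] tendsto_unique[OF trivial_limit_at_top_linorder] by blast
  have "?Z (r *\<^sub>R f) R = r *\<^sub>R ?Z f R" for R
  proof -
    have "FI \<sigma> (?T (r *\<^sub>R f) R) = FI \<sigma> (\<lambda>x. of_real r * ?T f R x)"
    proof (rule FI_cong_AE)
      show "AE x in lborel. ?T (r *\<^sub>R f) R x = of_real r * ?T f R x"
        using L2_fun_scaleR[of r f] by eventually_elim (simp add: truncate_ball_def)
    qed (use nice'(3) in measurable)
    also have "\<dots> = (\<lambda>\<xi>. of_real r * FI \<sigma> (?T f R) \<xi>)" by (simp add: FI_cmult fun_eq_iff)
    finally show ?thesis by (simp add: to_L2_scaleR square_integrable_FI[OF nice \<sigma>])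
  qed
  then have "((\<lambda>R. ?Z (r *\<^sub>R f) R) \<longlongrightarrow> r *\<^sub>R FT \<sigma> f) at_top"
    using tendsto_scaleR[OF tendsto_const FT_tendsto[OF \<sigma>, of f]] by simp
  then show "FT \<sigma> (r *\<^sub>R f) = r *\<^sub>R FT \<sigma> f"
    using FT_tendsto[OF \<sigma>, of "r *\<^sub>R f"] tendsto_unique[OF trivial_limit_at_top_linorder] by blast
qed

theorem norm_FT:
  assumes \<sigma>: "\<bar>\<sigma>\<bar> = 1"
  shows "norm (FT \<sigma> f) = norm f"
proof -
  let ?T = "\<lambda>R. truncate_ball R (L2_fun f)"
  have "((\<lambda>R. norm (to_L2 (FI \<sigma> (?T R)))) \<longlongrightarrow> norm (FT \<sigma> f)) at_top"
    by (intro tendsto_norm FT_tendsto \<sigma>)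
  moreover have "norm (to_L2 (FI \<sigma> (?T R))) = norm (to_L2 (?T R))" for R
    by (rule plancherel_L1_L2[OF integrable_L1_L2_truncate \<sigma>]) simp
  moreover have "((\<lambda>R. norm (to_L2 (?T R))) \<longlongrightarrow> norm f) at_top"
    using tendsto_norm[OF tendsto_truncate[of "L2_fun f"]] by simp
  ultimately show ?thesis using tendsto_unique[OF trivial_limit_at_top_linorder] by fastforce
qed

lemma bounded_linear_FT:
  assumes "\<bar>\<sigma>\<bar> = 1"
  shows "bounded_linear (FT \<sigma>)"
  by (rule bounded_linear_intro[where K = 1]) (use assms in \<open>auto simp: FT_linear norm_FT\<close>)

text \<open>Polarisation: the inner product is a combination of norms, and norms are
  preserved.\<close>

lemma FT_inner:
  assumes \<sigma>: "\<bar>\<sigma>\<bar> = 1"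
  shows "FT \<sigma> f \<bullet> FT \<sigma> g = f \<bullet> g"
  unfolding dot_norm FT_linear(1)[OF \<sigma>, symmetric] norm_FT[OF \<sigma>] ..

lemma integrable_mult_cnj:
  assumes a: "square_integrable a" and b: "square_integrable b"
  shows "integrable lborel (\<lambda>x. a x * cnj (b x))"
proof (rule Bochner_Integration.integrable_bound)
  note [measurable] = square_integrable_measurable[OF a] square_integrable_measurable[OF b]
  show "(\<lambda>x. a x * cnj (b x)) \<in> borel_measurable lborel" by measurable
  show "integrable lborel (\<lambda>x. (cmod (a x))\<^sup>2 + (cmod (b x))\<^sup>2)"
    using a b by (simp add: square_integrable_def)
  have "cmod (a x) * cmod (b x) \<le> (cmod (a x))\<^sup>2 + (cmod (b x))\<^sup>2" for x
  proof -
    have "0 \<le> cmod (a x) * cmod (b x)" by simp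
    then show ?thesis using sum_squares_bound[of "cmod (a x)" "cmod (b x)"] by linarith
  qed
  then show "AE x in lborel. norm (a x * cnj (b x)) \<le> norm ((cmod (a x))\<^sup>2 + (cmod (b x))\<^sup>2)"
    by (intro AE_I2) (simp add: norm_mult)
qed

text \<open>For functions in L1 and L2 this is the exchange formula with conjugates; density extends
  it in one argument at a time. Real parts appear because the inner product is the real part of the
  Hermitian one.\<close>

lemma FT_adjoint:
  assumes \<sigma>: "\<bar>\<sigma>\<bar> = 1"
  shows "FT \<sigma> f \<bullet> g = f \<bullet> FT (- \<sigma>) g"
proof -
  have \<sigma>': "\<bar>- \<sigma>\<bar> = 1" using \<sigma> by simp
  note cont [continuous_intros] = bounded_linear.continuous_on[OF bounded_linear_FT]
  have base: "FT \<sigma> (to_L2 f) \<bullet> to_L2 g = to_L2 f \<bullet> FT (- \<sigma>) (to_L2 g)"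
    if f: "integrable_L1_L2 f" and g: "integrable_L1_L2 g" for f g :: "'a \<Rightarrow> complex"
  proof -
    let ?c = "complex_of_real ((2 * pi) powr (- real DIM('a) / 2))"
    note f' = integrable_L1_L2D[OF f] and g' = integrable_L1_L2D[OF g]
    note Ff = square_integrable_FI[OF f \<sigma>] and Fg = square_integrable_FI[OF g \<sigma>']
    have Re: "(LINT x|lborel. a x \<bullet> b x) = Re (LINT x|lborel. a x * cnj (b x))"
      if "square_integrable a" "square_integrable b" for a b :: "'a \<Rightarrow> complex"
      using integral_Re[OF integrable_mult_cnj[OF that]] by (simp add: inner_complex_def)
    have "(LINT \<xi>|lborel. FI \<sigma> f \<xi> * cnj (g \<xi>)) = ?c * (LINT \<xi>|lborel. cnj (g \<xi>) * (LINT x|lborel. phase \<sigma> x \<xi> * f x))"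
      unfolding FI_def by (subst integral_mult_right_zero[symmetric]) (simp only: mult_ac)
    also have "\<dots> = ?c * (LINT x|lborel. f x * (LINT \<xi>|lborel. phase \<sigma> x \<xi> * cnj (g \<xi>)))"
      using f' g' by (subst integral_phase_swap) auto
    also have "\<dots> = (LINT x|lborel. f x * cnj (FI (- \<sigma>) g x))"
    proof -
      have "cnj (FI (- \<sigma>) g x) = ?c * (LINT \<xi>|lborel. phase \<sigma> x \<xi> * cnj (g \<xi>))" for x
      proof -
        have "cnj (LINT \<xi>|lborel. phase (- \<sigma>) \<xi> x * g \<xi>) = (LINT \<xi>|lborel. cnj (phase (- \<sigma>) \<xi> x * g \<xi>))"
          by (rule Bochner_Integration.integral_cnj[symmetric])
        also have "\<dots> = (LINT \<xi>|lborel. phase \<sigma> x \<xi> * cnj (g \<xi>))"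
          by (simp add: cnj_phase) (simp add: phase_def inner_commute)
        finally show ?thesis by (simp add: FI_def)
      qed
      then show ?thesis by (subst integral_mult_right_zero[symmetric]) (simp only: mult_ac)
    qed
    finally show ?thesis
      using f' g' Ff Fg by (simp add: FT_to_L2[OF f \<sigma>] FT_to_L2[OF g \<sigma>'] to_L2_inner Re)
  qed
  have "FT \<sigma> (to_L2 f) \<bullet> g = to_L2 f \<bullet> FT (- \<sigma>) g" if f: "integrable_L1_L2 f" for f
  proof (rule L2_dense_induct[where f = g])
    show "closed {g. FT \<sigma> (to_L2 f) \<bullet> g = to_L2 f \<bullet> FT (- \<sigma>) g}"
      by (intro closed_Collect_eq continuous_intros \<sigma>')
  qed (rule base[OF f])
  then show ?thesis
    by (intro L2_dense_induct[where f = f and P = "\<lambda>f. FT \<sigma> f \<bullet> g = f \<bullet> FT (- \<sigma>) g"] closed_Collect_eq continuous_intros \<sigma>) auto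
qed

text \<open>The adjoint undoes an isometry: the inner product of
  \<open>FT (- \<sigma>) (FT \<sigma> f)\<close> with the error \<open>h\<close> equals that of
  \<open>f\<close> with \<open>h\<close>, so \<open>h \<bullet> h = 0\<close>. Inversion thus needs
  no pointwise formula.\<close>

theorem FT_inverse:
  assumes \<sigma>: "\<bar>\<sigma>\<bar> = 1"
  shows "FT (- \<sigma>) (FT \<sigma> f) = f"
proof -
  let ?h = "FT (- \<sigma>) (FT \<sigma> f) - f"
  have "(FT (- \<sigma>) (FT \<sigma> f)) \<bullet> ?h = FT \<sigma> f \<bullet> FT \<sigma> ?h"
    using FT_adjoint[of "- \<sigma>" "FT \<sigma> f" ?h] \<sigma> by simp
  then have "?h \<bullet> ?h = 0" by (simp add: FT_inner[OF \<sigma>] inner_diff_left)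
  then show ?thesis by simp
qed

lemma inv_fourier_fourier [simp]: "inv_fourier (fourier f) = f"
  using FT_inverse[of 1] by (simp add: fourier_eq_FT inv_fourier_eq_FT)

lemma fourier_inv_fourier [simp]: "fourier (inv_fourier f) = f"
  using FT_inverse[of "- 1"] by (simp add: fourier_eq_FT inv_fourier_eq_FT)

lemma norm_fourier [simp]: "norm (fourier f) = norm f"
  by (simp add: fourier_eq_FT norm_FT)

lemma bounded_linear_fourier: "bounded_linear fourier"
  by (simp add: fourier_eq_FT bounded_linear_FT)

lemma bounded_linear_inv_fourier: "bounded_linear inv_fourier"
  by (simp add: inv_fourier_eq_FT bounded_linear_FT)

lemma norm_inv_fourier [simp]: "norm (inv_fourier f) = norm f"
  by (simp add: inv_fourier_eq_FT norm_FT)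

section \<open>Riesz potentials\<close>

lemma nn_integral_lborel_affine:
  fixes f :: "'a::euclidean_space \<Rightarrow> ennreal"
  assumes [measurable]: "f \<in> borel_measurable borel" and c: "c \<noteq> 0"
  shows "(\<integral>\<^sup>+x. f x \<partial>lborel) = ennreal (\<bar>c\<bar> ^ DIM('a)) * (\<integral>\<^sup>+x. f (t + c *\<^sub>R x) \<partial>lborel)"
  by (subst lborel_affine[OF c, of t])
    (simp add: nn_integral_density nn_integral_distr nn_integral_cmult)

lemma nn_integral_lborel_translate:
  fixes f :: "'a::euclidean_space \<Rightarrow> ennreal"
  assumes "f \<in> borel_measurable borel"
  shows "(\<integral>\<^sup>+x. f (x + t) \<partial>lborel) = (\<integral>\<^sup>+x. f x \<partial>lborel)"
  using nn_integral_lborel_affine[OF assms, of 1 t] by (simp add: add.commute)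

lemma nn_integral_lborel_reflect:
  fixes f :: "'a::euclidean_space \<Rightarrow> ennreal"
  assumes "f \<in> borel_measurable borel"
  shows "(\<integral>\<^sup>+x. f (t - x) \<partial>lborel) = (\<integral>\<^sup>+x. f x \<partial>lborel)"
  using nn_integral_lborel_affine[OF assms, of "- 1" t] by simp

section \<open>Mellin transforms and powers of the norm as superpositions of Gaussians\<close>

text \<open>The Mellin transform of a nonnegative function, with values in \<open>ennreal\<close> so
  that interchanges with other integrals are free of convergence conditions and \<open>q\<close> may
  be negative.\<close>

definition mellin :: "real \<Rightarrow> (real \<Rightarrow> real) \<Rightarrow> ennreal" where
  "mellin q h = (\<integral>\<^sup>+t. ennreal (indicator {0<..} t * t powr (q - 1) * h t) \<partial>lborel)"

lemma mellin_mono: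
  assumes "\<And>t. t > 0 \<Longrightarrow> h t \<le> k t"
  shows "mellin q h \<le> mellin q k"
  unfolding mellin_def
  by (intro nn_integral_mono ennreal_leI) (auto simp: indicator_def intro!: mult_left_mono assms)

lemma mellin_scale:
  assumes [measurable]: "h \<in> borel_measurable borel" and r: "r > 0"
  shows "mellin q (\<lambda>t. h (t * r)) = ennreal (r powr (- q)) * mellin q h"
proof -
  have "mellin q h = ennreal \<bar>r\<bar> *
      (\<integral>\<^sup>+t. ennreal (indicator {0<..} (0 + r * t) * (0 + r * t) powr (q - 1) * h (0 + r * t)) \<partial>lborel)"
    unfolding mellin_def using r by (intro nn_integral_real_affine) auto
  also have "(\<integral>\<^sup>+t. ennreal (indicator {0<..} (0 + r * t) * (0 + r * t) powr (q - 1) * h (0 + r * t)) \<partial>lborel)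
      = (\<integral>\<^sup>+t. ennreal (r powr (q - 1)) * ennreal (indicator {0<..} t * t powr (q - 1) * h (t * r)) \<partial>lborel)"
    using r by (intro nn_integral_cong)
      (auto simp: indicator_def powr_mult ennreal_mult'[symmetric] zero_less_mult_iff mult_ac)
  also have "\<dots> = ennreal (r powr (q - 1)) * mellin q (\<lambda>t. h (t * r))"
    unfolding mellin_def by (rule nn_integral_cmult) measurable
  finally have "mellin q h = ennreal (r powr q) * mellin q (\<lambda>t. h (t * r))"
    using r by (simp add: mult.assoc[symmetric] ennreal_mult'[symmetric] powr_diff)
  then have "ennreal (r powr (- q)) * mellin q h
      = ennreal (r powr (- q) * r powr q) * mellin q (\<lambda>t. h (t * r))"
    by (simp add: ennreal_mult' mult.assoc)
  also have "r powr (- q) * r powr q = 1" using r by (simp add: powr_add[symmetric])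
  finally show ?thesis by simp
qed

lemma mellin_exp:
  assumes "q > 0"
  shows "mellin q (\<lambda>t. exp (- t)) = ennreal (Gamma q)"
proof -
  have "mellin q (\<lambda>t. exp (- t)) = (\<integral>\<^sup>+t. ennreal (t powr (q - 1) / exp t) * indicator {0..} t \<partial>lborel)"
    unfolding mellin_def
    by (intro nn_integral_cong) (auto simp: indicator_def exp_minus divide_inverse)
  also have "\<dots> = ennreal (Gamma q)"
    by (rule nn_integral_has_integral_lebesgue'[OF _ Gamma_integral_real[OF assms]]) simp
  finally show ?thesis .
qed

text \<open>A Beta integral of which only the finiteness matters. After splitting at 1,
  \<open>p > 0\<close> gives convergence at the origin and \<open>p < r\<close> at infinity.\<close>

lemma mellin_beta_finite:
  assumes p: "0 < p" "p < r"
  shows "mellin p (\<lambda>t. (1 + t) powr (- r)) < \<infinity>"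
proof -
  have 0: "((\<lambda>t. t powr (p - 1)) has_integral (1 powr (p - 1 + 1) / (p - 1 + 1))) {0..1}"
    using p by (intro has_integral_powr_from_0) auto
  have 1: "((\<lambda>t. t powr (p - 1 - r)) has_integral (- (1 powr (p - 1 - r + 1)) / (p - 1 - r + 1))) {1..}"
    using p by (intro has_integral_powr_to_inf) auto
  have "mellin p (\<lambda>t. (1 + t) powr (- r))
      \<le> (\<integral>\<^sup>+t. (ennreal (t powr (p - 1)) * indicator {0..1} t + ennreal (t powr (p - 1 - r)) * indicator {1..} t) \<partial>lborel)"
    unfolding mellin_def
  proof (rule nn_integral_mono)
    fix t :: real
    consider "t \<le> 0" | "0 < t" "t \<le> 1" | "t > 1" by linarith
    then show "ennreal (indicator {0<..} t * t powr (p - 1) * (1 + t) powr (- r))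
        \<le> ennreal (t powr (p - 1)) * indicator {0..1} t + ennreal (t powr (p - 1 - r)) * indicator {1..} t"
    proof cases
      case 2
      have "(1 + t) powr (- r) \<le> (1 + t) powr 0" using 2 p by (intro powr_mono) auto
      then have "t powr (p - 1) * (1 + t) powr (- r) \<le> t powr (p - 1)"
        using 2 by (simp add: mult_left_le)
      then have "ennreal (t powr (p - 1) * (1 + t) powr (- r)) \<le> ennreal (t powr (p - 1))" by (rule ennreal_leI)
      also have "\<dots> \<le> ennreal (t powr (p - 1)) + ennreal (t powr (p - 1 - r)) * indicator {1..} t" by simp
      finally show ?thesis using 2 by simp
    next
      case 3
      have "(1 + t) powr (- r) \<le> t powr (- r)" using 3 p by (intro powr_mono2') auto
      then have "t powr (p - 1) * (1 + t) powr (- r) \<le> t powr (p - 1) * t powr (- r)"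
        by (rule mult_left_mono) simp
      also have "\<dots> = t powr (p - 1 - r)" using 3 by (simp add: powr_add[symmetric])
      finally show ?thesis using 3 by (simp add: ennreal_leI)
    qed simp
  qed
  also have "\<dots> = (\<integral>\<^sup>+t. ennreal (t powr (p - 1)) * indicator {0..1} t \<partial>lborel)
      + (\<integral>\<^sup>+t. ennreal (t powr (p - 1 - r)) * indicator {1..} t \<partial>lborel)"
    by (rule nn_integral_add) measurable
  also have "\<dots> < \<infinity>"
    using nn_integral_has_integral_lebesgue'[OF _ 0] nn_integral_has_integral_lebesgue'[OF _ 1] by simp
  finally show ?thesis .
qed

lemma measurable_gauss' [measurable]:
  assumes [measurable]: "f \<in> borel_measurable M" "g \<in> borel_measurable M"
  shows "(\<lambda>x. gauss (f x) (g x)) \<in> borel_measurable M"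
  unfolding gauss_def by measurable

text \<open>Subordination: scaling turns the Gamma integral into a negative power of
  \<open>(norm x)^2\<close>.\<close>

lemma mellin_gauss:
  assumes q: "q > 0" and x: "x \<noteq> 0"
  shows "mellin q (\<lambda>t. gauss t x) = ennreal (Gamma q * norm x powr (- (2 * q)))"
proof -
  have "(norm x)\<^sup>2 powr (- q) = (norm x powr 2) powr (- q)" using x by simp
  also have "\<dots> = norm x powr (- (2 * q))" by (simp only: powr_powr) simp
  finally show ?thesis
    unfolding gauss_def
    using mellin_scale[of "\<lambda>t. exp (- t)" "(norm x)\<^sup>2" q] x q Gamma_real_pos[OF q]
    by (simp add: mellin_exp ennreal_mult' mult.commute)
qed

text \<open>The dual formula, for the inverted widths that come out of the Fourier transform. By
  scaling, the constant is the Mellin transform of \<open>exp (- (1 / (4 * s)))\<close> at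
  \<open>- q\<close>. Its value is irrelevant, but it must be finite and, since a later constant
  divides by it, positive.\<close>

lemma mellin_gauss_inverse:
  assumes q: "q > 0"
  obtains C where "C > 0"
    "\<And>x::'a::euclidean_space. x \<noteq> 0 \<Longrightarrow> mellin (- q) (\<lambda>t. gauss (1 / (4 * t)) x) = ennreal (C * norm x powr (- (2 * q)))"
proof -
  let ?h = "\<lambda>s::real. exp (- (1 / (4 * s)))"
  \<comment> \<open>An integer \<open>k > q\<close> turns the flatness of the exponential at 0 into
    the power \<open>s powr k\<close>: the inequality \<open>(1 + y / k)^k \<le> exp y\<close> at
    \<open>y = 1 / (4 * s)\<close> bounds the integrand by one of Beta type.\<close>
  obtain k :: nat where k: "q < real k" using reals_Archimedean2 by blast
  then have k0: "k > 0" using q by (cases k) auto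
  have "?h s \<le> (4 * k) powr k * (s powr k * (1 + s * (4 * k)) powr (- k))" if s: "s > 0" for s :: real
  proof -
    have "(1 + 1 / (4 * s) / k) ^ k \<le> exp (1 / (4 * s))"
      using s k0 by (intro exp_ge_one_plus_x_over_n_power_n) (auto intro: order_trans[of _ 0])
    moreover have "1 + 1 / (4 * s) / k = (1 + s * (4 * k)) / (s * (4 * k))" using s k0 by (simp add: field_simps)
    ultimately have "inverse (exp (1 / (4 * s))) \<le> inverse (((1 + s * (4 * k)) / (s * (4 * k))) ^ k)"
      using s k0 by (intro le_imp_inverse_le zero_less_power divide_pos_pos add_pos_pos) auto
    also have "\<dots> = (s * (4 * k)) ^ k / (1 + s * (4 * k)) ^ k" by (simp add: power_divide)
    also have "\<dots> = (4 * k) powr k * (s powr k * (1 + s * (4 * k)) powr (- k))"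
      using s k0 by (simp add: powr_minus powr_realpow add_pos_pos power_mult_distrib divide_inverse mult_ac)
    finally show ?thesis by (simp add: exp_minus)
  qed
  then have "mellin (- q) ?h \<le> mellin (- q) (\<lambda>s. (4 * k) powr k * (s powr k * (1 + s * (4 * k)) powr (- k)))"
    by (rule mellin_mono)
  also have "\<dots> = ennreal ((4 * k) powr k) * mellin (real k - q) (\<lambda>s. (1 + s * (4 * k)) powr (- k))"
    unfolding mellin_def
  proof (subst nn_integral_cmult[symmetric])
    show "(\<integral>\<^sup>+t. ennreal (indicator {0<..} t * t powr (- q - 1) * ((4 * k) powr k * (t powr k * (1 + t * (4 * k)) powr (- k)))) \<partial>lborel)
      = (\<integral>\<^sup>+t. ennreal ((4 * k) powr k) * ennreal (indicator {0<..} t * t powr (k - q - 1) * (1 + t * (4 * k)) powr (- k)) \<partial>lborel)"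
    proof (rule nn_integral_cong)
      fix t :: real
      have eq: "t powr (k - q - 1) = t powr (- q - 1) * t powr k" by (simp add: powr_add[symmetric] algebra_simps)
      have "indicator {0<..} t * t powr (- q - 1) * ((4 * k) powr k * (t powr k * (1 + t * (4 * k)) powr (- k)))
        = (4 * k) powr k * (indicator {0<..} t * t powr (k - q - 1) * (1 + t * (4 * k)) powr (- k))"
        unfolding eq by (simp only: mult_ac)
      then show "ennreal (indicator {0<..} t * t powr (- q - 1) * ((4 * k) powr k * (t powr k * (1 + t * (4 * k)) powr (- k))))
        = ennreal ((4 * k) powr k) * ennreal (indicator {0<..} t * t powr (k - q - 1) * (1 + t * (4 * k)) powr (- k))"
        by (simp only:) (rule ennreal_mult', simp)
    qed
  qed measurable
  also have "\<dots> = ennreal ((4 * k) powr k) * (ennreal ((4 * k) powr (- (k - q))) * mellin (real k - q) (\<lambda>s. (1 + s) powr (- k)))"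
    using mellin_scale[of "\<lambda>s. (1 + s) powr (- k)" "4 * k" "real k - q"] k0 by simp
  also have "\<dots> < \<infinity>"
    using mellin_beta_finite[of "real k - q" k] q k by (simp add: ennreal_mult_less_top)
  finally have fin: "mellin (- q) ?h < \<infinity>" .
  \<comment> \<open>The integrand is positive on the unit interval, which is not a null set.\<close>
  have pos: "mellin (- q) ?h \<noteq> 0"
  proof
    assume "mellin (- q) ?h = 0"
    then have "AE t in lborel. ennreal (indicator {0<..} t * t powr (- q - 1) * ?h t) = 0"
      unfolding mellin_def by (subst (asm) nn_integral_0_iff_AE) auto
    then have "AE t in lborel. t \<notin> {0<..<1::real}"
      by eventually_elim (auto simp: indicator_def split: if_splits)
    then have "emeasure lborel {0<..<1::real} = 0"
      by (subst (asm) AE_iff_measurable[where N = "{0<..<1}"]) auto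
    then show False by simp
  qed
  obtain C where C: "mellin (- q) ?h = ennreal C" "C > 0"
    using fin pos by (cases "mellin (- q) ?h") (auto simp: less_le)
  have "mellin (- q) (\<lambda>t. gauss (1 / (4 * t)) x) = ennreal (C * norm x powr (- (2 * q)))" if x: "x \<noteq> 0" for x :: 'a
  proof -
    have "(\<lambda>t. gauss (1 / (4 * t)) x) = (\<lambda>t. ?h (t * (1 / (norm x)\<^sup>2)))"
      by (simp add: gauss_def fun_eq_iff)
    then have "mellin (- q) (\<lambda>t. gauss (1 / (4 * t)) x) = ennreal ((1 / (norm x)\<^sup>2) powr (- (- q))) * mellin (- q) ?h"
      using x mellin_scale[of ?h "1 / (norm x)\<^sup>2" "- q"] by simp
    also have "(1 / (norm x)\<^sup>2) powr (- (- q)) = norm x powr (- (2 * q))"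
    proof -
      have "1 / (norm x)\<^sup>2 = norm x powr (- 2)" using x by (simp add: powr_minus_divide)
      then show ?thesis by (simp only: powr_powr) simp
    qed
    finally show ?thesis using C by (simp add: ennreal_mult' mult.commute)
  qed
  with C(2) show thesis using that by blast
qed

section \<open>Integrals of powers of the norm over balls and their complements\<close>

lemma radial_scale:
  fixes S :: "real set" and p :: real
  assumes R: "R > 0" and [measurable]: "S \<in> sets borel"
  shows "(\<integral>\<^sup>+y. ennreal (indicator S (norm (y::'a::euclidean_space) / R) * norm y powr (- p)) \<partial>lborel)
    = ennreal (R powr (DIM('a) - p)) * (\<integral>\<^sup>+y. ennreal (indicator S (norm (y::'a)) * norm y powr (- p)) \<partial>lborel)"
proof -
  have "(\<integral>\<^sup>+y. ennreal (indicator S (norm (y::'a) / R) * norm y powr (- p)) \<partial>lborel)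
      = ennreal (\<bar>R\<bar> ^ DIM('a)) * (\<integral>\<^sup>+y. ennreal (indicator S (norm (0 + R *\<^sub>R (y::'a)) / R) * norm (0 + R *\<^sub>R y) powr (- p)) \<partial>lborel)"
    using R by (intro nn_integral_lborel_affine) auto
  also have "(\<integral>\<^sup>+y. ennreal (indicator S (norm (0 + R *\<^sub>R (y::'a)) / R) * norm (0 + R *\<^sub>R y) powr (- p)) \<partial>lborel)
      = (\<integral>\<^sup>+y. ennreal (R powr (- p)) * ennreal (indicator S (norm (y::'a)) * norm y powr (- p)) \<partial>lborel)"
    using R by (intro nn_integral_cong) (simp add: powr_mult ennreal_mult'[symmetric] mult_ac)
  also have "\<dots> = ennreal (R powr (- p)) * (\<integral>\<^sup>+y. ennreal (indicator S (norm (y::'a)) * norm y powr (- p)) \<partial>lborel)"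
    by (rule nn_integral_cmult) measurable
  also have "ennreal (\<bar>R\<bar> ^ DIM('a)) * \<dots> = ennreal (\<bar>R\<bar> ^ DIM('a) * R powr (- p)) * (\<integral>\<^sup>+y. ennreal (indicator S (norm (y::'a)) * norm y powr (- p)) \<partial>lborel)"
    using R by (simp add: ennreal_mult' mult.assoc)
  also have "\<bar>R\<bar> ^ DIM('a) * R powr (- p) = R powr (DIM('a) - p)"
    using R by (simp add: powr_diff powr_realpow powr_minus divide_inverse)
  finally show ?thesis .
qed

lemma mellin_nn_integral_swap:
  fixes G :: "real \<Rightarrow> 'a::euclidean_space \<Rightarrow> real"
  assumes [measurable]: "(\<lambda>(t, x). G t x) \<in> borel_measurable (borel \<Otimes>\<^sub>M borel)"
    and [measurable]: "w \<in> borel_measurable borel"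
  shows "(\<integral>\<^sup>+x. mellin q (\<lambda>t. G t x) * w x \<partial>lborel)
    = (\<integral>\<^sup>+t. ennreal (indicator {0<..} t * t powr (q - 1)) * (\<integral>\<^sup>+x. ennreal (G t x) * w x \<partial>lborel) \<partial>lborel)"
proof -
  have "(\<integral>\<^sup>+x. mellin q (\<lambda>t. G t x) * w x \<partial>lborel)
      = (\<integral>\<^sup>+x. \<integral>\<^sup>+t. ennreal (indicator {0<..} t * t powr (q - 1) * G t x) * w x \<partial>lborel \<partial>lborel)"
    unfolding mellin_def by (intro nn_integral_cong nn_integral_multc[symmetric]) measurable
  also have "\<dots> = (\<integral>\<^sup>+t. \<integral>\<^sup>+x. ennreal (indicator {0<..} t * t powr (q - 1) * G t x) * w x \<partial>lborel \<partial>lborel)"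
    by (rule lborel_pair.Fubini') measurable
  also have "\<dots> = (\<integral>\<^sup>+t. ennreal (indicator {0<..} t * t powr (q - 1)) * (\<integral>\<^sup>+x. ennreal (G t x) * w x \<partial>lborel) \<partial>lborel)"
    by (intro nn_integral_cong, subst nn_integral_cmult[symmetric])
      (measurable, simp add: ennreal_mult' mult.assoc)
  finally show ?thesis .
qed

lemma mult_ennreal_less_topD:
  assumes "ennreal c * x < \<infinity>" "c > 0"
  shows "x < \<infinity>"
  using assms by (cases "x = \<infinity>") (auto simp: ennreal_mult_top less_top)

text \<open>In place of polar coordinates the power is written as a Mellin transform of Gaussians
  and the indicator is dominated by a Gaussian. Their product integrates to a power of
  \<open>1 + t\<close>, and finiteness becomes that of a Beta integral, which holds for
  \<open>0 < p < d\<close>.\<close>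

lemma radial_inner:
  fixes p :: real
  assumes p: "0 < p" "p < DIM('a)"
  obtains C where "C \<ge> 0" "\<And>R. R > 0 \<Longrightarrow>
    (\<integral>\<^sup>+y. ennreal (indicator {..R} (norm (y::'a::euclidean_space)) * norm y powr (- p)) \<partial>lborel) \<le> ennreal (C * R powr (DIM('a) - p))"
proof -
  let ?I = "\<integral>\<^sup>+y. ennreal (indicator {..1} (norm (y::'a)) * norm y powr (- p)) \<partial>lborel"
  have q: "p / 2 > 0" using p by simp
  have "ennreal (Gamma (p / 2)) * ?I = (\<integral>\<^sup>+y. ennreal (Gamma (p / 2)) * ennreal (indicator {..1} (norm (y::'a)) * norm y powr (- p)) \<partial>lborel)"
    by (rule nn_integral_cmult[symmetric]) measurable
  also have "\<dots> \<le> (\<integral>\<^sup>+y. mellin (p / 2) (\<lambda>t. gauss t (y::'a)) * ennreal (exp 1 * gauss 1 y) \<partial>lborel)"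
  proof (rule nn_integral_mono_AE, use AE_lborel_singleton[of 0] in eventually_elim)
    case (elim y)
    \<comment> \<open>On the unit ball \<open>exp (1 - (norm y)^2)\<close> is at least 1.\<close>
    have "indicator {..1} (norm y) \<le> exp 1 * gauss 1 y"
      by (auto simp: indicator_def gauss_def exp_add[symmetric] power_le_one)
    then have "Gamma (p / 2) * (indicator {..1} (norm y) * norm y powr (- p)) \<le> (Gamma (p / 2) * norm y powr (- p)) * (exp 1 * gauss 1 y)"
      using mult_left_mono[of "indicator {..1} (norm y)" "exp 1 * gauss 1 y" "Gamma (p / 2) * norm y powr (- p)"] Gamma_real_pos[OF q]
      by (simp add: mult_ac)
    then have "ennreal (Gamma (p / 2) * (indicator {..1} (norm y) * norm y powr (- p))) \<le> ennreal ((Gamma (p / 2) * norm y powr (- p)) * (exp 1 * gauss 1 y))"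
      by (rule ennreal_leI)
    moreover have "mellin (p / 2) (\<lambda>t. gauss t y) = ennreal (Gamma (p / 2) * norm y powr (- p))"
      using mellin_gauss[OF q elim] by simp
    ultimately show ?case using Gamma_real_pos[OF q] by (simp add: ennreal_mult')
  qed
  also have "\<dots> = (\<integral>\<^sup>+t. ennreal (indicator {0<..} t * t powr (p / 2 - 1)) * (\<integral>\<^sup>+y. ennreal (gauss t (y::'a)) * ennreal (exp 1 * gauss 1 y) \<partial>lborel) \<partial>lborel)"
    by (rule mellin_nn_integral_swap) measurable
  also have "\<dots> = (\<integral>\<^sup>+t. ennreal (exp 1 * pi powr (DIM('a) / 2)) * ennreal (indicator {0<..} t * t powr (p / 2 - 1) * (1 + t) powr (- (DIM('a) / 2))) \<partial>lborel)"
  proof (rule nn_integral_cong)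
    fix t :: real
    show "ennreal (indicator {0<..} t * t powr (p / 2 - 1)) * (\<integral>\<^sup>+y. ennreal (gauss t (y::'a)) * ennreal (exp 1 * gauss 1 y) \<partial>lborel)
      = ennreal (exp 1 * pi powr (DIM('a) / 2)) * ennreal (indicator {0<..} t * t powr (p / 2 - 1) * (1 + t) powr (- (DIM('a) / 2)))"
    proof (cases "t > 0")
      case True
      have "(\<integral>\<^sup>+y. ennreal (gauss t (y::'a)) * ennreal (exp 1 * gauss 1 y) \<partial>lborel) = (\<integral>\<^sup>+y. ennreal (exp 1) * ennreal (gauss (1 + t) (y::'a)) \<partial>lborel)"
      proof (rule nn_integral_cong)
        fix y :: 'a
        have "gauss t y * (exp 1 * gauss 1 y) = exp 1 * gauss (1 + t) y"
          by (simp add: gauss_def exp_add[symmetric] algebra_simps)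
        then show "ennreal (gauss t y) * ennreal (exp 1 * gauss 1 y) = ennreal (exp 1) * ennreal (gauss (1 + t) y)"
          by (simp add: ennreal_mult'[symmetric])
      qed
      also have "\<dots> = ennreal (exp 1) * ennreal ((pi / (1 + t)) powr (DIM('a) / 2))"
        using True by (subst nn_integral_cmult) (auto simp: nn_integral_gauss)
      also have "(pi / (1 + t)) powr (DIM('a) / 2) = pi powr (DIM('a) / 2) * (1 + t) powr (- (DIM('a) / 2))"
        using True by (simp add: powr_divide powr_minus_divide)
      finally show ?thesis by (simp add: ennreal_mult'[symmetric] mult_ac)
    qed simp
  qed
  also have "\<dots> = ennreal (exp 1 * pi powr (DIM('a) / 2)) * mellin (p / 2) (\<lambda>t. (1 + t) powr (- (DIM('a) / 2)))"
    unfolding mellin_def by (rule nn_integral_cmult) measurable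
  also have "\<dots> < \<infinity>"
    using mellin_beta_finite[of "p / 2" "DIM('a) / 2"] p by (simp add: ennreal_mult_less_top)
  finally have "?I < \<infinity>" using Gamma_real_pos[OF q] by (rule mult_ennreal_less_topD)
  then obtain C where C: "C \<ge> 0" "?I = ennreal C" by (cases ?I) auto
  have "(\<integral>\<^sup>+y. ennreal (indicator {..R} (norm (y::'a)) * norm y powr (- p)) \<partial>lborel) \<le> ennreal (C * R powr (DIM('a) - p))"
    if R: "R > 0" for R
  proof -
    have "indicator {..R} (norm y) = (indicator {..1} (norm y / R) :: real)" for y :: 'a
      using R by (auto simp: indicator_def)
    then show ?thesis using radial_scale[OF R, of "{..1}" p, where 'a='a] C by (simp add: ennreal_mult' mult.commute)
  qed
  with C(1) show thesis using that by blast
qed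

text \<open>For norms at least 1 the power is comparable to
  \<open>(1 + (norm y)^2) powr (- (p / 2))\<close>, whose Mellin representation carries the extra
  factor \<open>exp (- t)\<close>. Integration in space leaves a Gamma integral at
  \<open>(p - d) / 2\<close>, convergent because \<open>p > d\<close>.\<close>

lemma radial_outer:
  fixes p :: real
  assumes p: "p > DIM('a)"
  obtains C where "C \<ge> 0" "\<And>R. R > 0 \<Longrightarrow>
    (\<integral>\<^sup>+y. ennreal (indicator {R..} (norm (y::'a::euclidean_space)) * norm y powr (- p)) \<partial>lborel) \<le> ennreal (C * R powr (DIM('a) - p))"
proof -
  let ?I = "\<integral>\<^sup>+y. ennreal (indicator {1..} (norm (y::'a)) * norm y powr (- p)) \<partial>lborel"
  have q: "p / 2 > 0" using p by simp
  have "ennreal (Gamma (p / 2)) * ?I = (\<integral>\<^sup>+y. ennreal (Gamma (p / 2)) * ennreal (indicator {1..} (norm (y::'a)) * norm y powr (- p)) \<partial>lborel)"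
    by (rule nn_integral_cmult[symmetric]) measurable
  also have "\<dots> \<le> (\<integral>\<^sup>+y. mellin (p / 2) (\<lambda>t. exp (- t) * gauss t (y::'a)) * ennreal (2 powr (p / 2)) \<partial>lborel)"
  proof (rule nn_integral_mono)
    fix y :: 'a
    have "mellin (p / 2) (\<lambda>t. exp (- t) * gauss t y) = mellin (p / 2) (\<lambda>t. exp (- (t * (1 + (norm y)\<^sup>2))))"
      by (simp add: gauss_def exp_add[symmetric] algebra_simps)
    also have "\<dots> = ennreal ((1 + (norm y)\<^sup>2) powr (- (p / 2))) * ennreal (Gamma (p / 2))"
      by (subst mellin_scale[of "\<lambda>t. exp (- t)"]) (auto simp: add_pos_nonneg mellin_exp[OF q])
    finally have m: "mellin (p / 2) (\<lambda>t. exp (- t) * gauss t y) = ennreal ((1 + (norm y)\<^sup>2) powr (- (p / 2)) * Gamma (p / 2))"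
      by (simp add: ennreal_mult')
    have "indicator {1..} (norm y) * norm y powr (- p) \<le> (1 + (norm y)\<^sup>2) powr (- (p / 2)) * 2 powr (p / 2)"
    proof (cases "1 \<le> norm y")
      case True
      then have "1 \<le> (norm y)\<^sup>2" by (simp add: one_le_power)
      then have "(2 * (norm y)\<^sup>2) powr (- (p / 2)) \<le> (1 + (norm y)\<^sup>2) powr (- (p / 2))"
        using p by (intro powr_mono2') auto
      moreover have "(2 * (norm y)\<^sup>2) powr (- (p / 2)) * 2 powr (p / 2) = norm y powr (- p)"
      proof -
        have "(norm y)\<^sup>2 = norm y powr 2" using True by simp
        then have "(norm y)\<^sup>2 powr (- (p / 2)) = norm y powr (- p)" by (simp only: powr_powr) simp
        moreover have "2 powr (- (p / 2)) * 2 powr (p / 2) = (1::real)" by (simp add: powr_add[symmetric])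
        ultimately show ?thesis by (simp add: powr_mult)
      qed
      ultimately have "norm y powr (- p) \<le> (1 + (norm y)\<^sup>2) powr (- (p / 2)) * 2 powr (p / 2)"
        by (metis mult_right_mono powr_ge_zero)
      then show ?thesis using True by simp
    qed simp
    then have "Gamma (p / 2) * (indicator {1..} (norm y) * norm y powr (- p)) \<le> Gamma (p / 2) * ((1 + (norm y)\<^sup>2) powr (- (p / 2)) * 2 powr (p / 2))"
      using Gamma_real_pos[OF q] by (intro mult_left_mono) auto
    then have "ennreal (Gamma (p / 2) * (indicator {1..} (norm y) * norm y powr (- p)))
        \<le> ennreal ((1 + (norm y)\<^sup>2) powr (- (p / 2)) * Gamma (p / 2) * 2 powr (p / 2))"
      by (intro ennreal_leI) (simp add: mult_ac)
    then show "ennreal (Gamma (p / 2)) * ennreal (indicator {1..} (norm y) * norm y powr (- p))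
        \<le> mellin (p / 2) (\<lambda>t. exp (- t) * gauss t y) * ennreal (2 powr (p / 2))"
      unfolding m using Gamma_real_pos[OF q] by (simp add: ennreal_mult'[symmetric])
  qed
  also have "\<dots> = (\<integral>\<^sup>+t. ennreal (indicator {0<..} t * t powr (p / 2 - 1)) * (\<integral>\<^sup>+y. ennreal (exp (- t) * gauss t (y::'a)) * ennreal (2 powr (p / 2)) \<partial>lborel) \<partial>lborel)"
    by (rule mellin_nn_integral_swap) measurable
  also have "\<dots> = (\<integral>\<^sup>+t. ennreal (2 powr (p / 2) * pi powr (DIM('a) / 2)) * ennreal (indicator {0<..} t * t powr ((p - DIM('a)) / 2 - 1) * exp (- t)) \<partial>lborel)"
  proof (rule nn_integral_cong)
    fix t :: real
    show "ennreal (indicator {0<..} t * t powr (p / 2 - 1)) * (\<integral>\<^sup>+y. ennreal (exp (- t) * gauss t (y::'a)) * ennreal (2 powr (p / 2)) \<partial>lborel)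
      = ennreal (2 powr (p / 2) * pi powr (DIM('a) / 2)) * ennreal (indicator {0<..} t * t powr ((p - DIM('a)) / 2 - 1) * exp (- t))"
    proof (cases "t > 0")
      case True
      have "(\<integral>\<^sup>+y. ennreal (exp (- t) * gauss t (y::'a)) * ennreal (2 powr (p / 2)) \<partial>lborel)
          = (\<integral>\<^sup>+y. ennreal (exp (- t) * 2 powr (p / 2)) * ennreal (gauss t (y::'a)) \<partial>lborel)"
        by (intro nn_integral_cong) (simp add: ennreal_mult'[symmetric] mult_ac)
      also have "\<dots> = ennreal (exp (- t) * 2 powr (p / 2)) * ennreal ((pi / t) powr (DIM('a) / 2))"
        using True by (subst nn_integral_cmult) (auto simp: nn_integral_gauss)
      also have "(pi / t) powr (DIM('a) / 2) = pi powr (DIM('a) / 2) * t powr (- (DIM('a) / 2))"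
        using True by (simp add: powr_divide powr_minus_divide)
      finally have 1: "(\<integral>\<^sup>+y. ennreal (exp (- t) * gauss t (y::'a)) * ennreal (2 powr (p / 2)) \<partial>lborel)
          = ennreal (exp (- t) * 2 powr (p / 2) * (pi powr (DIM('a) / 2) * t powr (- (DIM('a) / 2))))"
        by (simp add: ennreal_mult')
      have "t powr ((p - DIM('a)) / 2 - 1) = t powr (p / 2 - 1) * t powr (- (DIM('a) / 2))"
      proof -
        have "(p - DIM('a)) / 2 - 1 = (p / 2 - 1) + - (DIM('a) / 2)" by (simp add: diff_divide_distrib)
        then show ?thesis by (simp only: powr_add)
      qed
      then show ?thesis unfolding 1 using True by (simp add: ennreal_mult'[symmetric] mult_ac)
    qed simp
  qed
  also have "\<dots> = ennreal (2 powr (p / 2) * pi powr (DIM('a) / 2)) * mellin ((p - DIM('a)) / 2) (\<lambda>t. exp (- t))"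
    unfolding mellin_def by (rule nn_integral_cmult) measurable
  also have "\<dots> < \<infinity>" using p by (subst mellin_exp) (auto simp: ennreal_mult_less_top)
  finally have "?I < \<infinity>" using Gamma_real_pos[OF q] by (rule mult_ennreal_less_topD)
  then obtain C where C: "C \<ge> 0" "?I = ennreal C" by (cases ?I) auto
  have "(\<integral>\<^sup>+y. ennreal (indicator {R..} (norm (y::'a)) * norm y powr (- p)) \<partial>lborel) \<le> ennreal (C * R powr (DIM('a) - p))"
    if R: "R > 0" for R
  proof -
    have "indicator {R..} (norm y) = (indicator {1..} (norm y / R) :: real)" for y :: 'a
      using R by (auto simp: indicator_def)
    then show ?thesis using radial_scale[OF R, of "{1..}" p, where 'a='a] C by (simp add: ennreal_mult' mult.commute)
  qed
  with C(1) show thesis using that by blast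
qed

section \<open>Composition of Riesz kernels and Schur's test\<close>

text \<open>Split at \<open>R = |x| / 2\<close>. Near 0 and near \<open>x\<close> one factor is at
  most a power of \<open>R\<close> and the other is locally integrable, by \<open>A, B < d\<close>;
  away from both points the product is at most a multiple of \<open>|y| powr (- (A + B))\<close>,
  integrable at infinity by \<open>A + B > d\<close>. By homogeneity each region contributes the
  same power of \<open>|x|\<close>.\<close>

lemma riesz_composition:
  fixes A B :: real
  assumes A: "0 < A" "A < DIM('a::euclidean_space)" and B: "0 < B" "B < DIM('a)" and AB: "A + B > DIM('a)"
  obtains C where "C \<ge> 0" "\<And>x::'a. x \<noteq> 0 \<Longrightarrow>
    (\<integral>\<^sup>+y. ennreal (norm (x - y) powr (- A) * norm y powr (- B)) \<partial>lborel) \<le> ennreal (C * norm x powr (DIM('a) - A - B))"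
proof -
  let ?d = "real DIM('a)"
  obtain C1 where C1: "C1 \<ge> 0" "\<And>R. R > 0 \<Longrightarrow>
    (\<integral>\<^sup>+y. ennreal (indicator {..R} (norm (y::'a)) * norm y powr (- B)) \<partial>lborel) \<le> ennreal (C1 * R powr (?d - B))"
    using radial_inner[OF B] by blast
  obtain C2 where C2: "C2 \<ge> 0" "\<And>R. R > 0 \<Longrightarrow>
    (\<integral>\<^sup>+y. ennreal (indicator {..R} (norm (y::'a)) * norm y powr (- A)) \<partial>lborel) \<le> ennreal (C2 * R powr (?d - A))"
    using radial_inner[OF A] by blast
  obtain C3 where C3: "C3 \<ge> 0" "\<And>R. R > 0 \<Longrightarrow>
    (\<integral>\<^sup>+y. ennreal (indicator {R..} (norm (y::'a)) * norm y powr (- (A + B))) \<partial>lborel) \<le> ennreal (C3 * R powr (?d - (A + B)))"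
    using radial_outer[OF AB] by blast
  define K where "K = C1 + C2 + 3 powr A * C3"
  have K: "K \<ge> 0" using C1 C2 C3 by (simp add: K_def)
  have "(\<integral>\<^sup>+y. ennreal (norm (x - y) powr (- A) * norm y powr (- B)) \<partial>lborel)
      \<le> ennreal (K * (1/2) powr (?d - A - B) * norm x powr (?d - A - B))" if x: "x \<noteq> 0" for x :: 'a
  proof -
    define R where "R = norm x / 2"
    have R: "R > 0" using x by (simp add: R_def)
    let ?f1 = "\<lambda>y. ennreal (indicator {..R} (norm (y::'a)) * norm y powr (- B))"
    let ?f2 = "\<lambda>y. ennreal (indicator {..R} (norm (y::'a)) * norm y powr (- A))"
    let ?f3 = "\<lambda>y. ennreal (indicator {R..} (norm (y::'a)) * norm y powr (- (A + B)))"
    have pt: "ennreal (norm (x - y) powr (- A) * norm y powr (- B))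
        \<le> ennreal (R powr (- A)) * ?f1 y + ennreal (R powr (- B)) * ?f2 (x - y) + ennreal (3 powr A) * ?f3 y" for y
    proof -
      have tri: "norm x \<le> norm (x - y) + norm y" using norm_triangle_ineq[of "x - y" y] by simp
      have tri2: "norm y \<le> norm (x - y) + norm x" using norm_triangle_ineq[of "y - x" x] by (simp add: norm_minus_commute)
      have "norm (x - y) powr (- A) * norm y powr (- B)
          \<le> R powr (- A) * (indicator {..R} (norm y) * norm y powr (- B))
          + R powr (- B) * (indicator {..R} (norm (x - y)) * norm (x - y) powr (- A))
          + 3 powr A * (indicator {R..} (norm y) * norm y powr (- (A + B)))" (is "?l \<le> ?a + ?b + ?c")
      proof -
        have nn: "0 \<le> ?a" "0 \<le> ?b" "0 \<le> ?c" by auto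
        consider "norm y \<le> R" | "norm (x - y) \<le> R" | "norm y > R" "norm (x - y) > R" by linarith
        then show ?thesis
        proof cases
          case 1
          then have "R \<le> norm (x - y)" using tri by (simp add: R_def)
          then have "norm (x - y) powr (- A) \<le> R powr (- A)" using R A by (intro powr_mono2') auto
          then have "?l \<le> R powr (- A) * norm y powr (- B)" by (rule mult_right_mono) simp
          then have "?l \<le> ?a" using 1 by simp
          then show ?thesis using nn by linarith
        next
          case 2
          then have "R \<le> norm y" using tri by (simp add: R_def)
          then have "norm y powr (- B) \<le> R powr (- B)" using R B by (intro powr_mono2') auto
          then have "?l \<le> norm (x - y) powr (- A) * R powr (- B)" by (rule mult_left_mono) simp
          then have "?l \<le> ?b" using 2 by (simp add: mult.commute)
          then show ?thesis using nn by linarith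
        next
          case 3
          \<comment> \<open>Away from both points
            \<open>|y| \<le> |x - y| + 2 R \<le> 3 |x - y|\<close>, the origin of the factor
            \<open>3 powr A\<close>.\<close>
          then have "norm y / 3 \<le> norm (x - y)" using tri2 by (simp add: R_def)
          then have "norm (x - y) powr (- A) \<le> (norm y / 3) powr (- A)" using R A 3 by (intro powr_mono2') auto
          also have "(norm y / 3) powr (- A) = 3 powr A * norm y powr (- A)"
            by (simp add: powr_divide powr_minus_divide)
          finally have "?l \<le> 3 powr A * norm y powr (- A) * norm y powr (- B)" by (rule mult_right_mono) simp
          also have "\<dots> = 3 powr A * norm y powr (- (A + B))" by (simp add: powr_add[symmetric])
          finally have "?l \<le> ?c" using 3 by simp
          then show ?thesis using nn by linarith
        qed
      qed
      then have "ennreal ?l \<le> ennreal (?a + ?b + ?c)" by (rule ennreal_leI)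
      then show ?thesis by (simp add: ennreal_mult'[symmetric] ennreal_plus[symmetric] del: ennreal_plus)
    qed
    have "(\<integral>\<^sup>+y. ennreal (norm (x - y) powr (- A) * norm y powr (- B)) \<partial>lborel)
        \<le> (\<integral>\<^sup>+y. (ennreal (R powr (- A)) * ?f1 y + ennreal (R powr (- B)) * ?f2 (x - y)) + ennreal (3 powr A) * ?f3 y \<partial>lborel)"
      by (intro nn_integral_mono pt)
    also have "\<dots> = ennreal (R powr (- A)) * (\<integral>\<^sup>+y. ?f1 y \<partial>lborel) + ennreal (R powr (- B)) * (\<integral>\<^sup>+y. ?f2 (x - y) \<partial>lborel)
        + ennreal (3 powr A) * (\<integral>\<^sup>+y. ?f3 y \<partial>lborel)"
      by (subst nn_integral_add, measurable, subst nn_integral_add, measurable) (simp add: nn_integral_cmult)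
    also have "(\<integral>\<^sup>+y. ?f2 (x - y) \<partial>lborel) = (\<integral>\<^sup>+y. ?f2 y \<partial>lborel)"
      by (rule nn_integral_lborel_reflect) measurable
    also have "ennreal (R powr (- A)) * (\<integral>\<^sup>+y. ?f1 y \<partial>lborel) + ennreal (R powr (- B)) * (\<integral>\<^sup>+y. ?f2 y \<partial>lborel)
        + ennreal (3 powr A) * (\<integral>\<^sup>+y. ?f3 y \<partial>lborel)
      \<le> ennreal (R powr (- A)) * ennreal (C1 * R powr (?d - B)) + ennreal (R powr (- B)) * ennreal (C2 * R powr (?d - A))
        + ennreal (3 powr A) * ennreal (C3 * R powr (?d - (A + B)))"
      by (intro add_mono mult_left_mono C1(2) C2(2) C3(2) R) auto
    also have "\<dots> = ennreal (R powr (- A) * (C1 * R powr (?d - B)) + R powr (- B) * (C2 * R powr (?d - A)) + 3 powr A * (C3 * R powr (?d - (A + B))))"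
      using C1 C2 C3 by (simp add: ennreal_mult'[symmetric] ennreal_plus[symmetric] del: ennreal_plus)
    also have "R powr (- A) * (C1 * R powr (?d - B)) + R powr (- B) * (C2 * R powr (?d - A)) + 3 powr A * (C3 * R powr (?d - (A + B)))
       = K * R powr (?d - A - B)"
    proof -
      have "R powr (- A) * R powr (?d - B) = R powr (?d - A - B)" "R powr (- B) * R powr (?d - A) = R powr (?d - A - B)"
        by (simp_all add: powr_add[symmetric] algebra_simps)
      moreover have "?d - (A + B) = ?d - A - B" by simp
      ultimately show ?thesis unfolding K_def by (simp only: distrib_right mult.left_commute[of _ C1] mult.left_commute[of _ C2] mult.assoc)
    qed
    also have "R powr (?d - A - B) = (1/2) powr (?d - A - B) * norm x powr (?d - A - B)"
      by (simp add: R_def powr_mult[symmetric])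
    finally show ?thesis by (simp add: mult.assoc)
  qed
  with K show thesis using that[of "K * (1/2) powr (?d - A - B)"] by simp
qed

text \<open>Schur's test with the weight \<open>|x| powr ((lam + d) / 2)\<close>.\<close>

lemma riesz_quadratic_form:
  fixes lam :: real
  assumes lam: "0 < lam" "lam < DIM('a::euclidean_space)"
  obtains C where "C \<ge> 0" "\<And>a::'a \<Rightarrow> real. a \<in> borel_measurable borel \<Longrightarrow> (\<And>x. 0 \<le> a x) \<Longrightarrow>
    (\<integral>\<^sup>+x. \<integral>\<^sup>+y. ennreal (norm (x - y) powr (lam - DIM('a)) * (a x * a y)) \<partial>lborel \<partial>lborel)
    \<le> ennreal C * (\<integral>\<^sup>+x. ennreal (norm x powr lam * (a x)\<^sup>2) \<partial>lborel)"
proof -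
  let ?d = "real DIM('a)"
  define A where "A = ?d - lam"
  \<comment> \<open>Midway between \<open>lam\<close> and \<open>d\<close>: this keeps
    \<open>B\<close> below \<open>d\<close> and makes \<open>A + B - d = B - lam\<close> positive,
    so that the composition estimate applies. The power of the norm that results in the end is
    \<open>d - A = lam\<close>.\<close>
  define B where "B = (lam + ?d) / 2"
  have AB: "0 < A" "A < ?d" "0 < B" "B < ?d" "A + B > ?d" using lam by (auto simp: A_def B_def field_simps)
  obtain C where C: "C \<ge> 0" "\<And>x::'a. x \<noteq> 0 \<Longrightarrow>
    (\<integral>\<^sup>+y. ennreal (norm (x - y) powr (- A) * norm y powr (- B)) \<partial>lborel) \<le> ennreal (C * norm x powr (?d - A - B))"
    using riesz_composition[OF AB] by blast
  have "(\<integral>\<^sup>+x. \<integral>\<^sup>+y. ennreal (norm (x - y) powr (lam - ?d) * (a x * a y)) \<partial>lborel \<partial>lborel)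
    \<le> ennreal (2 * C) * (\<integral>\<^sup>+x. ennreal (norm x powr lam * (a x)\<^sup>2) \<partial>lborel)"
    if [measurable]: "a \<in> borel_measurable borel" and a: "\<And>x. 0 \<le> a x" for a :: "'a \<Rightarrow> real"
  proof -
    define k where "k x y = ennreal (norm x powr B * (a x)\<^sup>2) * ennreal (norm (x - y) powr (- A) * norm y powr (- B))" for x y
    have [measurable]: "(\<lambda>(x, y). k x y) \<in> borel_measurable (borel \<Otimes>\<^sub>M borel)" unfolding k_def by measurable
    have "(\<integral>\<^sup>+x. \<integral>\<^sup>+y. ennreal (norm (x - y) powr (lam - ?d) * (a x * a y)) \<partial>lborel \<partial>lborel)
        \<le> (\<integral>\<^sup>+x. \<integral>\<^sup>+y. k x y + k y x \<partial>lborel \<partial>lborel)"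
    proof (rule nn_integral_mono_AE, use AE_lborel_singleton[of 0] in eventually_elim, rule nn_integral_mono_AE, use AE_lborel_singleton[of 0] in eventually_elim)
      case (elim x y)
      \<comment> \<open>The factors \<open>p\<close> and \<open>q\<close> redistribute
        \<open>a x * a y\<close> with the Schur weight, so that the bound by
        \<open>p^2 + q^2\<close> leaves in each term the square of \<open>a\<close> at one point
        only.\<close>
      define p where "p = a x * norm x powr (B / 2) * norm y powr (- (B / 2))"
      define q where "q = a y * norm y powr (B / 2) * norm x powr (- (B / 2))"
      have sq: "(norm z powr (c / 2))\<^sup>2 = norm z powr c" "norm z powr (c / 2) * norm z powr (- (c / 2)) = 1" if "z \<noteq> 0" for z :: 'a and c
        using that by (simp_all add: power2_eq_square powr_add[symmetric])
      have "p * q = a x * a y * (norm x powr (B / 2) * norm x powr (- (B / 2))) * (norm y powr (B / 2) * norm y powr (- (B / 2)))"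
        by (simp only: p_def q_def mult_ac)
      then have "a x * a y = p * q" by (simp only: sq(2)[OF elim(1)] sq(2)[OF elim(2)] mult_1_right)
      also have "\<dots> \<le> p\<^sup>2 + q\<^sup>2"
      proof -
        have "0 \<le> p * q" using a by (simp add: p_def q_def)
        then show ?thesis using sum_squares_bound[of p q] by linarith
      qed
      also have "p\<^sup>2 = norm x powr B * (a x)\<^sup>2 * norm y powr (- B)"
        using sq(1)[OF elim(1), of B] sq(1)[OF elim(2), of "- B"] by (simp only: p_def power_mult_distrib minus_divide_left mult_ac)
      also have "q\<^sup>2 = norm y powr B * (a y)\<^sup>2 * norm x powr (- B)"
        using sq(1)[OF elim(2), of B] sq(1)[OF elim(1), of "- B"] by (simp only: q_def power_mult_distrib minus_divide_left mult_ac)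
      finally have "norm (x - y) powr (- A) * (a x * a y)
          \<le> norm (x - y) powr (- A) * (norm x powr B * (a x)\<^sup>2 * norm y powr (- B) + norm y powr B * (a y)\<^sup>2 * norm x powr (- B))"
        by (rule mult_left_mono) simp
      also have "\<dots> = norm x powr B * (a x)\<^sup>2 * (norm (x - y) powr (- A) * norm y powr (- B))
          + norm y powr B * (a y)\<^sup>2 * (norm (y - x) powr (- A) * norm x powr (- B))"
        by (simp only: distrib_left mult_ac norm_minus_commute[of y x])
      finally have "ennreal (norm (x - y) powr (lam - ?d) * (a x * a y)) \<le> ennreal \<dots>"
        unfolding A_def by (intro ennreal_leI) simp
      then show ?case
        unfolding k_def by (simp add: ennreal_mult'[symmetric] ennreal_plus[symmetric] del: ennreal_plus)
    qed
    also have "\<dots> = (\<integral>\<^sup>+x. (\<integral>\<^sup>+y. k x y \<partial>lborel) + (\<integral>\<^sup>+y. k y x \<partial>lborel) \<partial>lborel)"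
      by (intro nn_integral_cong nn_integral_add) measurable
    also have "\<dots> = (\<integral>\<^sup>+x. \<integral>\<^sup>+y. k x y \<partial>lborel \<partial>lborel) + (\<integral>\<^sup>+x. \<integral>\<^sup>+y. k y x \<partial>lborel \<partial>lborel)"
      by (rule nn_integral_add) measurable
    also have "(\<integral>\<^sup>+x. \<integral>\<^sup>+y. k y x \<partial>lborel \<partial>lborel) = (\<integral>\<^sup>+x. \<integral>\<^sup>+y. k x y \<partial>lborel \<partial>lborel)"
      by (rule lborel_pair.Fubini') measurable
    also have "(\<integral>\<^sup>+x. \<integral>\<^sup>+y. k x y \<partial>lborel \<partial>lborel) \<le> (\<integral>\<^sup>+x. ennreal C * ennreal (norm x powr lam * (a x)\<^sup>2) \<partial>lborel)"
    proof (rule nn_integral_mono_AE, use AE_lborel_singleton[of 0] in eventually_elim)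
      case (elim x)
      have "(\<integral>\<^sup>+y. k x y \<partial>lborel)
          = ennreal (norm x powr B * (a x)\<^sup>2) * (\<integral>\<^sup>+y. ennreal (norm (x - y) powr (- A) * norm y powr (- B)) \<partial>lborel)"
        unfolding k_def by (rule nn_integral_cmult) measurable
      also have "\<dots> \<le> ennreal (norm x powr B * (a x)\<^sup>2) * ennreal (C * norm x powr (?d - A - B))"
        by (intro mult_left_mono C(2) elim) simp
      also have "\<dots> = ennreal (C * ((norm x powr B * norm x powr (?d - A - B)) * (a x)\<^sup>2))"
        by (simp add: ennreal_mult'[symmetric] mult_ac)
      also have "norm x powr B * norm x powr (?d - A - B) = norm x powr lam"
        by (simp add: powr_add[symmetric] A_def)
      finally show ?case using C(1) by (simp add: ennreal_mult')
    qed
    also have "\<dots> = ennreal C * (\<integral>\<^sup>+x. ennreal (norm x powr lam * (a x)\<^sup>2) \<partial>lborel)"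
      by (rule nn_integral_cmult) measurable
    finally have "(\<integral>\<^sup>+x. \<integral>\<^sup>+y. ennreal (norm (x - y) powr (lam - ?d) * (a x * a y)) \<partial>lborel \<partial>lborel)
        \<le> ennreal C * (\<integral>\<^sup>+x. ennreal (norm x powr lam * (a x)\<^sup>2) \<partial>lborel) + ennreal C * (\<integral>\<^sup>+x. ennreal (norm x powr lam * (a x)\<^sup>2) \<partial>lborel)"
      by (simp add: add_mono)
    also have "\<dots> = ennreal (2 * C) * (\<integral>\<^sup>+x. ennreal (norm x powr lam * (a x)\<^sup>2) \<partial>lborel)"
      using C(1) by (simp add: distrib_right[symmetric] ennreal_plus[symmetric] del: ennreal_plus)
    finally show ?thesis .
  qed
  then show thesis using C(1) that[of "2 * C"] by simp
qed

text \<open>With \<open>a\<close> and \<open>b\<close> the moduli of the transforms of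
  \<open>u\<close> and \<open>v\<close>, this is the nonnegative majorant of the transform of
  \<open>u * cnj v\<close>; values in \<open>ennreal\<close> dispense with integrability.\<close>

definition corr :: "('a::euclidean_space \<Rightarrow> real) \<Rightarrow> ('a \<Rightarrow> real) \<Rightarrow> 'a \<Rightarrow> ennreal" where
  "corr a b \<eta> = (\<integral>\<^sup>+\<zeta>. ennreal (a (\<zeta> + \<eta>) * b \<zeta>) \<partial>lborel)"

lemma measurable_corr [measurable]:
  assumes [measurable]: "a \<in> borel_measurable borel" "b \<in> borel_measurable borel"
  shows "corr a b \<in> borel_measurable borel"
  unfolding corr_def by measurable

text \<open>The substitution \<open>x = \<zeta> + \<eta>\<close>, which gives the expression the
  shape treated by Schur's test.\<close>

lemma riesz_corr:
  fixes a :: "'a::euclidean_space \<Rightarrow> real"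
  assumes [measurable]: "a \<in> borel_measurable borel"
  shows "(\<integral>\<^sup>+\<eta>. ennreal (norm \<eta> powr p) * corr a a \<eta> \<partial>lborel)
    = (\<integral>\<^sup>+x. \<integral>\<^sup>+y. ennreal (norm (x - y) powr p * (a x * a y)) \<partial>lborel \<partial>lborel)"
proof -
  have "(\<integral>\<^sup>+\<eta>. ennreal (norm \<eta> powr p) * corr a a \<eta> \<partial>lborel)
      = (\<integral>\<^sup>+\<eta>. \<integral>\<^sup>+\<zeta>. ennreal (norm \<eta> powr p * (a (\<zeta> + \<eta>) * a \<zeta>)) \<partial>lborel \<partial>lborel)"
    unfolding corr_def by (intro nn_integral_cong, subst nn_integral_cmult[symmetric]) (measurable, simp add: ennreal_mult')
  also have "\<dots> = (\<integral>\<^sup>+\<zeta>. \<integral>\<^sup>+\<eta>. ennreal (norm \<eta> powr p * (a (\<zeta> + \<eta>) * a \<zeta>)) \<partial>lborel \<partial>lborel)"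
    by (rule lborel_pair.Fubini') measurable
  also have "\<dots> = (\<integral>\<^sup>+y. \<integral>\<^sup>+x. ennreal (norm (x - y) powr p * (a x * a y)) \<partial>lborel \<partial>lborel)"
  proof (rule nn_integral_cong)
    fix y :: 'a
    show "(\<integral>\<^sup>+\<eta>. ennreal (norm \<eta> powr p * (a (y + \<eta>) * a y)) \<partial>lborel) = (\<integral>\<^sup>+x. ennreal (norm (x - y) powr p * (a x * a y)) \<partial>lborel)"
      using nn_integral_lborel_translate[of "\<lambda>x. ennreal (norm (x - y) powr p * (a x * a y))" y] by (simp add: add.commute)
  qed
  also have "\<dots> = (\<integral>\<^sup>+x. \<integral>\<^sup>+y. ennreal (norm (x - y) powr p * (a x * a y)) \<partial>lborel \<partial>lborel)"
    by (rule lborel_pair.Fubini') measurable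
  finally show ?thesis .
qed

section \<open>Products and the Fourier transform\<close>

lemma AE_lborel_translate:
  fixes \<eta> :: "'a::euclidean_space"
  assumes "AE x in lborel. P x"
  shows "AE x in lborel. P (x + \<eta>)"
proof -
  have "AE x in distr lborel borel ((+) \<eta>). P x" unfolding lborel_distr_plus by (rule assms)
  then have "AE x in lborel. P (\<eta> + x)" by (rule AE_distrD[rotated]) simp
  then show ?thesis by (simp add: add.commute)
qed

definition L2_shift :: "'a::euclidean_space \<Rightarrow> 'a L2 \<Rightarrow> 'a L2" where
  "L2_shift \<eta> f = to_L2 (\<lambda>x. L2_fun f (x + \<eta>))"

lemma square_integrable_shift:
  assumes f: "square_integrable f"
  shows "square_integrable (\<lambda>x. f (x + \<eta>))"
proof -
  note [measurable] = square_integrable_measurable[OF f]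
  have "(\<integral>\<^sup>+x. ennreal ((cmod (f (x + \<eta>)))\<^sup>2) \<partial>lborel) = (\<integral>\<^sup>+x. ennreal ((cmod (f x))\<^sup>2) \<partial>lborel)"
    by (rule nn_integral_lborel_translate) measurable
  then show ?thesis using f by (simp add: square_integrable_iff_nn_integral)
qed

lemma L2_shift_to_L2:
  assumes f: "square_integrable f"
  shows "L2_shift \<eta> (to_L2 f) = to_L2 (\<lambda>x. f (x + \<eta>))"
  unfolding L2_shift_def
proof (rule to_L2_cong_AE)
  note [measurable] = square_integrable_measurable[OF f]
  show "(\<lambda>x. f (x + \<eta>)) \<in> borel_measurable borel" by measurable
  show "AE x in lborel. L2_fun (to_L2 f) (x + \<eta>) = f (x + \<eta>)"
    by (rule AE_lborel_translate[OF L2_fun_to_L2[OF f]])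
qed measurable

lemma L2_fun_shift: "AE x in lborel. L2_fun (L2_shift \<eta> f) x = L2_fun f (x + \<eta>)"
  unfolding L2_shift_def by (intro L2_fun_to_L2 square_integrable_shift) simp

lemma bounded_linear_L2_shift: "bounded_linear (L2_shift \<eta>)"
proof (rule bounded_linear_intro[where K = 1])
  fix f g :: "'a L2" and r :: real
  show "L2_shift \<eta> (f + g) = L2_shift \<eta> f + L2_shift \<eta> g"
    using L2_shift_to_L2[of "\<lambda>x. L2_fun f x + L2_fun g x" \<eta>] to_L2_add[of "L2_fun f" "L2_fun g"]
    by (simp add: L2_shift_def square_integrable_add to_L2_add square_integrable_shift)
  show "L2_shift \<eta> (r *\<^sub>R f) = r *\<^sub>R L2_shift \<eta> f"
    using L2_shift_to_L2[of "\<lambda>x. of_real r * L2_fun f x" \<eta>] to_L2_scaleR[of "L2_fun f" r]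
    by (simp add: L2_shift_def square_integrable_cmult to_L2_scaleR square_integrable_shift)
  show "norm (L2_shift \<eta> f) \<le> norm f * 1"
    unfolding L2_shift_def
  proof (rule norm_to_L2_le)
    have "(\<integral>\<^sup>+x. ennreal ((cmod (L2_fun f (x + \<eta>)))\<^sup>2) \<partial>lborel) = (\<integral>\<^sup>+x. ennreal ((cmod (L2_fun f x))\<^sup>2) \<partial>lborel)"
      by (rule nn_integral_lborel_translate) measurable
    then show "(\<integral>\<^sup>+x. ennreal ((cmod (L2_fun f (x + \<eta>)))\<^sup>2) \<partial>lborel) \<le> ennreal ((norm f * 1)\<^sup>2)"
      by (simp add: nn_norm_L2_square)
  qed simp
qed

lemma bounded_multiplier_phase: "bounded_multiplier (\<lambda>x. phase \<sigma> x \<eta>) 1"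
  by standard auto

text \<open>For functions in L1 and L2 the exponentials combine under the integral; both sides are
  continuous on L2, so density does the rest.\<close>

lemma fourier_modulation: "fourier (L2_mult (\<lambda>x. phase 1 x \<eta>) u) = L2_shift \<eta> (fourier u)"
proof (rule L2_dense_induct[where f = u])
  interpret bounded_multiplier "\<lambda>x. phase 1 x \<eta>" 1 by (rule bounded_multiplier_phase)
  show "closed {u. fourier (L2_mult (\<lambda>x. phase 1 x \<eta>) u) = L2_shift \<eta> (fourier u)}"
    by (intro closed_Collect_eq bounded_linear.continuous_on[OF bounded_linear_fourier]
        bounded_linear.continuous_on[OF bounded_linear_mult] bounded_linear.continuous_on[OF bounded_linear_L2_shift]
        continuous_on_id)
  fix f :: "'a \<Rightarrow> complex" assume f: "integrable_L1_L2 f"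
  note f' = integrable_L1_L2D[OF f]
  have pf: "integrable_L1_L2 (\<lambda>x. phase 1 x \<eta> * f x)"
    using f' by (simp add: integrable_L1_L2_def integrable_phase_mult square_integrable_mult)
  have "FI 1 (\<lambda>x. phase 1 x \<eta> * f x) = (\<lambda>\<xi>. FI 1 f (\<xi> + \<eta>))"
    by (rule ext) (simp add: FI_def phase_def mult.assoc[symmetric] exp_add[symmetric] inner_add_right distrib_left)
  then show "fourier (L2_mult (\<lambda>x. phase 1 x \<eta>) (to_L2 f)) = L2_shift \<eta> (fourier (to_L2 f))"
    by (simp add: mult_to_L2 f' fourier_eq_FT FT_to_L2[OF pf] FT_to_L2[OF f] L2_shift_to_L2 square_integrable_FI[OF f])
qed

lemma bounded_linear_L2_cmult: "bounded_linear (L2_cmult c)"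
  unfolding L2_cmult_eq_mult[abs_def] by (rule bounded_multiplier.bounded_linear_mult[OF bounded_multiplier_const])

lemma fourier_cmult: "fourier (L2_cmult c u) = L2_cmult c (fourier u)"
proof (rule L2_dense_induct[where f = u])
  show "closed {u::'a L2. fourier (L2_cmult c u) = L2_cmult c (fourier u)}"
    by (intro closed_Collect_eq bounded_linear.continuous_on[OF bounded_linear_fourier]
        bounded_linear.continuous_on[OF bounded_linear_L2_cmult] continuous_on_id)
  fix f :: "'a \<Rightarrow> complex" assume f: "integrable_L1_L2 f"
  note f' = integrable_L1_L2D[OF f]
  have pf: "integrable_L1_L2 (\<lambda>x. c * f x)"
    using f' by (simp add: integrable_L1_L2_def square_integrable_cmult)
  have "FI 1 (\<lambda>x. c * f x) = (\<lambda>\<xi>. c * FI 1 f \<xi>)" by (intro ext FI_cmult)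
  then show "fourier (L2_cmult c (to_L2 f)) = L2_cmult c (fourier (to_L2 f))"
    by (simp add: L2_cmult_to_L2 f' fourier_eq_FT FT_to_L2[OF pf] FT_to_L2[OF f] square_integrable_FI[OF f])
qed

lemma fourier_inner: "fourier f \<bullet> fourier g = f \<bullet> g"
  by (simp add: fourier_eq_FT FT_inner)

text \<open>The type carries only a real inner product. The imaginary part of the Hermitian one is
  the real product with \<open>\<i>\<close> times the second factor, so invariance of the real
  product and commutation with scalars give Parseval's identity over the complex numbers.\<close>

lemma L2_cinner_decompose:
  "(LINT x|lborel. L2_fun f x * cnj (L2_fun g x)) = Complex (f \<bullet> g) (f \<bullet> L2_cmult \<i> g)"
proof (rule complex_eqI)
  note int = integrable_mult_cnj[OF square_integrable_L2_fun[of f] square_integrable_L2_fun[of g]]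
  show "Re (LINT x|lborel. L2_fun f x * cnj (L2_fun g x)) = Re (Complex (f \<bullet> g) (f \<bullet> L2_cmult \<i> g))"
    using integral_Re[OF int] by (simp add: L2_inner inner_complex_def)
  have "f \<bullet> L2_cmult \<i> g = (LINT x|lborel. L2_fun f x \<bullet> (\<i> * L2_fun g x))"
    using L2_cmult_to_L2[of "L2_fun g" \<i>] to_L2_inner[of "L2_fun f" "\<lambda>x. \<i> * L2_fun g x"]
    by (simp add: square_integrable_cmult)
  also have "\<dots> = (LINT x|lborel. Im (L2_fun f x * cnj (L2_fun g x)))"
    by (intro Bochner_Integration.integral_cong refl) (simp add: inner_complex_def)
  also have "\<dots> = Im (LINT x|lborel. L2_fun f x * cnj (L2_fun g x))" by (rule integral_Im[OF int])
  finally show "Im (LINT x|lborel. L2_fun f x * cnj (L2_fun g x)) = Im (Complex (f \<bullet> g) (f \<bullet> L2_cmult \<i> g))" by simp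
qed

lemma fourier_parseval:
  "(LINT x|lborel. L2_fun (fourier f) x * cnj (L2_fun (fourier g) x)) = (LINT x|lborel. L2_fun f x * cnj (L2_fun g x))"
  by (simp add: L2_cinner_decompose fourier_cmult[symmetric] fourier_inner)

text \<open>The phase is absorbed into \<open>u\<close>, where it becomes a shift of frequency, and
  Parseval's identity applies. The product \<open>u * cnj v\<close> is only known to be in L1, so
  its transform stays an integral and is not treated as an element of L2.\<close>

lemma fourier_product:
  "(LINT y|lborel. phase 1 y \<eta> * (L2_fun u y * cnj (L2_fun v y)))
    = (LINT \<zeta>|lborel. L2_fun (fourier u) (\<zeta> + \<eta>) * cnj (L2_fun (fourier v) \<zeta>))"
proof -
  interpret bounded_multiplier "\<lambda>x. phase 1 x \<eta>" 1 by (rule bounded_multiplier_phase)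
  let ?u = "L2_mult (\<lambda>x. phase 1 x \<eta>) u"
  have "(LINT y|lborel. phase 1 y \<eta> * (L2_fun u y * cnj (L2_fun v y))) = (LINT y|lborel. L2_fun ?u y * cnj (L2_fun v y))"
    using L2_fun_mult[of u] by (intro integral_cong_AE) (auto elim: eventually_mono)
  also have "\<dots> = (LINT \<zeta>|lborel. L2_fun (fourier ?u) \<zeta> * cnj (L2_fun (fourier v) \<zeta>))"
    by (rule fourier_parseval[symmetric])
  also have "\<dots> = (LINT \<zeta>|lborel. L2_fun (fourier u) (\<zeta> + \<eta>) * cnj (L2_fun (fourier v) \<zeta>))"
    using L2_fun_shift[of \<eta> "fourier u"] by (intro integral_cong_AE) (auto simp: fourier_modulation elim: eventually_mono)
  finally show ?thesis .
qed

section \<open>Gaussian convolutions on the frequency side\<close>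

text \<open>A function that is not integrable has Bochner integral 0, so absolute values may be
  taken inside an oscillatory integral before anything is known about its convergence.\<close>

lemma norm_integral_le_nn_integral:
  fixes f :: "'a \<Rightarrow> complex"
  shows "ennreal (norm (LINT x|M. f x)) \<le> (\<integral>\<^sup>+x. ennreal (norm (f x)) \<partial>M)"
  by (cases "integrable M f") (auto simp: integral_norm_bound_ennreal not_integrable_integral_eq)

definition spec :: "'a::euclidean_space L2 \<Rightarrow> 'a \<Rightarrow> real" where
  "spec u \<xi> = cmod (L2_fun (fourier u) \<xi>)"

lemma spec_nonneg [simp]: "0 \<le> spec u \<xi>"
  by (simp add: spec_def)

lemma measurable_spec [measurable]: "spec u \<in> borel_measurable borel"
  unfolding spec_def by measurable

lemma norm_fourier_product_le:
  "ennreal (cmod (LINT y|lborel. phase 1 y \<eta> * (L2_fun u y * cnj (L2_fun v y)))) \<le> corr (spec u) (spec v) \<eta>"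
  unfolding fourier_product corr_def spec_def
  by (rule order_trans[OF norm_integral_le_nn_integral]) (simp add: norm_mult)

lemma integral_phase_minus_cnj:
  "(LINT x|lborel. phase (- 1) x \<eta> * (f x * cnj (g x))) = cnj (LINT x|lborel. phase 1 x \<eta> * (g x * cnj (f x)))"
  by (subst Bochner_Integration.integral_cnj[symmetric]) (simp add: cnj_phase mult.commute)

text \<open>A Gaussian is itself the transform of a Gaussian of inverted width; inserting this and
  exchanging integrals moves the convolution to frequencies. The application is to
  \<open>\<phi>\<close> a product of two L2 functions, hence the hypothesis of mere
  integrability.\<close>

lemma gauss_convolution:
  fixes \<phi> :: "'a::euclidean_space \<Rightarrow> complex"
  assumes \<phi>: "integrable lborel \<phi>" and t: "t > 0"
  shows "(LINT y|lborel. of_real (gauss t (x - y)) * \<phi> y)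
    = of_real ((4 * pi * t) powr (- (DIM('a) / 2))) *
      (LINT \<eta>|lborel. phase (- 1) x \<eta> * (of_real (gauss (1 / (4 * t)) \<eta>) * (LINT y|lborel. phase 1 y \<eta> * \<phi> y)))"
proof -
  have t4: "1 / (4 * t) > 0" using t by simp
  have k: "integrable lborel (\<lambda>\<eta>. phase (- 1) x \<eta> * of_real (gauss (1 / (4 * t)) \<eta>))"
    by (rule integrable_bounded_mult[where B = 1]) (auto intro!: integrable_of_real integrable_gauss t4)
  have inner: "(LINT \<eta>|lborel. phase 1 y \<eta> * (phase (- 1) x \<eta> * of_real (gauss (1 / (4 * t)) \<eta>)))
      = of_real ((4 * pi * t) powr (DIM('a) / 2)) * of_real (gauss t (x - y))" for y
  proof -
    have "phase 1 y \<eta> * (phase (- 1) x \<eta> * of_real (gauss (1 / (4 * t)) \<eta>)) = iexp (\<eta> \<bullet> (x - y)) * of_real (gauss (1 / (4 * t)) \<eta>)" for \<eta>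
      unfolding phase_def mult.assoc[symmetric] exp_add[symmetric]
      by (simp add: inner_diff_right algebra_simps inner_commute)
    then have "(LINT \<eta>|lborel. phase 1 y \<eta> * (phase (- 1) x \<eta> * of_real (gauss (1 / (4 * t)) \<eta>)))
        = of_real ((pi / (1 / (4 * t))) powr (DIM('a) / 2) * gauss (1 / (4 * (1 / (4 * t)))) (x - y))"
      by (simp only: integral_iexp_gauss[OF t4])
    then show ?thesis by (simp add: mult_ac)
  qed
  have "(LINT \<eta>|lborel. phase (- 1) x \<eta> * (of_real (gauss (1 / (4 * t)) \<eta>) * (LINT y|lborel. phase 1 y \<eta> * \<phi> y)))
      = (LINT \<eta>|lborel. (phase (- 1) x \<eta> * of_real (gauss (1 / (4 * t)) \<eta>)) * (LINT y|lborel. phase 1 y \<eta> * \<phi> y))"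
    by (simp only: mult.assoc)
  also have "\<dots> = (LINT y|lborel. \<phi> y * (LINT \<eta>|lborel. phase 1 y \<eta> * (phase (- 1) x \<eta> * of_real (gauss (1 / (4 * t)) \<eta>))))"
    by (rule integral_phase_swap[OF \<phi> k])
  also have "\<dots> = (LINT y|lborel. of_real ((4 * pi * t) powr (DIM('a) / 2)) * (of_real (gauss t (x - y)) * \<phi> y))"
    unfolding inner by (intro Bochner_Integration.integral_cong refl) (simp only: mult_ac)
  also have "\<dots> = of_real ((4 * pi * t) powr (DIM('a) / 2)) * (LINT y|lborel. of_real (gauss t (x - y)) * \<phi> y)"
    by simp
  finally have eq: "(LINT \<eta>|lborel. phase (- 1) x \<eta> * (of_real (gauss (1 / (4 * t)) \<eta>) * (LINT y|lborel. phase 1 y \<eta> * \<phi> y)))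
      = of_real ((4 * pi * t) powr (DIM('a) / 2)) * (LINT y|lborel. of_real (gauss t (x - y)) * \<phi> y)" .
  have one: "(4 * pi * t) powr (- (DIM('a) / 2)) * (4 * pi * t) powr (DIM('a) / 2) = 1"
    using t by (simp add: powr_add[symmetric])
  show ?thesis
    unfolding eq by (simp only: mult.assoc[symmetric] of_real_mult[symmetric] one of_real_1 mult_1_left)
qed

text \<open>One more exchange, against \<open>\<psi>\<close>. The two spatial variables collapse to
  a single frequency because the kernel depends on \<open>x - y\<close> only.\<close>

lemma gauss_quadrilinear:
  fixes \<phi> \<psi> :: "'a::euclidean_space \<Rightarrow> complex"
  assumes \<phi>: "integrable lborel \<phi>" and \<psi>: "integrable lborel \<psi>" and t: "t > 0"
  shows "(LINT x|lborel. (LINT y|lborel. of_real (gauss t (x - y)) * \<phi> y) * \<psi> x)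
    = of_real ((4 * pi * t) powr (- (DIM('a) / 2))) *
      (LINT \<eta>|lborel. of_real (gauss (1 / (4 * t)) \<eta>) * ((LINT y|lborel. phase 1 y \<eta> * \<phi> y) * (LINT x|lborel. phase (- 1) x \<eta> * \<psi> x)))"
proof -
  have t4: "1 / (4 * t) > 0" using t by simp
  let ?\<Phi> = "\<lambda>\<eta>. LINT y|lborel. phase 1 y \<eta> * \<phi> y"
  note [measurable] = borel_measurable_integrable[OF \<phi>, simplified]
  have "integrable lborel (\<lambda>\<eta>. ?\<Phi> \<eta> * of_real (gauss (1 / (4 * t)) \<eta>))"
    by (rule integrable_bounded_mult[OF integrable_of_real[OF integrable_gauss[OF t4]] _ cmod_integral_phase_le[OF \<phi>]]) measurable
  then have k: "integrable lborel (\<lambda>\<eta>. of_real (gauss (1 / (4 * t)) \<eta>) * ?\<Phi> \<eta>)" by (simp only: mult.commute)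
  let ?c = "complex_of_real ((4 * pi * t) powr (- (DIM('a) / 2)))"
  have "(LINT x|lborel. (LINT y|lborel. of_real (gauss t (x - y)) * \<phi> y) * \<psi> x)
      = (LINT x|lborel. ?c * (\<psi> x * (LINT \<eta>|lborel. phase (- 1) x \<eta> * (of_real (gauss (1 / (4 * t)) \<eta>) * ?\<Phi> \<eta>))))"
    unfolding gauss_convolution[OF \<phi> t] by (intro Bochner_Integration.integral_cong refl) (simp only: mult_ac)
  also have "\<dots> = ?c * (LINT x|lborel. \<psi> x * (LINT \<eta>|lborel. phase (- 1) x \<eta> * (of_real (gauss (1 / (4 * t)) \<eta>) * ?\<Phi> \<eta>)))"
    by (rule integral_mult_right_zero)
  also have "(LINT x|lborel. \<psi> x * (LINT \<eta>|lborel. phase (- 1) x \<eta> * (of_real (gauss (1 / (4 * t)) \<eta>) * ?\<Phi> \<eta>)))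
      = (LINT \<eta>|lborel. (of_real (gauss (1 / (4 * t)) \<eta>) * ?\<Phi> \<eta>) * (LINT x|lborel. phase (- 1) x \<eta> * \<psi> x))"
    by (rule integral_phase_swap[OF \<psi> k, symmetric])
  finally show ?thesis by (simp only: mult.assoc)
qed

section \<open>The Hardy inequality and the Hartree nonlinearity\<close>

text \<open>The Mellin weight at \<open>lam / 2\<close> sums the Gaussians to the Riesz kernel; the
  singular point \<open>y = x\<close> is discarded as a null set.\<close>

lemma riesz_direct:
  fixes k :: "'a::euclidean_space \<Rightarrow> ennreal"
  assumes [measurable]: "k \<in> borel_measurable borel" and lam: "0 < lam"
  shows "(\<integral>\<^sup>+t. ennreal (indicator {0<..} t * t powr (lam / 2 - 1)) * (\<integral>\<^sup>+y. ennreal (gauss t (x - y)) * k y \<partial>lborel) \<partial>lborel)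
    = ennreal (Gamma (lam / 2)) * (\<integral>\<^sup>+y. ennreal (norm (x - y) powr (- lam)) * k y \<partial>lborel)"
proof -
  have q: "lam / 2 > 0" using lam by simp
  have "(\<integral>\<^sup>+t. ennreal (indicator {0<..} t * t powr (lam / 2 - 1)) * (\<integral>\<^sup>+y. ennreal (gauss t (x - y)) * k y \<partial>lborel) \<partial>lborel)
      = (\<integral>\<^sup>+y. mellin (lam / 2) (\<lambda>t. gauss t (x - y)) * k y \<partial>lborel)"
    by (rule mellin_nn_integral_swap[symmetric]) measurable
  also have "\<dots> = (\<integral>\<^sup>+y. ennreal (Gamma (lam / 2)) * (ennreal (norm (x - y) powr (- lam)) * k y) \<partial>lborel)"
  proof (rule nn_integral_cong_AE, use AE_lborel_singleton[of x] in eventually_elim)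
    case (elim y)
    then have "x - y \<noteq> 0" by simp
    from mellin_gauss[OF q this] show ?case
      using Gamma_real_pos[OF q] by (simp add: ennreal_mult' mult.assoc)
  qed
  also have "\<dots> = ennreal (Gamma (lam / 2)) * (\<integral>\<^sup>+y. ennreal (norm (x - y) powr (- lam)) * k y \<partial>lborel)"
    by (rule nn_integral_cmult) measurable
  finally show ?thesis .
qed

text \<open>The frequency counterpart with the same weight in \<open>t\<close>. It encodes, tested
  against nonnegative functions only, that the transform of \<open>|x| powr (- lam)\<close> is a
  positive multiple of \<open>|\<eta>| powr (lam - d)\<close>.\<close>

lemma riesz_dual:
  fixes lam :: real
  assumes lam: "0 < lam" "lam < DIM('a::euclidean_space)"
  obtains C where "C > 0" "\<And>k::'a \<Rightarrow> ennreal. k \<in> borel_measurable borel \<Longrightarrow>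
    (\<integral>\<^sup>+t. ennreal (indicator {0<..} t * t powr (lam / 2 - 1)) *
        (ennreal ((4 * pi * t) powr (- (DIM('a) / 2))) * (\<integral>\<^sup>+\<eta>. ennreal (gauss (1 / (4 * t)) \<eta>) * k \<eta> \<partial>lborel)) \<partial>lborel)
    = ennreal C * (\<integral>\<^sup>+\<eta>. ennreal (norm \<eta> powr (lam - DIM('a))) * k \<eta> \<partial>lborel)"
proof -
  let ?d = "real DIM('a)"
  \<comment> \<open>The powers of \<open>t\<close> from the weight and from the Gaussian
    normalisation add up to \<open>lam / 2 - 1 - d / 2 = - q - 1\<close>, that is, to a Mellin
    transform at \<open>- q\<close>.\<close>
  define q where "q = (?d - lam) / 2"
  have q: "q > 0" using lam by (simp add: q_def)
  obtain C where C: "C > 0" "\<And>x::'a. x \<noteq> 0 \<Longrightarrow> mellin (- q) (\<lambda>t. gauss (1 / (4 * t)) x) = ennreal (C * norm x powr (- (2 * q)))"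
    using mellin_gauss_inverse[OF q] by blast
  let ?c = "(4 * pi) powr (- (?d / 2))"
  have "(\<integral>\<^sup>+t. ennreal (indicator {0<..} t * t powr (lam / 2 - 1)) *
        (ennreal ((4 * pi * t) powr (- (?d / 2))) * (\<integral>\<^sup>+\<eta>. ennreal (gauss (1 / (4 * t)) \<eta>) * k \<eta> \<partial>lborel)) \<partial>lborel)
    = ennreal (?c * C) * (\<integral>\<^sup>+\<eta>. ennreal (norm \<eta> powr (lam - ?d)) * k \<eta> \<partial>lborel)"
    if [measurable]: "k \<in> borel_measurable borel" for k :: "'a \<Rightarrow> ennreal"
  proof -
    have "(\<integral>\<^sup>+t. ennreal (indicator {0<..} t * t powr (lam / 2 - 1)) *
        (ennreal ((4 * pi * t) powr (- (?d / 2))) * (\<integral>\<^sup>+\<eta>. ennreal (gauss (1 / (4 * t)) \<eta>) * k \<eta> \<partial>lborel)) \<partial>lborel)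
      = (\<integral>\<^sup>+t. ennreal ?c * (ennreal (indicator {0<..} t * t powr (- q - 1)) * (\<integral>\<^sup>+\<eta>. ennreal (gauss (1 / (4 * t)) \<eta>) * k \<eta> \<partial>lborel)) \<partial>lborel)"
    proof (rule nn_integral_cong)
      fix t :: real
      have "indicator {0<..} t * t powr (lam / 2 - 1) * (4 * pi * t) powr (- (?d / 2)) = ?c * (indicator {0<..} t * t powr (- q - 1))"
      proof (cases "t > 0")
        case True
        have "t powr (lam / 2 - 1) * t powr (- (?d / 2)) = t powr (- q - 1)"
        proof -
          have "- q - 1 = (lam / 2 - 1) + - (?d / 2)" by (simp add: q_def field_simps)
          then show ?thesis by (simp only: powr_add)
        qed
        then show ?thesis using True by (simp add: powr_mult mult_ac)
      qed simp
      then have "ennreal (indicator {0<..} t * t powr (lam / 2 - 1)) * ennreal ((4 * pi * t) powr (- (?d / 2)))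
          = ennreal ?c * ennreal (indicator {0<..} t * t powr (- q - 1))"
        by (simp add: ennreal_mult'[symmetric])
      then show "ennreal (indicator {0<..} t * t powr (lam / 2 - 1)) * (ennreal ((4 * pi * t) powr (- (?d / 2))) * (\<integral>\<^sup>+\<eta>. ennreal (gauss (1 / (4 * t)) \<eta>) * k \<eta> \<partial>lborel))
          = ennreal ?c * (ennreal (indicator {0<..} t * t powr (- q - 1)) * (\<integral>\<^sup>+\<eta>. ennreal (gauss (1 / (4 * t)) \<eta>) * k \<eta> \<partial>lborel))"
        by (simp only: mult.assoc[symmetric])
    qed
    also have "\<dots> = ennreal ?c * (\<integral>\<^sup>+t. ennreal (indicator {0<..} t * t powr (- q - 1)) * (\<integral>\<^sup>+\<eta>. ennreal (gauss (1 / (4 * t)) \<eta>) * k \<eta> \<partial>lborel) \<partial>lborel)"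
      by (rule nn_integral_cmult) measurable
    also have "(\<integral>\<^sup>+t. ennreal (indicator {0<..} t * t powr (- q - 1)) * (\<integral>\<^sup>+\<eta>. ennreal (gauss (1 / (4 * t)) \<eta>) * k \<eta> \<partial>lborel) \<partial>lborel)
        = (\<integral>\<^sup>+\<eta>. mellin (- q) (\<lambda>t. gauss (1 / (4 * t)) \<eta>) * k \<eta> \<partial>lborel)"
      by (rule mellin_nn_integral_swap[symmetric]) measurable
    also have "\<dots> = (\<integral>\<^sup>+\<eta>. ennreal C * (ennreal (norm \<eta> powr (lam - ?d)) * k \<eta>) \<partial>lborel)"
    proof (rule nn_integral_cong_AE, use AE_lborel_singleton[of 0] in eventually_elim)
      case (elim \<eta>)
      have "- (2 * q) = lam - ?d" by (simp add: q_def field_simps)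
      then show ?case using C(2)[OF elim] C(1) by (simp add: ennreal_mult' mult.assoc)
    qed
    also have "\<dots> = ennreal C * (\<integral>\<^sup>+\<eta>. ennreal (norm \<eta> powr (lam - ?d)) * k \<eta> \<partial>lborel)"
      by (rule nn_integral_cmult) measurable
    finally show ?thesis by (simp add: ennreal_mult' mult.assoc)
  qed
  moreover have "?c * C > 0" using C(1) by simp
  ultimately show thesis using that by blast
qed

text \<open>The left side is nonnegative and hence its own modulus, so its frequency representation
  may be estimated by absolute values. The phase that carries \<open>x\<close> has modulus 1, which
  makes the bound independent of \<open>x\<close>.\<close>

lemma nn_integral_gauss_square_le:
  fixes u :: "'a::euclidean_space L2"
  assumes t: "t > 0"
  shows "(\<integral>\<^sup>+y. ennreal (gauss t (x - y)) * ennreal ((cmod (L2_fun u y))\<^sup>2) \<partial>lborel)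
    \<le> ennreal ((4 * pi * t) powr (- (DIM('a) / 2))) * (\<integral>\<^sup>+\<eta>. ennreal (gauss (1 / (4 * t)) \<eta>) * corr (spec u) (spec u) \<eta> \<partial>lborel)"
proof -
  let ?\<phi> = "\<lambda>y. L2_fun u y * cnj (L2_fun u y)"
  have \<phi>: "integrable lborel ?\<phi>" by (intro integrable_mult_cnj square_integrable_L2_fun)
  have int: "integrable lborel (\<lambda>y. gauss t (x - y) * (cmod (L2_fun u y))\<^sup>2)"
  proof (rule Bochner_Integration.integrable_bound)
    show "integrable lborel (\<lambda>y. (cmod (L2_fun u y))\<^sup>2)"
      using square_integrable_L2_fun[of u] by (simp add: square_integrable_def)
    show "AE y in lborel. norm (gauss t (x - y) * (cmod (L2_fun u y))\<^sup>2) \<le> norm ((cmod (L2_fun u y))\<^sup>2)"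
      using t by (intro AE_I2) (simp add: abs_mult mult_left_le_one_le gauss_le_one)
  qed measurable
  have "(\<integral>\<^sup>+y. ennreal (gauss t (x - y)) * ennreal ((cmod (L2_fun u y))\<^sup>2) \<partial>lborel)
      = ennreal (LINT y|lborel. gauss t (x - y) * (cmod (L2_fun u y))\<^sup>2)"
    by (subst nn_integral_eq_integral[OF int, symmetric]) (auto simp: ennreal_mult')
  also have "\<dots> = ennreal (cmod (of_real (LINT y|lborel. gauss t (x - y) * (cmod (L2_fun u y))\<^sup>2)))"
    by (simp add: abs_of_nonneg Bochner_Integration.integral_nonneg)
  also have "of_real (LINT y|lborel. gauss t (x - y) * (cmod (L2_fun u y))\<^sup>2) = (LINT y|lborel. of_real (gauss t (x - y)) * ?\<phi> y)"
    unfolding integral_complex_of_real[symmetric] by (simp only: of_real_mult complex_norm_square)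
  also have "\<dots> = of_real ((4 * pi * t) powr (- (DIM('a) / 2))) *
      (LINT \<eta>|lborel. phase (- 1) x \<eta> * (of_real (gauss (1 / (4 * t)) \<eta>) * (LINT y|lborel. phase 1 y \<eta> * ?\<phi> y)))"
    by (rule gauss_convolution[OF \<phi> t])
  also have "ennreal (cmod \<dots>) = ennreal ((4 * pi * t) powr (- (DIM('a) / 2))) *
      ennreal (cmod (LINT \<eta>|lborel. phase (- 1) x \<eta> * (of_real (gauss (1 / (4 * t)) \<eta>) * (LINT y|lborel. phase 1 y \<eta> * ?\<phi> y))))"
    by (simp add: norm_mult ennreal_mult')
  also have "\<dots> \<le> ennreal ((4 * pi * t) powr (- (DIM('a) / 2))) *
      (\<integral>\<^sup>+\<eta>. ennreal (gauss (1 / (4 * t)) \<eta>) * corr (spec u) (spec u) \<eta> \<partial>lborel)"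
  proof (intro mult_left_mono order_trans[OF norm_integral_le_nn_integral] nn_integral_mono)
    fix \<eta> :: 'a
    have "ennreal (cmod (phase (- 1) x \<eta> * (of_real (gauss (1 / (4 * t)) \<eta>) * (LINT y|lborel. phase 1 y \<eta> * ?\<phi> y))))
        = ennreal (gauss (1 / (4 * t)) \<eta>) * ennreal (cmod (LINT y|lborel. phase 1 y \<eta> * ?\<phi> y))"
      by (simp add: norm_mult ennreal_mult')
    also have "\<dots> \<le> ennreal (gauss (1 / (4 * t)) \<eta>) * corr (spec u) (spec u) \<eta>"
      by (intro mult_left_mono norm_fourier_product_le) simp
    finally show "ennreal (cmod (phase (- 1) x \<eta> * (of_real (gauss (1 / (4 * t)) \<eta>) * (LINT y|lborel. phase 1 y \<eta> * ?\<phi> y)))) \<le> \<dots>" .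
  qed simp
  finally show ?thesis .
qed

text \<open>The integration over widths contributes \<open>C / Gamma (lam / 2)\<close> to the
  constant, Schur's test contributes \<open>D\<close>. Values in \<open>ennreal\<close> let
  \<open>u\<close> range over all of L2, where the homogeneous norm on the right may be
  infinite.\<close>

lemma hardy:
  fixes lam :: real
  assumes lam: "0 < lam" "lam < DIM('a::euclidean_space)"
  obtains H where "H \<ge> 0" "\<And>(u::'a L2) x. (\<integral>\<^sup>+y. ennreal (norm (x - y) powr (- lam)) * ennreal ((cmod (L2_fun u y))\<^sup>2) \<partial>lborel)
    \<le> ennreal H * (\<integral>\<^sup>+\<xi>. ennreal (norm \<xi> powr lam * (spec u \<xi>)\<^sup>2) \<partial>lborel)"
proof -
  let ?d = "real DIM('a)"
  obtain C where C: "C > 0" "\<And>k::'a \<Rightarrow> ennreal. k \<in> borel_measurable borel \<Longrightarrow>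
    (\<integral>\<^sup>+t. ennreal (indicator {0<..} t * t powr (lam / 2 - 1)) *
        (ennreal ((4 * pi * t) powr (- (?d / 2))) * (\<integral>\<^sup>+\<eta>. ennreal (gauss (1 / (4 * t)) \<eta>) * k \<eta> \<partial>lborel)) \<partial>lborel)
    = ennreal C * (\<integral>\<^sup>+\<eta>. ennreal (norm \<eta> powr (lam - ?d)) * k \<eta> \<partial>lborel)"
    using riesz_dual[OF lam] by blast
  obtain D where D: "D \<ge> 0" "\<And>a::'a \<Rightarrow> real. a \<in> borel_measurable borel \<Longrightarrow> (\<And>x. 0 \<le> a x) \<Longrightarrow>
    (\<integral>\<^sup>+x. \<integral>\<^sup>+y. ennreal (norm (x - y) powr (lam - ?d) * (a x * a y)) \<partial>lborel \<partial>lborel)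
    \<le> ennreal D * (\<integral>\<^sup>+x. ennreal (norm x powr lam * (a x)\<^sup>2) \<partial>lborel)"
    using riesz_quadratic_form[OF lam] by blast
  have G: "Gamma (lam / 2) > 0" using lam by (intro Gamma_real_pos) simp
  have "(\<integral>\<^sup>+y. ennreal (norm (x - y) powr (- lam)) * ennreal ((cmod (L2_fun u y))\<^sup>2) \<partial>lborel)
    \<le> ennreal (C * D / Gamma (lam / 2)) * (\<integral>\<^sup>+\<xi>. ennreal (norm \<xi> powr lam * (spec u \<xi>)\<^sup>2) \<partial>lborel)" for u :: "'a L2" and x
  proof -
    let ?L = "\<integral>\<^sup>+y. ennreal (norm (x - y) powr (- lam)) * ennreal ((cmod (L2_fun u y))\<^sup>2) \<partial>lborel"
    have "ennreal (Gamma (lam / 2)) * ?L = (\<integral>\<^sup>+t. ennreal (indicator {0<..} t * t powr (lam / 2 - 1)) *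
        (\<integral>\<^sup>+y. ennreal (gauss t (x - y)) * ennreal ((cmod (L2_fun u y))\<^sup>2) \<partial>lborel) \<partial>lborel)"
      using lam by (intro riesz_direct[symmetric]) auto
    also have "\<dots> \<le> (\<integral>\<^sup>+t. ennreal (indicator {0<..} t * t powr (lam / 2 - 1)) *
        (ennreal ((4 * pi * t) powr (- (?d / 2))) * (\<integral>\<^sup>+\<eta>. ennreal (gauss (1 / (4 * t)) \<eta>) * corr (spec u) (spec u) \<eta> \<partial>lborel)) \<partial>lborel)"
    proof (rule nn_integral_mono)
      fix t :: real
      show "ennreal (indicator {0<..} t * t powr (lam / 2 - 1)) * (\<integral>\<^sup>+y. ennreal (gauss t (x - y)) * ennreal ((cmod (L2_fun u y))\<^sup>2) \<partial>lborel)
        \<le> ennreal (indicator {0<..} t * t powr (lam / 2 - 1)) *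
        (ennreal ((4 * pi * t) powr (- (?d / 2))) * (\<integral>\<^sup>+\<eta>. ennreal (gauss (1 / (4 * t)) \<eta>) * corr (spec u) (spec u) \<eta> \<partial>lborel))"
        by (cases "t > 0") (auto intro!: mult_left_mono nn_integral_gauss_square_le)
    qed
    also have "\<dots> = ennreal C * (\<integral>\<^sup>+\<eta>. ennreal (norm \<eta> powr (lam - ?d)) * corr (spec u) (spec u) \<eta> \<partial>lborel)"
      by (rule C(2)) measurable
    also have "\<dots> \<le> ennreal C * (ennreal D * (\<integral>\<^sup>+\<xi>. ennreal (norm \<xi> powr lam * (spec u \<xi>)\<^sup>2) \<partial>lborel))"
      by (intro mult_left_mono, subst riesz_corr) (auto intro!: D(2))
    finally have "ennreal (1 / Gamma (lam / 2)) * (ennreal (Gamma (lam / 2)) * ?L)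
        \<le> ennreal (1 / Gamma (lam / 2)) * (ennreal C * (ennreal D * (\<integral>\<^sup>+\<xi>. ennreal (norm \<xi> powr lam * (spec u \<xi>)\<^sup>2) \<partial>lborel)))"
      by (rule mult_left_mono) simp
    moreover have "ennreal (1 / Gamma (lam / 2)) * ennreal (Gamma (lam / 2)) = 1"
      using G by (simp add: ennreal_mult'[symmetric])
    moreover have "ennreal (1 / Gamma (lam / 2)) * (ennreal C * ennreal D) = ennreal (C * D / Gamma (lam / 2))"
      using G C D by (simp add: ennreal_mult'[symmetric])
    ultimately show ?thesis by (simp only: mult.assoc[symmetric] mult_1_left)
  qed
  moreover have "C * D / Gamma (lam / 2) \<ge> 0" using C D G by simp
  ultimately show thesis using that by blast
qed

section \<open>Sobolev weights\<close>

lemma japanese_bracket_ge_one: "1 \<le> japanese_bracket \<xi>"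
  by (simp add: japanese_bracket_def)

lemma norm_le_japanese_bracket: "norm \<xi> \<le> japanese_bracket \<xi>"
  unfolding japanese_bracket_def by (rule real_le_rsqrt) simp

lemma measurable_japanese_bracket [measurable]: "japanese_bracket \<in> borel_measurable borel"
  unfolding japanese_bracket_def by measurable

lemma measurable_sobolev_weighted [measurable]: "sobolev_weighted s u \<in> borel_measurable borel"
  unfolding sobolev_weighted_def by measurable

lemma cmod_sobolev_weighted: "cmod (sobolev_weighted s u \<xi>) = japanese_bracket \<xi> powr s * spec u \<xi>"
  by (simp add: sobolev_weighted_def spec_def norm_mult)

lemma nn_sobolev_norm_square:
  assumes "u \<in> sobolev_space s"
  shows "(\<integral>\<^sup>+\<xi>. ennreal ((japanese_bracket \<xi> powr s * spec u \<xi>)\<^sup>2) \<partial>lborel) = ennreal ((sobolev_norm s u)\<^sup>2)"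
  using assms nn_norm_to_L2_square[of "sobolev_weighted s u"]
  by (simp add: sobolev_space_def sobolev_norm_def cmod_sobolev_weighted)

lemma sobolev_norm_nonneg [simp]: "0 \<le> sobolev_norm s u"
  by (simp add: sobolev_norm_def)

text \<open>Here \<open>s \<ge> lam / 2\<close> enters: it makes \<open>|\<xi>| powr lam\<close> at
  most the square of the Sobolev weight.\<close>

lemma homogeneous_le_sobolev_norm:
  assumes u: "u \<in> sobolev_space s" and s: "s \<ge> lam / 2" "lam > 0"
  shows "(\<integral>\<^sup>+\<xi>. ennreal (norm \<xi> powr lam * (spec u \<xi>)\<^sup>2) \<partial>lborel) \<le> ennreal ((sobolev_norm s u)\<^sup>2)"
  unfolding nn_sobolev_norm_square[OF u, symmetric]
proof (intro nn_integral_mono ennreal_leI)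
  fix \<xi> :: 'a
  have "norm \<xi> powr lam \<le> japanese_bracket \<xi> powr lam"
    using s norm_le_japanese_bracket[of \<xi>] by (intro powr_mono2) auto
  also have "\<dots> \<le> japanese_bracket \<xi> powr (s + s)"
    using s japanese_bracket_ge_one[of \<xi>] by (intro powr_mono) auto
  also have "\<dots> = (japanese_bracket \<xi> powr s)\<^sup>2" by (simp only: powr_add power2_eq_square)
  finally show "norm \<xi> powr lam * (spec u \<xi>)\<^sup>2 \<le> (japanese_bracket \<xi> powr s * spec u \<xi>)\<^sup>2"
    unfolding power_mult_distrib by (rule mult_right_mono) simp
qed

text \<open>The nonnegative form \<open>spectral_form\<close> replaces, on the Fourier side, the quadrilinear form
  \<open>\<integral>\<integral> u(y) v(y) w(x) z(x) / |x - y| powr lam\<close>.\<close>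

definition riesz_form :: "real \<Rightarrow> ('a::euclidean_space \<Rightarrow> ennreal) \<Rightarrow> ('a \<Rightarrow> ennreal) \<Rightarrow> ennreal" where
  "riesz_form lam p q = (\<integral>\<^sup>+x. (\<integral>\<^sup>+y. ennreal (norm (x - y) powr (- lam)) * p y \<partial>lborel) * q x \<partial>lborel)"

definition spectral_form :: "real \<Rightarrow> ('a::euclidean_space \<Rightarrow> real) \<Rightarrow> ('a \<Rightarrow> real) \<Rightarrow> ('a \<Rightarrow> real) \<Rightarrow> ('a \<Rightarrow> real) \<Rightarrow> ennreal" where
  "spectral_form lam a b c e = (\<integral>\<^sup>+\<eta>. ennreal (norm \<eta> powr (lam - DIM('a))) * (corr a b \<eta> * corr e c \<eta>) \<partial>lborel)"

section \<open>Comparison of the spectral form with the Riesz form\<close>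

lemma riesz_form_prod:
  fixes p q :: "'a::euclidean_space \<Rightarrow> ennreal"
  assumes [measurable]: "p \<in> borel_measurable borel" "q \<in> borel_measurable borel"
  shows "riesz_form lam p q
    = (\<integral>\<^sup>+z. ennreal (norm (fst z - snd z) powr (- lam)) * (p (snd z) * q (fst z)) \<partial>(lborel \<Otimes>\<^sub>M lborel))"
proof -
  have "riesz_form lam p q = (\<integral>\<^sup>+x. \<integral>\<^sup>+y. ennreal (norm (x - y) powr (- lam)) * (p y * q x) \<partial>lborel \<partial>lborel)"
    unfolding riesz_form_def mult.assoc[symmetric] by (intro nn_integral_cong nn_integral_multc[symmetric]) measurable
  also have "\<dots> = (\<integral>\<^sup>+x. \<integral>\<^sup>+y. (\<lambda>z. ennreal (norm (fst z - snd z) powr (- lam)) * (p (snd z) * q (fst z))) (x, y) \<partial>lborel \<partial>lborel)"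
    by simp
  also have "\<dots> = (\<integral>\<^sup>+z. ennreal (norm (fst z - snd z) powr (- lam)) * (p (snd z) * q (fst z)) \<partial>(lborel \<Otimes>\<^sub>M lborel))"
    by (rule lborel.nn_integral_fst) measurable
  finally show ?thesis .
qed

lemma riesz_form_commute:
  fixes p q :: "'a::euclidean_space \<Rightarrow> ennreal"
  assumes [measurable]: "p \<in> borel_measurable borel" "q \<in> borel_measurable borel"
  shows "riesz_form lam p q = riesz_form lam q p"
proof -
  have "riesz_form lam p q = (\<integral>\<^sup>+x. \<integral>\<^sup>+y. ennreal (norm (x - y) powr (- lam)) * p y * q x \<partial>lborel \<partial>lborel)"
    unfolding riesz_form_def by (intro nn_integral_cong nn_integral_multc[symmetric]) measurable
  also have "\<dots> = (\<integral>\<^sup>+y. \<integral>\<^sup>+x. ennreal (norm (x - y) powr (- lam)) * p y * q x \<partial>lborel \<partial>lborel)"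
    by (rule lborel_pair.Fubini') measurable
  also have "\<dots> = (\<integral>\<^sup>+y. \<integral>\<^sup>+x. ennreal (norm (y - x) powr (- lam)) * q x * p y \<partial>lborel \<partial>lborel)"
    by (intro nn_integral_cong) (simp only: norm_minus_commute mult_ac)
  also have "\<dots> = riesz_form lam q p"
    unfolding riesz_form_def by (intro nn_integral_cong nn_integral_multc) measurable
  finally show ?thesis .
qed

text \<open>Half of the kernel goes to each factor, and the inequality is the one on the product
  space. It regroups the four functions into two pairs of squares, each with one function on either
  side of the kernel.\<close>

lemma riesz_form_Cauchy_Schwarz:
  fixes p p' q q' :: "'a::euclidean_space \<Rightarrow> ennreal"
  assumes [measurable]: "p \<in> borel_measurable borel" "q \<in> borel_measurable borel"
    "p' \<in> borel_measurable borel" "q' \<in> borel_measurable borel"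
  shows "(riesz_form lam (\<lambda>y. p y * p' y) (\<lambda>x. q x * q' x))\<^sup>2
    \<le> riesz_form lam (\<lambda>y. (p y)\<^sup>2) (\<lambda>x. (q x)\<^sup>2) * riesz_form lam (\<lambda>y. (p' y)\<^sup>2) (\<lambda>x. (q' x)\<^sup>2)"
proof -
  let ?k = "\<lambda>z::'a \<times> 'a. ennreal (norm (fst z - snd z) powr (- lam / 2))"
  have k: "ennreal (norm (fst z - snd z) powr (- lam)) = ?k z * ?k z" for z :: "'a \<times> 'a"
    by (simp add: ennreal_mult'[symmetric] powr_add[symmetric])
  note k2 = riesz_form_prod[where 'a='a and lam = lam, unfolded k]
  have "riesz_form lam (\<lambda>y. p y * p' y) (\<lambda>x. q x * q' x)
      = (\<integral>\<^sup>+z. (?k z * p (snd z) * q (fst z)) * (?k z * p' (snd z) * q' (fst z)) \<partial>(lborel \<Otimes>\<^sub>M lborel))"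
    by (subst k2; (simp only: mult_ac)?) measurable
  moreover have "riesz_form lam (\<lambda>y. (p y)\<^sup>2) (\<lambda>x. (q x)\<^sup>2) = (\<integral>\<^sup>+z. (?k z * p (snd z) * q (fst z))\<^sup>2 \<partial>(lborel \<Otimes>\<^sub>M lborel))"
    by (subst k2; (simp only: power2_eq_square mult_ac)?) measurable
  moreover have "riesz_form lam (\<lambda>y. (p' y)\<^sup>2) (\<lambda>x. (q' x)\<^sup>2) = (\<integral>\<^sup>+z. (?k z * p' (snd z) * q' (fst z))\<^sup>2 \<partial>(lborel \<Otimes>\<^sub>M lborel))"
    by (subst k2; (simp only: power2_eq_square mult_ac)?) measurable
  ultimately show ?thesis by (simp only:) (rule Cauchy_Schwarz_nn_integral; measurable)
qed

lemma integrable_spec_product: "integrable lborel (\<lambda>\<zeta>. spec u (\<zeta> + \<eta>) * spec v \<zeta>)"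
proof -
  have "integrable lborel (\<lambda>\<zeta>. L2_fun (fourier u) (\<zeta> + \<eta>) * cnj (L2_fun (fourier v) \<zeta>))"
    by (intro integrable_mult_cnj square_integrable_shift square_integrable_L2_fun)
  then have "integrable lborel (\<lambda>\<zeta>. norm (L2_fun (fourier u) (\<zeta> + \<eta>) * cnj (L2_fun (fourier v) \<zeta>)))"
    by (rule integrable_norm)
  then show ?thesis by (simp add: norm_mult spec_def)
qed

lemma corr_spec: "corr (spec u) (spec v) \<eta> = ennreal (LINT \<zeta>|lborel. spec u (\<zeta> + \<eta>) * spec v \<zeta>)"
  unfolding corr_def by (rule nn_integral_eq_integral[OF integrable_spec_product]) simp

text \<open>For functions with nonnegative transform the correlations are exact transforms of
  products, so estimates by moduli on the frequency side can be reversed.\<close>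

definition pos_spec :: "'a::euclidean_space L2 \<Rightarrow> bool" where
  "pos_spec u \<longleftrightarrow> (AE \<xi> in lborel. L2_fun (fourier u) \<xi> = of_real (spec u \<xi>))"

lemma fourier_product_pos_spec:
  assumes u: "pos_spec u" and v: "pos_spec v"
  shows "(LINT y|lborel. phase 1 y \<eta> * (L2_fun u y * cnj (L2_fun v y))) = of_real (LINT \<zeta>|lborel. spec u (\<zeta> + \<eta>) * spec v \<zeta>)"
proof -
  have "(LINT \<zeta>|lborel. L2_fun (fourier u) (\<zeta> + \<eta>) * cnj (L2_fun (fourier v) \<zeta>))
      = (LINT \<zeta>|lborel. complex_of_real (spec u (\<zeta> + \<eta>) * spec v \<zeta>))"
  proof (rule integral_cong_AE)
    show "AE \<zeta> in lborel. L2_fun (fourier u) (\<zeta> + \<eta>) * cnj (L2_fun (fourier v) \<zeta>) = of_real (spec u (\<zeta> + \<eta>) * spec v \<zeta>)"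
      using AE_lborel_translate[OF u[unfolded pos_spec_def], of \<eta>] v[unfolded pos_spec_def]
      by eventually_elim simp
  qed measurable
  then show ?thesis unfolding fourier_product integral_complex_of_real .
qed

text \<open>The reverse of the usual estimate: with four nonnegative transforms the frequency
  integral is the exact value of a Gaussian form in space, and absolute values are taken only
  there.\<close>

lemma spectral_gauss_le:
  fixes u v w z :: "'a::euclidean_space L2"
  assumes pos: "pos_spec u" "pos_spec v" "pos_spec w" "pos_spec z" and t: "t > 0"
  shows "ennreal ((4 * pi * t) powr (- (DIM('a) / 2))) *
      (\<integral>\<^sup>+\<eta>. ennreal (gauss (1 / (4 * t)) \<eta>) * (corr (spec u) (spec v) \<eta> * corr (spec z) (spec w) \<eta>) \<partial>lborel)
    \<le> (\<integral>\<^sup>+x. (\<integral>\<^sup>+y. ennreal (gauss t (x - y)) * ennreal (cmod (L2_fun u y) * cmod (L2_fun v y)) \<partial>lborel)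
        * ennreal (cmod (L2_fun w x) * cmod (L2_fun z x)) \<partial>lborel)"
proof -
  let ?\<phi> = "\<lambda>y. L2_fun u y * cnj (L2_fun v y)" and ?\<psi> = "\<lambda>x. L2_fun w x * cnj (L2_fun z x)"
  let ?r = "\<lambda>u v \<eta>. LINT \<zeta>|lborel. spec u (\<zeta> + \<eta>) * spec v \<zeta>"
  let ?c = "(4 * pi * t) powr (- (DIM('a) / 2))"
  have \<phi>: "integrable lborel ?\<phi>" and \<psi>: "integrable lborel ?\<psi>" and \<psi>': "integrable lborel (\<lambda>x. L2_fun z x * cnj (L2_fun w x))"
    by (intro integrable_mult_cnj square_integrable_L2_fun)+
  have r0: "0 \<le> ?r u v \<eta>" for u v :: "'a L2" and \<eta> by (rule Bochner_Integration.integral_nonneg) simp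
  have rm[measurable]: "?r u v \<in> borel_measurable borel" for u v :: "'a L2" by measurable
  have \<Phi>: "(LINT y|lborel. phase 1 y \<eta> * ?\<phi> y) = of_real (?r u v \<eta>)" for \<eta>
    by (rule fourier_product_pos_spec[OF pos(1,2)])
  have \<Psi>: "(LINT x|lborel. phase (- 1) x \<eta> * ?\<psi> x) = of_real (?r z w \<eta>)" for \<eta>
    unfolding integral_phase_minus_cnj fourier_product_pos_spec[OF pos(4,3)] by simp
  have bd1: "?r u v \<eta> \<le> (LINT x|lborel. cmod (?\<phi> x))" for \<eta>
    using cmod_integral_phase_le[OF \<phi>, of 1 \<eta>] r0[of u \<eta> v] unfolding \<Phi> by simp
  have bd2: "?r z w \<eta> \<le> (LINT x|lborel. cmod (L2_fun z x * cnj (L2_fun w x)))" for \<eta>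
    using cmod_integral_phase_le[OF \<psi>', of 1 \<eta>] r0[of z \<eta> w] unfolding fourier_product_pos_spec[OF pos(4,3)] by simp
  \<comment> \<open>Needed to identify the nonnegative integral with the complex one: the
    correlations are bounded and the Gaussian is integrable.\<close>
  have int: "integrable lborel (\<lambda>\<eta>. gauss (1 / (4 * t)) \<eta> * (?r u v \<eta> * ?r z w \<eta>))"
  proof (rule Bochner_Integration.integrable_bound)
    show "integrable lborel (\<lambda>\<eta>::'a. gauss (1 / (4 * t)) \<eta> * ((LINT x|lborel. cmod (?\<phi> x)) * (LINT x|lborel. cmod (L2_fun z x * cnj (L2_fun w x)))))"
      using t by (intro integrable_mult_left integrable_gauss) simp
    have "?r u v \<eta> * ?r z w \<eta> \<le> (LINT x|lborel. cmod (?\<phi> x)) * (LINT x|lborel. cmod (L2_fun z x * cnj (L2_fun w x)))" for \<eta>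
      by (intro mult_mono bd1 bd2 r0 Bochner_Integration.integral_nonneg) simp
    then have "gauss (1 / (4 * t)) \<eta> * (?r u v \<eta> * ?r z w \<eta>)
        \<le> gauss (1 / (4 * t)) \<eta> * ((LINT x|lborel. cmod (?\<phi> x)) * (LINT x|lborel. cmod (L2_fun z x * cnj (L2_fun w x))))" for \<eta>
      by (rule mult_left_mono) simp
    moreover have "0 \<le> gauss (1 / (4 * t)) \<eta> * (?r u v \<eta> * ?r z w \<eta>)" for \<eta>
      by (intro mult_nonneg_nonneg r0) simp
    ultimately show "AE \<eta> in lborel. norm (gauss (1 / (4 * t)) \<eta> * (?r u v \<eta> * ?r z w \<eta>))
        \<le> norm (gauss (1 / (4 * t)) \<eta> * ((LINT x|lborel. cmod (?\<phi> x)) * (LINT x|lborel. cmod (L2_fun z x * cnj (L2_fun w x)))))"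
      unfolding real_norm_def by (intro AE_I2 order_trans[OF _ abs_ge_self]) (simp only: abs_of_nonneg)
  qed measurable
  have "ennreal ?c * (\<integral>\<^sup>+\<eta>. ennreal (gauss (1 / (4 * t)) \<eta>) * (corr (spec u) (spec v) \<eta> * corr (spec z) (spec w) \<eta>) \<partial>lborel)
      = ennreal ?c * (\<integral>\<^sup>+\<eta>. ennreal (gauss (1 / (4 * t)) \<eta> * (?r u v \<eta> * ?r z w \<eta>)) \<partial>lborel)"
    by (simp add: corr_spec ennreal_mult' r0)
  also have "\<dots> = ennreal ?c * ennreal (LINT \<eta>|lborel. gauss (1 / (4 * t)) \<eta> * (?r u v \<eta> * ?r z w \<eta>))"
    using int by (subst nn_integral_eq_integral) (auto intro!: AE_I2 mult_nonneg_nonneg r0)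
  also have "\<dots> = ennreal (?c * (LINT \<eta>|lborel. gauss (1 / (4 * t)) \<eta> * (?r u v \<eta> * ?r z w \<eta>)))"
    by (rule ennreal_mult'[symmetric]) simp
  also have "\<dots> \<le> ennreal (cmod (of_real (?c * (LINT \<eta>|lborel. gauss (1 / (4 * t)) \<eta> * (?r u v \<eta> * ?r z w \<eta>)))))"
    unfolding norm_of_real by (intro ennreal_leI abs_ge_self)
  also have "of_real (?c * (LINT \<eta>|lborel. gauss (1 / (4 * t)) \<eta> * (?r u v \<eta> * ?r z w \<eta>)))
      = of_real ?c * (LINT \<eta>|lborel. of_real (gauss (1 / (4 * t)) \<eta>) * ((LINT y|lborel. phase 1 y \<eta> * ?\<phi> y) * (LINT x|lborel. phase (- 1) x \<eta> * ?\<psi> x)))"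
    unfolding \<Phi> \<Psi> of_real_mult[symmetric] integral_complex_of_real ..
  also have "\<dots> = (LINT x|lborel. (LINT y|lborel. of_real (gauss t (x - y)) * ?\<phi> y) * ?\<psi> x)"
    by (rule gauss_quadrilinear[OF \<phi> \<psi> t, symmetric])
  also have "ennreal (cmod \<dots>) \<le> (\<integral>\<^sup>+x. ennreal (cmod (LINT y|lborel. of_real (gauss t (x - y)) * ?\<phi> y)) * ennreal (cmod (L2_fun w x) * cmod (L2_fun z x)) \<partial>lborel)"
    by (rule order_trans[OF norm_integral_le_nn_integral]) (simp add: norm_mult ennreal_mult')
  also have "\<dots> \<le> (\<integral>\<^sup>+x. (\<integral>\<^sup>+y. ennreal (gauss t (x - y)) * ennreal (cmod (L2_fun u y) * cmod (L2_fun v y)) \<partial>lborel)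
        * ennreal (cmod (L2_fun w x) * cmod (L2_fun z x)) \<partial>lborel)"
    by (intro nn_integral_mono mult_right_mono order_trans[OF norm_integral_le_nn_integral])
      (auto simp: norm_mult ennreal_mult')
  finally show ?thesis .
qed

text \<open>The return from frequencies to space. The two Mellin formulas are used in the direction
  opposite to that of Hardy's inequality, so the constant is \<open>Gamma (lam / 2)\<close> divided
  by the dual one.\<close>

lemma spectral_form_le_riesz_form:
  fixes lam :: real
  assumes lam: "0 < lam" "lam < DIM('a::euclidean_space)"
  obtains C where "C \<ge> 0" "\<And>u v w z :: 'a L2. pos_spec u \<Longrightarrow> pos_spec v \<Longrightarrow> pos_spec w \<Longrightarrow> pos_spec z \<Longrightarrow>
    spectral_form lam (spec u) (spec v) (spec w) (spec z)
    \<le> ennreal C * riesz_form lam (\<lambda>y. ennreal (cmod (L2_fun u y) * cmod (L2_fun v y))) (\<lambda>x. ennreal (cmod (L2_fun w x) * cmod (L2_fun z x)))"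
proof -
  let ?d = "real DIM('a)"
  obtain C where C: "C > 0" "\<And>k::'a \<Rightarrow> ennreal. k \<in> borel_measurable borel \<Longrightarrow>
    (\<integral>\<^sup>+t. ennreal (indicator {0<..} t * t powr (lam / 2 - 1)) *
        (ennreal ((4 * pi * t) powr (- (?d / 2))) * (\<integral>\<^sup>+\<eta>. ennreal (gauss (1 / (4 * t)) \<eta>) * k \<eta> \<partial>lborel)) \<partial>lborel)
    = ennreal C * (\<integral>\<^sup>+\<eta>. ennreal (norm \<eta> powr (lam - ?d)) * k \<eta> \<partial>lborel)"
    using riesz_dual[OF lam] by blast
  let ?G = "Gamma (lam / 2)"
  have G: "?G > 0" using lam by (intro Gamma_real_pos) simp
  have "spectral_form lam (spec u) (spec v) (spec w) (spec z) \<le> ennreal (?G / C) *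
      riesz_form lam (\<lambda>y. ennreal (cmod (L2_fun u y) * cmod (L2_fun v y))) (\<lambda>x. ennreal (cmod (L2_fun w x) * cmod (L2_fun z x)))"
    if pos: "pos_spec u" "pos_spec v" "pos_spec w" "pos_spec z" for u v w z :: "'a L2"
  proof -
    let ?p = "\<lambda>y. ennreal (cmod (L2_fun u y) * cmod (L2_fun v y))"
    let ?q = "\<lambda>x. ennreal (cmod (L2_fun w x) * cmod (L2_fun z x))"
    let ?m = "\<lambda>t::real. ennreal (indicator {0<..} t * t powr (lam / 2 - 1))"
    have "ennreal C * spectral_form lam (spec u) (spec v) (spec w) (spec z)
        = (\<integral>\<^sup>+t. ?m t * (ennreal ((4 * pi * t) powr (- (?d / 2))) * (\<integral>\<^sup>+\<eta>. ennreal (gauss (1 / (4 * t)) \<eta>) *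
            (corr (spec u) (spec v) \<eta> * corr (spec z) (spec w) \<eta>) \<partial>lborel)) \<partial>lborel)"
      unfolding spectral_form_def by (rule C(2)[symmetric]) measurable
    also have "\<dots> \<le> (\<integral>\<^sup>+t. ?m t * (\<integral>\<^sup>+x. (\<integral>\<^sup>+y. ennreal (gauss t (x - y)) * ?p y \<partial>lborel) * ?q x \<partial>lborel) \<partial>lborel)"
    proof (rule nn_integral_mono)
      fix t :: real
      show "?m t * (ennreal ((4 * pi * t) powr (- (?d / 2))) * (\<integral>\<^sup>+\<eta>. ennreal (gauss (1 / (4 * t)) \<eta>) *
            (corr (spec u) (spec v) \<eta> * corr (spec z) (spec w) \<eta>) \<partial>lborel))
        \<le> ?m t * (\<integral>\<^sup>+x. (\<integral>\<^sup>+y. ennreal (gauss t (x - y)) * ?p y \<partial>lborel) * ?q x \<partial>lborel)"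
        by (cases "t > 0") (auto intro!: mult_left_mono spectral_gauss_le pos)
    qed
    also have "\<dots> = (\<integral>\<^sup>+t. \<integral>\<^sup>+x. (?m t * (\<integral>\<^sup>+y. ennreal (gauss t (x - y)) * ?p y \<partial>lborel)) * ?q x \<partial>lborel \<partial>lborel)"
      by (intro nn_integral_cong, subst nn_integral_cmult[symmetric]) (measurable, simp only: mult.assoc)
    also have "\<dots> = (\<integral>\<^sup>+x. \<integral>\<^sup>+t. (?m t * (\<integral>\<^sup>+y. ennreal (gauss t (x - y)) * ?p y \<partial>lborel)) * ?q x \<partial>lborel \<partial>lborel)"
      by (rule lborel_pair.Fubini') measurable
    also have "\<dots> = (\<integral>\<^sup>+x. (\<integral>\<^sup>+t. ?m t * (\<integral>\<^sup>+y. ennreal (gauss t (x - y)) * ?p y \<partial>lborel) \<partial>lborel) * ?q x \<partial>lborel)"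
      by (intro nn_integral_cong nn_integral_multc) measurable
    also have "\<dots> = (\<integral>\<^sup>+x. ennreal ?G * ((\<integral>\<^sup>+y. ennreal (norm (x - y) powr (- lam)) * ?p y \<partial>lborel) * ?q x) \<partial>lborel)"
      using lam by (intro nn_integral_cong) (subst riesz_direct, auto simp: mult.assoc)
    also have "\<dots> = ennreal ?G * riesz_form lam ?p ?q"
      unfolding riesz_form_def by (rule nn_integral_cmult) measurable
    finally have "ennreal (1 / C) * (ennreal C * spectral_form lam (spec u) (spec v) (spec w) (spec z)) \<le> ennreal (1 / C) * (ennreal ?G * riesz_form lam ?p ?q)"
      by (rule mult_left_mono) simp
    moreover have "ennreal (1 / C) * ennreal C = 1" "ennreal (1 / C) * ennreal ?G = ennreal (?G / C)"
      using C(1) G by (simp_all add: ennreal_mult'[symmetric])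
    ultimately show ?thesis by (simp only: mult.assoc[symmetric] mult_1_left)
  qed
  moreover have "?G / C \<ge> 0" using C(1) G by simp
  ultimately show thesis using that by blast
qed

section \<open>The Hartree term in L2\<close>

text \<open>Isolates what the nonlinear estimates rest on: Hardy's inequality in H^s with its
  constant \<open>H\<close>, and a name \<open>V\<close> for the potential, which
  \<open>V_def\<close> determines completely.\<close>

locale hartree_setting =
  fixes lam s H :: real and V :: "'a::euclidean_space L2 \<Rightarrow> 'a \<Rightarrow> real"
  assumes lam: "0 < lam" and s: "lam / 2 \<le> s" and H: "0 \<le> H"
    and V_def: "V u x = Defs.convolution (\<lambda>z. norm z powr (- lam)) (\<lambda>y. (cmod (L2_fun u y))\<^sup>2) x"
    and hardy: "u \<in> sobolev_space s \<Longrightarrow>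
      (\<integral>\<^sup>+y. ennreal (norm (x - y) powr (- lam)) * ennreal ((cmod (L2_fun u y))\<^sup>2) \<partial>lborel) \<le> ennreal (H * (sobolev_norm s u)\<^sup>2)"
begin

lemma measurable_V [measurable]: "V u \<in> borel_measurable borel"
  unfolding V_def[abs_def] Defs.convolution_def by measurable

text \<open>Hardy's inequality makes the convolution finite at every point, so for \<open>u\<close>
  in H^s the Bochner integral in \<open>V\<close> is the true value and not the default 0.\<close>

lemma integrable_V:
  fixes u :: "'a L2"
  assumes u: "u \<in> sobolev_space s"
  shows "integrable lborel (\<lambda>y. norm (x - y) powr (- lam) * (cmod (L2_fun u y))\<^sup>2)"
proof (rule integrableI_nonneg)
  show "(\<integral>\<^sup>+y. ennreal (norm (x - y) powr (- lam) * (cmod (L2_fun u y))\<^sup>2) \<partial>lborel) < \<infinity>"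
    using hardy[OF u, of x] by (simp add: ennreal_mult' order_le_less_trans)
qed auto

lemma V_nonneg: "0 \<le> V u x"
  unfolding V_def Defs.convolution_def by (rule Bochner_Integration.integral_nonneg) simp

lemma nn_V:
  assumes u: "u \<in> sobolev_space s"
  shows "ennreal (V u x) = (\<integral>\<^sup>+y. ennreal (norm (x - y) powr (- lam)) * ennreal ((cmod (L2_fun u y))\<^sup>2) \<partial>lborel)"
  unfolding V_def Defs.convolution_def
  by (subst nn_integral_eq_integral[OF integrable_V[OF u], symmetric]) (auto simp: ennreal_mult')

lemma V_le:
  assumes u: "u \<in> sobolev_space s"
  shows "V u x \<le> H * (sobolev_norm s u)\<^sup>2"
  using hardy[OF u, of x] H unfolding nn_V[OF u, symmetric] by (simp add: ennreal_le_iff)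

lemma bounded_multiplier_V:
  assumes u: "u \<in> sobolev_space s"
  shows "bounded_multiplier (\<lambda>x. of_real (V u x)) (H * (sobolev_norm s u)\<^sup>2)"
  by standard (use V_le[OF u] V_nonneg in auto)

lemma hartree_eq: "hartree lam u = to_L2 (\<lambda>x. of_real (V u x) * L2_fun u x)"
  by (simp add: hartree_def V_def)

lemma square_integrable_hartree:
  assumes u: "u \<in> sobolev_space s"
  shows "square_integrable (\<lambda>x. of_real (V u x) * L2_fun u x)"
  by (rule bounded_multiplier.square_integrable_mult[OF bounded_multiplier_V[OF u]]) simp

text \<open>Hardy's inequality removes the kernel uniformly in the other variable; the symmetry of
  the kernel allows \<open>u\<close> on either side.\<close>

lemma riesz_form_V_le:
  fixes u :: "'a L2"
  assumes u: "u \<in> sobolev_space s" and [measurable]: "q \<in> borel_measurable borel"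
  shows "riesz_form lam q (\<lambda>y. ennreal ((cmod (L2_fun u y))\<^sup>2)) \<le> ennreal (H * (sobolev_norm s u)\<^sup>2) * (\<integral>\<^sup>+x. q x \<partial>lborel)"
    "riesz_form lam (\<lambda>y. ennreal ((cmod (L2_fun u y))\<^sup>2)) q \<le> ennreal (H * (sobolev_norm s u)\<^sup>2) * (\<integral>\<^sup>+x. q x \<partial>lborel)"
proof -
  have "riesz_form lam (\<lambda>y. ennreal ((cmod (L2_fun u y))\<^sup>2)) q \<le> (\<integral>\<^sup>+x. ennreal (H * (sobolev_norm s u)\<^sup>2) * q x \<partial>lborel)"
    unfolding riesz_form_def by (intro nn_integral_mono mult_right_mono hardy u) simp
  also have "\<dots> = ennreal (H * (sobolev_norm s u)\<^sup>2) * (\<integral>\<^sup>+x. q x \<partial>lborel)"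
    by (rule nn_integral_cmult) measurable
  finally show 1: "riesz_form lam (\<lambda>y. ennreal ((cmod (L2_fun u y))\<^sup>2)) q \<le> \<dots>" .
  have "riesz_form lam q (\<lambda>y. ennreal ((cmod (L2_fun u y))\<^sup>2)) = riesz_form lam (\<lambda>y. ennreal ((cmod (L2_fun u y))\<^sup>2)) q"
    by (rule riesz_form_commute) measurable
  with 1 show "riesz_form lam q (\<lambda>y. ennreal ((cmod (L2_fun u y))\<^sup>2)) \<le> ennreal (H * (sobolev_norm s u)\<^sup>2) * (\<integral>\<^sup>+x. q x \<partial>lborel)"
    by simp
qed

text \<open>Cauchy-Schwarz with the kernel split evenly, after bounding the difference of
  \<open>|u|^2\<close> and \<open>|v|^2\<close> by \<open>|u - v| * (|u| + |v|)\<close>. Hardy's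
  inequality disposes of the factor with the sum; the factor with \<open>u - v\<close> keeps its
  kernel, which is spent later in the integration over \<open>x\<close>.\<close>

lemma V_diff_le:
  assumes u: "u \<in> sobolev_space s" "sobolev_norm s u \<le> M" and v: "v \<in> sobolev_space s" "sobolev_norm s v \<le> M"
  shows "ennreal ((V u x - V v x)\<^sup>2) \<le> ennreal (4 * H * M\<^sup>2) *
    (\<integral>\<^sup>+y. ennreal (norm (x - y) powr (- lam)) * ennreal ((cmod (L2_fun u y - L2_fun v y))\<^sup>2) \<partial>lborel)"
proof -
  let ?k = "\<lambda>y. norm (x - y) powr (- lam / 2)"
  let ?f = "\<lambda>y. ennreal (?k y * cmod (L2_fun u y - L2_fun v y))"
  let ?g = "\<lambda>y. ennreal (?k y * (cmod (L2_fun u y) + cmod (L2_fun v y)))"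
  have k: "norm (x - y) powr (- lam) = (?k y)\<^sup>2" for y by (simp add: power2_eq_square powr_add[symmetric])
  have "V u x - V v x = (LINT y|lborel. norm (x - y) powr (- lam) * (cmod (L2_fun u y))\<^sup>2 - norm (x - y) powr (- lam) * (cmod (L2_fun v y))\<^sup>2)"
    unfolding V_def Defs.convolution_def
    by (rule Bochner_Integration.integral_diff[symmetric]; rule integrable_V; fact)
  then have eq: "complex_of_real (V u x - V v x) = (LINT y|lborel. complex_of_real (norm (x - y) powr (- lam) * (cmod (L2_fun u y))\<^sup>2 - norm (x - y) powr (- lam) * (cmod (L2_fun v y))\<^sup>2))"
    by (simp only: integral_complex_of_real)
  have "ennreal \<bar>V u x - V v x\<bar> = ennreal (cmod (complex_of_real (V u x - V v x)))"
    by (simp only: norm_of_real)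
  also have "\<dots> \<le> (\<integral>\<^sup>+y. ennreal (cmod (complex_of_real (norm (x - y) powr (- lam) * (cmod (L2_fun u y))\<^sup>2 - norm (x - y) powr (- lam) * (cmod (L2_fun v y))\<^sup>2))) \<partial>lborel)"
    unfolding eq by (rule norm_integral_le_nn_integral)
  also have "\<dots> \<le> (\<integral>\<^sup>+y. ?f y * ?g y \<partial>lborel)"
  proof (rule nn_integral_mono)
    fix y
    let ?a = "cmod (L2_fun u y)" and ?b = "cmod (L2_fun v y)"
    have "?a\<^sup>2 - ?b\<^sup>2 = (?a - ?b) * (?a + ?b)" by (simp add: power2_eq_square algebra_simps)
    then have "\<bar>?a\<^sup>2 - ?b\<^sup>2\<bar> = \<bar>?a - ?b\<bar> * (?a + ?b)" by (simp add: abs_mult)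
    also have "\<dots> \<le> cmod (L2_fun u y - L2_fun v y) * (?a + ?b)"
      by (intro mult_right_mono norm_triangle_ineq3) simp
    finally have "(?k y)\<^sup>2 * \<bar>?a\<^sup>2 - ?b\<^sup>2\<bar> \<le> (?k y)\<^sup>2 * (cmod (L2_fun u y - L2_fun v y) * (?a + ?b))"
      by (rule mult_left_mono) simp
    then have "\<bar>norm (x - y) powr (- lam) * ?a\<^sup>2 - norm (x - y) powr (- lam) * ?b\<^sup>2\<bar>
        \<le> ?k y * cmod (L2_fun u y - L2_fun v y) * (?k y * (?a + ?b))"
      unfolding k right_diff_distrib[symmetric] abs_mult by (simp add: power2_eq_square mult_ac)
    then have "ennreal \<bar>norm (x - y) powr (- lam) * ?a\<^sup>2 - norm (x - y) powr (- lam) * ?b\<^sup>2\<bar>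
        \<le> ennreal (?k y * cmod (L2_fun u y - L2_fun v y) * (?k y * (?a + ?b)))"
      by (rule ennreal_leI)
    also have "\<dots> = ?f y * ?g y" by (rule ennreal_mult'') simp
    finally show "ennreal (cmod (complex_of_real (norm (x - y) powr (- lam) * ?a\<^sup>2 - norm (x - y) powr (- lam) * ?b\<^sup>2))) \<le> ?f y * ?g y"
      by (simp only: norm_of_real)
  qed
  finally have "(ennreal \<bar>V u x - V v x\<bar>)\<^sup>2 \<le> (\<integral>\<^sup>+y. ?f y * ?g y \<partial>lborel)\<^sup>2"
    by (rule power_mono) simp
  also have "\<dots> \<le> (\<integral>\<^sup>+y. (?f y)\<^sup>2 \<partial>lborel) * (\<integral>\<^sup>+y. (?g y)\<^sup>2 \<partial>lborel)"
    by (rule Cauchy_Schwarz_nn_integral) measurable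
  also have "(\<integral>\<^sup>+y. (?f y)\<^sup>2 \<partial>lborel) = (\<integral>\<^sup>+y. ennreal (norm (x - y) powr (- lam)) * ennreal ((cmod (L2_fun u y - L2_fun v y))\<^sup>2) \<partial>lborel)"
    unfolding k by (intro nn_integral_cong) (simp add: ennreal_power power_mult_distrib ennreal_mult')
  also have "(\<integral>\<^sup>+y. ennreal (norm (x - y) powr (- lam)) * ennreal ((cmod (L2_fun u y - L2_fun v y))\<^sup>2) \<partial>lborel) * (\<integral>\<^sup>+y. (?g y)\<^sup>2 \<partial>lborel) \<le> (\<integral>\<^sup>+y. ennreal (norm (x - y) powr (- lam)) * ennreal ((cmod (L2_fun u y - L2_fun v y))\<^sup>2) \<partial>lborel) * ennreal (4 * H * M\<^sup>2)"
  proof (rule mult_left_mono)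
    let ?h = "\<lambda>u y. ennreal (norm (x - y) powr (- lam)) * ennreal ((cmod (L2_fun u y))\<^sup>2)"
    have "(\<integral>\<^sup>+y. (?g y)\<^sup>2 \<partial>lborel) \<le> (\<integral>\<^sup>+y. ennreal 2 * ?h u y + ennreal 2 * ?h v y \<partial>lborel)"
    proof (rule nn_integral_mono)
      fix y
      let ?a = "cmod (L2_fun u y)" and ?b = "cmod (L2_fun v y)"
      have "(?a + ?b)\<^sup>2 \<le> 2 * ?a\<^sup>2 + 2 * ?b\<^sup>2"
        using sum_squares_bound[of ?a ?b] by (simp add: power2_sum)
      then have "(?k y)\<^sup>2 * (?a + ?b)\<^sup>2 \<le> (?k y)\<^sup>2 * (2 * ?a\<^sup>2 + 2 * ?b\<^sup>2)"
        by (rule mult_left_mono) simp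
      then have "(?k y * (?a + ?b))\<^sup>2 \<le> 2 * (norm (x - y) powr (- lam) * ?a\<^sup>2) + 2 * (norm (x - y) powr (- lam) * ?b\<^sup>2)"
        unfolding k power_mult_distrib by (simp only: distrib_left mult_ac)
      then have "ennreal ((?k y * (?a + ?b))\<^sup>2) \<le> ennreal (2 * (norm (x - y) powr (- lam) * ?a\<^sup>2) + 2 * (norm (x - y) powr (- lam) * ?b\<^sup>2))"
        by (rule ennreal_leI)
      then show "(?g y)\<^sup>2 \<le> ennreal 2 * ?h u y + ennreal 2 * ?h v y"
        by (subst ennreal_power) (simp_all add: ennreal_mult')
    qed
    also have "\<dots> = (\<integral>\<^sup>+y. ennreal 2 * ?h u y \<partial>lborel) + (\<integral>\<^sup>+y. ennreal 2 * ?h v y \<partial>lborel)"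
      by (rule nn_integral_add) measurable
    also have "\<dots> = ennreal 2 * ennreal (V u x) + ennreal 2 * ennreal (V v x)"
      unfolding nn_V[OF u(1)] nn_V[OF v(1)] by (subst (1 2) nn_integral_cmult) measurable
    also have "\<dots> = ennreal (2 * V u x + 2 * V v x)"
      by (subst ennreal_plus) (simp_all add: V_nonneg ennreal_mult')
    also have "\<dots> \<le> ennreal (4 * H * M\<^sup>2)"
    proof (rule ennreal_leI)
      have "V w x \<le> H * M\<^sup>2" if "w \<in> sobolev_space s" "sobolev_norm s w \<le> M" for w
        by (rule order_trans[OF V_le[OF that(1)]]) (intro mult_left_mono power_mono that H sobolev_norm_nonneg)
      from this[OF u] this[OF v] show "2 * V u x + 2 * V v x \<le> 4 * H * M\<^sup>2" by simp
    qed
    finally show "(\<integral>\<^sup>+y. (?g y)\<^sup>2 \<partial>lborel) \<le> ennreal (4 * H * M\<^sup>2)" .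
  qed simp
  finally show ?thesis by (simp add: ennreal_power mult.commute)
qed

text \<open>The difference is \<open>V u * (u - v) + (V u - V v) * v\<close>; the terms cost
  \<open>H * M^2\<close> and \<open>2 * H * M^2\<close>. The distance is measured in L2 while
  \<open>M\<close> bounds norms in H^s, the asymmetry on which the contraction in L2 rests.\<close>

lemma hartree_lipschitz:
  fixes u v :: "'a L2"
  assumes u: "u \<in> sobolev_space s" "sobolev_norm s u \<le> M" and v: "v \<in> sobolev_space s" "sobolev_norm s v \<le> M"
  shows "norm (hartree lam u - hartree lam v) \<le> 3 * H * M\<^sup>2 * norm (u - v)"
proof -
  let ?w = "\<lambda>x. L2_fun u x - L2_fun v x"
  have M: "0 \<le> M" using u(2) sobolev_norm_nonneg[of s u] by linarith
  have w: "square_integrable ?w" by (simp add: square_integrable_diff)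
  have wn: "to_L2 ?w = u - v" using to_L2_diff[of "L2_fun u" "L2_fun v"] by simp
  interpret Vu: bounded_multiplier "\<lambda>x. of_real (V u x)" "H * (sobolev_norm s u)\<^sup>2" by (rule bounded_multiplier_V[OF u(1)])
  interpret Vv: bounded_multiplier "\<lambda>x. of_real (V v x)" "H * (sobolev_norm s v)\<^sup>2" by (rule bounded_multiplier_V[OF v(1)])
  have sq1: "square_integrable (\<lambda>x. of_real (V u x) * ?w x)" by (rule Vu.square_integrable_mult[OF w])
  have sq2: "square_integrable (\<lambda>x. of_real (V u x) * L2_fun v x - of_real (V v x) * L2_fun v x)"
    by (intro square_integrable_diff Vu.square_integrable_mult Vv.square_integrable_mult square_integrable_L2_fun)
  have "hartree lam u - hartree lam v = to_L2 (\<lambda>x. of_real (V u x) * L2_fun u x - of_real (V v x) * L2_fun v x)"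
    unfolding hartree_eq by (intro to_L2_diff square_integrable_hartree u v)
  also have "\<dots> = to_L2 (\<lambda>x. of_real (V u x) * ?w x + (of_real (V u x) * L2_fun v x - of_real (V v x) * L2_fun v x))"
    by (simp add: right_diff_distrib)
  also have "\<dots> = to_L2 (\<lambda>x. of_real (V u x) * ?w x) + to_L2 (\<lambda>x. of_real (V u x) * L2_fun v x - of_real (V v x) * L2_fun v x)"
    by (rule to_L2_add[OF sq1 sq2, symmetric])
  finally have "norm (hartree lam u - hartree lam v) \<le> norm (to_L2 (\<lambda>x. of_real (V u x) * ?w x)) + norm (to_L2 (\<lambda>x. of_real (V u x) * L2_fun v x - of_real (V v x) * L2_fun v x))"
    by (simp only: norm_triangle_ineq)
  also have "norm (to_L2 (\<lambda>x. of_real (V u x) * ?w x)) \<le> H * M\<^sup>2 * norm (u - v)"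
  proof -
    have "norm (to_L2 (\<lambda>x. of_real (V u x) * ?w x)) \<le> H * (sobolev_norm s u)\<^sup>2 * norm (u - v)"
      using Vu.norm_mult_le[of "u - v"] Vu.mult_to_L2[OF w] unfolding wn by simp
    also have "\<dots> \<le> H * M\<^sup>2 * norm (u - v)"
      by (intro mult_right_mono mult_left_mono power_mono u H) auto
    finally show ?thesis .
  qed
  also have "norm (to_L2 (\<lambda>x. of_real (V u x) * L2_fun v x - of_real (V v x) * L2_fun v x)) \<le> 2 * H * M\<^sup>2 * norm (u - v)"
  proof (rule norm_to_L2_le)
    let ?W = "\<lambda>y. ennreal ((cmod (?w y))\<^sup>2)"
    have "(\<integral>\<^sup>+x. ennreal ((cmod (of_real (V u x) * L2_fun v x - of_real (V v x) * L2_fun v x))\<^sup>2) \<partial>lborel)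
        \<le> (\<integral>\<^sup>+x. ennreal (4 * H * M\<^sup>2) * ((\<integral>\<^sup>+y. ennreal (norm (x - y) powr (- lam)) * ?W y \<partial>lborel) * ennreal ((cmod (L2_fun v x))\<^sup>2)) \<partial>lborel)"
    proof (rule nn_integral_mono)
      fix x
      have "of_real (V u x) * L2_fun v x - of_real (V v x) * L2_fun v x = of_real (V u x - V v x) * L2_fun v x"
        by (simp add: left_diff_distrib)
      then have "ennreal ((cmod (of_real (V u x) * L2_fun v x - of_real (V v x) * L2_fun v x))\<^sup>2)
          = ennreal ((V u x - V v x)\<^sup>2) * ennreal ((cmod (L2_fun v x))\<^sup>2)"
        by (simp only: norm_mult norm_of_real power_mult_distrib power2_abs) (rule ennreal_mult', simp)
      also have "\<dots> \<le> ennreal (4 * H * M\<^sup>2) * (\<integral>\<^sup>+y. ennreal (norm (x - y) powr (- lam)) * ?W y \<partial>lborel) * ennreal ((cmod (L2_fun v x))\<^sup>2)"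
        by (intro mult_right_mono V_diff_le u v) simp
      finally show "ennreal ((cmod (of_real (V u x) * L2_fun v x - of_real (V v x) * L2_fun v x))\<^sup>2)
          \<le> ennreal (4 * H * M\<^sup>2) * ((\<integral>\<^sup>+y. ennreal (norm (x - y) powr (- lam)) * ?W y \<partial>lborel) * ennreal ((cmod (L2_fun v x))\<^sup>2))"
        by (simp only: mult.assoc)
    qed
    also have "\<dots> = ennreal (4 * H * M\<^sup>2) * riesz_form lam ?W (\<lambda>x. ennreal ((cmod (L2_fun v x))\<^sup>2))"
      unfolding riesz_form_def by (rule nn_integral_cmult) measurable
    \<comment> \<open>The kernel left over from \<open>V_diff_le\<close> is spent on
      \<open>|v|^2\<close>: Hardy's inequality in the variable \<open>x\<close> leaves the integral
      of \<open>|u - v|^2\<close>.\<close>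
    also have "\<dots> \<le> ennreal (4 * H * M\<^sup>2) * (ennreal (H * (sobolev_norm s v)\<^sup>2) * (\<integral>\<^sup>+x. ?W x \<partial>lborel))"
      by (intro mult_left_mono riesz_form_V_le v) simp_all
    also have "(\<integral>\<^sup>+x. ?W x \<partial>lborel) = ennreal ((norm (u - v))\<^sup>2)"
      using nn_norm_to_L2_square[OF w] by (simp add: wn)
    also have "ennreal (4 * H * M\<^sup>2) * (ennreal (H * (sobolev_norm s v)\<^sup>2) * ennreal ((norm (u - v))\<^sup>2))
        = ennreal (4 * H * M\<^sup>2 * (H * (sobolev_norm s v)\<^sup>2 * (norm (u - v))\<^sup>2))"
      using H by (simp add: ennreal_mult'[symmetric])
    also have "\<dots> \<le> ennreal (4 * H * M\<^sup>2 * (H * M\<^sup>2 * (norm (u - v))\<^sup>2))"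
      by (intro ennreal_leI mult_left_mono mult_right_mono power_mono v) (use H in auto)
    also have "4 * H * M\<^sup>2 * (H * M\<^sup>2 * (norm (u - v))\<^sup>2) = (2 * H * M\<^sup>2 * norm (u - v))\<^sup>2"
      by (simp add: power2_eq_square)
    finally show "(\<integral>\<^sup>+x. ennreal ((cmod (of_real (V u x) * L2_fun v x - of_real (V v x) * L2_fun v x))\<^sup>2) \<partial>lborel)
      \<le> ennreal ((2 * H * M\<^sup>2 * norm (u - v))\<^sup>2)" .
  qed (use H in simp)
  finally show ?thesis by (simp add: mult_ac)
qed

text \<open>Two configurations cover all positions of a weighted factor \<open>a\<close>. If
  \<open>a\<close> and \<open>g\<close> are on different sides of the kernel, Cauchy-Schwarz pairs
  each of them with one copy of \<open>u\<close>; if they share a side, Hardy's inequality absorbs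
  \<open>|u|^2\<close> and Cauchy-Schwarz in L2 remains.\<close>

lemma riesz_form_quartic_le:
  fixes u a g :: "'a L2"
  assumes u: "u \<in> sobolev_space s"
  shows "riesz_form lam (\<lambda>y. ennreal (cmod (L2_fun a y) * cmod (L2_fun u y))) (\<lambda>x. ennreal (cmod (L2_fun u x) * cmod (L2_fun g x)))
      \<le> ennreal (H * (sobolev_norm s u)\<^sup>2 * (norm a * norm g))"
    "riesz_form lam (\<lambda>y. ennreal (cmod (L2_fun u y) * cmod (L2_fun u y))) (\<lambda>x. ennreal (cmod (L2_fun a x) * cmod (L2_fun g x)))
      \<le> ennreal (H * (sobolev_norm s u)\<^sup>2 * (norm a * norm g))"
proof -
  let ?B = "H * (sobolev_norm s u)\<^sup>2"
  have sqrt_le: "x \<le> ennreal r" if "x\<^sup>2 \<le> ennreal (r\<^sup>2)" "0 \<le> r" for x r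
  proof (cases x)
    case (real t)
    then have "t\<^sup>2 \<le> r\<^sup>2" using that by (simp add: ennreal_power)
    then have "t \<le> r" using that(2) by (rule power2_le_imp_le)
    then show ?thesis unfolding real(2) by (rule ennreal_leI)
  next
    case top
    then show ?thesis using that by (simp add: power2_eq_square ennreal_top_mult top_unique)
  qed
  let ?n = "\<lambda>f y. ennreal (cmod (L2_fun f y))"
  have sq: "(?n f y)\<^sup>2 = ennreal ((cmod (L2_fun f y))\<^sup>2)" for f :: "'a L2" and y by (simp add: ennreal_power)
  have split: "ennreal (cmod (L2_fun f y) * cmod (L2_fun h y)) = ?n f y * ?n h y" for f h :: "'a L2" and y
    by (rule ennreal_mult') simp
  show "riesz_form lam (\<lambda>y. ennreal (cmod (L2_fun a y) * cmod (L2_fun u y))) (\<lambda>x. ennreal (cmod (L2_fun u x) * cmod (L2_fun g x)))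
      \<le> ennreal (?B * (norm a * norm g))"
  proof (rule sqrt_le)
    have "(riesz_form lam (\<lambda>y. ennreal (cmod (L2_fun a y) * cmod (L2_fun u y))) (\<lambda>x. ennreal (cmod (L2_fun u x) * cmod (L2_fun g x))))\<^sup>2
        \<le> riesz_form lam (\<lambda>y. (?n a y)\<^sup>2) (\<lambda>x. (?n u x)\<^sup>2) * riesz_form lam (\<lambda>y. (?n u y)\<^sup>2) (\<lambda>x. (?n g x)\<^sup>2)"
      unfolding split by (rule riesz_form_Cauchy_Schwarz) measurable
    also have "\<dots> \<le> (ennreal ?B * ennreal ((norm a)\<^sup>2)) * (ennreal ?B * ennreal ((norm g)\<^sup>2))"
      unfolding sq nn_norm_L2_square by (intro mult_mono riesz_form_V_le u) auto
    also have "\<dots> = ennreal ((?B * (norm a * norm g))\<^sup>2)"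
      using H by (simp add: ennreal_mult'[symmetric] power2_eq_square mult_ac)
    finally show "(riesz_form lam (\<lambda>y. ennreal (cmod (L2_fun a y) * cmod (L2_fun u y))) (\<lambda>x. ennreal (cmod (L2_fun u x) * cmod (L2_fun g x))))\<^sup>2
        \<le> ennreal ((?B * (norm a * norm g))\<^sup>2)" .
  qed (use H in simp)
  have "(\<integral>\<^sup>+x. ?n a x * ?n g x \<partial>lborel) \<le> ennreal (norm a * norm g)"
  proof (rule sqrt_le)
    have "(\<integral>\<^sup>+x. ?n a x * ?n g x \<partial>lborel)\<^sup>2 \<le> (\<integral>\<^sup>+x. (?n a x)\<^sup>2 \<partial>lborel) * (\<integral>\<^sup>+x. (?n g x)\<^sup>2 \<partial>lborel)"
      by (rule Cauchy_Schwarz_nn_integral) measurable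
    also have "\<dots> = ennreal ((norm a * norm g)\<^sup>2)"
      unfolding sq nn_norm_L2_square[symmetric] by (simp add: ennreal_mult'[symmetric] power_mult_distrib)
    finally show "(\<integral>\<^sup>+x. ?n a x * ?n g x \<partial>lborel)\<^sup>2 \<le> ennreal ((norm a * norm g)\<^sup>2)" .
  qed simp
  then have "ennreal ?B * (\<integral>\<^sup>+x. ?n a x * ?n g x \<partial>lborel) \<le> ennreal ?B * ennreal (norm a * norm g)"
    by (rule mult_left_mono) simp
  then show "riesz_form lam (\<lambda>y. ennreal (cmod (L2_fun u y) * cmod (L2_fun u y))) (\<lambda>x. ennreal (cmod (L2_fun a x) * cmod (L2_fun g x)))
      \<le> ennreal (?B * (norm a * norm g))"
    unfolding split power2_eq_square[of "?n u _", symmetric] sq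
    by (intro order_trans[OF riesz_form_V_le(2)[OF u]]) (measurable, use H in \<open>simp add: ennreal_mult'\<close>)
qed

end

section \<open>From the pairing with the Hartree term to the spectral form\<close>

text \<open>Absolute values are taken after the passage to frequencies, which is valid without any
  sign of the transforms but gives only an upper bound.\<close>

lemma spectral_gauss_upper:
  fixes u v w z :: "'a::euclidean_space L2"
  assumes t: "t > 0"
  shows "ennreal (cmod (LINT x|lborel. (LINT y|lborel. of_real (gauss t (x - y)) * (L2_fun u y * cnj (L2_fun v y))) * (L2_fun w x * cnj (L2_fun z x))))
    \<le> ennreal ((4 * pi * t) powr (- (DIM('a) / 2))) *
      (\<integral>\<^sup>+\<eta>. ennreal (gauss (1 / (4 * t)) \<eta>) * (corr (spec u) (spec v) \<eta> * corr (spec z) (spec w) \<eta>) \<partial>lborel)"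
proof -
  let ?\<phi> = "\<lambda>y. L2_fun u y * cnj (L2_fun v y)" and ?\<psi> = "\<lambda>x. L2_fun w x * cnj (L2_fun z x)"
  have \<phi>: "integrable lborel ?\<phi>" and \<psi>: "integrable lborel ?\<psi>"
    by (intro integrable_mult_cnj square_integrable_L2_fun)+
  have "ennreal (cmod (LINT x|lborel. (LINT y|lborel. of_real (gauss t (x - y)) * ?\<phi> y) * ?\<psi> x))
      = ennreal ((4 * pi * t) powr (- (DIM('a) / 2))) * ennreal (cmod (LINT \<eta>|lborel. of_real (gauss (1 / (4 * t)) \<eta>) * ((LINT y|lborel. phase 1 y \<eta> * ?\<phi> y) * (LINT x|lborel. phase (- 1) x \<eta> * ?\<psi> x))))"
    unfolding gauss_quadrilinear[OF \<phi> \<psi> t] by (simp add: norm_mult ennreal_mult')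
  also have "\<dots> \<le> ennreal ((4 * pi * t) powr (- (DIM('a) / 2))) *
      (\<integral>\<^sup>+\<eta>. ennreal (gauss (1 / (4 * t)) \<eta>) * (corr (spec u) (spec v) \<eta> * corr (spec z) (spec w) \<eta>) \<partial>lborel)"
  proof (intro mult_left_mono order_trans[OF norm_integral_le_nn_integral] nn_integral_mono)
    fix \<eta> :: 'a
    have "ennreal (cmod (of_real (gauss (1 / (4 * t)) \<eta>) * ((LINT y|lborel. phase 1 y \<eta> * ?\<phi> y) * (LINT x|lborel. phase (- 1) x \<eta> * ?\<psi> x))))
        = ennreal (gauss (1 / (4 * t)) \<eta>) * (ennreal (cmod (LINT y|lborel. phase 1 y \<eta> * ?\<phi> y)) * ennreal (cmod (LINT x|lborel. phase 1 x \<eta> * (L2_fun z x * cnj (L2_fun w x)))))"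
      by (simp add: norm_mult ennreal_mult' integral_phase_minus_cnj)
    also have "\<dots> \<le> ennreal (gauss (1 / (4 * t)) \<eta>) * (corr (spec u) (spec v) \<eta> * corr (spec z) (spec w) \<eta>)"
      by (intro mult_left_mono mult_mono norm_fourier_product_le) auto
    finally show "ennreal (cmod (of_real (gauss (1 / (4 * t)) \<eta>) * ((LINT y|lborel. phase 1 y \<eta> * ?\<phi> y) * (LINT x|lborel. phase (- 1) x \<eta> * ?\<psi> x)))) \<le> \<dots>" .
  qed simp
  finally show ?thesis .
qed

context hartree_setting
begin

text \<open>\<open>V u\<close> is an average over \<open>t\<close> of Gaussian convolutions. The
  bound at each \<open>t\<close> concerns the modulus of the whole integral over \<open>x\<close>,
  so the integral over \<open>t\<close> has to be pulled outside first; boundedness of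
  \<open>V u\<close> gives the absolute integrability that Fubini requires.\<close>

lemma hartree_pairing_le:
  assumes lamd: "lam < DIM('a)"
  obtains C where "C \<ge> 0" "\<And>u z :: 'a L2. u \<in> sobolev_space s \<Longrightarrow>
    ennreal (cmod (LINT x|lborel. of_real (V u x) * (L2_fun u x * cnj (L2_fun z x))))
    \<le> ennreal C * spectral_form lam (spec u) (spec u) (spec u) (spec z)"
proof -
  let ?d = "real DIM('a)"
  obtain C where C: "C > 0" "\<And>k::'a \<Rightarrow> ennreal. k \<in> borel_measurable borel \<Longrightarrow>
    (\<integral>\<^sup>+t. ennreal (indicator {0<..} t * t powr (lam / 2 - 1)) *
        (ennreal ((4 * pi * t) powr (- (?d / 2))) * (\<integral>\<^sup>+\<eta>. ennreal (gauss (1 / (4 * t)) \<eta>) * k \<eta> \<partial>lborel)) \<partial>lborel)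
    = ennreal C * (\<integral>\<^sup>+\<eta>. ennreal (norm \<eta> powr (lam - ?d)) * k \<eta> \<partial>lborel)"
    using riesz_dual[OF lam lamd] by blast
  let ?G = "Gamma (lam / 2)"
  have G: "?G > 0" using lam by (intro Gamma_real_pos) simp
  have "ennreal (cmod (LINT x|lborel. of_real (V u x) * (L2_fun u x * cnj (L2_fun z x))))
    \<le> ennreal (C / ?G) * spectral_form lam (spec u) (spec u) (spec u) (spec z)"
    if u: "u \<in> sobolev_space s" for u z :: "'a L2"
  proof -
    let ?W = "\<lambda>x. L2_fun u x * cnj (L2_fun z x)"
    have W: "integrable lborel ?W" by (intro integrable_mult_cnj square_integrable_L2_fun)
    define m where "m t = indicator {0<..} t * t powr (lam / 2 - 1)" for t :: real
    have m0: "0 \<le> m t" for t by (simp add: m_def)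
    have [measurable]: "m \<in> borel_measurable borel" unfolding m_def by measurable
    define P where "P t x = (LINT y|lborel. gauss t (x - y) * (cmod (L2_fun u y))\<^sup>2)" for t x
    have P0: "0 \<le> P t x" for t x unfolding P_def by (rule Bochner_Integration.integral_nonneg) simp
    have Pm[measurable]: "(\<lambda>z. P (f z) (g z)) \<in> borel_measurable N"
      if [measurable]: "f \<in> borel_measurable N" "g \<in> borel_measurable N" for f g and N :: "'b measure"
      unfolding P_def by measurable
    have nnP: "ennreal (P t x) = (\<integral>\<^sup>+y. ennreal (gauss t (x - y)) * ennreal ((cmod (L2_fun u y))\<^sup>2) \<partial>lborel)" if t: "t > 0" for t x
    proof -
      have int: "integrable lborel (\<lambda>y. gauss t (x - y) * (cmod (L2_fun u y))\<^sup>2)"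
      proof (rule Bochner_Integration.integrable_bound)
        show "integrable lborel (\<lambda>y. (cmod (L2_fun u y))\<^sup>2)"
          using square_integrable_L2_fun[of u] by (simp add: square_integrable_def)
        show "AE y in lborel. norm (gauss t (x - y) * (cmod (L2_fun u y))\<^sup>2) \<le> norm ((cmod (L2_fun u y))\<^sup>2)"
          using t by (intro AE_I2) (simp add: abs_mult mult_left_le_one_le gauss_le_one)
      qed measurable
      show ?thesis unfolding P_def
        by (subst nn_integral_eq_integral[OF int, symmetric]) (auto simp: ennreal_mult')
    qed
    have nnt: "(\<integral>\<^sup>+t. ennreal (m t * P t x) \<partial>lborel) = ennreal (?G * V u x)" for x
    proof -
      have "(\<integral>\<^sup>+t. ennreal (m t * P t x) \<partial>lborel)
          = (\<integral>\<^sup>+t. ennreal (m t) * (\<integral>\<^sup>+y. ennreal (gauss t (x - y)) * ennreal ((cmod (L2_fun u y))\<^sup>2) \<partial>lborel) \<partial>lborel)"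
      proof (rule nn_integral_cong)
        fix t :: real
        show "ennreal (m t * P t x) = ennreal (m t) * (\<integral>\<^sup>+y. ennreal (gauss t (x - y)) * ennreal ((cmod (L2_fun u y))\<^sup>2) \<partial>lborel)"
          by (cases "t > 0") (simp_all add: nnP[symmetric] ennreal_mult' m0, simp add: m_def)
      qed
      also have "\<dots> = ennreal ?G * (\<integral>\<^sup>+y. ennreal (norm (x - y) powr (- lam)) * ennreal ((cmod (L2_fun u y))\<^sup>2) \<partial>lborel)"
        unfolding m_def using lam by (intro riesz_direct) auto
      also have "\<dots> = ennreal (?G * V u x)"
        using G by (simp add: nn_V[OF u, symmetric] ennreal_mult')
      finally show ?thesis .
    qed
    have intt: "integrable lborel (\<lambda>t. m t * P t x)" for x
      by (rule integrableI_nonneg) (auto simp: nnt m0 P0 simp del: ennreal_mult')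
    have LINTt: "(LINT t|lborel. m t * P t x) = ?G * V u x" for x
    proof -
      have "ennreal (LINT t|lborel. m t * P t x) = ennreal (?G * V u x)"
        unfolding nnt[symmetric] by (rule nn_integral_eq_integral[symmetric, OF intt]) (simp add: m0 P0)
      moreover have "0 \<le> (LINT t|lborel. m t * P t x)" by (rule Bochner_Integration.integral_nonneg) (simp add: m0 P0)
      moreover have "0 \<le> ?G * V u x" using G V_nonneg by simp
      ultimately show ?thesis by (simp add: ennreal_inj)
    qed
    have int2: "integrable (lborel \<Otimes>\<^sub>M lborel) (\<lambda>(x, t). of_real (m t * P t x) * ?W x)"
    proof (rule lborel_pair.Fubini_integrable)
      show "(\<lambda>(x, t). of_real (m t * P t x) * ?W x) \<in> borel_measurable (lborel \<Otimes>\<^sub>M lborel)" by measurable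
      have "(LINT t|lborel. norm (case (x, t) of (x, t) \<Rightarrow> of_real (m t * P t x) * ?W x)) = ?G * V u x * cmod (?W x)" for x
        by (simp add: norm_mult abs_mult abs_of_nonneg m0 P0 LINTt)
      moreover have "integrable lborel (\<lambda>x. ?G * V u x * cmod (?W x))"
      proof (rule Bochner_Integration.integrable_bound)
        show "integrable lborel (\<lambda>x. ?G * (H * (sobolev_norm s u)\<^sup>2) * cmod (?W x))"
          using W by simp
        show "AE x in lborel. norm (?G * V u x * cmod (?W x)) \<le> norm (?G * (H * (sobolev_norm s u)\<^sup>2) * cmod (?W x))"
          unfolding real_norm_def abs_mult abs_norm_cancel
          using V_le[OF u] V_nonneg[of u] by (intro AE_I2 mult_right_mono mult_left_mono) (auto simp: abs_of_nonneg H)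
      qed measurable
      ultimately show "integrable lborel (\<lambda>x. LINT t|lborel. norm (case (x, t) of (x, t) \<Rightarrow> of_real (m t * P t x) * ?W x))"
        by (simp only:)
      show "AE x in lborel. integrable lborel (\<lambda>t. case (x, t) of (x, t) \<Rightarrow> of_real (m t * P t x) * ?W x)"
        using intt by (intro AE_I2) (simp only: prod.case, intro integrable_mult_left integrable_of_real)
    qed
    have "of_real ?G * (LINT x|lborel. of_real (V u x) * ?W x) = (LINT x|lborel. of_real ?G * (of_real (V u x) * ?W x))"
      by (rule integral_mult_right_zero[symmetric])
    also have "\<dots> = (LINT x|lborel. LINT t|lborel. of_real (m t * P t x) * ?W x)"
    proof (rule Bochner_Integration.integral_cong[OF refl])
      fix x
      have "(LINT t|lborel. of_real (m t * P t x) * ?W x) = of_real (LINT t|lborel. m t * P t x) * ?W x"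
        by (simp only: integral_mult_left_zero integral_complex_of_real)
      then show "of_real ?G * (of_real (V u x) * ?W x) = (LINT t|lborel. of_real (m t * P t x) * ?W x)"
        by (simp only: LINTt of_real_mult mult.assoc)
    qed
    also have "\<dots> = (LINT t|lborel. LINT x|lborel. of_real (m t * P t x) * ?W x)"
      using lborel_pair.Fubini_integral[OF int2] by simp
    finally have eq: "of_real ?G * (LINT x|lborel. of_real (V u x) * ?W x) = (LINT t|lborel. LINT x|lborel. of_real (m t * P t x) * ?W x)" .
    have "ennreal ?G * ennreal (cmod (LINT x|lborel. of_real (V u x) * ?W x)) = ennreal (cmod (of_real ?G * (LINT x|lborel. of_real (V u x) * ?W x)))"
      using G by (simp add: norm_mult ennreal_mult')
    also have "\<dots> \<le> (\<integral>\<^sup>+t. ennreal (cmod (LINT x|lborel. of_real (m t * P t x) * ?W x)) \<partial>lborel)"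
      unfolding eq by (rule norm_integral_le_nn_integral)
    also have "\<dots> \<le> (\<integral>\<^sup>+t. ennreal (m t) * (ennreal ((4 * pi * t) powr (- (?d / 2))) *
        (\<integral>\<^sup>+\<eta>. ennreal (gauss (1 / (4 * t)) \<eta>) * (corr (spec u) (spec u) \<eta> * corr (spec z) (spec u) \<eta>) \<partial>lborel)) \<partial>lborel)"
    proof (rule nn_integral_mono)
      fix t :: real
      show "ennreal (cmod (LINT x|lborel. of_real (m t * P t x) * ?W x)) \<le> ennreal (m t) * (ennreal ((4 * pi * t) powr (- (?d / 2))) *
        (\<integral>\<^sup>+\<eta>. ennreal (gauss (1 / (4 * t)) \<eta>) * (corr (spec u) (spec u) \<eta> * corr (spec z) (spec u) \<eta>) \<partial>lborel))"
      proof (cases "t > 0")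
        case True
        have "of_real (P t x) = (LINT y|lborel. of_real (gauss t (x - y)) * (L2_fun u y * cnj (L2_fun u y)))" for x
          unfolding P_def integral_complex_of_real[symmetric] by (simp only: of_real_mult complex_norm_square)
        moreover have "(LINT x|lborel. of_real (m t * P t x) * ?W x) = of_real (m t) * (LINT x|lborel. of_real (P t x) * ?W x)"
          by (simp only: of_real_mult mult.assoc integral_mult_right_zero)
        ultimately have "ennreal (cmod (LINT x|lborel. of_real (m t * P t x) * ?W x))
            = ennreal (m t) * ennreal (cmod (LINT x|lborel. (LINT y|lborel. of_real (gauss t (x - y)) * (L2_fun u y * cnj (L2_fun u y))) * ?W x))"
          by (simp only: norm_mult norm_of_real abs_of_nonneg[OF m0]) (rule ennreal_mult', rule m0)
        also have "\<dots> \<le> ennreal (m t) * (ennreal ((4 * pi * t) powr (- (?d / 2))) *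
          (\<integral>\<^sup>+\<eta>. ennreal (gauss (1 / (4 * t)) \<eta>) * (corr (spec u) (spec u) \<eta> * corr (spec z) (spec u) \<eta>) \<partial>lborel))"
          by (intro mult_left_mono spectral_gauss_upper True) simp
        finally show ?thesis .
      qed (simp add: m_def)
    qed
    also have "\<dots> = ennreal C * spectral_form lam (spec u) (spec u) (spec u) (spec z)"
      unfolding spectral_form_def m_def by (rule C(2)) measurable
    finally have "ennreal (1 / ?G) * (ennreal ?G * ennreal (cmod (LINT x|lborel. of_real (V u x) * ?W x)))
        \<le> ennreal (1 / ?G) * (ennreal C * spectral_form lam (spec u) (spec u) (spec u) (spec z))"
      by (rule mult_left_mono) simp
    moreover have "ennreal (1 / ?G) * ennreal ?G = 1" "ennreal (1 / ?G) * ennreal C = ennreal (C / ?G)"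
      using C(1) G by (simp_all add: ennreal_mult'[symmetric])
    ultimately show ?thesis by (simp only: mult.assoc[symmetric] mult_1_left)
  qed
  moreover have "C / ?G \<ge> 0" using C(1) G by simp
  ultimately show thesis using that by blast
qed

end

section \<open>Distribution of the Sobolev weight over three frequencies\<close>

lemma japanese_bracket_triangle: "japanese_bracket (x + y) \<le> japanese_bracket x + japanese_bracket y"
proof -
  let ?a = "japanese_bracket x" and ?b = "japanese_bracket y"
  have a: "?a\<^sup>2 = 1 + (norm x)\<^sup>2" and b: "?b\<^sup>2 = 1 + (norm y)\<^sup>2" by (simp_all add: japanese_bracket_def)
  have n: "0 \<le> ?a" "0 \<le> ?b" by (simp_all add: japanese_bracket_def)
  have "(norm (x + y))\<^sup>2 \<le> (norm x + norm y)\<^sup>2" by (intro power_mono norm_triangle_ineq) simp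
  also have "\<dots> = (norm x)\<^sup>2 + (norm y)\<^sup>2 + 2 * (norm x * norm y)" by (simp add: power2_sum)
  also have "norm x * norm y \<le> ?a * ?b"
    using n by (intro mult_mono norm_le_japanese_bracket) auto
  finally have "1 + (norm (x + y))\<^sup>2 \<le> ?a\<^sup>2 + ?b\<^sup>2 + 2 * (?a * ?b)" unfolding a b by simp
  also have "\<dots> = (?a + ?b)\<^sup>2" by (simp add: power2_sum)
  finally show ?thesis
    unfolding japanese_bracket_def[of "x + y"] using n by (intro real_le_lsqrt) auto
qed

lemma japanese_bracket_minus: "japanese_bracket (- x) = japanese_bracket x"
  by (simp add: japanese_bracket_def)

text \<open>The largest of the three brackets, multiplied by 3, dominates the left one; monotonicity
  of the power then treats \<open>s\<close> below and above 1 alike.\<close>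

lemma japanese_bracket_powr_sum3:
  assumes s: "0 \<le> s"
  shows "japanese_bracket (x - y + z) powr s
    \<le> 3 powr s * (japanese_bracket x powr s + japanese_bracket y powr s + japanese_bracket z powr s)"
proof -
  let ?a = "japanese_bracket x" and ?b = "japanese_bracket y" and ?c = "japanese_bracket z"
  have pos: "1 \<le> ?a" "1 \<le> ?b" "1 \<le> ?c" by (rule japanese_bracket_ge_one)+
  define m where "m = max ?a (max ?b ?c)"
  have "japanese_bracket (x - y + z) \<le> japanese_bracket (x - y) + ?c" by (rule japanese_bracket_triangle)
  also have "japanese_bracket (x - y) \<le> ?a + ?b"
    using japanese_bracket_triangle[of x "- y"] by (simp add: japanese_bracket_minus)
  finally have "japanese_bracket (x - y + z) \<le> 3 * m" unfolding m_def by linarith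
  then have "japanese_bracket (x - y + z) powr s \<le> (3 * m) powr s"
    using s japanese_bracket_ge_one[of "x - y + z"] by (intro powr_mono2) auto
  also have "\<dots> = 3 powr s * m powr s" using pos by (intro powr_mult) 
  also have "m powr s \<le> ?a powr s + ?b powr s + ?c powr s"
  proof -
    have "0 \<le> ?a powr s" "0 \<le> ?b powr s" "0 \<le> ?c powr s" by auto
    moreover have "m = ?a \<or> m = ?b \<or> m = ?c" by (auto simp: m_def max_def)
    ultimately show ?thesis by auto
  qed
  finally show ?thesis by simp
qed

text \<open>The common shift \<open>\<eta>\<close> leaves two independent frequencies, and the
  double integral exposes all four arguments to the weight at once.\<close>

lemma corr_mult_corr:
  fixes a b e c :: "'a::euclidean_space \<Rightarrow> real"
  assumes [measurable]: "a \<in> borel_measurable borel" "b \<in> borel_measurable borel" "e \<in> borel_measurable borel" "c \<in> borel_measurable borel"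
  shows "corr a b \<eta> * corr e c \<eta> = (\<integral>\<^sup>+p. \<integral>\<^sup>+q. ennreal (a (p + \<eta>) * b p) * ennreal (e (q + \<eta>) * c q) \<partial>lborel \<partial>lborel)"
proof -
  have "corr a b \<eta> * corr e c \<eta> = (\<integral>\<^sup>+p. ennreal (a (p + \<eta>) * b p) * corr e c \<eta> \<partial>lborel)"
    unfolding corr_def[of a b] by (rule nn_integral_multc[symmetric]) measurable
  also have "\<dots> = (\<integral>\<^sup>+p. \<integral>\<^sup>+q. ennreal (a (p + \<eta>) * b p) * ennreal (e (q + \<eta>) * c q) \<partial>lborel \<partial>lborel)"
    unfolding corr_def by (intro nn_integral_cong nn_integral_cmult[symmetric]) measurable
  finally show ?thesis .
qed

text \<open>The frequencies satisfy \<open>q + \<eta> = (p + \<eta>) - p + q\<close>; this is the fractional Leibniz rule.\<close>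

lemma spectral_form_weight_le:
  fixes a b c g :: "'a::euclidean_space \<Rightarrow> real"
  assumes [measurable]: "a \<in> borel_measurable borel" "b \<in> borel_measurable borel" "c \<in> borel_measurable borel" "g \<in> borel_measurable borel"
    and nn: "\<And>x. 0 \<le> a x" "\<And>x. 0 \<le> b x" "\<And>x. 0 \<le> c x" "\<And>x. 0 \<le> g x" and s: "0 \<le> s"
  defines "J \<equiv> \<lambda>\<xi>::'a. japanese_bracket \<xi> powr s"
  shows "spectral_form lam a b c (\<lambda>\<xi>. J \<xi> * g \<xi>) \<le> ennreal (3 powr s) *
    (spectral_form lam (\<lambda>\<xi>. J \<xi> * a \<xi>) b c g + spectral_form lam a (\<lambda>\<xi>. J \<xi> * b \<xi>) c g + spectral_form lam a b (\<lambda>\<xi>. J \<xi> * c \<xi>) g)"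
proof -
  have [measurable]: "J \<in> borel_measurable borel" unfolding J_def by measurable
  have J0: "0 \<le> J x" for x by (simp add: J_def)
  let ?k = "\<lambda>\<eta>::'a. ennreal (norm \<eta> powr (lam - DIM('a)))"
  let ?A = "\<lambda>\<eta>. corr (\<lambda>\<xi>. J \<xi> * a \<xi>) b \<eta> * corr g c \<eta>"
  let ?B = "\<lambda>\<eta>. corr a (\<lambda>\<xi>. J \<xi> * b \<xi>) \<eta> * corr g c \<eta>"
  let ?C = "\<lambda>\<eta>. corr a b \<eta> * corr g (\<lambda>\<xi>. J \<xi> * c \<xi>) \<eta>"
  have pt: "corr a b \<eta> * corr (\<lambda>\<xi>. J \<xi> * g \<xi>) c \<eta> \<le> ennreal (3 powr s) * (?A \<eta> + ?B \<eta> + ?C \<eta>)" for \<eta>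
  proof -
    let ?f1 = "\<lambda>p q. ennreal (J (p + \<eta>) * a (p + \<eta>) * b p) * ennreal (g (q + \<eta>) * c q)"
    let ?f2 = "\<lambda>p q. ennreal (a (p + \<eta>) * (J p * b p)) * ennreal (g (q + \<eta>) * c q)"
    let ?f3 = "\<lambda>p q. ennreal (a (p + \<eta>) * b p) * ennreal (g (q + \<eta>) * (J q * c q))"
    have le: "ennreal (a (p + \<eta>) * b p) * ennreal (J (q + \<eta>) * g (q + \<eta>) * c q)
        \<le> ennreal (3 powr s) * (?f1 p q + ?f2 p q + ?f3 p q)" for p q
    proof -
      define r where "r = a (p + \<eta>) * b p * (g (q + \<eta>) * c q)"
      have r: "0 \<le> r" by (simp add: r_def nn)
      have "J (q + \<eta>) \<le> 3 powr s * (J (p + \<eta>) + J p + J q)"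
        using japanese_bracket_powr_sum3[OF s, of "p + \<eta>" p q] by (simp add: J_def add.commute)
      then have "J (q + \<eta>) * r \<le> 3 powr s * (J (p + \<eta>) + J p + J q) * r" using r by (rule mult_right_mono)
      then have "ennreal (J (q + \<eta>) * r) \<le> ennreal (3 powr s * (J (p + \<eta>) + J p + J q) * r)" by (rule ennreal_leI)
      also have "3 powr s * (J (p + \<eta>) + J p + J q) * r = 3 powr s * (J (p + \<eta>) * r + J p * r + J q * r)"
        by (simp add: algebra_simps)
      also have "ennreal \<dots> = ennreal (3 powr s) * (ennreal (J (p + \<eta>) * r) + ennreal (J p * r) + ennreal (J q * r))"
        using r J0 by (simp add: ennreal_mult')
      also have "ennreal (J (p + \<eta>) * r) = ?f1 p q"
        using nn J0 by (simp add: r_def ennreal_mult'[symmetric] mult_ac)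
      also have "ennreal (J p * r) = ?f2 p q"
        using nn J0 by (simp add: r_def ennreal_mult'[symmetric] mult_ac)
      also have "ennreal (J q * r) = ?f3 p q"
        using nn J0 by (simp add: r_def ennreal_mult'[symmetric] mult_ac)
      finally show ?thesis using nn J0 by (simp add: r_def ennreal_mult'[symmetric] mult_ac)
    qed
    have "corr a b \<eta> * corr (\<lambda>\<xi>. J \<xi> * g \<xi>) c \<eta> = (\<integral>\<^sup>+p. \<integral>\<^sup>+q. ennreal (a (p + \<eta>) * b p) * ennreal (J (q + \<eta>) * g (q + \<eta>) * c q) \<partial>lborel \<partial>lborel)"
      by (rule corr_mult_corr) measurable
    also have "\<dots> \<le> (\<integral>\<^sup>+p. \<integral>\<^sup>+q. ennreal (3 powr s) * (?f1 p q + ?f2 p q + ?f3 p q) \<partial>lborel \<partial>lborel)"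
      by (intro nn_integral_mono le)
    also have "\<dots> = (\<integral>\<^sup>+p. ennreal (3 powr s) * ((\<integral>\<^sup>+q. ?f1 p q \<partial>lborel) + (\<integral>\<^sup>+q. ?f2 p q \<partial>lborel) + (\<integral>\<^sup>+q. ?f3 p q \<partial>lborel)) \<partial>lborel)"
      by (intro nn_integral_cong, subst nn_integral_cmult, measurable, subst nn_integral_add, measurable, subst nn_integral_add, measurable)
    also have "\<dots> = ennreal (3 powr s) * ((\<integral>\<^sup>+p. \<integral>\<^sup>+q. ?f1 p q \<partial>lborel \<partial>lborel) + (\<integral>\<^sup>+p. \<integral>\<^sup>+q. ?f2 p q \<partial>lborel \<partial>lborel) + (\<integral>\<^sup>+p. \<integral>\<^sup>+q. ?f3 p q \<partial>lborel \<partial>lborel))"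
      by (subst nn_integral_cmult, measurable, subst nn_integral_add, measurable, subst nn_integral_add, measurable)
    also have "\<dots> = ennreal (3 powr s) * (?A \<eta> + ?B \<eta> + ?C \<eta>)"
      by (subst (1 2 3) corr_mult_corr) (auto intro!: arg_cong2[where f = "(+)"] simp: mult.assoc)
    finally show ?thesis .
  qed
  have "spectral_form lam a b c (\<lambda>\<xi>. J \<xi> * g \<xi>) \<le> (\<integral>\<^sup>+\<eta>. ennreal (3 powr s) * (?k \<eta> * ?A \<eta> + ?k \<eta> * ?B \<eta> + ?k \<eta> * ?C \<eta>) \<partial>lborel)"
    unfolding spectral_form_def
  proof (rule nn_integral_mono)
    fix \<eta> :: 'a
    have "?k \<eta> * (corr a b \<eta> * corr (\<lambda>\<xi>. J \<xi> * g \<xi>) c \<eta>) \<le> ?k \<eta> * (ennreal (3 powr s) * (?A \<eta> + ?B \<eta> + ?C \<eta>))"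
      by (intro mult_left_mono pt) simp
    then show "?k \<eta> * (corr a b \<eta> * corr (\<lambda>\<xi>. J \<xi> * g \<xi>) c \<eta>) \<le> ennreal (3 powr s) * (?k \<eta> * ?A \<eta> + ?k \<eta> * ?B \<eta> + ?k \<eta> * ?C \<eta>)"
      by (simp only: distrib_left mult.left_commute)
  qed
  also have "\<dots> = ennreal (3 powr s) * ((\<integral>\<^sup>+\<eta>. ?k \<eta> * ?A \<eta> \<partial>lborel) + (\<integral>\<^sup>+\<eta>. ?k \<eta> * ?B \<eta> \<partial>lborel) + (\<integral>\<^sup>+\<eta>. ?k \<eta> * ?C \<eta> \<partial>lborel))"
    by (subst nn_integral_cmult, measurable, subst nn_integral_add, measurable, subst nn_integral_add, measurable)
  finally show ?thesis unfolding spectral_form_def .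
qed

lemma corr_cong_AE:
  fixes a b a' b' :: "'a::euclidean_space \<Rightarrow> real"
  assumes "AE x in lborel. a x = a' x" "AE x in lborel. b x = b' x"
  shows "corr a b = corr a' b'"
  unfolding corr_def
proof (intro ext nn_integral_cong_AE)
  fix \<eta> :: 'a
  show "AE \<zeta> in lborel. ennreal (a (\<zeta> + \<eta>) * b \<zeta>) = ennreal (a' (\<zeta> + \<eta>) * b' \<zeta>)"
    using AE_lborel_translate[OF assms(1), of \<eta>] assms(2) by eventually_elim simp
qed

lemma spectral_form_cong_AE:
  assumes "AE x in lborel. a x = a' x" "AE x in lborel. b x = b' x" "AE x in lborel. c x = c' x" "AE x in lborel. e x = e' x"
  shows "spectral_form lam a b c e = spectral_form lam a' b' c' e'"
  unfolding spectral_form_def corr_cong_AE[OF assms(1,2)] corr_cong_AE[OF assms(4,3)] ..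

text \<open>Discards the phases of a transform: applied to \<open>spec u\<close> it yields a
  function with the same Sobolev norm as \<open>u\<close> and nonnegative transform, in general with
  nothing else in common with \<open>u\<close>.\<close>

definition of_spec :: "('a::euclidean_space \<Rightarrow> real) \<Rightarrow> 'a L2" where
  "of_spec a = inv_fourier (to_L2 (\<lambda>\<xi>. of_real (a \<xi>)))"

lemma of_spec:
  fixes a :: "'a::euclidean_space \<Rightarrow> real"
  assumes sq: "square_integrable (\<lambda>\<xi>. complex_of_real (a \<xi>))" and nn: "\<And>\<xi>. 0 \<le> a \<xi>"
  shows "AE \<xi> in lborel. spec (of_spec a) \<xi> = a \<xi>" "pos_spec (of_spec a)"
    "ennreal ((norm (of_spec a))\<^sup>2) = (\<integral>\<^sup>+\<xi>. ennreal ((a \<xi>)\<^sup>2) \<partial>lborel)"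
proof -
  have f: "fourier (of_spec a) = to_L2 (\<lambda>\<xi>. of_real (a \<xi>))" by (simp add: of_spec_def)
  have ae: "AE \<xi> in lborel. L2_fun (fourier (of_spec a)) \<xi> = of_real (a \<xi>)"
    unfolding f by (rule L2_fun_to_L2[OF sq])
  then show s: "AE \<xi> in lborel. spec (of_spec a) \<xi> = a \<xi>"
    by eventually_elim (simp add: spec_def nn)
  show "pos_spec (of_spec a)"
    unfolding pos_spec_def using ae s by eventually_elim simp
  have "norm (of_spec a) = norm (to_L2 (\<lambda>\<xi>. complex_of_real (a \<xi>)))" by (simp add: of_spec_def)
  then show "ennreal ((norm (of_spec a))\<^sup>2) = (\<integral>\<^sup>+\<xi>. ennreal ((a \<xi>)\<^sup>2) \<partial>lborel)"
    using nn_norm_to_L2_square[OF sq] by simp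
qed

subsection \<open>Truncated Sobolev norms\<close>

definition cutoff_weight :: "real \<Rightarrow> nat \<Rightarrow> 'a::euclidean_space \<Rightarrow> real" where
  "cutoff_weight s n \<xi> = indicator (cball 0 (real n)) \<xi> * japanese_bracket \<xi> powr s"

text \<open>The result stays on the frequency side. Each cutoff is bounded on L2 and the H^s norm is
  their supremum over \<open>n\<close>, so H^s bounds pass through limits and integrals in L2 with
  no prior knowledge that the outcome lies in H^s.\<close>

definition sobolev_cutoff :: "real \<Rightarrow> nat \<Rightarrow> 'a::euclidean_space L2 \<Rightarrow> 'a L2" where
  "sobolev_cutoff s n f = L2_mult (\<lambda>\<xi>. of_real (cutoff_weight s n \<xi>)) (fourier f)"

lemma measurable_cutoff_weight [measurable]: "cutoff_weight s n \<in> borel_measurable borel"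
proof -
  have [measurable]: "cball (0::'a) (real n) \<in> sets borel" by (simp add: borel_closed)
  show "(cutoff_weight s n :: 'a \<Rightarrow> real) \<in> borel_measurable borel" unfolding cutoff_weight_def by measurable
qed

lemma cutoff_weight_nonneg: "0 \<le> cutoff_weight s n \<xi>"
  by (simp add: cutoff_weight_def)

lemma cutoff_weight_le:
  assumes s: "0 \<le> s"
  shows "cutoff_weight s n \<xi> \<le> sqrt (1 + (real n)\<^sup>2) powr s"
proof (cases "norm \<xi> \<le> real n")
  case True
  then have "japanese_bracket \<xi> \<le> sqrt (1 + (real n)\<^sup>2)"
    unfolding japanese_bracket_def by (intro real_sqrt_le_mono add_left_mono power_mono) auto
  then have "japanese_bracket \<xi> powr s \<le> sqrt (1 + (real n)\<^sup>2) powr s"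
    using s japanese_bracket_ge_one[of \<xi>] by (intro powr_mono2) auto
  then show ?thesis using True by (simp add: cutoff_weight_def)
qed (simp add: cutoff_weight_def)

lemma bounded_multiplier_cutoff:
  assumes s: "0 \<le> s"
  shows "bounded_multiplier (\<lambda>\<xi>. of_real (cutoff_weight s n \<xi>)) (sqrt (1 + (real n)\<^sup>2) powr s)"
proof
  show "cmod (of_real (cutoff_weight s n \<xi>)) \<le> sqrt (1 + (real n)\<^sup>2) powr s" for \<xi> :: 'a
    using cutoff_weight_le[OF s, of n \<xi>] cutoff_weight_nonneg[of s n \<xi>] by simp
qed measurable

lemma bounded_linear_sobolev_cutoff:
  assumes s: "0 \<le> s"
  shows "bounded_linear (sobolev_cutoff s n)"
  unfolding sobolev_cutoff_def[abs_def]
  by (rule bounded_linear_compose[OF bounded_multiplier.bounded_linear_mult[OF bounded_multiplier_cutoff[OF s]] bounded_linear_fourier])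

lemma nn_norm_sobolev_cutoff:
  assumes s: "0 \<le> s"
  shows "ennreal ((norm (sobolev_cutoff s n f))\<^sup>2) = (\<integral>\<^sup>+\<xi>. ennreal ((cutoff_weight s n \<xi> * spec f \<xi>)\<^sup>2) \<partial>lborel)"
proof -
  have sq: "square_integrable (\<lambda>\<xi>. of_real (cutoff_weight s n \<xi>) * L2_fun (fourier f) \<xi>)"
    by (rule bounded_multiplier.square_integrable_mult[OF bounded_multiplier_cutoff[OF s]]) simp
  show ?thesis
    unfolding sobolev_cutoff_def L2_mult_def nn_norm_to_L2_square[OF sq]
    by (simp add: norm_mult spec_def abs_of_nonneg cutoff_weight_nonneg)
qed

lemma sobolev_cutoff_le:
  assumes s: "0 \<le> s" and f: "f \<in> sobolev_space s"
  shows "norm (sobolev_cutoff s n f) \<le> sobolev_norm s f"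
proof -
  have "ennreal ((norm (sobolev_cutoff s n f))\<^sup>2) \<le> ennreal ((sobolev_norm s f)\<^sup>2)"
    unfolding nn_norm_sobolev_cutoff[OF s] nn_sobolev_norm_square[OF f, symmetric]
    by (intro nn_integral_mono ennreal_leI power_mono mult_right_mono)
      (auto simp: cutoff_weight_def indicator_def)
  then have "(norm (sobolev_cutoff s n f))\<^sup>2 \<le> (sobolev_norm s f)\<^sup>2" by (simp add: ennreal_le_iff)
  then show ?thesis by (rule power2_le_imp_le) simp
qed

text \<open>Fatou's lemma: at each frequency the truncated weight equals the full one from some
  \<open>n\<close> on.\<close>

lemma sobolev_cutoffI:
  assumes s: "0 \<le> s" and B: "0 \<le> B" and le: "\<And>n. norm (sobolev_cutoff s n f) \<le> B"
  shows "f \<in> sobolev_space s" "sobolev_norm s f \<le> B"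
proof -
  have "(\<integral>\<^sup>+\<xi>. ennreal ((japanese_bracket \<xi> powr s * spec f \<xi>)\<^sup>2) \<partial>lborel)
      = (\<integral>\<^sup>+\<xi>. liminf (\<lambda>n. ennreal ((cutoff_weight s n \<xi> * spec f \<xi>)\<^sup>2)) \<partial>lborel)"
  proof (rule nn_integral_cong)
    fix \<xi> :: 'a
    obtain n0 :: nat where n0: "norm \<xi> \<le> real n0" using real_arch_simple by blast
    have "\<forall>\<^sub>F n in sequentially. ennreal ((cutoff_weight s n \<xi> * spec f \<xi>)\<^sup>2) = ennreal ((japanese_bracket \<xi> powr s * spec f \<xi>)\<^sup>2)"
      using eventually_ge_at_top[of n0]
    proof eventually_elim
      case (elim n)
      then have "real n0 \<le> real n" by simp
      with n0 have "norm \<xi> \<le> real n" by linarith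
      then show ?case by (simp add: cutoff_weight_def)
    qed
    then have "(\<lambda>n. ennreal ((cutoff_weight s n \<xi> * spec f \<xi>)\<^sup>2)) \<longlonglongrightarrow> ennreal ((japanese_bracket \<xi> powr s * spec f \<xi>)\<^sup>2)"
      by (rule tendsto_eventually)
    then show "ennreal ((japanese_bracket \<xi> powr s * spec f \<xi>)\<^sup>2) = liminf (\<lambda>n. ennreal ((cutoff_weight s n \<xi> * spec f \<xi>)\<^sup>2))"
      by (intro lim_imp_Liminf[symmetric]) auto
  qed
  also have "\<dots> \<le> liminf (\<lambda>n. \<integral>\<^sup>+\<xi>. ennreal ((cutoff_weight s n \<xi> * spec f \<xi>)\<^sup>2) \<partial>lborel)"
    by (rule nn_integral_liminf) measurable
  also have "\<dots> \<le> ennreal (B\<^sup>2)"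
  proof (rule order_trans[OF Liminf_le_Limsup Limsup_bounded])
    show "\<forall>\<^sub>F n in sequentially. (\<integral>\<^sup>+\<xi>. ennreal ((cutoff_weight s n \<xi> * spec f \<xi>)\<^sup>2) \<partial>lborel) \<le> ennreal (B\<^sup>2)"
      unfolding nn_norm_sobolev_cutoff[OF s, symmetric]
      by (intro always_eventually allI ennreal_leI power_mono le) simp
  qed simp
  finally have *: "(\<integral>\<^sup>+\<xi>. ennreal ((cmod (sobolev_weighted s f \<xi>))\<^sup>2) \<partial>lborel) \<le> ennreal (B\<^sup>2)"
    by (simp add: cmod_sobolev_weighted)
  show "f \<in> sobolev_space s"
    unfolding sobolev_space_def mem_Collect_eq
    by (rule nn_integral_le_square_imp_square_integrable[OF measurable_sobolev_weighted *])
  show "sobolev_norm s f \<le> B"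
    unfolding sobolev_norm_def by (rule norm_to_L2_le[OF B *])
qed

lemma sobolev_spec_cong:
  assumes u: "u \<in> sobolev_space s" and ae: "AE \<xi> in lborel. spec v \<xi> = spec u \<xi>"
  shows "v \<in> sobolev_space s" "sobolev_norm s v = sobolev_norm s u"
proof -
  have eq: "(\<integral>\<^sup>+\<xi>. ennreal ((japanese_bracket \<xi> powr s * spec v \<xi>)\<^sup>2) \<partial>lborel) = ennreal ((sobolev_norm s u)\<^sup>2)"
    unfolding nn_sobolev_norm_square[OF u, symmetric]
    by (rule nn_integral_cong_AE) (use ae in eventually_elim, simp)
  then have "(\<integral>\<^sup>+\<xi>. ennreal ((cmod (sobolev_weighted s v \<xi>))\<^sup>2) \<partial>lborel) \<le> ennreal ((sobolev_norm s u)\<^sup>2)"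
    by (simp add: cmod_sobolev_weighted)
  then show v: "v \<in> sobolev_space s"
    unfolding sobolev_space_def mem_Collect_eq
    by (rule nn_integral_le_square_imp_square_integrable[OF measurable_sobolev_weighted])
  show "sobolev_norm s v = sobolev_norm s u"
    using eq unfolding nn_sobolev_norm_square[OF v] by (simp add: ennreal_inj)
qed

section \<open>The cubic estimate in H^s\<close>

context hartree_setting
begin

lemma s_nonneg: "0 \<le> s"
  using lam s by linarith

text \<open>Duality: pairing \<open>hartree lam u\<close> with the \<open>z\<close> whose transform is the truncation of
  \<open>\<langle>\<xi>\<rangle> powr (2 s)\<close> times that of \<open>hartree lam u\<close> gives the square of the truncated Sobolev
  norm.\<close>

theorem hartree_sobolev:
  assumes lamd: "lam < DIM('a)"
  obtains K where "K \<ge> 0" "\<And>u :: 'a L2. u \<in> sobolev_space s \<Longrightarrow>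
    hartree lam u \<in> sobolev_space s \<and> sobolev_norm s (hartree lam u) \<le> K * (sobolev_norm s u) ^ 3"
proof -
  obtain C1 where C1: "C1 \<ge> 0" "\<And>u z :: 'a L2. u \<in> sobolev_space s \<Longrightarrow>
    ennreal (cmod (LINT x|lborel. of_real (V u x) * (L2_fun u x * cnj (L2_fun z x))))
    \<le> ennreal C1 * spectral_form lam (spec u) (spec u) (spec u) (spec z)"
    using hartree_pairing_le[OF lamd] by blast
  obtain C2 where C2: "C2 \<ge> 0" "\<And>u v w z :: 'a L2. pos_spec u \<Longrightarrow> pos_spec v \<Longrightarrow> pos_spec w \<Longrightarrow> pos_spec z \<Longrightarrow>
    spectral_form lam (spec u) (spec v) (spec w) (spec z)
    \<le> ennreal C2 * riesz_form lam (\<lambda>y. ennreal (cmod (L2_fun u y) * cmod (L2_fun v y))) (\<lambda>x. ennreal (cmod (L2_fun w x) * cmod (L2_fun z x)))"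
    using spectral_form_le_riesz_form[OF lam lamd] by blast
  \<comment> \<open>\<open>C1\<close> comes from the passage to frequencies, \<open>3 powr s\<close>
    from splitting the weight, 3 from the number of terms, \<open>C2\<close> from the return to
    space and \<open>H\<close> from Hardy's inequality.\<close>
  define K where "K = C1 * 3 powr s * (3 * C2 * H)"
  have K: "K \<ge> 0" using C1 C2 H by (simp add: K_def)
  have main: "norm (sobolev_cutoff s n (hartree lam u)) \<le> K * (sobolev_norm s u) ^ 3"
    if u: "u \<in> sobolev_space s" for u :: "'a L2" and n
  proof -
    let ?f = "hartree lam u" and ?N = "sobolev_norm s u"
    let ?J = "\<lambda>\<xi>::'a. japanese_bracket \<xi> powr s"
    let ?c = "cutoff_weight s n :: 'a \<Rightarrow> real"
    \<comment> \<open>The truncation keeps \<open>g\<close> square integrable, so that its norm is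
      finite before the Hartree term is known to lie in H^s.\<close>
    define g where "g \<xi> = ?c \<xi> * spec ?f \<xi>" for \<xi>
    have gm[measurable]: "g \<in> borel_measurable borel" unfolding g_def by measurable
    have g0: "0 \<le> g \<xi>" for \<xi> by (simp add: g_def cutoff_weight_nonneg)
    interpret c: bounded_multiplier "\<lambda>\<xi>. of_real (?c \<xi>)" "sqrt (1 + (real n)\<^sup>2) powr s"
      by (rule bounded_multiplier_cutoff[OF s_nonneg])
    have sqg: "square_integrable (\<lambda>\<xi>. complex_of_real (g \<xi>))"
      by (rule square_integrable_mono[OF c.square_integrable_mult[OF square_integrable_L2_fun[of "fourier ?f"]]])
        (measurable, simp add: g_def norm_mult spec_def)
    have sqJ: "square_integrable (\<lambda>\<xi>. complex_of_real (?J \<xi> * spec u \<xi>))"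
      by (rule square_integrable_mono[of "sobolev_weighted s u"])
        (use u in \<open>auto simp: sobolev_space_def cmod_sobolev_weighted abs_mult norm_mult\<close>)
    have squ: "square_integrable (\<lambda>\<xi>. complex_of_real (spec u \<xi>))"
      by (rule square_integrable_mono[OF square_integrable_L2_fun[of "fourier u"]]) (measurable, simp add: spec_def)
    \<comment> \<open>With \<open>p\<close> for \<open>u\<close>, \<open>pJ\<close> for the weighted
      \<open>u\<close> and \<open>pg\<close> for \<open>g\<close>, all transforms are nonnegative,
      as the return to space demands, and no norm has changed.\<close>
    define p where "p = of_spec (spec u)"
    define pJ where "pJ = of_spec (\<lambda>\<xi>. ?J \<xi> * spec u \<xi>)"
    define pg where "pg = of_spec g"
    note p = of_spec[OF squ spec_nonneg, folded p_def]
    have pJ: "AE \<xi> in lborel. spec pJ \<xi> = ?J \<xi> * spec u \<xi>" "pos_spec pJ" "ennreal ((norm pJ)\<^sup>2) = ennreal (?N\<^sup>2)"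
      using of_spec[OF sqJ] nn_sobolev_norm_square[OF u] by (simp_all add: pJ_def)
    note pg = of_spec[OF sqg g0, folded pg_def]
    have normJ: "norm pJ = ?N" using pJ(3) by (simp add: ennreal_inj)
    have normg: "norm pg = norm (sobolev_cutoff s n ?f)"
    proof -
      have "ennreal ((norm pg)\<^sup>2) = ennreal ((norm (sobolev_cutoff s n ?f))\<^sup>2)"
        by (simp only: pg(3) nn_norm_sobolev_cutoff[OF s_nonneg] g_def)
      then show ?thesis by (simp add: ennreal_inj)
    qed
    let ?Y = "norm pg"
    have pH: "p \<in> sobolev_space s" "sobolev_norm s p = ?N"
      using sobolev_spec_cong[OF u p(1)] by auto
    define B where "B = ennreal (H * ?N\<^sup>2 * (?N * ?Y))"
    have T: "spectral_form lam (spec u) (spec u) (spec u) (\<lambda>\<xi>. ?J \<xi> * g \<xi>) \<le> ennreal (3 powr s) * (ennreal C2 * B + ennreal C2 * B + ennreal C2 * B)"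
    proof (rule order_trans[OF spectral_form_weight_le], measurable)
      have "spectral_form lam (\<lambda>\<xi>. ?J \<xi> * spec u \<xi>) (spec u) (spec u) g = spectral_form lam (spec pJ) (spec p) (spec p) (spec pg)"
        by (rule spectral_form_cong_AE; (use p(1) pJ(1) pg(1) in eventually_elim, simp))
      also have "\<dots> \<le> ennreal C2 * riesz_form lam (\<lambda>y. ennreal (cmod (L2_fun pJ y) * cmod (L2_fun p y))) (\<lambda>x. ennreal (cmod (L2_fun p x) * cmod (L2_fun pg x)))"
        by (intro C2(2) p pJ pg)
      also have "\<dots> \<le> ennreal C2 * B"
        using riesz_form_quartic_le(1)[OF pH(1), of pJ pg] by (intro mult_left_mono) (simp_all add: pH normJ B_def)
      finally have 1: "spectral_form lam (\<lambda>\<xi>. ?J \<xi> * spec u \<xi>) (spec u) (spec u) g \<le> ennreal C2 * B" .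
      have "spectral_form lam (spec u) (\<lambda>\<xi>. ?J \<xi> * spec u \<xi>) (spec u) g = spectral_form lam (spec p) (spec pJ) (spec p) (spec pg)"
        by (rule spectral_form_cong_AE; (use p(1) pJ(1) pg(1) in eventually_elim, simp))
      also have "\<dots> \<le> ennreal C2 * riesz_form lam (\<lambda>y. ennreal (cmod (L2_fun p y) * cmod (L2_fun pJ y))) (\<lambda>x. ennreal (cmod (L2_fun p x) * cmod (L2_fun pg x)))"
        by (intro C2(2) p pJ pg)
      also have "\<dots> \<le> ennreal C2 * B"
        using riesz_form_quartic_le(1)[OF pH(1), of pJ pg]
        by (intro mult_left_mono) (simp_all add: pH normJ B_def mult.commute[of "cmod (L2_fun p _)" "cmod (L2_fun pJ _)"])
      finally have 2: "spectral_form lam (spec u) (\<lambda>\<xi>. ?J \<xi> * spec u \<xi>) (spec u) g \<le> ennreal C2 * B" .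
      have "spectral_form lam (spec u) (spec u) (\<lambda>\<xi>. ?J \<xi> * spec u \<xi>) g = spectral_form lam (spec p) (spec p) (spec pJ) (spec pg)"
        by (rule spectral_form_cong_AE; (use p(1) pJ(1) pg(1) in eventually_elim, simp))
      also have "\<dots> \<le> ennreal C2 * riesz_form lam (\<lambda>y. ennreal (cmod (L2_fun p y) * cmod (L2_fun p y))) (\<lambda>x. ennreal (cmod (L2_fun pJ x) * cmod (L2_fun pg x)))"
        by (intro C2(2) p pJ pg)
      also have "\<dots> \<le> ennreal C2 * B"
        using riesz_form_quartic_le(2)[OF pH(1), of pJ pg] by (intro mult_left_mono) (simp_all add: pH normJ B_def)
      finally have 3: "spectral_form lam (spec u) (spec u) (\<lambda>\<xi>. ?J \<xi> * spec u \<xi>) g \<le> ennreal C2 * B" .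
      show "ennreal (3 powr s) * (spectral_form lam (\<lambda>\<xi>. ?J \<xi> * spec u \<xi>) (spec u) (spec u) g
          + spectral_form lam (spec u) (\<lambda>\<xi>. ?J \<xi> * spec u \<xi>) (spec u) g + spectral_form lam (spec u) (spec u) (\<lambda>\<xi>. ?J \<xi> * spec u \<xi>) g)
          \<le> ennreal (3 powr s) * (ennreal C2 * B + ennreal C2 * B + ennreal C2 * B)"
        by (intro mult_left_mono add_mono 1 2 3) simp
    qed (auto simp: g0 s_nonneg)
    let ?m = "\<lambda>\<xi>. complex_of_real (?c \<xi>)"
    \<comment> \<open>Applying the multiplier twice makes the pairing with the Hartree term equal to
      the integral of the square of \<open>g\<close>; on the other hand \<open>spec z\<close> is the
      full weight times \<open>g\<close>, because the indicator is idempotent.\<close>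
    define z where "z = inv_fourier (L2_mult ?m (L2_mult ?m (fourier ?f)))"
    have fz: "AE \<xi> in lborel. L2_fun (fourier z) \<xi> = ?m \<xi> * (?m \<xi> * L2_fun (fourier ?f) \<xi>)"
      using c.L2_fun_mult[of "L2_mult ?m (fourier ?f)"] c.L2_fun_mult[of "fourier ?f"]
      by eventually_elim (simp add: z_def)
    have sz: "AE \<xi> in lborel. spec z \<xi> = ?J \<xi> * g \<xi>"
      using fz by eventually_elim
        (auto simp: spec_def g_def norm_mult cutoff_weight_def indicator_def)
    have "ennreal (?Y\<^sup>2) = (\<integral>\<^sup>+\<xi>. ennreal ((g \<xi>)\<^sup>2) \<partial>lborel)" by (rule pg(3))
    also have "\<dots> = ennreal (LINT \<xi>|lborel. (g \<xi>)\<^sup>2)"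
      using sqg by (intro nn_integral_eq_integral) (auto simp: square_integrable_def)
    also have "\<dots> \<le> ennreal (cmod (of_real (LINT \<xi>|lborel. (g \<xi>)\<^sup>2)))"
      unfolding norm_of_real by (intro ennreal_leI abs_ge_self)
    also have "of_real (LINT \<xi>|lborel. (g \<xi>)\<^sup>2) = (LINT \<xi>|lborel. complex_of_real ((g \<xi>)\<^sup>2))"
      by (rule integral_complex_of_real[symmetric])
    also have "\<dots> = (LINT \<xi>|lborel. L2_fun (fourier ?f) \<xi> * cnj (L2_fun (fourier z) \<xi>))"
    proof (rule integral_cong_AE)
      show "AE \<xi> in lborel. complex_of_real ((g \<xi>)\<^sup>2) = L2_fun (fourier ?f) \<xi> * cnj (L2_fun (fourier z) \<xi>)"
        using fz
      proof eventually_elim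
        case (elim \<xi>)
        have "(g \<xi>)\<^sup>2 = (?c \<xi>)\<^sup>2 * (cmod (L2_fun (fourier ?f) \<xi>))\<^sup>2" by (simp add: g_def spec_def power_mult_distrib)
        then have "complex_of_real ((g \<xi>)\<^sup>2) = of_real ((?c \<xi>)\<^sup>2) * (L2_fun (fourier ?f) \<xi> * cnj (L2_fun (fourier ?f) \<xi>))"
          by (simp only: of_real_mult complex_norm_square)
        then show ?case unfolding elim by (simp add: power2_eq_square)
      qed
    qed measurable
    also have "\<dots> = (LINT x|lborel. L2_fun ?f x * cnj (L2_fun z x))" by (rule fourier_parseval)
    also have "\<dots> = (LINT x|lborel. of_real (V u x) * (L2_fun u x * cnj (L2_fun z x)))"
    proof (rule integral_cong_AE)
      show "AE x in lborel. L2_fun ?f x * cnj (L2_fun z x) = of_real (V u x) * (L2_fun u x * cnj (L2_fun z x))"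
        using L2_fun_to_L2[OF square_integrable_hartree[OF u]] unfolding hartree_eq by eventually_elim simp
    qed measurable
    also have "ennreal (cmod \<dots>) \<le> ennreal C1 * spectral_form lam (spec u) (spec u) (spec u) (spec z)"
      by (rule C1(2)[OF u])
    also have "spectral_form lam (spec u) (spec u) (spec u) (spec z) = spectral_form lam (spec u) (spec u) (spec u) (\<lambda>\<xi>. ?J \<xi> * g \<xi>)"
      by (rule spectral_form_cong_AE) (use sz in auto)
    also have "ennreal C1 * \<dots> \<le> ennreal C1 * (ennreal (3 powr s) * (ennreal C2 * B + ennreal C2 * B + ennreal C2 * B))"
      by (intro mult_left_mono T) simp
    also have "\<dots> = ennreal (C1 * (3 powr s * (3 * (C2 * (H * ?N\<^sup>2 * (?N * ?Y))))))"
    proof -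
      have "ennreal C2 * B + ennreal C2 * B + ennreal C2 * B = ennreal (3 * (C2 * (H * ?N\<^sup>2 * (?N * ?Y))))"
      proof -
        have "ennreal C2 * B = ennreal (C2 * (H * ?N\<^sup>2 * (?N * ?Y)))" unfolding B_def using C2 by (simp add: ennreal_mult')
        moreover have "0 \<le> C2 * (H * ?N\<^sup>2 * (?N * ?Y))" using C2 H by simp
        ultimately show ?thesis by (simp only: ennreal_plus[symmetric] add_nonneg_nonneg) (simp add: mult_ac)
      qed
      then show ?thesis using C1 by (simp only: ennreal_mult'[symmetric] powr_ge_zero)
    qed
    also have "C1 * (3 powr s * (3 * (C2 * (H * ?N\<^sup>2 * (?N * ?Y))))) = K * ?N ^ 3 * ?Y"
      by (simp add: K_def power2_eq_square power3_eq_cube)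
    finally have "?Y\<^sup>2 \<le> K * ?N ^ 3 * ?Y" using K by (simp add: ennreal_le_iff)
    \<comment> \<open>The quadratic inequality is divided by \<open>?Y\<close>, which is finite
      thanks to the truncation; the outcome no longer depends on \<open>n\<close>.\<close>
    then have "?Y \<le> K * ?N ^ 3"
      by (cases "?Y = 0") (use K in \<open>auto simp: power2_eq_square\<close>)
    then show ?thesis by (simp add: normg)
  qed
  have "hartree lam u \<in> sobolev_space s \<and> sobolev_norm s (hartree lam u) \<le> K * (sobolev_norm s u) ^ 3"
    if u: "u \<in> sobolev_space s" for u :: "'a L2"
    using sobolev_cutoffI[OF s_nonneg _ main[OF u]] K by simp
  with K show thesis using that by blast
qed

end

section \<open>Integral equations in a Banach space\<close>

text \<open>A single primitive, taken from the left end of the interval, serves both orientations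
  and later gives continuity and additivity without cases.\<close>

lemma oriented_integral_eq_diff:
  fixes f :: "real \<Rightarrow> 'b::banach"
  assumes f: "continuous_on {A..B} f" and x: "x \<in> {A..B}" and y: "y \<in> {A..B}"
  shows "oriented_integral x y f = integral {A..y} f - integral {A..x} f"
proof -
  have *: "integral {A..p} f + integral {p..q} f = integral {A..q} f" if "A \<le> p" "p \<le> q" "q \<le> B" for p q
    using that by (intro Henstock_Kurzweil_Integration.integral_combine integrable_continuous_interval continuous_on_subset[OF f]) auto
  show ?thesis
  proof (cases "x \<le> y")
    case True
    then show ?thesis using *[of x y] x y by (simp add: oriented_integral_def eq_diff_eq add.commute)
  next
    case False
    then show ?thesis using *[of y x] x y by (simp add: oriented_integral_def algebra_simps)
  qed
qed

lemma continuous_on_oriented_integral: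
  fixes f :: "real \<Rightarrow> 'b::banach"
  assumes f: "continuous_on {A..B} f" and x: "x \<in> {A..B}"
  shows "continuous_on {A..B} (\<lambda>t. oriented_integral x t f)"
proof -
  have "continuous_on {A..B} (\<lambda>t. integral {A..t} f - integral {A..x} f)"
    by (intro continuous_on_diff indefinite_integral_continuous_1 integrable_continuous_interval f continuous_on_const)
  then show ?thesis by (rule continuous_on_eq) (simp add: oriented_integral_eq_diff[OF f x])
qed

lemma closed_segment_subset_Icc:
  fixes x y :: real
  assumes "x \<in> {A..B}" "y \<in> {A..B}"
  shows "closed_segment x y \<subseteq> {A..B}"
  using assms by (auto simp: closed_segment_eq_real_ivl)

lemma oriented_integral_cong:
  assumes "\<And>r. r \<in> closed_segment x y \<Longrightarrow> f r = g r"
  shows "oriented_integral x y f = oriented_integral x y g"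
  unfolding oriented_integral_def using assms
  by (auto simp: closed_segment_eq_real_ivl intro!: Henstock_Kurzweil_Integration.integral_cong)

lemma oriented_integral_bounded_linear:
  fixes f :: "real \<Rightarrow> 'b::banach" and h :: "'b \<Rightarrow> 'c::banach"
  assumes f: "continuous_on (closed_segment x y) f" and h: "bounded_linear h"
  shows "oriented_integral x y (\<lambda>r. h (f r)) = h (oriented_integral x y f)"
proof -
  have *: "integral {p..q} (\<lambda>r. h (f r)) = h (integral {p..q} f)" if "continuous_on {p..q} f" for p q
    using integral_linear[OF integrable_continuous_interval[OF that] h] by (simp add: o_def)
  show ?thesis
    using f by (auto simp: oriented_integral_def closed_segment_eq_real_ivl * linear_neg[OF bounded_linear.linear[OF h]])
qed

lemma oriented_integral_diff:
  fixes f g :: "real \<Rightarrow> 'b::banach"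
  assumes "continuous_on (closed_segment x y) f" "continuous_on (closed_segment x y) g"
  shows "oriented_integral x y f - oriented_integral x y g = oriented_integral x y (\<lambda>r. f r - g r)"
proof -
  have *: "integral {p..q} (\<lambda>r. f r - g r) = integral {p..q} f - integral {p..q} g"
    if "continuous_on {p..q} f" "continuous_on {p..q} g" for p q
    using that by (intro Henstock_Kurzweil_Integration.integral_diff integrable_continuous_interval)
  show ?thesis
    using assms by (auto simp: oriented_integral_def closed_segment_eq_real_ivl *)
qed

text \<open>\<open>n = 0\<close> is the usual bound; higher powers are what the iterated Gronwall
  argument produces, as each integration raises the exponent by 1.\<close>

lemma norm_oriented_integral_power_le:
  fixes f :: "real \<Rightarrow> 'b::banach"
  assumes f: "continuous_on (closed_segment x y) f"
    and bd: "\<And>r. r \<in> closed_segment x y \<Longrightarrow> norm (f r) \<le> c * \<bar>r - x\<bar> ^ n"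
  shows "norm (oriented_integral x y f) \<le> c * \<bar>y - x\<bar> ^ Suc n / real (Suc n)"
proof (cases "x \<le> y")
  case True
  have "((\<lambda>r. c * (r - x) ^ n) has_integral (c * (y - x) ^ Suc n / real (Suc n) - c * (x - x) ^ Suc n / real (Suc n))) {x..y}"
  proof (rule fundamental_theorem_of_calculus[OF True])
    fix r
    have "((\<lambda>r. c * (r - x) ^ Suc n / real (Suc n)) has_real_derivative c * (r - x) ^ n) (at r within {x..y})"
      by (rule derivative_eq_intros refl | simp)+
    then show "((\<lambda>r. c * (r - x) ^ Suc n / real (Suc n)) has_vector_derivative c * (r - x) ^ n) (at r within {x..y})"
      by (simp only: has_real_derivative_iff_has_vector_derivative)
  qed
  then have g: "((\<lambda>r. c * (r - x) ^ n) has_integral (c * (y - x) ^ Suc n / real (Suc n))) {x..y}" by simp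
  have "norm (integral {x..y} f) \<le> integral {x..y} (\<lambda>r. c * (r - x) ^ n)"
  proof (rule Henstock_Kurzweil_Integration.integral_norm_bound_integral)
    show "f integrable_on {x..y}" using f True by (intro integrable_continuous_interval) (simp add: closed_segment_eq_real_ivl)
    show "(\<lambda>r. c * (r - x) ^ n) integrable_on {x..y}" using g by blast
    show "norm (f r) \<le> c * (r - x) ^ n" if "r \<in> {x..y}" for r
      using bd[of r] that True by (simp add: closed_segment_eq_real_ivl)
  qed
  then show ?thesis using True integral_unique[OF g] by (simp add: oriented_integral_def)
next
  case False
  then have yx: "y \<le> x" by simp
  have "((\<lambda>r. c * (x - r) ^ n) has_integral (- c * (x - x) ^ Suc n / real (Suc n) - (- c * (x - y) ^ Suc n / real (Suc n)))) {y..x}"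
  proof (rule fundamental_theorem_of_calculus[OF yx])
    fix r
    have "((\<lambda>r. - c * (x - r) ^ Suc n / real (Suc n)) has_real_derivative c * (x - r) ^ n) (at r within {y..x})"
      by (rule derivative_eq_intros refl | simp)+
    then show "((\<lambda>r. - c * (x - r) ^ Suc n / real (Suc n)) has_vector_derivative c * (x - r) ^ n) (at r within {y..x})"
      by (simp only: has_real_derivative_iff_has_vector_derivative)
  qed
  then have g: "((\<lambda>r. c * (x - r) ^ n) has_integral (c * (x - y) ^ Suc n / real (Suc n))) {y..x}" by simp
  have "norm (integral {y..x} f) \<le> integral {y..x} (\<lambda>r. c * (x - r) ^ n)"
  proof (rule Henstock_Kurzweil_Integration.integral_norm_bound_integral)
    show "f integrable_on {y..x}" using f False by (intro integrable_continuous_interval) (simp add: closed_segment_eq_real_ivl)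
    show "(\<lambda>r. c * (x - r) ^ n) integrable_on {y..x}" using g by blast
    show "norm (f r) \<le> c * (x - r) ^ n" if "r \<in> {y..x}" for r
      using bd[of r] that False by (simp add: closed_segment_eq_real_ivl)
  qed
  then show ?thesis using False integral_unique[OF g] by (simp add: oriented_integral_def)
qed

lemma norm_oriented_integral_le:
  fixes f :: "real \<Rightarrow> 'b::banach"
  assumes "continuous_on (closed_segment x y) f" and "\<And>r. r \<in> closed_segment x y \<Longrightarrow> norm (f r) \<le> c"
  shows "norm (oriented_integral x y f) \<le> c * \<bar>y - x\<bar>"
  using norm_oriented_integral_power_le[OF assms(1), of c 0] assms(2) by simp

section \<open>Picard iteration and uniqueness for integral equations\<close>

text \<open>The contraction principle for bounded continuous functions with values in
  \<open>D\<close>, a complete set because \<open>D\<close> is closed. Continuity, invariance and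
  the Lipschitz bound are asked on \<open>D\<close> only, so that a ball of a stronger norm, closed
  in the norm of the space, can serve.\<close>

lemma picard_exists:
  fixes g :: "real \<Rightarrow> 'b::banach \<Rightarrow> 'b"
  assumes h: "0 < h" and D: "closed D" and w0: "w0 \<in> D" and L: "0 \<le> L" "L * h < 1"
    and cont: "\<And>w. continuous_on {t0 - h..t0 + h} w \<Longrightarrow> (\<And>t. t \<in> {t0 - h..t0 + h} \<Longrightarrow> w t \<in> D) \<Longrightarrow>
      continuous_on {t0 - h..t0 + h} (\<lambda>r. g r (w r))"
    and maps: "\<And>w t. continuous_on {t0 - h..t0 + h} w \<Longrightarrow> (\<And>t. t \<in> {t0 - h..t0 + h} \<Longrightarrow> w t \<in> D) \<Longrightarrow>
      t \<in> {t0 - h..t0 + h} \<Longrightarrow> w0 + oriented_integral t0 t (\<lambda>r. g r (w r)) \<in> D"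
    and lip: "\<And>r x y. r \<in> {t0 - h..t0 + h} \<Longrightarrow> x \<in> D \<Longrightarrow> y \<in> D \<Longrightarrow> norm (g r x - g r y) \<le> L * norm (x - y)"
  obtains w where "continuous_on {t0 - h..t0 + h} w" "\<And>t. t \<in> {t0 - h..t0 + h} \<Longrightarrow> w t \<in> D"
    "\<And>t. t \<in> {t0 - h..t0 + h} \<Longrightarrow> w t = w0 + oriented_integral t0 t (\<lambda>r. g r (w r))"
proof -
  let ?I = "{t0 - h..t0 + h}"
  have t0: "t0 \<in> ?I" using h by simp
  \<comment> \<open>The functions of the complete space live on the whole line, so times are clamped
    to the interval; beyond either end the iterates are constant.\<close>
  define cl where "cl t = max (t0 - h) (min (t0 + h) t)" for t
  have clI: "cl t \<in> ?I" for t using h by (auto simp: cl_def)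
  have cl_id: "cl t = t" if "t \<in> ?I" for t using that by (auto simp: cl_def)
  have cl_cont: "continuous_on UNIV cl" unfolding cl_def by (intro continuous_intros)
  define \<Psi> where "\<Psi> w t = w0 + oriented_integral t0 (cl t) (\<lambda>r. g r (w r))" for w :: "real \<Rightarrow> 'b" and t
  define S where "S = {w :: real \<Rightarrow>\<^sub>C 'b. \<forall>t. w t \<in> D}"
  have gc: "continuous_on ?I (\<lambda>r. g r (w r))" if "w \<in> S" for w :: "real \<Rightarrow>\<^sub>C 'b"
    using that by (intro cont) (auto simp: S_def)
  have \<Psi>b: "\<Psi> w \<in> bcontfun" if w: "w \<in> S" for w :: "real \<Rightarrow>\<^sub>C 'b"
  proof -
    have c: "continuous_on ?I (\<lambda>t. w0 + oriented_integral t0 t (\<lambda>r. g r (w r)))"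
      by (intro continuous_intros continuous_on_oriented_integral gc w t0)
    then have "bounded ((\<lambda>t. w0 + oriented_integral t0 t (\<lambda>r. g r (w r))) ` ?I)"
      by (intro compact_imp_bounded compact_continuous_image) auto
    then obtain b where b: "\<And>t. t \<in> ?I \<Longrightarrow> norm (w0 + oriented_integral t0 t (\<lambda>r. g r (w r))) \<le> b"
      unfolding bounded_iff by blast
    show ?thesis
    proof (rule bcontfun_normI)
      show "continuous_on UNIV (\<Psi> w)"
        unfolding \<Psi>_def by (rule continuous_on_compose2[OF c cl_cont]) (use clI in auto)
      show "norm (\<Psi> w t) \<le> b" for t unfolding \<Psi>_def by (rule b[OF clI])
    qed
  qed
  have app: "apply_bcontfun (Bcontfun (\<Psi> w)) = \<Psi> w" if "w \<in> S" for w :: "real \<Rightarrow>\<^sub>C 'b"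
    using \<Psi>b[OF that] by (rule Bcontfun_inverse)
  have "\<exists>!w\<in>S. Bcontfun (\<Psi> w) = w"
  proof (rule Banach_fix)
    have "closed S"
    proof -
      have "S = PiC UNIV (\<lambda>_. D)" by (auto simp: S_def mem_PiC_iff Pi_iff)
      then show ?thesis using closed_PiC[of UNIV "\<lambda>_. D"] D by simp
    qed
    then show "complete S" by (simp add: complete_eq_closed)
    show "S \<noteq> {}"
    proof -
      have "const_bcontfun w0 \<in> S" using w0 by (simp add: S_def)
      then show ?thesis by blast
    qed
    show "0 \<le> L * h" "L * h < 1" using L h by auto
    show "(\<lambda>w. Bcontfun (\<Psi> (apply_bcontfun w))) ` S \<subseteq> S"
    proof clarify
      fix w assume w: "w \<in> S"
      have "\<Psi> w t \<in> D" for t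
        unfolding \<Psi>_def using w by (intro maps clI) (auto simp: S_def)
      then show "Bcontfun (\<Psi> w) \<in> S" by (simp add: S_def app[OF w])
    qed
    fix w v assume w: "w \<in> S" and v: "v \<in> S"
    show "dist (Bcontfun (\<Psi> w)) (Bcontfun (\<Psi> v)) \<le> L * h * dist w v"
    proof (rule dist_bound)
      fix t
      have seg: "closed_segment t0 (cl t) \<subseteq> ?I" by (rule closed_segment_subset_Icc[OF t0 clI])
      have cw: "continuous_on (closed_segment t0 (cl t)) (\<lambda>r. g r (w r))" by (rule continuous_on_subset[OF gc[OF w] seg])
      have cv: "continuous_on (closed_segment t0 (cl t)) (\<lambda>r. g r (v r))" by (rule continuous_on_subset[OF gc[OF v] seg])
      have "norm (oriented_integral t0 (cl t) (\<lambda>r. g r (w r) - g r (v r))) \<le> L * dist w v * \<bar>cl t - t0\<bar>"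
      proof (rule norm_oriented_integral_le)
        show "continuous_on (closed_segment t0 (cl t)) (\<lambda>r. g r (w r) - g r (v r))"
          by (intro continuous_on_diff cw cv)
        fix r assume r: "r \<in> closed_segment t0 (cl t)"
        have "norm (g r (w r) - g r (v r)) \<le> L * norm (w r - v r)"
          using r seg w v by (intro lip) (auto simp: S_def)
        also have "\<dots> \<le> L * dist w v"
          using dist_bounded[of w r v] L by (intro mult_left_mono) (auto simp: dist_norm)
        finally show "norm (g r (w r) - g r (v r)) \<le> L * dist w v" .
      qed
      also have "\<dots> \<le> L * dist w v * h"
        using clI[of t] L by (intro mult_left_mono) (auto simp: abs_le_iff)
      finally show "dist (apply_bcontfun (Bcontfun (\<Psi> w)) t) (apply_bcontfun (Bcontfun (\<Psi> v)) t) \<le> L * h * dist w v"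
        unfolding app[OF w] app[OF v] \<Psi>_def dist_norm
        by (simp add: oriented_integral_diff[OF cw cv] mult_ac)
    qed
  qed
  then obtain w where w: "w \<in> S" "Bcontfun (\<Psi> w) = w" by blast
  then have eq: "apply_bcontfun w = \<Psi> w" using app[OF w(1)] by simp
  show thesis
  proof (rule that[of "apply_bcontfun w"])
    show "continuous_on ?I (apply_bcontfun w)" by simp
    show "w t \<in> D" for t using w(1) by (simp add: S_def)
    show "w t = w0 + oriented_integral t0 t (\<lambda>r. g r (w r))" if "t \<in> ?I" for t
    proof -
      have "w t = \<Psi> w t" using eq by metis
      then show ?thesis by (simp only: \<Psi>_def cl_id[OF that])
    qed
  qed
qed

text \<open>Gronwall's argument in iterated form: the \<open>n\<close>-th iteration bounds the difference of two
  solutions by \<open>M (L |t - t0|)\<^sup>n / n!\<close>.\<close>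

lemma integral_equation_unique:
  fixes w v p q :: "real \<Rightarrow> 'b::banach"
  assumes t0: "t0 \<in> {A..B}"
    and w: "continuous_on {A..B} w" and v: "continuous_on {A..B} v"
    and p: "continuous_on {A..B} p" and q: "continuous_on {A..B} q"
    and L: "0 \<le> L" and lip: "\<And>r. r \<in> {A..B} \<Longrightarrow> norm (p r - q r) \<le> L * norm (w r - v r)"
    and weq: "\<And>t. t \<in> {A..B} \<Longrightarrow> w t = w0 + oriented_integral t0 t p"
    and veq: "\<And>t. t \<in> {A..B} \<Longrightarrow> v t = w0 + oriented_integral t0 t q"
    and t: "t \<in> {A..B}"
  shows "w t = v t"
proof -
  have "bounded ((\<lambda>t. w t - v t) ` {A..B})"
    by (intro compact_imp_bounded compact_continuous_image continuous_on_diff w v) auto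
  then obtain M where M: "\<And>r. r \<in> {A..B} \<Longrightarrow> norm (w r - v r) \<le> M"
    unfolding bounded_iff by blast
  have bd: "norm (w r - v r) \<le> M * L ^ n / fact n * \<bar>r - t0\<bar> ^ n" if "r \<in> {A..B}" for r n
    using that
  proof (induction n arbitrary: r)
    case 0
    then show ?case using M by simp
  next
    case (Suc n)
    have seg: "closed_segment t0 r \<subseteq> {A..B}" by (rule closed_segment_subset_Icc[OF t0 Suc.prems])
    have cp: "continuous_on (closed_segment t0 r) p" and cq: "continuous_on (closed_segment t0 r) q"
      by (rule continuous_on_subset[OF _ seg], fact)+
    have "w r - v r = oriented_integral t0 r (\<lambda>x. p x - q x)"
      using weq[OF Suc.prems] veq[OF Suc.prems] oriented_integral_diff[OF cp cq] by simp
    also have "norm \<dots> \<le> (L * (M * L ^ n / fact n)) * \<bar>r - t0\<bar> ^ Suc n / real (Suc n)"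
    proof (rule norm_oriented_integral_power_le)
      show "continuous_on (closed_segment t0 r) (\<lambda>x. p x - q x)" by (intro continuous_on_diff cp cq)
      fix x assume "x \<in> closed_segment t0 r"
      then have x: "x \<in> {A..B}" using seg by blast
      have "norm (p x - q x) \<le> L * norm (w x - v x)" by (rule lip[OF x])
      also have "\<dots> \<le> L * (M * L ^ n / fact n * \<bar>x - t0\<bar> ^ n)" by (intro mult_left_mono Suc.IH x L)
      finally show "norm (p x - q x) \<le> L * (M * L ^ n / fact n) * \<bar>x - t0\<bar> ^ n" by (simp only: mult.assoc)
    qed
    also have "(L * (M * L ^ n / fact n)) * \<bar>r - t0\<bar> ^ Suc n / real (Suc n) = M * L ^ Suc n / fact (Suc n) * \<bar>r - t0\<bar> ^ Suc n"
      by (simp add: field_simps del: of_nat_Suc)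
    finally show ?case .
  qed
  \<comment> \<open>These are multiples of the terms of a convergent exponential series.\<close>
  have "(\<lambda>n. M * ((L * \<bar>t - t0\<bar>) ^ n /\<^sub>R fact n)) \<longlonglongrightarrow> M * 0"
    by (intro tendsto_mult tendsto_const summable_LIMSEQ_zero summable_exp_generic)
  then have "(\<lambda>n. M * L ^ n / fact n * \<bar>t - t0\<bar> ^ n) \<longlonglongrightarrow> 0"
    by (simp add: power_mult_distrib divide_inverse mult_ac)
  then have "norm (w t - v t) \<le> 0"
    by (rule LIMSEQ_le_const) (use bd[OF t] in auto)
  then show ?thesis by simp
qed

section \<open>Evolution operators and Sobolev regularity\<close>

text \<open>The multipliers depend on time only strongly continuously. The increment is split into
  \<open>m (X n)\<close> acting on \<open>x (X n) - x a\<close>, where unimodularity preserves the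
  norm, and \<open>m (X n)\<close> acting on the fixed vector \<open>x a\<close>, where dominated
  convergence applies.\<close>

lemma continuous_on_L2_mult:
  fixes m :: "real \<Rightarrow> 'a::euclidean_space \<Rightarrow> complex"
  assumes m: "\<And>t. m t \<in> borel_measurable borel" and one: "\<And>t \<xi>. cmod (m t \<xi>) = 1"
    and cont: "\<And>\<xi>. continuous_on S (\<lambda>t. m t \<xi>)" and x: "continuous_on S x"
  shows "continuous_on S (\<lambda>t. L2_mult (m t) (x t))"
  unfolding continuous_on_sequentially o_def
proof (intro allI ballI impI)
  fix X a assume X: "a \<in> S" "(\<forall>n. X n \<in> S) \<and> X \<longlonglongrightarrow> a"
  have bm: "bounded_multiplier (m t) 1" for t by standard (use m one in auto)
  interpret bounded_linear "L2_mult (m t)" for t by (rule bounded_multiplier.bounded_linear_mult[OF bm])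
  have "(\<lambda>n. x (X n)) \<longlonglongrightarrow> x a" using x X unfolding continuous_on_sequentially o_def by blast
  then have "(\<lambda>n. norm (x (X n) - x a)) \<longlonglongrightarrow> 0" by (intro tendsto_norm_zero LIM_zero)
  then have "(\<lambda>n. norm (L2_mult (m (X n)) (x (X n) - x a))) \<longlonglongrightarrow> 0"
    by (simp only: norm_L2_mult_unimodular[OF m one])
  then have 1: "(\<lambda>n. L2_mult (m (X n)) (x (X n) - x a)) \<longlonglongrightarrow> 0" by (simp only: tendsto_norm_zero_iff)
  have "(\<lambda>n. m (X n) \<xi>) \<longlonglongrightarrow> m a \<xi>" for \<xi>
    using cont[of \<xi>] X unfolding continuous_on_sequentially o_def by blast
  then have 2: "(\<lambda>n. L2_mult (m (X n)) (x a)) \<longlonglongrightarrow> L2_mult (m a) (x a)"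
    by (rule tendsto_L2_mult[OF bm bm])
  show "(\<lambda>n. L2_mult (m (X n)) (x (X n))) \<longlonglongrightarrow> L2_mult (m a) (x a)"
    using tendsto_add[OF 1 2] by (simp add: diff)
qed

section \<open>H^s as seen from L2: multipliers, continuity and closed balls\<close>

text \<open>The image of \<open>f\<close> under the isometry from H^s into L2 on the frequency side;
  continuity into H^s becomes ordinary continuity of an L2-valued map.\<close>

definition sob :: "real \<Rightarrow> 'a::euclidean_space L2 \<Rightarrow> 'a L2" where
  "sob s f = to_L2 (sobolev_weighted s f)"

lemma sobolev_norm_eq: "sobolev_norm s f = norm (sob s f)"
  by (simp add: sobolev_norm_def sob_def)

lemma sob_diff:
  assumes f: "f \<in> sobolev_space s" and g: "g \<in> sobolev_space s"
  shows "f - g \<in> sobolev_space s" "sob s (f - g) = sob s f - sob s g"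
proof -
  interpret F: bounded_linear fourier by (rule bounded_linear_fourier)
  have ae: "AE \<xi> in lborel. sobolev_weighted s f \<xi> - sobolev_weighted s g \<xi> = sobolev_weighted s (f - g) \<xi>"
    using L2_fun_diff[of "fourier f" "fourier g"]
    by eventually_elim (simp add: sobolev_weighted_def F.diff right_diff_distrib)
  have sq: "square_integrable (sobolev_weighted s f)" "square_integrable (sobolev_weighted s g)"
    using f g by (auto simp: sobolev_space_def)
  show "f - g \<in> sobolev_space s"
    unfolding sobolev_space_def mem_Collect_eq
    by (rule square_integrable_cong_AE[OF square_integrable_diff[OF sq] _ ae]) measurable
  show "sob s (f - g) = sob s f - sob s g"
    unfolding sob_def to_L2_diff[OF sq]
    by (rule to_L2_cong_AE[symmetric]) (use ae in auto)
qed

text \<open>Fourier multipliers commute with the Sobolev weight, so a bounded symbol acts on H^s as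
  it does on L2.\<close>

lemma sob_multiplier:
  assumes m: "bounded_multiplier m B" and f: "f \<in> sobolev_space s"
  shows "inv_fourier (L2_mult m (fourier f)) \<in> sobolev_space s"
    "sob s (inv_fourier (L2_mult m (fourier f))) = L2_mult m (sob s f)"
proof -
  interpret bounded_multiplier m B by fact
  have sq: "square_integrable (sobolev_weighted s f)" using f by (auto simp: sobolev_space_def)
  have ae: "AE \<xi> in lborel. m \<xi> * sobolev_weighted s f \<xi> = sobolev_weighted s (inv_fourier (L2_mult m (fourier f))) \<xi>"
    using L2_fun_mult[of "fourier f"] by eventually_elim (simp add: sobolev_weighted_def)
  show "inv_fourier (L2_mult m (fourier f)) \<in> sobolev_space s"
    unfolding sobolev_space_def mem_Collect_eq
    by (rule square_integrable_cong_AE[OF square_integrable_mult[OF sq] _ ae]) measurable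
  show "sob s (inv_fourier (L2_mult m (fourier f))) = L2_mult m (sob s f)"
    unfolding sob_def mult_to_L2[OF sq]
    by (rule to_L2_cong_AE[symmetric]) (use ae in auto)
qed

lemma inv_fourier_cmult: "inv_fourier (L2_cmult c f) = L2_cmult c (inv_fourier f)"
proof -
  have "fourier (L2_cmult c (inv_fourier f)) = L2_cmult c f" by (simp add: fourier_cmult)
  then show ?thesis by (metis inv_fourier_fourier)
qed

lemma sobolev_cmult:
  assumes f: "f \<in> sobolev_space s"
  shows "L2_cmult c f \<in> sobolev_space s" "sobolev_norm s (L2_cmult c f) \<le> cmod c * sobolev_norm s f"
proof -
  have eq: "L2_cmult c f = inv_fourier (L2_mult (\<lambda>x. c) (fourier f))"
    by (simp add: L2_cmult_eq_mult[symmetric] inv_fourier_cmult)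
  show "L2_cmult c f \<in> sobolev_space s"
    unfolding eq by (rule sob_multiplier(1)[OF bounded_multiplier_const f])
  show "sobolev_norm s (L2_cmult c f) \<le> cmod c * sobolev_norm s f"
    unfolding sobolev_norm_eq eq sob_multiplier(2)[OF bounded_multiplier_const f]
    by (rule bounded_multiplier.norm_mult_le[OF bounded_multiplier_const])
qed

lemma norm_L2_cmult_le: "norm (L2_cmult c f) \<le> cmod c * norm f"
  unfolding L2_cmult_eq_mult by (rule bounded_multiplier.norm_mult_le[OF bounded_multiplier_const])

lemma norm_le_sobolev_norm:
  assumes s: "0 \<le> s" and f: "f \<in> sobolev_space s"
  shows "norm f \<le> sobolev_norm s f"
proof -
  have "ennreal ((norm (fourier f))\<^sup>2) \<le> ennreal ((sobolev_norm s f)\<^sup>2)"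
    unfolding nn_norm_L2_square nn_sobolev_norm_square[OF f, symmetric]
  proof (intro nn_integral_mono ennreal_leI power_mono)
    fix \<xi> :: 'a
    have "1 \<le> japanese_bracket \<xi> powr s" using japanese_bracket_ge_one[of \<xi>] s by (rule ge_one_powr_ge_zero)
    then have "1 * spec f \<xi> \<le> japanese_bracket \<xi> powr s * spec f \<xi>" by (intro mult_right_mono) auto
    then show "cmod (L2_fun (fourier f) \<xi>) \<le> japanese_bracket \<xi> powr s * spec f \<xi>" by (simp add: spec_def)
  qed simp
  then have "(norm f)\<^sup>2 \<le> (sobolev_norm s f)\<^sup>2" by (simp add: ennreal_le_iff)
  then show ?thesis by (rule power2_le_imp_le) simp
qed

lemma continuous_sobolev_iff:
  fixes I :: "real set" and u :: "real \<Rightarrow> 'a::euclidean_space L2"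
  assumes u: "\<And>t. t \<in> I \<Longrightarrow> u t \<in> sobolev_space s"
  shows "continuous_sobolev s I u \<longleftrightarrow> continuous_on I (\<lambda>t. sob s (u t))"
proof -
  have "((\<lambda>\<tau>. sobolev_norm s (u \<tau> - u t)) \<longlongrightarrow> 0) (at t within I) \<longleftrightarrow> ((\<lambda>\<tau>. sob s (u \<tau>)) \<longlongrightarrow> sob s (u t)) (at t within I)"
    if t: "t \<in> I" for t
  proof -
    have "\<forall>\<^sub>F \<tau> in at t within I. sobolev_norm s (u \<tau> - u t) = norm (sob s (u \<tau>) - sob s (u t))"
      unfolding eventually_at_filter using u t
      by (intro always_eventually) (auto simp: sobolev_norm_eq sob_diff)
    then have "((\<lambda>\<tau>. sobolev_norm s (u \<tau> - u t)) \<longlongrightarrow> 0) (at t within I) \<longleftrightarrow> ((\<lambda>\<tau>. norm (sob s (u \<tau>) - sob s (u t))) \<longlongrightarrow> 0) (at t within I)"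
      by (rule tendsto_cong)
    then show ?thesis by (simp add: tendsto_norm_zero_iff LIM_zero_iff)
  qed
  then show ?thesis unfolding continuous_sobolev_def continuous_on_def using u by auto
qed

lemma continuous_sob_imp_continuous:
  fixes I :: "real set" and u :: "real \<Rightarrow> 'a::euclidean_space L2"
  assumes s: "0 \<le> s" and u: "\<And>t. t \<in> I \<Longrightarrow> u t \<in> sobolev_space s"
    and cont: "continuous_on I (\<lambda>t. sob s (u t))"
  shows "continuous_on I u"
  unfolding continuous_on_iff
proof (intro ballI allI impI)
  fix t e assume t: "t \<in> I" and e: "(e::real) > 0"
  obtain d where d: "d > 0" "\<And>r. r \<in> I \<Longrightarrow> dist r t < d \<Longrightarrow> dist (sob s (u r)) (sob s (u t)) < e"
    using cont t e unfolding continuous_on_iff by blast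
  have "dist (u r) (u t) < e" if r: "r \<in> I" "dist r t < d" for r
  proof -
    have "dist (u r) (u t) \<le> sobolev_norm s (u r - u t)"
      unfolding dist_norm by (rule norm_le_sobolev_norm[OF s sob_diff(1)[OF u u]]) (use r t in auto)
    also have "\<dots> = dist (sob s (u r)) (sob s (u t))"
      unfolding sobolev_norm_eq dist_norm using sob_diff(2)[OF u[OF r(1)] u[OF t]] by simp
    also have "\<dots> < e" by (rule d(2)[OF r])
    finally show ?thesis .
  qed
  with d(1) show "\<exists>d>0. \<forall>r\<in>I. dist r t < d \<longrightarrow> dist (u r) (u t) < e" by blast
qed

definition sobolev_ball :: "real \<Rightarrow> real \<Rightarrow> 'a::euclidean_space L2 set" where
  "sobolev_ball s R = {f \<in> sobolev_space s. sobolev_norm s f \<le> R}"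

lemma sobolev_ball_eq:
  assumes "0 \<le> s" "0 \<le> R"
  shows "sobolev_ball s R = {f. \<forall>n. norm (sobolev_cutoff s n f) \<le> R}"
proof (intro equalityI subsetI)
  show "f \<in> {f. \<forall>n. norm (sobolev_cutoff s n f) \<le> R}" if "f \<in> sobolev_ball s R" for f
    using that order_trans[OF sobolev_cutoff_le[OF assms(1), of f]] by (simp add: sobolev_ball_def)
  show "f \<in> sobolev_ball s R" if "f \<in> {f. \<forall>n. norm (sobolev_cutoff s n f) \<le> R}" for f
    using that sobolev_cutoffI[OF assms, of f] by (simp add: sobolev_ball_def)
qed

text \<open>Closed in L2, not merely in H^s: the ball is cut out by inequalities for bounded
  operators on L2. It can therefore be the domain of a contraction in the L2 norm.\<close>

lemma closed_sobolev_ball: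
  assumes s: "0 \<le> s" and R: "0 \<le> R"
  shows "closed (sobolev_ball s R)"
  unfolding sobolev_ball_eq[OF s R] Collect_all_eq
  by (intro closed_INT ballI closed_Collect_le continuous_on_norm continuous_on_const
      bounded_linear.continuous_on[OF bounded_linear_sobolev_cutoff[OF s]] continuous_on_id)

text \<open>The integral is taken in L2 and \<open>f\<close> is continuous there only, yet the H^s
  bound survives: each cutoff commutes with the integral, and the cutoffs together recover the H^s
  norm.\<close>

lemma oriented_integral_sobolev_ball:
  assumes s: "0 \<le> s" and R: "0 \<le> R" and f: "continuous_on (closed_segment x y) f"
    and bd: "\<And>r. r \<in> closed_segment x y \<Longrightarrow> f r \<in> sobolev_ball s R"
    and w: "w \<in> sobolev_ball s Q" and Q: "0 \<le> Q"
  shows "w + oriented_integral x y f \<in> sobolev_ball s (Q + R * \<bar>y - x\<bar>)"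
proof -
  have Q': "0 \<le> Q + R * \<bar>y - x\<bar>" using Q R by simp
  have "norm (sobolev_cutoff s n (w + oriented_integral x y f)) \<le> Q + R * \<bar>y - x\<bar>" for n
  proof -
    interpret c: bounded_linear "sobolev_cutoff s n" by (rule bounded_linear_sobolev_cutoff[OF s])
    have "norm (sobolev_cutoff s n (oriented_integral x y f)) \<le> R * \<bar>y - x\<bar>"
      unfolding oriented_integral_bounded_linear[OF f c.bounded_linear_axioms, symmetric]
    proof (rule norm_oriented_integral_le)
      show "continuous_on (closed_segment x y) (\<lambda>r. sobolev_cutoff s n (f r))" by (rule c.continuous_on[OF f])
      show "norm (sobolev_cutoff s n (f r)) \<le> R" if "r \<in> closed_segment x y" for r
        using bd[OF that] by (simp add: sobolev_ball_eq[OF s R])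
    qed
    moreover have "norm (sobolev_cutoff s n w) \<le> Q" using w by (simp add: sobolev_ball_eq[OF s Q])
    ultimately show ?thesis unfolding c.add by (intro norm_triangle_mono)
  qed
  then show ?thesis by (simp add: sobolev_ball_eq[OF s Q'])
qed

section \<open>The evolution operators and the interaction picture\<close>

locale dispersion =
  fixes A B :: real and \<alpha> \<beta> :: "real \<Rightarrow> real"
  assumes cont_\<alpha>: "continuous_on {A..B} \<alpha>" and cont_\<beta>: "continuous_on {A..B} \<beta>"
begin

text \<open>Phases are accumulated from the fixed left end \<open>A\<close> and not from the initial
  time, so that the two-time propagator factors into \<open>symbol t\<close> and the conjugate of
  \<open>symbol r\<close>.\<close>

definition symbol :: "real \<Rightarrow> 'a::euclidean_space \<Rightarrow> complex" where
  "symbol t \<xi> = exp (\<i> * of_real ((norm \<xi>)^4 * integral {A..t} \<beta> - (norm \<xi>)\<^sup>2 * integral {A..t} \<alpha>))"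

lemma cmod_symbol: "cmod (symbol t \<xi>) = 1"
  by (simp add: symbol_def norm_exp_i_times)

lemma measurable_symbol [measurable]: "symbol t \<in> borel_measurable borel"
  unfolding symbol_def by measurable

lemma continuous_on_symbol: "continuous_on {A..B} (\<lambda>t. symbol t \<xi>)"
  unfolding symbol_def
  by (intro continuous_intros indefinite_integral_continuous_1 integrable_continuous_interval cont_\<alpha> cont_\<beta>)

definition evol :: "real \<Rightarrow> 'a::euclidean_space L2 \<Rightarrow> 'a L2" where
  "evol t f = inv_fourier (L2_mult (symbol t) (fourier f))"

definition evol_inv :: "real \<Rightarrow> 'a::euclidean_space L2 \<Rightarrow> 'a L2" where
  "evol_inv t f = inv_fourier (L2_mult (\<lambda>\<xi>. cnj (symbol t \<xi>)) (fourier f))"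

lemma bounded_multiplier_symbol: "bounded_multiplier (symbol t) 1" "bounded_multiplier (\<lambda>\<xi>. cnj (symbol t \<xi>)) 1"
  by (standard, measurable, simp add: cmod_symbol)+

lemma symbol_cancel: "symbol t \<xi> * cnj (symbol t \<xi>) = 1" "cnj (symbol t \<xi>) * symbol t \<xi> = 1"
  using complex_norm_square[of "symbol t \<xi>"] by (simp_all add: cmod_symbol mult.commute)

lemma evol_evol_inv [simp]: "evol t (evol_inv t f) = f"
  by (simp add: evol_def evol_inv_def bounded_multiplier.mult_mult[OF bounded_multiplier_symbol(2)] symbol_cancel)

lemma evol_inv_evol [simp]: "evol_inv t (evol t f) = f"
  by (simp add: evol_def evol_inv_def bounded_multiplier.mult_mult[OF bounded_multiplier_symbol(1)] symbol_cancel)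

lemma bounded_linear_evol: "bounded_linear (evol t)" "bounded_linear (evol_inv t)"
  unfolding evol_def[abs_def] evol_inv_def[abs_def]
  by (rule bounded_linear_compose[OF bounded_linear_inv_fourier] bounded_linear_compose[OF _ bounded_linear_fourier]
      bounded_multiplier.bounded_linear_mult[OF bounded_multiplier_symbol(1)]
      bounded_multiplier.bounded_linear_mult[OF bounded_multiplier_symbol(2)])+

lemma norm_evol: "norm (evol t f) = norm f" "norm (evol_inv t f) = norm f"
  by (simp_all add: evol_def evol_inv_def norm_L2_mult_unimodular cmod_symbol)

lemma evol_cmult: "evol t (L2_cmult c f) = L2_cmult c (evol t f)"
proof -
  have "L2_mult (symbol t) (L2_cmult c g) = L2_cmult c (L2_mult (symbol t) g)" for g :: "'a L2"
    unfolding L2_cmult_eq_mult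
    by (simp add: bounded_multiplier.mult_mult[OF bounded_multiplier_const] bounded_multiplier.mult_mult[OF bounded_multiplier_symbol(1)] mult.commute)
  then show ?thesis by (simp add: evol_def fourier_cmult inv_fourier_cmult)
qed

lemma continuous_on_evol:
  assumes S: "S \<subseteq> {A..B}" and x: "continuous_on S x"
  shows "continuous_on S (\<lambda>t. evol t (x t))" "continuous_on S (\<lambda>t. evol_inv t (x t))"
    "continuous_on S (\<lambda>t. L2_mult (symbol t) (x t))"
proof -
  note F = bounded_linear.continuous_on[OF bounded_linear_fourier] bounded_linear.continuous_on[OF bounded_linear_inv_fourier]
  have c: "continuous_on S (\<lambda>t. symbol t \<xi>)" for \<xi> :: 'a by (rule continuous_on_subset[OF continuous_on_symbol S])
  show "continuous_on S (\<lambda>t. evol t (x t))"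
    unfolding evol_def by (intro F continuous_on_L2_mult c x) (auto simp: cmod_symbol)
  show "continuous_on S (\<lambda>t. evol_inv t (x t))"
    unfolding evol_inv_def by (intro F continuous_on_L2_mult continuous_on_cnj c x) (auto simp: cmod_symbol)
  show "continuous_on S (\<lambda>t. L2_mult (symbol t) (x t))"
    by (intro continuous_on_L2_mult c x) (auto simp: cmod_symbol)
qed

lemma evol_sobolev:
  assumes f: "f \<in> sobolev_space s"
  shows "evol t f \<in> sobolev_space s" "sob s (evol t f) = L2_mult (symbol t) (sob s f)"
    "sobolev_norm s (evol t f) = sobolev_norm s f"
    "evol_inv t f \<in> sobolev_space s" "sobolev_norm s (evol_inv t f) = sobolev_norm s f"
  using sob_multiplier[OF bounded_multiplier_symbol(1) f] sob_multiplier[OF bounded_multiplier_symbol(2) f]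
  by (simp_all add: evol_def evol_inv_def sobolev_norm_eq norm_L2_mult_unimodular cmod_symbol)

lemma propagator_eq:
  assumes t: "t \<in> {A..B}" and r: "r \<in> {A..B}"
  shows "propagator \<alpha> \<beta> t r f = evol t (evol_inv r f)"
proof -
  have "exp (- \<i> * of_real ((norm \<xi>)^2 * oriented_integral r t \<alpha>) + \<i> * of_real ((norm \<xi>)^4 * oriented_integral r t \<beta>))
      = symbol t \<xi> * cnj (symbol r \<xi>)" for \<xi> :: 'a
    unfolding oriented_integral_eq_diff[OF cont_\<alpha> r t] oriented_integral_eq_diff[OF cont_\<beta> r t] symbol_def
    by (simp add: exp_cnj exp_add[symmetric] algebra_simps)
  then have "propagator \<alpha> \<beta> t r f = inv_fourier (L2_mult (\<lambda>\<xi>. symbol t \<xi> * cnj (symbol r \<xi>)) (fourier f))"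
    by (simp add: propagator_def fourier_multiplier_def L2_mult_def)
  then show ?thesis
    by (simp add: evol_def evol_inv_def bounded_multiplier.mult_mult[OF bounded_multiplier_symbol(2)])
qed

text \<open>\<open>evol t\<close> does not depend on the integration variable, so it leaves the
  integral, and its inverse removes it from the equation. The integrability clause holds on both
  sides, as the integrand is continuous.\<close>

lemma mild_solution_iff:
  fixes u :: "real \<Rightarrow> 'a::euclidean_space L2"
  assumes I: "{p..q} \<subseteq> {A..B}" and t0: "t0 \<in> {p..q}"
    and cont: "continuous_on {p..q} (\<lambda>r. hartree lam (u r))"
  shows "mild_solution lam \<theta> \<alpha> \<beta> t0 u0 {p..q} u \<longleftrightarrow>
    (\<forall>t\<in>{p..q}. evol_inv t (u t) = evol_inv t0 u0 +
      oriented_integral t0 t (\<lambda>r. L2_cmult (\<i> * of_real \<theta>) (evol_inv r (hartree lam (u r)))))"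
proof -
  have "(\<lambda>\<tau>. propagator \<alpha> \<beta> t \<tau> (hartree lam (u \<tau>))) integrable_on closed_segment t0 t \<and>
        u t = propagator \<alpha> \<beta> t t0 u0 + L2_cmult (\<i> * of_real \<theta>) (oriented_integral t0 t (\<lambda>\<tau>. propagator \<alpha> \<beta> t \<tau> (hartree lam (u \<tau>))))
    \<longleftrightarrow> evol_inv t (u t) = evol_inv t0 u0 + oriented_integral t0 t (\<lambda>r. L2_cmult (\<i> * of_real \<theta>) (evol_inv r (hartree lam (u r))))"
    if t: "t \<in> {p..q}" for t
  proof -
    let ?Z = "evol_inv t0 u0 + oriented_integral t0 t (\<lambda>r. L2_cmult (\<i> * of_real \<theta>) (evol_inv r (hartree lam (u r))))"
    interpret e: bounded_linear "evol t :: 'a L2 \<Rightarrow> 'a L2" by (rule bounded_linear_evol)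
    have tAB: "t \<in> {A..B}" and t0AB: "t0 \<in> {A..B}" using t t0 I by auto
    have seg: "closed_segment t0 t \<subseteq> {p..q}" by (rule closed_segment_subset_Icc[OF t0 t])
    have c: "continuous_on (closed_segment t0 t) (\<lambda>r. evol_inv r (hartree lam (u r)))"
      using seg I by (intro continuous_on_evol continuous_on_subset[OF cont]) auto
    have eq: "propagator \<alpha> \<beta> t \<tau> (hartree lam (u \<tau>)) = evol t (evol_inv \<tau> (hartree lam (u \<tau>)))"
      if "\<tau> \<in> closed_segment t0 t" for \<tau>
      using that seg I by (intro propagator_eq tAB) auto
    have "(\<lambda>\<tau>. evol t (evol_inv \<tau> (hartree lam (u \<tau>)))) integrable_on closed_segment t0 t"
      using e.continuous_on[OF c] by (auto simp: closed_segment_eq_real_ivl intro!: integrable_continuous_interval)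
    then have int: "(\<lambda>\<tau>. propagator \<alpha> \<beta> t \<tau> (hartree lam (u \<tau>))) integrable_on closed_segment t0 t"
      by (rule integrable_eq) (simp add: eq)
    have "oriented_integral t0 t (\<lambda>\<tau>. propagator \<alpha> \<beta> t \<tau> (hartree lam (u \<tau>)))
        = oriented_integral t0 t (\<lambda>\<tau>. evol t (evol_inv \<tau> (hartree lam (u \<tau>))))"
      by (rule oriented_integral_cong) (rule eq)
    also have "\<dots> = evol t (oriented_integral t0 t (\<lambda>\<tau>. evol_inv \<tau> (hartree lam (u \<tau>))))"
      by (rule oriented_integral_bounded_linear[OF c e.bounded_linear_axioms])
    finally have "propagator \<alpha> \<beta> t t0 u0 + L2_cmult (\<i> * of_real \<theta>) (oriented_integral t0 t (\<lambda>\<tau>. propagator \<alpha> \<beta> t \<tau> (hartree lam (u \<tau>))))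
        = evol t (evol_inv t0 u0 + oriented_integral t0 t (\<lambda>r. L2_cmult (\<i> * of_real \<theta>) (evol_inv r (hartree lam (u r)))))"
      by (simp add: propagator_eq[OF tAB t0AB] e.add evol_cmult oriented_integral_bounded_linear[OF c bounded_linear_L2_cmult])
    then have X: "propagator \<alpha> \<beta> t t0 u0 + L2_cmult (\<i> * of_real \<theta>) (oriented_integral t0 t (\<lambda>\<tau>. propagator \<alpha> \<beta> t \<tau> (hartree lam (u \<tau>)))) = evol t ?Z" .
    have "u t = evol t ?Z \<longleftrightarrow> evol_inv t (u t) = ?Z"
    proof
      assume "u t = evol t ?Z"
      then show "evol_inv t (u t) = ?Z" by (simp only: evol_inv_evol)
    next
      assume "evol_inv t (u t) = ?Z"
      from this[symmetric] show "u t = evol t ?Z" by (simp only: evol_evol_inv)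
    qed
    then show ?thesis using int unfolding X by blast
  qed
  then show ?thesis unfolding mild_solution_def by auto
qed

end

section \<open>The Cauchy problem\<close>

locale hartree_cauchy = hartree_setting lam s H V + dispersion A B \<alpha> \<beta>
  for lam s H :: real and V :: "'a::euclidean_space L2 \<Rightarrow> 'a \<Rightarrow> real" and A B :: real and \<alpha> \<beta> :: "real \<Rightarrow> real" +
  fixes \<theta> K :: real
  assumes K: "0 \<le> K"
    and cubic: "\<And>u :: 'a L2. u \<in> sobolev_space s \<Longrightarrow>
      hartree lam u \<in> sobolev_space s \<and> sobolev_norm s (hartree lam u) \<le> K * (sobolev_norm s u) ^ 3"
begin

text \<open>The nonlinearity in the interaction picture \<open>w(t) = evol_inv t (u t)\<close>.\<close>

definition force :: "real \<Rightarrow> 'a L2 \<Rightarrow> 'a L2" where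
  "force r w = L2_cmult (\<i> * of_real \<theta>) (evol_inv r (hartree lam (evol r w)))"

lemma hartree_continuous_on_ball:
  fixes u :: "real \<Rightarrow> 'a L2"
  assumes u: "continuous_on S u" and ball: "\<And>t. t \<in> S \<Longrightarrow> u t \<in> sobolev_ball s R"
  shows "continuous_on S (\<lambda>t. hartree lam (u t))"
proof -
  have "continuous_on (sobolev_ball s R) (hartree lam :: 'a L2 \<Rightarrow> 'a L2)"
  proof (rule lipschitz_on_continuous_on[where L = "3 * H * R\<^sup>2"], rule lipschitz_onI)
    show "dist (hartree lam x) (hartree lam y) \<le> 3 * H * R\<^sup>2 * dist x y" if "x \<in> sobolev_ball s R" "y \<in> sobolev_ball s R" for x y :: "'a L2"
      using that unfolding dist_norm by (intro hartree_lipschitz) (auto simp: sobolev_ball_def)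
    show "0 \<le> 3 * H * R\<^sup>2" using H by simp
  qed
  then show ?thesis by (rule continuous_on_compose2[OF _ u]) (use ball in auto)
qed

lemma evol_ball: "w \<in> sobolev_ball s R \<Longrightarrow> evol r w \<in> sobolev_ball s R"
  by (simp add: sobolev_ball_def evol_sobolev)

lemma force_continuous:
  assumes S: "S \<subseteq> {A..B}" and w: "continuous_on S w" and ball: "\<And>t. t \<in> S \<Longrightarrow> w t \<in> sobolev_ball s R"
  shows "continuous_on S (\<lambda>r. force r (w r))"
  unfolding force_def
  by (intro bounded_linear.continuous_on[OF bounded_linear_L2_cmult] continuous_on_evol(2)[OF S]
      hartree_continuous_on_ball[where R = R] continuous_on_evol(1)[OF S] w evol_ball ball)

lemma force_lipschitz:
  assumes "x \<in> sobolev_ball s R" "y \<in> sobolev_ball s R"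
  shows "norm (force r x - force r y) \<le> 3 * \<bar>\<theta>\<bar> * H * R\<^sup>2 * norm (x - y)"
proof -
  interpret c: bounded_linear "L2_cmult (\<i> * of_real \<theta>) :: 'a L2 \<Rightarrow> 'a L2" by (rule bounded_linear_L2_cmult)
  interpret e: bounded_linear "evol r :: 'a L2 \<Rightarrow> 'a L2" by (rule bounded_linear_evol)
  interpret i: bounded_linear "evol_inv r :: 'a L2 \<Rightarrow> 'a L2" by (rule bounded_linear_evol)
  have "norm (force r x - force r y) = norm (L2_cmult (\<i> * of_real \<theta>) (evol_inv r (hartree lam (evol r x) - hartree lam (evol r y))))"
    by (simp add: force_def c.diff i.diff)
  also have "\<dots> \<le> \<bar>\<theta>\<bar> * norm (hartree lam (evol r x) - hartree lam (evol r y))"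
    using norm_L2_cmult_le[of "\<i> * of_real \<theta>" "evol_inv r (hartree lam (evol r x) - hartree lam (evol r y))"]
    by (simp add: norm_mult norm_evol)
  also have "\<dots> \<le> \<bar>\<theta>\<bar> * (3 * H * R\<^sup>2 * norm (evol r x - evol r y))"
    using assms[THEN evol_ball, of r] by (intro mult_left_mono hartree_lipschitz) (auto simp: sobolev_ball_def)
  also have "norm (evol r x - evol r y) = norm (x - y)" by (simp add: e.diff[symmetric] norm_evol)
  finally show ?thesis by (simp add: mult_ac)
qed

lemma force_ball:
  assumes x: "x \<in> sobolev_ball s R"
  shows "force r x \<in> sobolev_ball s (\<bar>\<theta>\<bar> * K * R ^ 3)"
proof -
  have ex: "evol r x \<in> sobolev_space s" "sobolev_norm s (evol r x) \<le> R"
    using evol_ball[OF x, of r] by (auto simp: sobolev_ball_def)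
  let ?h = "hartree lam (evol r x)"
  have h: "?h \<in> sobolev_space s" "sobolev_norm s ?h \<le> K * (sobolev_norm s (evol r x)) ^ 3" using cubic[OF ex(1)] by auto
  have "sobolev_norm s (force r x) \<le> \<bar>\<theta>\<bar> * sobolev_norm s (evol_inv r ?h)"
    unfolding force_def using sobolev_cmult(2)[OF evol_sobolev(4)[OF h(1)], of "\<i> * of_real \<theta>"] by (simp add: norm_mult)
  also have "\<dots> = \<bar>\<theta>\<bar> * sobolev_norm s ?h" by (simp only: evol_sobolev(5)[OF h(1)])
  also have "\<dots> \<le> \<bar>\<theta>\<bar> * (K * R ^ 3)"
    by (intro mult_left_mono order_trans[OF h(2)] power_mono ex K) auto
  finally show ?thesis
    unfolding sobolev_ball_def force_def using sobolev_cmult(1)[OF evol_sobolev(4)[OF h(1)]] by (simp add: mult.assoc)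
qed

text \<open>A Picard solution is continuous in L2 and bounded in H^s. Since \<open>force\<close> is
  bounded in H^s on the ball, the equation makes \<open>w\<close> Lipschitz in H^s; the unimodular
  \<open>symbol\<close>, strongly continuous in time, carries continuity over to the evolved
  solution.\<close>

lemma interaction_solution_regular:
  assumes I: "{p..q} \<subseteq> {A..B}" and t0: "t0 \<in> {p..q}" and R: "0 \<le> R"
    and w: "continuous_on {p..q} w" and ball: "\<And>t. t \<in> {p..q} \<Longrightarrow> w t \<in> sobolev_ball s R"
    and weq: "\<And>t. t \<in> {p..q} \<Longrightarrow> w t = w0 + oriented_integral t0 t (\<lambda>r. force r (w r))"
  shows "continuous_on {p..q} (\<lambda>t. sob s (evol t (w t)))"
proof -
  define C where "C = \<bar>\<theta>\<bar> * K * R ^ 3"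
  have C: "0 \<le> C" using K R by (simp add: C_def)
  have fc: "continuous_on {p..q} (\<lambda>r. force r (w r))" by (rule force_continuous[OF I w ball])
  \<comment> \<open>An increment of \<open>w\<close> is an integral without free term, hence the
    ball of radius 0 in the place of the initial datum.\<close>
  have z: "(0 :: 'a L2) \<in> sobolev_ball s 0"
  proof -
    have "norm (sobolev_cutoff s n (0::'a L2)) \<le> 0" for n
      using linear_0[OF bounded_linear.linear[OF bounded_linear_sobolev_cutoff[OF s_nonneg]]] by simp
    then show ?thesis by (simp add: sobolev_ball_eq[OF s_nonneg])
  qed
  have lip: "norm (sob s (w t) - sob s (w r)) \<le> C * \<bar>t - r\<bar>" if t: "t \<in> {p..q}" and r: "r \<in> {p..q}" for t r
  proof -
    have seg: "closed_segment r t \<subseteq> {p..q}" by (rule closed_segment_subset_Icc[OF r t])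
    have "w t - w r = 0 + oriented_integral r t (\<lambda>r. force r (w r))"
      unfolding weq[OF t] weq[OF r] oriented_integral_eq_diff[OF fc t0 t] oriented_integral_eq_diff[OF fc t0 r] oriented_integral_eq_diff[OF fc r t]
      by simp
    also have "\<dots> \<in> sobolev_ball s (0 + C * \<bar>t - r\<bar>)"
      using seg by (intro oriented_integral_sobolev_ball s_nonneg C continuous_on_subset[OF fc seg] z)
        (auto simp: C_def intro!: force_ball ball)
    finally have "sobolev_norm s (w t - w r) \<le> C * \<bar>t - r\<bar>" by (simp add: sobolev_ball_def)
    moreover have "w t \<in> sobolev_space s" "w r \<in> sobolev_space s" using ball[OF t] ball[OF r] by (auto simp: sobolev_ball_def)
    ultimately show ?thesis by (simp add: sobolev_norm_eq sob_diff(2))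
  qed
  have "continuous_on {p..q} (\<lambda>t. sob s (w t))"
  proof (rule lipschitz_on_continuous_on[where L = C], rule lipschitz_onI)
    show "dist (sob s (w t)) (sob s (w r)) \<le> C * dist t r" if "t \<in> {p..q}" "r \<in> {p..q}" for t r
      using lip[OF that] by (simp add: dist_norm)
  qed (rule C)
  then have "continuous_on {p..q} (\<lambda>t. L2_mult (symbol t) (sob s (w t)))" by (rule continuous_on_evol(3)[OF I])
  then show ?thesis
  proof (rule continuous_on_eq)
    fix t assume "t \<in> {p..q}"
    then have "w t \<in> sobolev_space s" using ball[of t] by (simp add: sobolev_ball_def)
    then show "L2_mult (symbol t) (sob s (w t)) = sob s (evol t (w t))" by (rule evol_sobolev(2)[symmetric])
  qed
qed

section \<open>Existence in a ball of H^s and uniqueness among continuous H^s solutions\<close>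

text \<open>On the ball of radius \<open>2 * N\<close> the Lipschitz constant is
  \<open>3 * |\<theta>| * H * (2 * N)^2\<close>, the source of 12, and \<open>force\<close> is
  bounded in H^s by \<open>|\<theta>| * K * (2 * N)^3\<close>, the source of 8: the second smallness
  condition lets the integral add at most \<open>N\<close> to the datum.\<close>

lemma local_existence:
  fixes u0 :: "'a L2"
  assumes I: "{t0 - h..t0 + h} \<subseteq> {A..B}" and h: "0 < h"
    and u0: "u0 \<in> sobolev_space s" and N: "N = sobolev_norm s u0"
    and small: "12 * \<bar>\<theta>\<bar> * H * N\<^sup>2 * h < 1" "8 * \<bar>\<theta>\<bar> * K * N\<^sup>2 * h \<le> 1"
  obtains u where "continuous_sobolev s {t0 - h..t0 + h} u" "mild_solution lam \<theta> \<alpha> \<beta> t0 u0 {t0 - h..t0 + h} u"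
    "\<And>t. t \<in> {t0 - h..t0 + h} \<Longrightarrow> u t \<in> sobolev_ball s (2 * N)"
proof -
  let ?I = "{t0 - h..t0 + h}"
  have N0: "0 \<le> N" using N by simp
  have t0: "t0 \<in> ?I" using h by simp
  define w0 where "w0 = evol_inv t0 u0"
  have w0: "w0 \<in> sobolev_ball s N" using evol_sobolev(4,5)[OF u0] by (simp add: w0_def sobolev_ball_def N)
  obtain w where w: "continuous_on ?I w" "\<And>t. t \<in> ?I \<Longrightarrow> w t \<in> sobolev_ball s (2 * N)"
    "\<And>t. t \<in> ?I \<Longrightarrow> w t = w0 + oriented_integral t0 t (\<lambda>r. force r (w r))"
  proof (rule picard_exists[OF h, where D = "sobolev_ball s (2 * N)" and L = "3 * \<bar>\<theta>\<bar> * H * (2 * N)\<^sup>2" and g = force])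
    note result = that
    show "closed (sobolev_ball s (2 * N) :: 'a L2 set)" using N0 by (intro closed_sobolev_ball s_nonneg) simp
    show "w0 \<in> sobolev_ball s (2 * N)" using w0 N0 by (auto simp: sobolev_ball_def)
    show "0 \<le> 3 * \<bar>\<theta>\<bar> * H * (2 * N)\<^sup>2" using H by simp
    show "3 * \<bar>\<theta>\<bar> * H * (2 * N)\<^sup>2 * h < 1" using small(1) by (simp add: power_mult_distrib mult_ac)
    show "continuous_on ?I (\<lambda>r. force r (x r))"
      if "continuous_on ?I x" "\<And>t. t \<in> ?I \<Longrightarrow> x t \<in> sobolev_ball s (2 * N)" for x
      by (rule force_continuous[OF I that])
    show "norm (force r x - force r y) \<le> 3 * \<bar>\<theta>\<bar> * H * (2 * N)\<^sup>2 * norm (x - y)"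
      if "x \<in> sobolev_ball s (2 * N)" "y \<in> sobolev_ball s (2 * N)" for r x y
      by (rule force_lipschitz[OF that])
    show "w0 + oriented_integral t0 t (\<lambda>r. force r (x r)) \<in> sobolev_ball s (2 * N)"
      if x: "continuous_on ?I x" "\<And>t. t \<in> ?I \<Longrightarrow> x t \<in> sobolev_ball s (2 * N)" and t: "t \<in> ?I" for x t
    proof -
      let ?C = "\<bar>\<theta>\<bar> * K * (2 * N) ^ 3"
      have C: "0 \<le> ?C" using K N0 by simp
      have seg: "closed_segment t0 t \<subseteq> ?I" by (rule closed_segment_subset_Icc[OF t0 t])
      have "w0 + oriented_integral t0 t (\<lambda>r. force r (x r)) \<in> sobolev_ball s (N + ?C * \<bar>t - t0\<bar>)"
        using seg by (intro oriented_integral_sobolev_ball s_nonneg C N0 w0 continuous_on_subset[OF force_continuous[OF I x] seg])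
          (assumption, rule force_ball[OF x(2)], blast)
      moreover have "N + ?C * \<bar>t - t0\<bar> \<le> 2 * N"
      proof -
        have "?C * \<bar>t - t0\<bar> \<le> ?C * h" using t C by (intro mult_left_mono) (auto simp: abs_le_iff)
        also have "\<dots> = (8 * \<bar>\<theta>\<bar> * K * N\<^sup>2 * h) * N" by (simp add: power2_eq_square power3_eq_cube)
        also have "\<dots> \<le> 1 * N" by (intro mult_right_mono small N0)
        finally show ?thesis by simp
      qed
      ultimately show ?thesis by (auto simp: sobolev_ball_def)
    qed
    show thesis
      if "continuous_on ?I w" "\<And>t. t \<in> ?I \<Longrightarrow> w t \<in> sobolev_ball s (2 * N)"
        "\<And>t. t \<in> ?I \<Longrightarrow> w t = w0 + oriented_integral t0 t (\<lambda>r. force r (w r))" for w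
      by (rule result[OF that])
  qed
  let ?u = "\<lambda>t. evol t (w t)"
  have ball: "?u t \<in> sobolev_ball s (2 * N)" if "t \<in> ?I" for t by (rule evol_ball[OF w(2)[OF that]])
  show thesis
  proof (rule that[of ?u])
    have "continuous_on ?I (\<lambda>t. sob s (?u t))"
      using N0 by (intro interaction_solution_regular[OF I t0 _ w(1,2,3)]) auto
    then show "continuous_sobolev s ?I ?u"
      using ball by (subst continuous_sobolev_iff) (auto simp: sobolev_ball_def)
    show "mild_solution lam \<theta> \<alpha> \<beta> t0 u0 ?I ?u"
    proof (subst mild_solution_iff[OF I t0])
      show "continuous_on ?I (\<lambda>r. hartree lam (?u r))"
        by (rule hartree_continuous_on_ball[OF continuous_on_evol(1)[OF I w(1)] ball])
      show "\<forall>t\<in>?I. evol_inv t (?u t) = evol_inv t0 u0 + oriented_integral t0 t (\<lambda>r. L2_cmult (\<i> * of_real \<theta>) (evol_inv r (hartree lam (?u r))))"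
        using w(3) by (simp add: w0_def[symmetric] force_def)
    qed
  qed (rule ball)
qed

text \<open>No size restriction on the competitor: compactness of the time interval puts both
  solutions in a common ball of some radius \<open>R\<close>, on which \<open>force\<close> is
  Lipschitz in L2.\<close>

lemma uniqueness:
  assumes I: "{t0 - h..t0 + h} \<subseteq> {A..B}" and h: "0 < h"
    and u: "continuous_sobolev s {t0 - h..t0 + h} u" "mild_solution lam \<theta> \<alpha> \<beta> t0 u0 {t0 - h..t0 + h} u"
    and v: "continuous_sobolev s {t0 - h..t0 + h} v" "mild_solution lam \<theta> \<alpha> \<beta> t0 u0 {t0 - h..t0 + h} v"
    and t: "t \<in> {t0 - h..t0 + h}"
  shows "v t = (u t :: 'a L2)"
proof -
  let ?I = "{t0 - h..t0 + h}"
  have t0: "t0 \<in> ?I" using h by simp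
  have sol: "\<exists>R. \<forall>t\<in>?I. x t \<in> sobolev_ball s R" "continuous_on ?I x"
    if x: "continuous_sobolev s ?I x" for x :: "real \<Rightarrow> 'a L2"
  proof -
    have xs: "x t \<in> sobolev_space s" if "t \<in> ?I" for t using x that by (simp add: continuous_sobolev_def)
    have c: "continuous_on ?I (\<lambda>t. sob s (x t))" 
      by (rule continuous_sobolev_iff[THEN iffD1, OF xs x])
    then have "bounded ((\<lambda>t. sob s (x t)) ` ?I)" by (intro compact_imp_bounded compact_continuous_image) auto
    then show "\<exists>R. \<forall>t\<in>?I. x t \<in> sobolev_ball s R"
      using xs by (auto simp: bounded_iff sobolev_ball_def sobolev_norm_eq)
    show "continuous_on ?I x" by (rule continuous_sob_imp_continuous[OF s_nonneg xs c])
  qed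
  obtain Ru Rv where R: "\<And>t. t \<in> ?I \<Longrightarrow> u t \<in> sobolev_ball s Ru" "\<And>t. t \<in> ?I \<Longrightarrow> v t \<in> sobolev_ball s Rv"
    using sol(1)[OF u(1)] sol(1)[OF v(1)] by blast
  define R where "R = max Ru Rv"
  have ball: "u t \<in> sobolev_ball s R" "v t \<in> sobolev_ball s R" if "t \<in> ?I" for t
    using R[OF that] by (auto simp: R_def sobolev_ball_def)
  have eq: "evol_inv t (x t) = evol_inv t0 u0 + oriented_integral t0 t (\<lambda>r. force r (evol_inv r (x r)))"
    if x: "continuous_sobolev s ?I x" "mild_solution lam \<theta> \<alpha> \<beta> t0 u0 ?I x" "\<And>t. t \<in> ?I \<Longrightarrow> x t \<in> sobolev_ball s R" and t: "t \<in> ?I" for x t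
  proof -
    have "continuous_on ?I (\<lambda>r. hartree lam (x r))" by (rule hartree_continuous_on_ball[OF sol(2)[OF x(1)] x(3)])
    from mild_solution_iff[OF I t0 this, THEN iffD1, OF x(2)] t show ?thesis by (simp add: force_def)
  qed
  have wb: "evol_inv t (x t) \<in> sobolev_ball s R" if "x t \<in> sobolev_ball s R" for x t
    using that by (simp add: sobolev_ball_def evol_sobolev)
  have cu: "continuous_on ?I (\<lambda>t. evol_inv t (u t))" and cv: "continuous_on ?I (\<lambda>t. evol_inv t (v t))"
    by (intro continuous_on_evol(2)[OF I] sol(2) u v)+
  have bu: "evol_inv r (u r) \<in> sobolev_ball s R" and bv: "evol_inv r (v r) \<in> sobolev_ball s R" if "r \<in> ?I" for r
    by (rule wb, rule ball[OF that])+
  have "evol_inv t (v t) = evol_inv t (u t)"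
  proof (rule integral_equation_unique[OF t0 cv cu])
    show "continuous_on ?I (\<lambda>r. force r (evol_inv r (v r)))" by (rule force_continuous[OF I cv bv])
    show "continuous_on ?I (\<lambda>r. force r (evol_inv r (u r)))" by (rule force_continuous[OF I cu bu])
    show "0 \<le> 3 * \<bar>\<theta>\<bar> * H * R\<^sup>2" using H by simp
    show "norm (force r (evol_inv r (v r)) - force r (evol_inv r (u r))) \<le> 3 * \<bar>\<theta>\<bar> * H * R\<^sup>2 * norm (evol_inv r (v r) - evol_inv r (u r))"
      if "r \<in> ?I" for r by (rule force_lipschitz[OF bv bu]) (rule that)+
    show "evol_inv t (v t) = evol_inv t0 u0 + oriented_integral t0 t (\<lambda>r. force r (evol_inv r (v r)))" if "t \<in> ?I" for t
      by (rule eq[OF v ball(2) that])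
    show "evol_inv t (u t) = evol_inv t0 u0 + oriented_integral t0 t (\<lambda>r. force r (evol_inv r (u r)))" if "t \<in> ?I" for t
      by (rule eq[OF u ball(1) that])
  qed (rule t)
  then have "evol t (evol_inv t (v t)) = evol t (evol_inv t (u t))" by simp
  then show ?thesis by simp
qed

end

theorem theorem3p1:
  fixes lam s t\<^sub>0 T \<theta> :: real and \<alpha> \<beta> :: "real \<Rightarrow> real"
  assumes "0 < lam" and "lam < real CARD('n::finite)"
    and "s \<ge> lam / 2"
    and "T > 0"
    and "\<theta> \<noteq> 0"
    and "continuous_on {t\<^sub>0 - T .. t\<^sub>0 + T} \<alpha>"
    and "continuous_on {t\<^sub>0 - T .. t\<^sub>0 + T} \<beta>"
    and "\<forall>t\<in>{t\<^sub>0 - T .. t\<^sub>0 + T}. \<beta> t \<noteq> 0"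
  shows "\<exists>C>0. \<exists>T\<^sub>0 :: real \<Rightarrow> real. \<forall>u\<^sub>0 \<in> (sobolev_space s :: (real ^ 'n) L2 set).
    let \<tau> = T\<^sub>0 (sobolev_norm s u\<^sub>0); I = {t\<^sub>0 - \<tau> .. t\<^sub>0 + \<tau>} in
      0 < \<tau> \<and> \<tau> \<le> T \<and>
      (\<exists>u. continuous_sobolev s I u \<and>
           mild_solution lam \<theta> \<alpha> \<beta> t\<^sub>0 u\<^sub>0 I u \<and>
           Linf_sobolev_norm s I u \<le> ereal (C * sobolev_norm s u\<^sub>0) \<and>
           (\<forall>v. continuous_sobolev s I v \<and> mild_solution lam \<theta> \<alpha> \<beta> t\<^sub>0 u\<^sub>0 I v
                \<longrightarrow> (\<forall>t\<in>I. v t = u t)))"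
proof -
  have lamd: "lam < DIM(real ^ 'n)" using assms(2) by simp
  obtain H where H: "H \<ge> 0" "\<And>(u::(real ^ 'n) L2) x. (\<integral>\<^sup>+y. ennreal (norm (x - y) powr (- lam)) * ennreal ((cmod (L2_fun u y))\<^sup>2) \<partial>lborel)
    \<le> ennreal H * (\<integral>\<^sup>+\<xi>. ennreal (norm \<xi> powr lam * (spec u \<xi>)\<^sup>2) \<partial>lborel)"
    using hardy[OF assms(1) lamd] by blast
  define V where "V u x = Defs.convolution (\<lambda>z. norm z powr (- lam)) (\<lambda>y. (cmod (L2_fun u y))\<^sup>2) x"
    for u :: "(real ^ 'n) L2" and x
  interpret hartree_setting lam s H V
  proof
    fix u :: "(real ^ 'n) L2" and x
    assume u: "u \<in> sobolev_space s"
    have "(\<integral>\<^sup>+y. ennreal (norm (x - y) powr (- lam)) * ennreal ((cmod (L2_fun u y))\<^sup>2) \<partial>lborel)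
        \<le> ennreal H * ennreal ((sobolev_norm s u)\<^sup>2)"
      by (rule order_trans[OF H(2) mult_left_mono[OF homogeneous_le_sobolev_norm[OF u assms(3,1)]]]) simp
    then show "(\<integral>\<^sup>+y. ennreal (norm (x - y) powr (- lam)) * ennreal ((cmod (L2_fun u y))\<^sup>2) \<partial>lborel)
        \<le> ennreal (H * (sobolev_norm s u)\<^sup>2)"
      using H(1) by (simp add: ennreal_mult')
  qed (use assms H V_def in auto)
  obtain K where K: "K \<ge> 0" "\<And>u :: (real ^ 'n) L2. u \<in> sobolev_space s \<Longrightarrow>
    hartree lam u \<in> sobolev_space s \<and> sobolev_norm s (hartree lam u) \<le> K * (sobolev_norm s u) ^ 3"
    using hartree_sobolev[OF lamd] by blast
  interpret hartree_cauchy lam s H V "t\<^sub>0 - T" "t\<^sub>0 + T" \<alpha> \<beta> \<theta> K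
    by unfold_locales (use assms K in auto)
  \<comment> \<open>The leading 1 makes the first smallness condition strict and keeps the quotient
    meaningful for zero data. The data enter only through \<open>M\<close>, the value of their
    norm.\<close>
  define T0 where "T0 M = min T (1 / (1 + 12 * \<bar>\<theta>\<bar> * H * M\<^sup>2 + 8 * \<bar>\<theta>\<bar> * K * M\<^sup>2))" for M
  have main: "0 < T0 (sobolev_norm s u\<^sub>0) \<and> T0 (sobolev_norm s u\<^sub>0) \<le> T \<and>
      (\<exists>u. continuous_sobolev s {t\<^sub>0 - T0 (sobolev_norm s u\<^sub>0) .. t\<^sub>0 + T0 (sobolev_norm s u\<^sub>0)} u \<and>
           mild_solution lam \<theta> \<alpha> \<beta> t\<^sub>0 u\<^sub>0 {t\<^sub>0 - T0 (sobolev_norm s u\<^sub>0) .. t\<^sub>0 + T0 (sobolev_norm s u\<^sub>0)} u \<and>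
           Linf_sobolev_norm s {t\<^sub>0 - T0 (sobolev_norm s u\<^sub>0) .. t\<^sub>0 + T0 (sobolev_norm s u\<^sub>0)} u \<le> ereal (2 * sobolev_norm s u\<^sub>0) \<and>
           (\<forall>v. continuous_sobolev s {t\<^sub>0 - T0 (sobolev_norm s u\<^sub>0) .. t\<^sub>0 + T0 (sobolev_norm s u\<^sub>0)} v \<and>
              mild_solution lam \<theta> \<alpha> \<beta> t\<^sub>0 u\<^sub>0 {t\<^sub>0 - T0 (sobolev_norm s u\<^sub>0) .. t\<^sub>0 + T0 (sobolev_norm s u\<^sub>0)} v
                \<longrightarrow> (\<forall>t\<in>{t\<^sub>0 - T0 (sobolev_norm s u\<^sub>0) .. t\<^sub>0 + T0 (sobolev_norm s u\<^sub>0)}. v t = u t)))"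
    if u0: "u\<^sub>0 \<in> sobolev_space s" for u\<^sub>0 :: "(real ^ 'n) L2"
  proof -
    define N where "N = sobolev_norm s u\<^sub>0"
    define h where "h = T0 N"
    define P where "P = 12 * \<bar>\<theta>\<bar> * H * N\<^sup>2"
    define Q where "Q = 8 * \<bar>\<theta>\<bar> * K * N\<^sup>2"
    have PQ: "0 \<le> P" "0 \<le> Q" using H K by (simp_all add: P_def Q_def)
    have hle: "h \<le> T" "h \<le> 1 / (1 + P + Q)" by (simp_all add: h_def T0_def P_def Q_def)
    have h0: "0 < h" using assms(4) PQ by (simp add: h_def T0_def flip: P_def Q_def)
    have "P * h \<le> P * (1 / (1 + P + Q))" "Q * h \<le> Q * (1 / (1 + P + Q))"
      by (intro mult_left_mono hle PQ)+
    moreover have "P * (1 / (1 + P + Q)) < 1" "Q * (1 / (1 + P + Q)) \<le> 1" using PQ by (simp_all add: divide_less_eq divide_le_eq)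
    ultimately have small: "P * h < 1" "Q * h \<le> 1" by linarith+
    let ?I = "{t\<^sub>0 - h..t\<^sub>0 + h}"
    have I: "?I \<subseteq> {t\<^sub>0 - T..t\<^sub>0 + T}" using hle by auto
    obtain u where u: "continuous_sobolev s ?I u" "mild_solution lam \<theta> \<alpha> \<beta> t\<^sub>0 u\<^sub>0 ?I u"
      "\<And>t. t \<in> ?I \<Longrightarrow> u t \<in> sobolev_ball s (2 * N)"
      using local_existence[OF I h0 u0 N_def small[unfolded P_def Q_def]] by blast
    have us: "u t \<in> sobolev_space s" "sobolev_norm s (u t) \<le> 2 * N" if "t \<in> ?I" for t
      using u(3)[OF that] by (auto simp: sobolev_ball_def)
    \<comment> \<open>Continuity in H^s supplies the measurability in time that the estimate of the
      essential supremum requires.\<close>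
    have "continuous_on ?I (\<lambda>t. sobolev_norm s (u t))"
      unfolding sobolev_norm_eq by (rule continuous_on_norm[OF continuous_sobolev_iff[THEN iffD1, OF us(1) u(1)]])
    then have "(\<lambda>t. sobolev_norm s (u t)) \<in> borel_measurable (lebesgue_on ?I)"
      by (rule continuous_imp_measurable_on_sets_lebesgue) simp
    then have "(\<lambda>t. ereal (sobolev_norm s (u t))) \<in> borel_measurable (lebesgue_on ?I)" by measurable
    then have "Linf_sobolev_norm s ?I u \<le> ereal (2 * N)"
      unfolding Linf_sobolev_norm_def by (rule esssup_I) (use us(2) in \<open>auto intro!: AE_I2\<close>)
    moreover have "\<forall>t\<in>?I. v t = u t" if "continuous_sobolev s ?I v \<and> mild_solution lam \<theta> \<alpha> \<beta> t\<^sub>0 u\<^sub>0 ?I v" for v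
      using uniqueness[OF I h0 u(1,2)] that by blast
    ultimately show ?thesis
      unfolding N_def[symmetric] h_def[symmetric] using h0 hle(1) u(1,2) by blast
  qed
  show ?thesis
    \<comment> \<open>The witness 2 is the ratio of the radius of the invariant ball to the norm of
      the datum, so it can be fixed before the datum.\<close>
    unfolding Let_def by (intro exI[of _ "2::real"] conjI exI[of _ T0] ballI main) simp
qed

end
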